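(* Let $d\in\mathbb{N}$. Let $V$ be a tractable homogeneous variety in $B_d$ such that $\mathrm{span}(V)=\mathbb{C}^d$. Let $(W_n)_{n\in\mathbb{N}}$ be a sequence of homogeneous varieties in $B_d$. Suppose that for every $n\in\mathbb{N}$, $A_n:\mathbb{C}^d\to\mathbb{C}^d$ is an invertible linear transformation such that $W_n=A_nV$. For every $n\in\mathbb{N}$ let $T_{A_n}:H_V\to H_{W_n}$ be the RKHS isomorphism determined by $T_{A_n}(k_x)=k_{A_nx}$, $x\in V$, and let $\varphi_{A_n}:\mathcal{M}_V\to\mathcal{M}_{W_n}$ be the induced multiplier algebra isomorphism given by $\varphi_{A_n}(f)=f\circ A_n^{-1}$, $f\in\mathcal{M}_V$. Then the following are equivalent: (1) $\|A_n\|_{\mathrm{OP}}\to 1$ and $\|A_n^{-1}\|_{\mathrm{OP}}\to 1$ as $n\to\infty$. (2) $\|T_{A_n}\|\,\|T_{A_n}^{-1}\|\to 1$ as $n\to\infty$. (3) $\|\varphi_{A_n}\|_{cb}\,\|\varphi_{A_n}^{-1}\|_{cb}\to 1$ as $n\to\infty$. (4) $\|A_n\|_{\mathrm{Mult}(V)}\to 1$ and $\|A_n^{-1}\|_{\mathrm{Mult}(W_n)}\to 1$ as $n\to\infty$.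
   Context: $\mathbb{C}^d$ carries the standard inner product $\langle\cdot,\cdot\rangle$, $B_d$ is its open unit ball, and $\|A\|_{\mathrm{OP}}$ is the operator norm of a linear map $A$ on $\mathbb{C}^d$. $\mathcal{H}_d^2$ is the Drury–Arveson space: the reproducing kernel Hilbert space (RKHS) on $B_d$ with kernel $k(x,y)=\frac{1}{1-\langle x,y\rangle}$; $k_x=k(\cdot,x)$. A variety in $B_d$ is the common zero set in $B_d$ of a nonempty subset of $\mathcal{H}_d^2$. It is homogeneous if it is the common vanishing locus in $B_d$ of homogeneous polynomials, and irreducible if it does not decompose into two non-trivial subvarieties; every homogeneous variety decomposes into a finite union of irreducible components. $H_V=\overline{\mathrm{span}}\{k_x:x\in V\}\subseteq\mathcal{H}_d^2$, identified (by restriction to $V$) with the RKHS on $V$ with kernel $k|_{V\times V}$. $\mathcal{M}_V=\mathrm{Mult}(H_V)$ is the algebra of functions $f:V\to\mathbb{C}$ with $fH_V\subseteq H_V$, identified with the multiplication operators $M_f$ on $H_V$; a matrix in $M_n(\mathcal{M}_V)$ is normed as an operator on $\oplus_{i=1}^nH_V$. For a linear $\varphi:\mathcal{M}_V\to\mathcal{M}_W$, $\varphi^{(n)}$ is its entrywise application to $n\times n$ matrices and $\|\varphi\|_{cb}=\sup_n\|\varphi^{(n)}\|$. A vector valued multiplier on $V$ is $F=(f_1,\dots,f_d)$ with $f_i\in\mathcal{M}_V$; $\|F\|_{\mathrm{Mult}(V)}$ is the norm of the row operator $(M_{f_1},\dots,M_{f_d}):\oplus_{i=1}^dH_V\to H_V$.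 For a linear map $A$ on $\mathbb{C}^d$, $\|A\|_{\mathrm{Mult}(V)}$ means the multiplier norm of the tuple of coordinate functions of $A|_V$. A RKHS isomorphism $T:H_V\to H_W$ is a bounded invertible linear map with $T(k_x)=\lambda(x)k_{F(x)}$ ($x\in V$) for a bijection $F:V\to W$ and a nowhere-vanishing $\lambda:V\to\mathbb{C}$. A multiplier algebra isomorphism $\mathcal{M}_V\to\mathcal{M}_W$ is a completely bounded algebra isomorphism with completely bounded inverse of the form $f\mapsto f\circ G$ for a bijection $G:W\to V$. It is known (Hartz) that if $V,W$ are homogeneous varieties and $A$ is an invertible linear map with $A(V)=W$, then $k_x\mapsto k_{Ax}$ extends to a RKHS isomorphism $T_A:H_V\to H_W$, and consequently $f\mapsto f\circ A^{-1}$ is a multiplier algebra isomorphism $\mathcal{M}_V\to\mathcal{M}_W$. A linear map $A$ is isometric on a set $X$ if $\|Ax\|=\|x\|$ for all $x\in X$. A union of subspaces $M=\cup_{i=1}^kM_i$ means a finite union ($k\in\mathbb{N}$) of linear subspaces with $M_i\nsubseteq M_j$ for $i\ne j$; if $E$ is a subspace orthogonal to $\mathrm{span}\,M$, then $E\oplus M:=\cup_{i=1}^k(E\oplus M_i)$. Tractable unions (recursive definition). Let $K$ be a finite-dimensional complex inner product space ($K=\mathbb{C}^d$ or a subspace) and $M=\cup_{i=1}^kM_i$ a union of subspaces of $K$ with $\sum_iM_i=K$. $M$ is a tractable union of linear subspaces of $K$ if one of the following holds: (i) $M=K$. (ii) There are $m\ge 2$ and a finite union $N=\cup_{i=1}^mN_i$,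 where each $N_i=\cup_{r=1}^{k_i}N_{i,r}$ is a finite union of linear subspaces of $K$, such that: (a) $M\subseteq N$; (b) each $N_i$ is a tractable union of linear subspaces of $\mathrm{span}\,N_i$; (c) $\mathrm{span}\,N_i\cap\mathrm{span}\,N_j=\{0\}$ for $i\neq j$; (d) $\dim\mathrm{span}\,N_i\le\dim K-1$ for each $i$; (e) every invertible linear $A:K\to K$ that is isometric on $M$ is isometric on $N$. (iii) $M\subseteq E\oplus N$, where $N\subseteq K$ is a tractable union of linear subspaces of $\mathrm{span}\,N$, and $\{0\}\ne E\subseteq K$ is a subspace orthogonal to $\mathrm{span}\,N$, such that every invertible linear $A:K\to K$ that is isometric on $M$ is isometric on $E\oplus N$. A homogeneous variety $V\subseteq B_d$ with $\mathrm{span}(V)=\mathbb{C}^d$ and irreducible decomposition $V=V_1\cup\cdots\cup V_k$ is tractable if $\cup_{i=1}^k\mathrm{span}(V_i)$ is equal to a tractable union of linear subspaces of $\mathbb{C}^d$. *)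

theory Defs
  imports "HOL-Analysis.Analysis"
begin

section \<open>Hilbert spaces of functions and reproducing kernels\<close>

text \<open>
  A function on a set \<open>X\<close> is represented by a total function that vanishes outside \<open>X\<close>.
\<close>

definition restr :: "'a set \<Rightarrow> ('a \<Rightarrow> complex) \<Rightarrow> 'a \<Rightarrow> complex" where
  "restr X f = (\<lambda>x. if x \<in> X then f x else 0)"

record 'a hfs =
  funs :: "('a \<Rightarrow> complex) set"
  ip :: "('a \<Rightarrow> complex) \<Rightarrow> ('a \<Rightarrow> complex) \<Rightarrow> complex"

definition hnorm :: "'a hfs \<Rightarrow> ('a \<Rightarrow> complex) \<Rightarrow> real" where
  "hnorm H f = sqrt (Re (ip H f f))"

definition hilbert_function_space :: "'a set \<Rightarrow> 'a hfs \<Rightarrow> bool" where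
  "hilbert_function_space X H \<longleftrightarrow>
     (\<forall>f\<in>funs H. \<forall>x. x \<notin> X \<longrightarrow> f x = 0) \<and>
     (\<lambda>x. 0) \<in> funs H \<and>
     (\<forall>f\<in>funs H. \<forall>g\<in>funs H. (\<lambda>x. f x + g x) \<in> funs H) \<and>
     (\<forall>c. \<forall>f\<in>funs H. (\<lambda>x. c * f x) \<in> funs H) \<and>
     (\<forall>f\<in>funs H. \<forall>g\<in>funs H. \<forall>h\<in>funs H.
        ip H (\<lambda>x. f x + g x) h = ip H f h + ip H g h) \<and>
     (\<forall>c. \<forall>f\<in>funs H. \<forall>h\<in>funs H. ip H (\<lambda>x. c * f x) h = c * ip H f h) \<and>
     (\<forall>f\<in>funs H. \<forall>g\<in>funs H. ip H g f = cnj (ip H f g)) \<and>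
     (\<forall>f\<in>funs H. f \<noteq> (\<lambda>x. 0) \<longrightarrow> Re (ip H f f) > 0) \<and>
     (\<forall>s::nat \<Rightarrow> 'a \<Rightarrow> complex.
        (\<forall>n. s n \<in> funs H) \<and>
        (\<forall>e>0. \<exists>N. \<forall>m\<ge>N. \<forall>n\<ge>N. hnorm H (\<lambda>x. s m x - s n x) < e) \<longrightarrow>
        (\<exists>f\<in>funs H. (\<lambda>n. hnorm H (\<lambda>x. s n x - f x)) \<longlonglongrightarrow> 0))"

definition is_rkhs :: "'a set \<Rightarrow> ('a \<Rightarrow> 'a \<Rightarrow> complex) \<Rightarrow> 'a hfs \<Rightarrow> bool" where
  "is_rkhs X k H \<longleftrightarrow>
     hilbert_function_space X H \<and>
     (\<forall>x\<in>X. restr X (\<lambda>y. k y x) \<in> funs H \<and>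
             (\<forall>f\<in>funs H. ip H f (restr X (\<lambda>y. k y x)) = f x))"


section \<open>The Drury--Arveson space\<close>

definition cinner :: "complex ^ 'd \<Rightarrow> complex ^ 'd \<Rightarrow> complex" where
  "cinner x y = (\<Sum>i\<in>UNIV. x $ i * cnj (y $ i))"

definition da_kernel :: "complex ^ 'd \<Rightarrow> complex ^ 'd \<Rightarrow> complex" where
  "da_kernel x y = 1 / (1 - cinner x y)"

text \<open>
  By Moore--Aronszajn the set of functions and the values of the inner product on it are
  determined by the kernel, so the choice is immaterial; existence is shown in
  \<open>is_rkhs_drury_arveson\<close> below.
\<close>

definition drury_arveson :: "(complex ^ 'd) hfs" where
  "drury_arveson = (SOME H. is_rkhs (ball 0 1) da_kernel H)"


section \<open>The spaces \<open>H\<^sub>V\<close>\<close>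

text \<open>The kernel function \<open>k\<^sub>x\<close>, as a function on \<open>V\<close>.\<close>

definition kfun :: "(complex ^ 'd) set \<Rightarrow> complex ^ 'd \<Rightarrow> complex ^ 'd \<Rightarrow> complex" where
  "kfun V x = restr V (\<lambda>y. da_kernel y x)"

definition kernel_span :: "(complex ^ 'd) set \<Rightarrow> (complex ^ 'd \<Rightarrow> complex) set" where
  "kernel_span V =
     {f. \<exists>F c. finite F \<and> F \<subseteq> V \<and> f = (\<lambda>y. \<Sum>x\<in>F. c x * kfun (ball 0 1) x y)}"

definition kernel_closed_span :: "(complex ^ 'd) set \<Rightarrow> (complex ^ 'd \<Rightarrow> complex) set" where
  "kernel_closed_span V =
     {f \<in> funs drury_arveson.
        \<forall>e>0. \<exists>g\<in>kernel_span V. hnorm drury_arveson (\<lambda>y. f y - g y) < e}"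

text \<open>
  The closed span, transported along restriction to \<open>V\<close> (which is injective on it).
\<close>

definition HV :: "(complex ^ 'd) set \<Rightarrow> (complex ^ 'd) hfs" where
  "HV V =
     \<lparr> funs = restr V ` kernel_closed_span V,
       ip = (\<lambda>f g. ip drury_arveson (inv_into (kernel_closed_span V) (restr V) f)
                                   (inv_into (kernel_closed_span V) (restr V) g)) \<rparr>"


section \<open>Operator norms, multipliers and isomorphisms\<close>

text \<open>
  Operator norms take values in \<open>[0,\<infinity>]\<close>; an operator is bounded iff its norm is finite.
\<close>

definition opnorm :: "'u set \<Rightarrow> ('u \<Rightarrow> ennreal) \<Rightarrow> ('v \<Rightarrow> ennreal) \<Rightarrow> ('u \<Rightarrow> 'v) \<Rightarrow> ennreal" where
  "opnorm S N N' T = (SUP x\<in>{x\<in>S. N x \<le> 1}. N' (T x))"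

definition hopnorm ::
    "'a hfs \<Rightarrow> 'b hfs \<Rightarrow> (('a \<Rightarrow> complex) \<Rightarrow> ('b \<Rightarrow> complex)) \<Rightarrow> ennreal" where
  "hopnorm H H' T = opnorm (funs H) (\<lambda>f. ennreal (hnorm H f)) (\<lambda>f. ennreal (hnorm H' f)) T"

text \<open>The Hilbert space direct sum of copies of \<open>H\<close> indexed by the finite set \<open>I\<close>.\<close>

definition dsum :: "'i set \<Rightarrow> 'a hfs \<Rightarrow> ('i \<Rightarrow> 'a \<Rightarrow> complex) set" where
  "dsum I H = {h. \<forall>i\<in>I. h i \<in> funs H}"

definition dsum_norm :: "'i set \<Rightarrow> 'a hfs \<Rightarrow> ('i \<Rightarrow> 'a \<Rightarrow> complex) \<Rightarrow> real" where
  "dsum_norm I H h = sqrt (\<Sum>i\<in>I. (hnorm H (h i))\<^sup>2)"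

definition multipliers :: "(complex ^ 'd) set \<Rightarrow> (complex ^ 'd \<Rightarrow> complex) set" where
  "multipliers V =
     {f. (\<forall>x. x \<notin> V \<longrightarrow> f x = 0) \<and>
         (\<forall>h\<in>funs (HV V). (\<lambda>x. f x * h x) \<in> funs (HV V))}"

text \<open>The norm of the row \<open>(M\<^bsub>f i\<^esub>)\<^sub>i\<close> as an operator from the \<open>d\<close>-fold sum of \<open>H\<^sub>V\<close> to \<open>H\<^sub>V\<close>.\<close>

definition row_mult_norm ::
    "(complex ^ 'd) set \<Rightarrow> ('d \<Rightarrow> complex ^ 'd \<Rightarrow> complex) \<Rightarrow> ennreal" where
  "row_mult_norm V f =
     opnorm (dsum UNIV (HV V)) (\<lambda>h. ennreal (dsum_norm UNIV (HV V) h))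
            (\<lambda>g. ennreal (hnorm (HV V) g)) (\<lambda>h x. \<Sum>i\<in>UNIV. f i x * h i x)"

definition lin_mult_norm ::
    "(complex ^ 'd) set \<Rightarrow> (complex ^ 'd \<Rightarrow> complex ^ 'd) \<Rightarrow> ennreal" where
  "lin_mult_norm V A = row_mult_norm V (\<lambda>i. restr V (\<lambda>x. A x $ i))"

definition mat_mult_norm ::
    "(complex ^ 'd) set \<Rightarrow> nat \<Rightarrow> (nat \<Rightarrow> nat \<Rightarrow> complex ^ 'd \<Rightarrow> complex) \<Rightarrow> ennreal" where
  "mat_mult_norm V n F =
     opnorm (dsum {..<n} (HV V)) (\<lambda>h. ennreal (dsum_norm {..<n} (HV V) h))
            (\<lambda>g. ennreal (dsum_norm {..<n} (HV V) g)) (\<lambda>h i x. \<Sum>j<n. F i j x * h j x)"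

definition cb_norm ::
    "(complex ^ 'd) set \<Rightarrow> (complex ^ 'd) set \<Rightarrow>
     ((complex ^ 'd \<Rightarrow> complex) \<Rightarrow> (complex ^ 'd \<Rightarrow> complex)) \<Rightarrow> ennreal" where
  "cb_norm V W \<phi> =
     (SUP n. opnorm {F. \<forall>i<n. \<forall>j<n. F i j \<in> multipliers V}
               (mat_mult_norm V n) (mat_mult_norm W n) (\<lambda>F i j. \<phi> (F i j)))"

definition rkhs_iso ::
    "(complex ^ 'd) set \<Rightarrow> (complex ^ 'd) set \<Rightarrow>
     ((complex ^ 'd \<Rightarrow> complex) \<Rightarrow> (complex ^ 'd \<Rightarrow> complex)) \<Rightarrow> bool" where
  "rkhs_iso V W T \<longleftrightarrow>
     (\<forall>f\<in>funs (HV V). \<forall>g\<in>funs (HV V). T (\<lambda>x. f x + g x) = (\<lambda>x. T f x + T g x)) \<and>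
     (\<forall>c. \<forall>f\<in>funs (HV V). T (\<lambda>x. c * f x) = (\<lambda>x. c * T f x)) \<and>
     bij_betw T (funs (HV V)) (funs (HV W)) \<and>
     hopnorm (HV V) (HV W) T < \<infinity> \<and>
     hopnorm (HV W) (HV V) (inv_into (funs (HV V)) T) < \<infinity> \<and>
     (\<exists>F \<Lambda>. bij_betw F V W \<and> (\<forall>x\<in>V. \<Lambda> x \<noteq> 0) \<and>
        (\<forall>x\<in>V. T (kfun V x) = (\<lambda>y. \<Lambda> x * kfun W (F x) y)))"

text \<open>The composition map \<open>f \<mapsto> f \<circ> G\<close>, for \<open>G\<close> mapping \<open>W\<close> into the domain of \<open>f\<close>.\<close>

definition comp_map ::
    "'a set \<Rightarrow> ('a \<Rightarrow> 'b) \<Rightarrow> ('b \<Rightarrow> complex) \<Rightarrow> 'a \<Rightarrow> complex" where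
  "comp_map W G f = restr W (f \<circ> G)"


section \<open>Varieties\<close>

definition variety :: "(complex ^ 'd) set \<Rightarrow> bool" where
  "variety V \<longleftrightarrow>
     (\<exists>S. S \<noteq> {} \<and> S \<subseteq> funs drury_arveson \<and> V = {z \<in> ball 0 1. \<forall>f\<in>S. f z = 0})"

definition homogeneous_poly :: "(complex ^ 'd \<Rightarrow> complex) \<Rightarrow> bool" where
  "homogeneous_poly p \<longleftrightarrow>
     (\<exists>m c. p = (\<lambda>z. \<Sum>\<alpha> | (\<Sum>i\<in>UNIV. \<alpha> i) = (m::nat). c \<alpha> * (\<Prod>i\<in>UNIV. (z $ i) ^ \<alpha> i)))"

definition homogeneous_variety :: "(complex ^ 'd) set \<Rightarrow> bool" where
  "homogeneous_variety V \<longleftrightarrow>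
     variety V \<and>
     (\<exists>P. (\<forall>p\<in>P. homogeneous_poly p) \<and> V = {z \<in> ball 0 1. \<forall>p\<in>P. p z = 0})"

definition irreducible_variety :: "(complex ^ 'd) set \<Rightarrow> bool" where
  "irreducible_variety V \<longleftrightarrow>
     variety V \<and>
     \<not> (\<exists>V1 V2. variety V1 \<and> variety V2 \<and> V1 \<noteq> V \<and> V2 \<noteq> V \<and> V = V1 \<union> V2)"

definition irreducible_decomposition ::
    "(complex ^ 'd) set \<Rightarrow> (complex ^ 'd) set set \<Rightarrow> bool" where
  "irreducible_decomposition V \<C> \<longleftrightarrow>
     finite \<C> \<and> (\<forall>C\<in>\<C>. irreducible_variety C) \<and> V = \<Union>\<C> \<and>
     (\<forall>C\<in>\<C>. \<forall>D\<in>\<C>. C \<subseteq> D \<longrightarrow> C = D)"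


section \<open>Tractable unions of subspaces\<close>

definition isometric_on :: "(complex ^ 'd \<Rightarrow> complex ^ 'd) \<Rightarrow> (complex ^ 'd) set \<Rightarrow> bool" where
  "isometric_on A X \<longleftrightarrow> (\<forall>x\<in>X. norm (A x) = norm x)"

text \<open>
  Invertible linear maps \<open>K \<rightarrow> K\<close> of a subspace \<open>K\<close> are represented by linear maps of the whole
  space that restrict to a bijection of \<open>K\<close>; every linear map on \<open>K\<close> has such an extension.
\<close>

definition lin_aut :: "(complex ^ 'd) set \<Rightarrow> (complex ^ 'd \<Rightarrow> complex ^ 'd) \<Rightarrow> bool" where
  "lin_aut K A \<longleftrightarrow> Vector_Spaces.linear (*s) (*s) A \<and> bij_betw A K K"

definition union_of_subspaces :: "(complex ^ 'd) set \<Rightarrow> bool" where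
  "union_of_subspaces M \<longleftrightarrow>
     (\<exists>\<S>. finite \<S> \<and> \<S> \<noteq> {} \<and> (\<forall>S\<in>\<S>. vec.subspace S) \<and>
          (\<forall>S\<in>\<S>. \<forall>S'\<in>\<S>. S \<subseteq> S' \<longrightarrow> S = S') \<and> M = \<Union>\<S>)"

definition isometries_extend :: "(complex ^ 'd) set \<Rightarrow> (complex ^ 'd) set \<Rightarrow> (complex ^ 'd) set \<Rightarrow> bool" where
  "isometries_extend K M N \<longleftrightarrow> (\<forall>A. lin_aut K A \<and> isometric_on A M \<longrightarrow> isometric_on A N)"

definition set_sum :: "(complex ^ 'd) set \<Rightarrow> (complex ^ 'd) set \<Rightarrow> (complex ^ 'd) set" where
  "set_sum E N = {e + x |e x. e \<in> E \<and> x \<in> N}"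

text \<open>
  \<open>tractable_union K M\<close>: \<open>M\<close> is a tractable union of linear subspaces of \<open>K\<close>. The
  recursive definition unfolds into an inductive predicate, since the dimension of the
  ambient subspace drops strictly in each recursive call. The sum of the subspaces
  making up \<open>M\<close> is the span of \<open>M\<close>.
\<close>

inductive tractable_union :: "(complex ^ 'd) set \<Rightarrow> (complex ^ 'd) set \<Rightarrow> bool" where
  whole: "vec.subspace K \<Longrightarrow> tractable_union K K"
| split: "\<lbrakk> vec.subspace K; union_of_subspaces M; vec.span M = K;
           m \<ge> (2::nat);
           M \<subseteq> (\<Union>i<m. N i);
           \<forall>i<m. N i \<subseteq> K;
           \<forall>i<m. tractable_union (vec.span (N i)) (N i);
           \<forall>i<m. \<forall>j<m. i \<noteq> j \<longrightarrow> vec.span (N i) \<inter> vec.span (N j) = {0};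
           \<forall>i<m. vec.dim (vec.span (N i)) + 1 \<le> vec.dim K;
           isometries_extend K M (\<Union>i<m. N i) \<rbrakk>
         \<Longrightarrow> tractable_union K M"
| ortho: "\<lbrakk> vec.subspace K; union_of_subspaces M; vec.span M = K;
           vec.subspace E; E \<noteq> {0}; E \<subseteq> K; N \<subseteq> K;
           tractable_union (vec.span N) N;
           \<forall>e\<in>E. \<forall>x\<in>vec.span N. cinner e x = 0;
           M \<subseteq> set_sum E N;
           isometries_extend K M (set_sum E N) \<rbrakk>
         \<Longrightarrow> tractable_union K M"

definition tractable_variety :: "(complex ^ 'd) set \<Rightarrow> bool" where
  "tractable_variety V \<longleftrightarrow>
     homogeneous_variety V \<and> vec.span V = UNIV \<and>
     (\<exists>\<C>. irreducible_decomposition V \<C> \<and> tractable_union UNIV (\<Union>C\<in>\<C>. vec.span C))"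


section \<open>Existence of the Drury--Arveson space\<close>

definition ell2 :: "('i \<Rightarrow> complex) \<Rightarrow> bool" where
  "ell2 c \<longleftrightarrow> (\<lambda>i. (cmod (c i))\<^sup>2) summable_on UNIV"

definition ip2 :: "('i \<Rightarrow> complex) \<Rightarrow> ('i \<Rightarrow> complex) \<Rightarrow> complex" where
  "ip2 c d = (\<Sum>\<^sub>\<infinity>i. c i * cnj (d i))"

lemma ip2_summable:
  assumes "ell2 c" "ell2 d"
  shows "(\<lambda>i. cmod (c i * cnj (d i))) summable_on UNIV"
proof (rule Infinite_Sum.abs_summable_on_comparison_test)
  have "(\<lambda>i. (cmod (c i))\<^sup>2 + (cmod (d i))\<^sup>2) summable_on UNIV"
    using assms unfolding ell2_def by (rule summable_on_add)
  then show "(\<lambda>i. norm ((cmod (c i))\<^sup>2 + (cmod (d i))\<^sup>2)) summable_on UNIV" by simp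
  fix i
  show "cmod (c i * cnj (d i)) \<le> norm ((cmod (c i))\<^sup>2 + (cmod (d i))\<^sup>2)"
  proof -
    have "0 \<le> cmod (c i) * cmod (d i)" by simp
    then have "cmod (c i) * cmod (d i) \<le> (cmod (c i))\<^sup>2 + (cmod (d i))\<^sup>2"
      using sum_squares_bound[of "cmod (c i)" "cmod (d i)"] by linarith
    then show ?thesis by (simp add: norm_mult)
  qed
qed

lemma ip2_summable': "ell2 c \<Longrightarrow> ell2 d \<Longrightarrow> (\<lambda>i. c i * cnj (d i)) summable_on UNIV"
  using Infinite_Sum.abs_summable_summable[OF ip2_summable] by blast

lemma ell2_0: "ell2 (\<lambda>i. 0)"
  by (simp add: ell2_def)

lemma ell2_scale: "ell2 c \<Longrightarrow> ell2 (\<lambda>i. a * c i)"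
  unfolding ell2_def by (auto simp: norm_mult power_mult_distrib intro: summable_on_cmult_right)

lemma ell2_add:
  assumes "ell2 c" "ell2 d"
  shows "ell2 (\<lambda>i. c i + d i)"
proof -
  have s: "(\<lambda>i. 2 * ((cmod (c i))\<^sup>2 + (cmod (d i))\<^sup>2)) summable_on UNIV"
    using assms unfolding ell2_def by (intro summable_on_cmult_right summable_on_add)
  have "(cmod (c i + d i))\<^sup>2 \<le> 2 * ((cmod (c i))\<^sup>2 + (cmod (d i))\<^sup>2)" for i
  proof -
    have "(cmod (c i + d i))\<^sup>2 \<le> (cmod (c i) + cmod (d i))\<^sup>2"
      by (simp add: norm_triangle_ineq power_mono)
    also have "\<dots> \<le> 2 * ((cmod (c i))\<^sup>2 + (cmod (d i))\<^sup>2)"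
      using sum_squares_bound[of "cmod (c i)" "cmod (d i)"] by (simp add: power2_sum)
    finally show ?thesis .
  qed
  then show ?thesis unfolding ell2_def
    by (intro summable_on_comparison_test[OF s]) auto
qed

lemma ell2_diff: "ell2 c \<Longrightarrow> ell2 d \<Longrightarrow> ell2 (\<lambda>i. c i - d i)"
  using ell2_add[of c "\<lambda>i. (-1) * d i"] ell2_scale[of d "-1"] by simp

lemma ip2_add: "ell2 c \<Longrightarrow> ell2 c' \<Longrightarrow> ell2 d \<Longrightarrow> ip2 (\<lambda>i. c i + c' i) d = ip2 c d + ip2 c' d"
  unfolding ip2_def by (simp add: distrib_right infsum_add ip2_summable')

lemma ip2_scale: "ip2 (\<lambda>i. a * c i) d = a * ip2 c d"
  unfolding ip2_def by (simp add: mult.assoc infsum_cmult_right')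

lemma ip2_cnj: "ip2 d c = cnj (ip2 c d)"
  unfolding ip2_def by (simp flip: infsum_cnj add: mult.commute)

lemma ip2_diff: "ell2 c \<Longrightarrow> ell2 c' \<Longrightarrow> ell2 d \<Longrightarrow> ip2 (\<lambda>i. c i - c' i) d = ip2 c d - ip2 c' d"
  using ip2_add[of c "\<lambda>i. (-1) * c' i" d] ell2_scale[of c' "-1"] ip2_scale[of "-1" c' d] by simp

lemma ip2_self: "ip2 c c = of_real (\<Sum>\<^sub>\<infinity>i. (cmod (c i))\<^sup>2)"
proof -
  let ?f = "\<lambda>i. (cmod (c i))\<^sup>2"
  have eq: "ip2 c c = (\<Sum>\<^sub>\<infinity>i. complex_of_real (?f i))"
    unfolding ip2_def by (simp only: complex_norm_square)
  show ?thesis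
  proof (cases "?f summable_on UNIV")
    case True
    then have "((\<lambda>i. complex_of_real (?f i)) has_sum complex_of_real (infsum ?f UNIV)) UNIV"
      by (intro has_sum_of_real has_sum_infsum)
    then show ?thesis using eq infsumI by metis
  next
    case False
    then have "\<not> (\<lambda>i. complex_of_real (?f i)) summable_on UNIV"
      using summable_on_Re by fastforce
    then show ?thesis using eq False by (simp add: infsum_not_exists)
  qed
qed

lemma ip2_pos:
  assumes "ell2 c" "c \<noteq> (\<lambda>i. 0)"
  shows "Re (ip2 c c) > 0"
proof -
  obtain i where i: "c i \<noteq> 0" using assms(2) by blast
  have "(\<Sum>i\<in>{i}. (cmod (c i))\<^sup>2) \<le> (\<Sum>\<^sub>\<infinity>i. (cmod (c i))\<^sup>2)"
    using assms(1) unfolding ell2_def by (intro finite_sum_le_infsum) auto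
  then show ?thesis using i by (simp add: ip2_self) (smt (verit) zero_less_power2 norm_eq_zero)
qed

lemma ip2_bound:
  assumes "ell2 c" "ell2 d" and t: "t > 0"
  shows "2 * cmod (ip2 c d) \<le> t * Re (ip2 c c) + Re (ip2 d d) / t"
proof -
  have sc: "(\<lambda>i. t * (cmod (c i))\<^sup>2) summable_on UNIV" "(\<lambda>i. (cmod (d i))\<^sup>2 / t) summable_on UNIV"
    using assms unfolding ell2_def 
    by (auto intro: summable_on_cmult_right summable_on_cmult_left simp: divide_inverse)
  have "cmod (ip2 c d) \<le> (\<Sum>\<^sub>\<infinity>i. cmod (c i * cnj (d i)))"
    unfolding ip2_def by (rule norm_infsum_bound[OF ip2_summable[OF assms(1,2)]])
  then have "2 * cmod (ip2 c d) \<le> (\<Sum>\<^sub>\<infinity>i. 2 * cmod (c i * cnj (d i)))"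
    by (simp add: infsum_cmult_right')
  also have "\<dots> \<le> (\<Sum>\<^sub>\<infinity>i. t * (cmod (c i))\<^sup>2 + (cmod (d i))\<^sup>2 / t)"
  proof (rule infsum_mono)
    show "(\<lambda>i. 2 * cmod (c i * cnj (d i))) summable_on UNIV"
      using ip2_summable[OF assms(1,2)] by (rule summable_on_cmult_right)
    show "(\<lambda>i. t * (cmod (c i))\<^sup>2 + (cmod (d i))\<^sup>2 / t) summable_on UNIV"
      using sc by (rule summable_on_add)
    fix i
    have "0 \<le> (t * cmod (c i) - cmod (d i))\<^sup>2 / t" using t by simp
    also have "\<dots> = t * (cmod (c i))\<^sup>2 + (cmod (d i))\<^sup>2 / t - 2 * (cmod (c i) * cmod (d i))"
      using t by (simp add: field_simps power2_eq_square)
    finally show "2 * cmod (c i * cnj (d i)) \<le> t * (cmod (c i))\<^sup>2 + (cmod (d i))\<^sup>2 / t"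
      by (simp add: norm_mult)
  qed
  also have "\<dots> = t * Re (ip2 c c) + Re (ip2 d d) / t"
    using sc by (simp add: infsum_add ip2_self infsum_cmult_right' infsum_cmult_left' divide_inverse)
  finally show ?thesis .
qed

lemma ell2_complete:
  fixes s :: "nat \<Rightarrow> 'i \<Rightarrow> complex"
  assumes s: "\<And>n. ell2 (s n)"
    and C: "\<And>e. e > 0 \<Longrightarrow> \<exists>N. \<forall>m\<ge>N. \<forall>n\<ge>N. Re (ip2 (\<lambda>i. s m i - s n i) (\<lambda>i. s m i - s n i)) < e"
  shows "\<exists>c. ell2 c \<and> (\<lambda>n. Re (ip2 (\<lambda>i. s n i - c i) (\<lambda>i. s n i - c i))) \<longlonglongrightarrow> 0"
proof -
  have fin: "(\<Sum>i\<in>F. (cmod (s m i - s n i))\<^sup>2) \<le> Re (ip2 (\<lambda>i. s m i - s n i) (\<lambda>i. s m i - s n i))"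
    if "finite F" for F m n
    using ell2_diff[OF s s, of m n] that unfolding ip2_self ell2_def 
    by simp (intro finite_sum_le_infsum; auto)
  have "Cauchy (\<lambda>n. s n i)" for i
  proof (rule CauchyI)
    fix e :: real assume e: "e > 0"
    from C[of "e\<^sup>2"] e obtain N where
      N: "\<forall>m\<ge>N. \<forall>n\<ge>N. Re (ip2 (\<lambda>i. s m i - s n i) (\<lambda>i. s m i - s n i)) < e\<^sup>2" by auto
    have "cmod (s m i - s n i) < e" if "m \<ge> N" "n \<ge> N" for m n
    proof -
      have "(cmod (s m i - s n i))\<^sup>2 < e\<^sup>2"
        using fin[of "{i}" m n] N that by fastforce
      then show ?thesis using e by (simp add: power2_less_imp_less)
    qed
    then show "\<exists>M. \<forall>m\<ge>M. \<forall>n\<ge>M. norm (s m i - s n i) < e" by blast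
  qed
  then have "\<forall>i. \<exists>l. (\<lambda>n. s n i) \<longlonglongrightarrow> l"
    using Cauchy_convergent_iff convergent_def by blast
  then obtain c where c: "\<And>i. (\<lambda>n. s n i) \<longlonglongrightarrow> c i" by metis
  have bd: "\<exists>N. \<forall>n\<ge>N. ell2 (\<lambda>i. s n i - c i) \<and> Re (ip2 (\<lambda>i. s n i - c i) (\<lambda>i. s n i - c i)) \<le> e"
    if e: "e > 0" for e
  proof -
    from C[OF e] obtain N where
      N: "\<forall>m\<ge>N. \<forall>n\<ge>N. Re (ip2 (\<lambda>i. s m i - s n i) (\<lambda>i. s m i - s n i)) < e" by auto
    have "ell2 (\<lambda>i. s n i - c i) \<and> Re (ip2 (\<lambda>i. s n i - c i) (\<lambda>i. s n i - c i)) \<le> e"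
      if n: "n \<ge> N" for n
    proof -
      have F: "(\<Sum>i\<in>F. (cmod (s n i - c i))\<^sup>2) \<le> e" if "finite F" for F
      proof (rule tendsto_upperbound)
        show "(\<lambda>m. \<Sum>i\<in>F. (cmod (s n i - s m i))\<^sup>2) \<longlonglongrightarrow> (\<Sum>i\<in>F. (cmod (s n i - c i))\<^sup>2)"
          by (intro tendsto_intros c)
        show "\<forall>\<^sub>F m in sequentially. (\<Sum>i\<in>F. (cmod (s n i - s m i))\<^sup>2) \<le> e"
          unfolding eventually_sequentially
          using fin[OF that, of n] N n by (meson less_imp_le order_trans)
      qed simp
      have sm: "(\<lambda>i. (cmod (s n i - c i))\<^sup>2) summable_on UNIV"
        by (rule nonneg_bdd_above_summable_on) (auto intro!: bdd_aboveI2[where M=e] F)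
      then show ?thesis
        unfolding ip2_self ell2_def by (auto intro!: infsum_le_finite_sums F)
    qed
    then show ?thesis by blast
  qed
  from bd[of 1] obtain n where n: "ell2 (\<lambda>i. s n i - c i)" by auto
  have "ell2 c" using ell2_diff[OF s[of n] n] by simp
  moreover have "(\<lambda>n. Re (ip2 (\<lambda>i. s n i - c i) (\<lambda>i. s n i - c i))) \<longlonglongrightarrow> 0"
  proof (rule LIMSEQ_I)
    fix r :: real assume "r > 0"
    with bd[of "r/2"] obtain N where
      "\<forall>n\<ge>N. Re (ip2 (\<lambda>i. s n i - c i) (\<lambda>i. s n i - c i)) \<le> r/2" by auto
    moreover have "Re (ip2 x x) \<ge> 0" for x :: "'i \<Rightarrow> complex"
      by (simp add: ip2_self infsum_nonneg)
    ultimately show "\<exists>N. \<forall>n\<ge>N. norm (Re (ip2 (\<lambda>i. s n i - c i) (\<lambda>i. s n i - c i)) - 0) < r"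
      using \<open>r > 0\<close> by (intro exI[of _ N]) (force simp: field_simps)
  qed
  ultimately show ?thesis by blast
qed

lemma rkhs_exists:
  fixes \<Phi> :: "'a \<Rightarrow> 'i \<Rightarrow> complex"
  assumes \<Phi>: "\<And>x. x \<in> X \<Longrightarrow> ell2 (\<Phi> x)"
    and k: "\<And>x y. x \<in> X \<Longrightarrow> y \<in> X \<Longrightarrow> k y x = ip2 (\<Phi> x) (\<Phi> y)"
  shows "\<exists>H. is_rkhs X k H"
proof -
  define S where "S = {c. ell2 c \<and> (\<forall>d. ell2 d \<longrightarrow> (\<forall>x\<in>X. ip2 d (\<Phi> x) = 0) \<longrightarrow> ip2 c d = 0)}"
  define U where "U = (\<lambda>c. restr X (\<lambda>x. ip2 c (\<Phi> x)))"
  define J where "J = inv_into S U"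
  define H where "H = \<lparr>funs = U ` S, ip = (\<lambda>f g. ip2 (J f) (J g))\<rparr>"
  have l: "ell2 c" if "c \<in> S" for c using that by (simp add: S_def)
  have S0: "(\<lambda>i. 0) \<in> S" by (auto simp: S_def ell2_0 ip2_def)
  have Sadd: "(\<lambda>i. c i + d i) \<in> S" if "c \<in> S" "d \<in> S" for c d
    using that by (auto simp: S_def ell2_add ip2_add)
  have Ssc: "(\<lambda>i. a * c i) \<in> S" if "c \<in> S" for a c
    using that by (auto simp: S_def ell2_scale ip2_scale)
  have Sdiff: "(\<lambda>i. c i - d i) \<in> S" if "c \<in> S" "d \<in> S" for c d
    using that by (auto simp: S_def ell2_diff ip2_diff)
  have S\<Phi>: "\<Phi> x \<in> S" if "x \<in> X" for x
    using that by (auto simp: S_def \<Phi>) (metis complex_cnj_zero ip2_cnj)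
  have Uadd: "U (\<lambda>i. c i + d i) = (\<lambda>x. U c x + U d x)" if "c \<in> S" "d \<in> S" for c d
    using that by (auto simp: U_def restr_def ip2_add l \<Phi>)
  have Usc: "U (\<lambda>i. a * c i) = (\<lambda>x. a * U c x)" for a c
    by (auto simp: U_def restr_def ip2_scale)
  have Udiff: "U (\<lambda>i. c i - d i) = (\<lambda>x. U c x - U d x)" if "c \<in> S" "d \<in> S" for c d
    using that by (auto simp: U_def restr_def ip2_diff l \<Phi>)
  have U0: "c = (\<lambda>i. 0)" if "c \<in> S" "U c = (\<lambda>x. 0)" for c
  proof -
    have "\<forall>x\<in>X. ip2 c (\<Phi> x) = 0" using that(2) unfolding U_def restr_def by metis
    then have "ip2 c c = 0" using that(1) by (auto simp: S_def)
    then show ?thesis using ip2_pos[OF l[OF that(1)]] by force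
  qed
  have inj: "inj_on U S"
  proof (rule inj_onI)
    fix c d assume "c \<in> S" "d \<in> S" "U c = U d"
    then have "(\<lambda>i. c i - d i) = (\<lambda>i. 0)" by (intro U0 Sdiff) (auto simp: Udiff)
    then show "c = d" by (auto simp: fun_eq_iff)
  qed
  have JU: "J (U c) = c" if "c \<in> S" for c using inj that by (simp add: J_def)
  have nrm: "hnorm H (\<lambda>x. U c x - U d x) = sqrt (Re (ip2 (\<lambda>i. c i - d i) (\<lambda>i. c i - d i)))"
    if "c \<in> S" "d \<in> S" for c d
    using that by (simp add: hnorm_def H_def JU Sdiff flip: Udiff)
  have complete: "\<exists>f\<in>funs H. (\<lambda>n. hnorm H (\<lambda>x. s n x - f x)) \<longlonglongrightarrow> 0"
    if s: "\<forall>n. s n \<in> funs H"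
      and C: "\<forall>e>0. \<exists>N. \<forall>m\<ge>N. \<forall>n\<ge>N. hnorm H (\<lambda>x. s m x - s n x) < e"
    for s :: "nat \<Rightarrow> 'a \<Rightarrow> complex"
  proof -
    have "\<forall>n. \<exists>t\<in>S. s n = U t" using s by (auto simp: H_def)
    then obtain t where t: "\<And>n. t n \<in> S" "\<And>n. s n = U (t n)" by metis
    have "\<exists>N. \<forall>m\<ge>N. \<forall>n\<ge>N. Re (ip2 (\<lambda>i. t m i - t n i) (\<lambda>i. t m i - t n i)) < e" if "e > 0" for e
      using C[rule_format, of "sqrt e"] that by (simp add: t nrm)
    from ell2_complete[OF l[OF t(1)] this] obtain c where
      c: "ell2 c" "(\<lambda>n. Re (ip2 (\<lambda>i. t n i - c i) (\<lambda>i. t n i - c i))) \<longlonglongrightarrow> 0" by blast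
    have "ip2 c d = 0" if d: "ell2 d" "\<forall>x\<in>X. ip2 d (\<Phi> x) = 0" for d
    proof -
      have eq: "cmod (ip2 (\<lambda>i. t n i - c i) d) = cmod (ip2 c d)" for n
        using t(1)[of n] d c(1) by (simp add: ip2_diff S_def)
      have b: "2 * cmod (ip2 c d) \<le> Re (ip2 d d) / r" if r: "r > 0" for r
      proof (rule tendsto_lowerbound)
        show "(\<lambda>n. r * Re (ip2 (\<lambda>i. t n i - c i) (\<lambda>i. t n i - c i)) + Re (ip2 d d) / r)
                \<longlonglongrightarrow> Re (ip2 d d) / r"
          using tendsto_add[OF tendsto_mult_left[OF c(2), of r] tendsto_const, of "Re (ip2 d d) / r"]
          by simp
        show "\<forall>\<^sub>F n in sequentially. 2 * cmod (ip2 c d)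
                \<le> r * Re (ip2 (\<lambda>i. t n i - c i) (\<lambda>i. t n i - c i)) + Re (ip2 d d) / r"
          using ip2_bound[OF ell2_diff[OF l[OF t(1)] c(1)] d(1) r] by (simp add: eq)
      qed simp
      have "2 * cmod (ip2 c d) \<le> 0"
      proof (rule tendsto_lowerbound)
        show "((\<lambda>r. Re (ip2 d d) / r) \<longlongrightarrow> 0) at_top"
          by (rule tendsto_divide_0[OF tendsto_const filterlim_at_top_imp_at_infinity[OF filterlim_ident]])
        show "\<forall>\<^sub>F r in at_top. 2 * cmod (ip2 c d) \<le> Re (ip2 d d) / r"
          using eventually_gt_at_top[of 0] by eventually_elim (rule b)
      qed simp
      then show ?thesis by simp
    qed
    then have cS: "c \<in> S" using c(1) by (auto simp: S_def)
    have "(\<lambda>n. hnorm H (\<lambda>x. s n x - U c x)) \<longlonglongrightarrow> 0"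
      using tendsto_real_sqrt[OF c(2)] by (simp add: t nrm cS)
    then show ?thesis using cS by (auto simp: H_def)
  qed
  have "hilbert_function_space X H"
    unfolding hilbert_function_space_def
  proof (intro conjI)
    show "\<forall>f\<in>funs H. \<forall>x. x \<notin> X \<longrightarrow> f x = 0" by (auto simp: H_def U_def restr_def)
    show "(\<lambda>x. 0) \<in> funs H"
      using S0 by (auto simp: H_def U_def restr_def ip2_def image_iff intro!: bexI[of _ "\<lambda>i. 0"])
    show "\<forall>f\<in>funs H. \<forall>g\<in>funs H. (\<lambda>x. f x + g x) \<in> funs H"
      using Sadd by (auto simp: H_def simp flip: Uadd)
    show "\<forall>c. \<forall>f\<in>funs H. (\<lambda>x. c * f x) \<in> funs H"
      using Ssc by (auto simp: H_def simp flip: Usc)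
    show "\<forall>f\<in>funs H. \<forall>g\<in>funs H. \<forall>h\<in>funs H. ip H (\<lambda>x. f x + g x) h = ip H f h + ip H g h"
      by (auto simp: H_def JU Sadd ip2_add l simp flip: Uadd)
    show "\<forall>c. \<forall>f\<in>funs H. \<forall>h\<in>funs H. ip H (\<lambda>x. c * f x) h = c * ip H f h"
      by (auto simp: H_def JU Ssc ip2_scale simp flip: Usc)
    show "\<forall>f\<in>funs H. \<forall>g\<in>funs H. ip H g f = cnj (ip H f g)"
      by (auto simp: H_def intro: ip2_cnj)
    show "\<forall>f\<in>funs H. f \<noteq> (\<lambda>x. 0) \<longrightarrow> Re (ip H f f) > 0"
    proof (intro ballI impI)
      fix f assume "f \<in> funs H" "f \<noteq> (\<lambda>x. 0)"
      then obtain c where c: "c \<in> S" "f = U c" by (auto simp: H_def)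
      then have "c \<noteq> (\<lambda>i. 0)" using \<open>f \<noteq> _\<close> by (auto simp: U_def restr_def ip2_def)
      then show "Re (ip H f f) > 0" using c ip2_pos[OF l] by (simp add: H_def JU)
    qed
  qed (use complete in blast)
  moreover have "restr X (\<lambda>y. k y x) = U (\<Phi> x)" if "x \<in> X" for x
    using that by (auto simp: U_def restr_def k)
  then have "\<forall>x\<in>X. restr X (\<lambda>y. k y x) \<in> funs H \<and> (\<forall>f\<in>funs H. ip H f (restr X (\<lambda>y. k y x)) = f x)"
    by (auto simp: H_def JU S\<Phi>) (simp add: U_def restr_def)
  ultimately show ?thesis by (auto simp: is_rkhs_def)
qed

text \<open>
  Feature map of the Drury--Arveson kernel: \<open>x\<close> is sent to the monomials in \<open>cnj x\<close> indexed by
  words, since \<open>1 / (1 - \<langle>y,x\<rangle>) = (\<Sum>n. (\<Sum>i. y\<^sub>i * cnj x\<^sub>i) ^ n)\<close>.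
\<close>

lemma sum_prod_words:
  fixes f :: "'d::finite \<Rightarrow> 'b::comm_semiring_1"
  shows "(\<Sum>w\<in>{w. length w = n}. prod_list (map f w)) = (\<Sum>i\<in>UNIV. f i) ^ n"
proof (induction n)
  case (Suc n)
  have *: "{w::'d list. length w = Suc n} = (\<lambda>(i, w). i # w) ` (UNIV \<times> {w. length w = n})"
    by (force simp: length_Suc_conv image_iff)
  show ?case
    unfolding * by (subst sum.reindex)
      (auto simp: inj_on_def sum.cartesian_product' case_prod_unfold sum_product Suc.IH[symmetric] o_def)
qed simp

lemma finite_words: "finite {w::'d::finite list. length w = n}"
  using finite_lists_length_eq[of "UNIV::'d set" n] by simp

lemma words_summable:
  fixes f :: "'d::finite \<Rightarrow> real"
  assumes "\<And>i. f i \<ge> 0" "(\<Sum>i\<in>UNIV. f i) < 1"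
  shows "(\<lambda>w. prod_list (map f w)) summable_on UNIV"
proof (rule nonneg_bdd_above_summable_on)
  let ?r = "\<Sum>i\<in>UNIV. f i"
  have nn: "prod_list (map f w) \<ge> 0" for w by (induction w) (auto simp: assms)
  show "prod_list (map f w) \<ge> 0" for w by (rule nn)
  have "(\<Sum>w\<in>F. prod_list (map f w)) \<le> 1 / (1 - ?r)" if F: "finite F" for F
  proof -
    obtain N where N: "\<forall>w\<in>F. length w < N"
      using F by (metis finite_nat_set_iff_bounded finite_imageI image_eqI)
    have "(\<Sum>w\<in>F. prod_list (map f w)) \<le> (\<Sum>w\<in>(\<Union>n<N. {w. length w = n}). prod_list (map f w))"
      using N by (intro sum_mono2) (auto simp: nn finite_words)
    also have "\<dots> = (\<Sum>n<N. ?r ^ n)"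
      by (subst sum.UNION_disjoint) (auto simp: finite_words sum_prod_words)
    also have "\<dots> \<le> (\<Sum>n. ?r ^ n)"
      using assms by (intro sum_le_suminf summable_geometric) (auto simp: sum_nonneg)
    also have "\<dots> = 1 / (1 - ?r)"
      using assms by (intro suminf_geometric) (simp add: sum_nonneg)
    finally show ?thesis .
  qed
  then show "bdd_above (sum (\<lambda>w. prod_list (map f w)) ` {F. F \<subseteq> UNIV \<and> finite F})"
    by (intro bdd_aboveI2) auto
qed

lemma words_has_sum:
  fixes f :: "'d::finite \<Rightarrow> complex"
  assumes "(\<Sum>i\<in>UNIV. cmod (f i)) < 1"
  shows "(\<Sum>\<^sub>\<infinity>w. prod_list (map f w)) = 1 / (1 - (\<Sum>i\<in>UNIV. f i))"
proof -
  let ?g = "\<lambda>w. prod_list (map f w)" and ?z = "\<Sum>i\<in>UNIV. f i"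
  have nz: "cmod ?z < 1" using assms norm_sum[of f UNIV] by linarith
  have "cmod (?g w) = prod_list (map (\<lambda>i. cmod (f i)) w)" for w
    by (induction w) (auto simp: norm_mult)
  then have abs: "(\<lambda>w. norm (?g w)) summable_on UNIV" using words_summable[of "\<lambda>i. cmod (f i)"] assms by simp
  then have sm: "?g summable_on UNIV" by (rule Infinite_Sum.abs_summable_summable)
  have bij: "bij_betw snd (SIGMA n:UNIV. {w::'d list. length w = n}) UNIV"
    by (rule bij_betw_byWitness[where f' = "\<lambda>w. (length w, w)"]) auto
  have "((\<lambda>p. ?g (snd p)) has_sum infsum ?g UNIV) (SIGMA n:UNIV. {w::'d list. length w = n})"
    using has_sum_reindex_bij_betw[OF bij, of ?g] sm by (simp add: summable_iff_has_sum_infsum)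
  then have "((\<lambda>n. ?z ^ n) has_sum infsum ?g UNIV) UNIV"
    by (rule has_sum_SigmaD) (auto intro!: has_sum_finiteI finite_words simp: sum_prod_words)
  then have "(\<lambda>n. ?z ^ n) sums infsum ?g UNIV" by (rule has_sum_imp_sums)
  then show ?thesis using geometric_sums[OF nz] sums_unique2 by blast
qed

lemma norm_vec_sq: "(norm (x :: complex ^ 'd))\<^sup>2 = (\<Sum>i\<in>UNIV. (cmod (x $ i))\<^sup>2)"
  by (simp add: norm_vec_def L2_set_def sum_nonneg)

lemma da_feature_map:
  fixes \<Phi> :: "complex ^ 'd \<Rightarrow> 'd list \<Rightarrow> complex"
  defines "\<Phi> \<equiv> \<lambda>x w. prod_list (map (\<lambda>i. cnj (x $ i)) w)"
  shows "x \<in> ball 0 1 \<Longrightarrow> ell2 (\<Phi> x)"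
    and "x \<in> ball 0 1 \<Longrightarrow> y \<in> ball 0 1 \<Longrightarrow> da_kernel y x = ip2 (\<Phi> x) (\<Phi> y)"
proof -
  have lt: "(norm x)\<^sup>2 < 1" if "x \<in> ball 0 1" for x :: "complex ^ 'd"
    using that by (simp add: power_less_one_iff abs_square_less_1)
  show "ell2 (\<Phi> x)" if x: "x \<in> ball 0 1"
  proof -
    have "(cmod (\<Phi> x w))\<^sup>2 = prod_list (map (\<lambda>i. (cmod (x $ i))\<^sup>2) w)" for w
      unfolding \<Phi>_def by (induction w) (auto simp: norm_mult power_mult_distrib)
    then show ?thesis
      unfolding ell2_def using words_summable[of "\<lambda>i. (cmod (x $ i))\<^sup>2"] lt[OF x]
      by (simp add: norm_vec_sq)
  qed
  show "da_kernel y x = ip2 (\<Phi> x) (\<Phi> y)" if x: "x \<in> ball 0 1" and y: "y \<in> ball 0 1"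
  proof -
    have "2 * (\<Sum>i\<in>UNIV. cmod (y $ i * cnj (x $ i))) \<le> (norm x)\<^sup>2 + (norm y)\<^sup>2"
      unfolding norm_vec_sq sum.distrib[symmetric] sum_distrib_left
    proof (rule sum_mono)
      fix i show "2 * cmod (y $ i * cnj (x $ i)) \<le> (cmod (x $ i))\<^sup>2 + (cmod (y $ i))\<^sup>2"
        using sum_squares_bound[of "cmod (x $ i)" "cmod (y $ i)"] by (simp add: norm_mult mult_ac)
    qed
    then have "(\<Sum>i\<in>UNIV. cmod (y $ i * cnj (x $ i))) < 1" using lt[OF x] lt[OF y] by linarith
    moreover have "\<Phi> x w * cnj (\<Phi> y w) = prod_list (map (\<lambda>i. y $ i * cnj (x $ i)) w)" for w
      unfolding \<Phi>_def by (induction w) (auto simp: mult_ac)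
    ultimately show ?thesis
      using words_has_sum[of "\<lambda>i. y $ i * cnj (x $ i)"]
      by (simp add: da_kernel_def cinner_def ip2_def)
  qed
qed

theorem is_rkhs_drury_arveson: "is_rkhs (ball 0 1) da_kernel (drury_arveson :: (complex ^ 'd) hfs)"
  unfolding drury_arveson_def
  by (rule someI_ex, rule rkhs_exists, fact da_feature_map(1), fact da_feature_map(2))

end

theory Submission
  imports Defs "HOL-Computational_Algebra.Fundamental_Theorem_Algebra"
begin

text \<open>
  Since \<open>A\<close> maps the cone \<open>V\<close> onto \<open>W\<close> inside the ball, it is isometric on \<open>V\<close>. The form
  \<open>\<langle>Ax, Ay\<rangle> - \<langle>x, y\<rangle>\<close> thus vanishes on the diagonal of every irreducible component of \<open>V\<close>; projecting
  step by step along generic directions, as in Noether normalization, shows that it vanishes on all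
  pairs of points of the component. Hence \<open>A\<close> is isometric on the tractable union \<open>M\<close> of the spans of
  the components.

  If \<open>A\<close> and its inverse have norm close to 1, then \<open>A\<^bsup>\<otimes>m\<^esup>\<close> is close to isometric on the span of the
  vectors \<open>x\<^bsup>\<otimes>m\<^esup>\<close>, \<open>x \<in> M\<close>, uniformly in \<open>m\<close>. This goes by induction on the definition of tractability:
  subspaces with trivial intersection become almost orthogonal in high tensor powers, low tensor
  powers are controlled by powers of the norms, and for \<open>E \<oplus> N\<close> one expands
  \<open>(\<langle>e, e'\<rangle> + \<langle>n, n'\<rangle>)\<^sup>m\<close>. Summing the resulting kernel inequalities over \<open>m\<close> bounds \<open>T\<^sub>A\<close> and its inverse,
  so (1) implies (2).

  The adjoint of \<open>T\<^sub>A\<close> is composition with \<open>A\<close>, so multiplication by \<open>f \<circ> A\<^sup>-\<^sup>1\<close> is similar via this adjoint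
  to multiplication by \<open>f\<close>, and (2) implies (3). Applying the multiplier isomorphisms to the row of
  coordinate functions gives (4) from (3). Finally the multiplier norm of a linear map on a spanning
  cone equals its operator norm, which makes (4) and (1) equivalent.
\<close>

section \<open>Algebras of functions\<close>

text \<open>With the second variable conjugated, the diagonal of \<open>Y \<times> Y\<close> is
  totally real, so a form vanishing on it satisfies no polynomial equation that could be divided
  out. On a linear space a line with a real parameter settles the matter; a variety need not contain
  such lines. Projecting until the image fills a linear space restores them, and only the primality
  of vanishing ideals is needed to come back, without smooth points or connectedness.

  In the analytic half the obstacle is uniformity in \<open>m\<close>: however close the norm of
  \<open>A\<close> is to 1, its \<open>m\<close>-th power is unbounded. Isometry on \<open>M\<close>
  controls the high degrees, and the threshold between high and low degrees depends only on
  \<open>\<epsilon>\<close> and on angles between subspaces, so it is fixed before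
  \<open>\<delta>\<close>. All degrees are carried through the induction together, because the
  expansion for \<open>E \<oplus> N\<close> in one degree involves \<open>N\<close> in all lower
  ones.

  Complete boundedness enters in passing from (3) to (4): the norm of a row is invisible to the
  norms of its single entries.\<close>

inductive_set falg :: "('a \<Rightarrow> complex) set \<Rightarrow> ('a \<Rightarrow> complex) set" for G where
  const: "(\<lambda>x. c) \<in> falg G"
| gen: "g \<in> G \<Longrightarrow> g \<in> falg G"
| add: "f \<in> falg G \<Longrightarrow> g \<in> falg G \<Longrightarrow> (\<lambda>x. f x + g x) \<in> falg G"
| mult: "f \<in> falg G \<Longrightarrow> g \<in> falg G \<Longrightarrow> (\<lambda>x. f x * g x) \<in> falg G"

lemma falg_uminus: "f \<in> falg G \<Longrightarrow> (\<lambda>x. - f x) \<in> falg G"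
  using falg.mult[OF falg.const[of "-1" G], of f] by simp

lemma falg_diff: "f \<in> falg G \<Longrightarrow> g \<in> falg G \<Longrightarrow> (\<lambda>x. f x - g x) \<in> falg G"
  using falg.add[OF _ falg_uminus, of f G g] by simp

lemma falg_sum: "(\<And>i. i \<in> I \<Longrightarrow> f i \<in> falg G) \<Longrightarrow> (\<lambda>x. \<Sum>i\<in>I. f i x) \<in> falg G"
  by (induction I rule: infinite_finite_induct) (auto intro: falg.intros)

lemma falg_prod: "(\<And>i. i \<in> I \<Longrightarrow> f i \<in> falg G) \<Longrightarrow> (\<lambda>x. \<Prod>i\<in>I. f i x) \<in> falg G"
  by (induction I rule: infinite_finite_induct) (auto intro: falg.intros)

lemma falg_power: "f \<in> falg G \<Longrightarrow> (\<lambda>x. f x ^ n) \<in> falg G"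
  by (induction n) (auto intro: falg.intros)

lemma falg_poly: "f \<in> falg G \<Longrightarrow> (\<lambda>x. poly s (f x)) \<in> falg G"
  by (induction s) (auto intro: falg.intros)

lemma falg_comp:
  assumes "f \<in> falg G" "\<And>g. g \<in> G \<Longrightarrow> (\<lambda>x. g (h x)) \<in> falg G'"
  shows "(\<lambda>x. f (h x)) \<in> falg G'"
  using assms(1) by induction (auto intro: falg.intros assms(2))

text \<open>Turns coefficient functions built from projected coordinates back into functions of the
  projected point, which can then be evaluated anywhere and not only at projections.\<close>

lemma falg_pullback:
  assumes "f \<in> falg ((\<lambda>g x. g (h x)) ` G)"
  shows "\<exists>p\<in>falg G. f = (\<lambda>x. p (h x))"
  using assms
proof induction
  case (add f g)
  then obtain p q where "p \<in> falg G" "f = (\<lambda>x. p (h x))" "q \<in> falg G" "g = (\<lambda>x. q (h x))"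
    by blast
  then show ?case by (intro bexI[of _ "\<lambda>x. p x + q x"]) (auto intro: falg.intros)
next
  case (mult f g)
  then obtain p q where "p \<in> falg G" "f = (\<lambda>x. p (h x))" "q \<in> falg G" "g = (\<lambda>x. q (h x))"
    by blast
  then show ?case by (intro bexI[of _ "\<lambda>x. p x * q x"]) (auto intro: falg.intros)
qed (auto intro: falg.intros)

lemma falg_cong_on:
  assumes "f \<in> falg G" "\<And>g. g \<in> G \<Longrightarrow> g x = g y"
  shows "f x = f y"
  using assms(1) by induction (auto intro: assms(2))

text \<open>The restrictions of \<open>S\<close> to \<open>X\<close> form an integral domain. No
  quotient is formed: being zero always means vanishing on \<open>X\<close>, and nonemptiness of
  \<open>X\<close> keeps 1 from being zero.\<close>

definition prime_on :: "('a \<Rightarrow> complex) set \<Rightarrow> 'a set \<Rightarrow> bool" where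
  "prime_on S X \<longleftrightarrow> X \<noteq> {} \<and>
     (\<forall>f\<in>S. \<forall>g\<in>S. (\<forall>x\<in>X. f x * g x = 0) \<longrightarrow> (\<forall>x\<in>X. f x = 0) \<or> (\<forall>x\<in>X. g x = 0))"

lemma prime_onD:
  "prime_on S X \<Longrightarrow> f \<in> S \<Longrightarrow> g \<in> S \<Longrightarrow> (\<And>x. x \<in> X \<Longrightarrow> f x * g x = 0) \<Longrightarrow>
    (\<forall>x\<in>X. f x = 0) \<or> (\<forall>x\<in>X. g x = 0)"
  unfolding prime_on_def by blast

text \<open>More vectors than coordinates are dependent, as over the fraction field. Elimination by
  cross-multiplication keeps the coefficients in \<open>falg G\<close>, and primality ensures that
  multiplying by a pivot preserves nontriviality.\<close>

lemma dependent_over_domain: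
  fixes m :: "'k \<Rightarrow> 'j \<Rightarrow> 'a \<Rightarrow> complex"
  assumes "finite J" "finite K" "card J < card K"
    and "prime_on (falg G) X" "\<And>k j. k \<in> K \<Longrightarrow> j \<in> J \<Longrightarrow> m k j \<in> falg G"
  shows "\<exists>a. (\<forall>k\<in>K. a k \<in> falg G) \<and> (\<exists>k\<in>K. \<exists>x\<in>X. a k x \<noteq> 0) \<and>
             (\<forall>j\<in>J. \<forall>x\<in>X. (\<Sum>k\<in>K. a k x * m k j x) = 0)"
  using assms
proof (induction J arbitrary: K m rule: finite_induct)
  case empty
  then obtain k where "k \<in> K" by (metis card.empty card_gt_0_iff ex_in_conv)
  moreover obtain x where "x \<in> X" using empty(3) unfolding prime_on_def by blast
  ultimately show ?case
    by (intro exI[of _ "\<lambda>k x. 1"]) (auto intro: falg.const)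
next
  case (insert j0 J)
  show ?case
  proof (cases "\<forall>k\<in>K. \<forall>x\<in>X. m k j0 x = 0")
    case True
    have "\<exists>a. (\<forall>k\<in>K. a k \<in> falg G) \<and> (\<exists>k\<in>K. \<exists>x\<in>X. a k x \<noteq> 0) \<and>
             (\<forall>j\<in>J. \<forall>x\<in>X. (\<Sum>k\<in>K. a k x * m k j x) = 0)"
      using insert.prems insert.hyps by (intro insert.IH) auto
    then show ?thesis using True by auto
  next
    case False
    then obtain k0 x0 where k0: "k0 \<in> K" "x0 \<in> X" "m k0 j0 x0 \<noteq> 0" by blast
    \<comment> \<open>Cross-multiplying with the pivot row \<open>k0\<close> clears column
      \<open>j0\<close>, which leaves one row and one column less.\<close>
    define m' where "m' = (\<lambda>k j x. m k0 j0 x * m k j x - m k j0 x * m k0 j x)"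
    have fin: "finite (K - {k0})" using insert.prems by simp
    have "\<exists>a. (\<forall>k\<in>K - {k0}. a k \<in> falg G) \<and> (\<exists>k\<in>K - {k0}. \<exists>x\<in>X. a k x \<noteq> 0) \<and>
             (\<forall>j\<in>J. \<forall>x\<in>X. (\<Sum>k\<in>K - {k0}. a k x * m' k j x) = 0)"
      using insert.prems insert.hyps k0
      by (intro insert.IH) (auto simp: m'_def intro!: falg_diff falg.mult)
    then obtain a where a: "\<And>k. k \<in> K - {k0} \<Longrightarrow> a k \<in> falg G"
      "\<exists>k\<in>K - {k0}. \<exists>x\<in>X. a k x \<noteq> 0"
      "\<And>j x. j \<in> J \<Longrightarrow> x \<in> X \<Longrightarrow> (\<Sum>k\<in>K - {k0}. a k x * m' k j x) = 0" by blast
    \<comment> \<open>Column \<open>j0\<close> forces the coefficient of row \<open>k0\<close>; the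
      other coefficients are multiplied by the pivot so that no division occurs.\<close>
    define b where "b = (\<lambda>k x. if k = k0 then - (\<Sum>k\<in>K - {k0}. a k x * m k j0 x)
                               else m k0 j0 x * a k x)"
    have b_off: "(\<Sum>k\<in>K. b k x * m k j x) =
        (\<Sum>k\<in>K - {k0}. a k x * (m k0 j0 x * m k j x - m k j0 x * m k0 j x))" for j x
    proof -
      have "(\<Sum>k\<in>K. b k x * m k j x) = b k0 x * m k0 j x + (\<Sum>k\<in>K - {k0}. b k x * m k j x)"
        using k0 insert.prems by (simp add: sum.remove)
      also have "(\<Sum>k\<in>K - {k0}. b k x * m k j x) = (\<Sum>k\<in>K - {k0}. m k0 j0 x * a k x * m k j x)"
        by (rule sum.cong) (auto simp: b_def)
      also have "b k0 x * m k0 j x = (\<Sum>k\<in>K - {k0}. - (a k x * m k j0 x * m k0 j x))"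
        by (simp add: b_def sum_distrib_right sum_negf)
      finally show ?thesis by (simp add: sum.distrib[symmetric] algebra_simps)
    qed
    have "\<forall>k\<in>K. b k \<in> falg G"
    proof
      fix k assume k: "k \<in> K"
      show "b k \<in> falg G"
      proof (cases "k = k0")
        case True
        then have "b k = (\<lambda>x. - (\<Sum>k\<in>K - {k0}. a k x * m k j0 x))" by (auto simp: b_def)
        also have "\<dots> \<in> falg G"
          using a insert.prems by (intro falg_uminus falg_sum falg.mult) auto
        finally show ?thesis .
      next
        case False
        then have "b k = (\<lambda>x. m k0 j0 x * a k x)" by (auto simp: b_def)
        also have "\<dots> \<in> falg G"
          using a insert.prems k k0 False by (intro falg.mult) auto
        finally show ?thesis .
      qed
    qed
    moreover have "\<exists>k\<in>K. \<exists>x\<in>X. b k x \<noteq> 0"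
    proof -
      obtain k1 x1 where k1: "k1 \<in> K - {k0}" "x1 \<in> X" "a k1 x1 \<noteq> 0" using a by blast
      have "\<not> (\<forall>x\<in>X. m k0 j0 x * a k1 x = 0)"
        using prime_onD[OF insert.prems(3), of "m k0 j0" "a k1"] k0 k1 a insert.prems by auto
      then show ?thesis using k1 by (intro bexI[of _ k1]) (auto simp: b_def)
    qed
    moreover have "\<forall>j\<in>insert j0 J. \<forall>x\<in>X. (\<Sum>k\<in>K. b k x * m k j x) = 0"
      using a(3) unfolding b_off by (auto simp: m'_def mult.commute intro!: sum.neutral)
    ultimately show ?thesis by blast
  qed
qed

text \<open>Gaussian elimination with pivots that equal 1 at the point \<open>z\<close>.\<close>

lemma nakayama_elimination:
  fixes B :: "'u \<Rightarrow> 'u \<Rightarrow> 'b \<Rightarrow> complex" and u :: "'u \<Rightarrow> 'a \<Rightarrow> complex"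
  assumes "finite U"
    and "\<And>i j. i \<in> U \<Longrightarrow> j \<in> U \<Longrightarrow> B i j \<in> falg G"
    and "\<And>i j. i \<in> U \<Longrightarrow> j \<in> U \<Longrightarrow> B i j z = (if i = j then 1 else 0)"
    and "\<And>i x. i \<in> U \<Longrightarrow> x \<in> X \<Longrightarrow> (\<Sum>j\<in>U. B i j (h x) * u j x) = 0"
  shows "\<exists>D\<in>falg G. D z = 1 \<and> (\<forall>x\<in>X. \<forall>i\<in>U. D (h x) * u i x = 0)"
  using assms
proof (induction U arbitrary: B rule: finite_induct)
  case empty
  show ?case by (intro bexI[of _ "\<lambda>x. 1"]) (auto intro: falg.const)
next
  case (insert n U)
  \<comment> \<open>The eliminated matrix is again the identity at \<open>z\<close>, because
    \<open>B n n z = 1\<close> and the off-diagonal entries vanish there.\<close>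
  define B' where "B' = (\<lambda>i j x. B n n x * B i j x - B i n x * B n j x)"
  have "\<exists>D\<in>falg G. D z = 1 \<and> (\<forall>x\<in>X. \<forall>i\<in>U. D (h x) * u i x = 0)"
  proof (rule insert.IH)
    fix i j assume "i \<in> U" "j \<in> U"
    then show "B' i j \<in> falg G" "B' i j z = (if i = j then 1 else 0)"
      using insert.prems insert.hyps
      by (auto simp: B'_def intro!: falg_diff falg.mult)
  next
    fix i x assume i: "i \<in> U" and x: "x \<in> X"
    have "(\<Sum>j\<in>U. B n j (h x) * u j x) = - (B n n (h x) * u n x)"
      using insert.prems(3)[of n x] x insert.hyps by (simp add: eq_neg_iff_add_eq_0 add.commute)
    moreover have "(\<Sum>j\<in>U. B i j (h x) * u j x) = - (B i n (h x) * u n x)"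
      using insert.prems(3)[of i x] i x insert.hyps by (simp add: eq_neg_iff_add_eq_0 add.commute)
    moreover have "(\<Sum>j\<in>U. B' i j (h x) * u j x) =
        B n n (h x) * (\<Sum>j\<in>U. B i j (h x) * u j x) - B i n (h x) * (\<Sum>j\<in>U. B n j (h x) * u j x)"
      by (simp add: B'_def sum_distrib_left algebra_simps sum_subtractf)
    ultimately show "(\<Sum>j\<in>U. B' i j (h x) * u j x) = 0" by simp
  qed
  then obtain D where D: "D \<in> falg G" "D z = 1" "\<And>x i. x \<in> X \<Longrightarrow> i \<in> U \<Longrightarrow> D (h x) * u i x = 0"
    by blast
  show ?case
  proof (intro bexI conjI ballI)
    show "(\<lambda>x. D x * B n n x) \<in> falg G" using D insert.prems by (auto intro: falg.mult)
    show "D z * B n n z = 1" using D insert.prems by simp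
    fix x i assume x: "x \<in> X" and i: "i \<in> insert n U"
    show "D (h x) * B n n (h x) * u i x = 0"
    proof (cases "i = n")
      case True
      have "D (h x) * (B n n (h x) * u n x + (\<Sum>j\<in>U. B n j (h x) * u j x)) = 0"
        using insert.prems(3)[of n x] x insert.hyps by simp
      moreover have "D (h x) * (\<Sum>j\<in>U. B n j (h x) * u j x) = 0"
        unfolding sum_distrib_left using D(3)[OF x] by (intro sum.neutral) (auto simp: mult.left_commute)
      ultimately show ?thesis using True by (simp add: distrib_left mult.assoc)
    next
      case False
      then have "D (h x) * u i x = 0" using i x D(3) by blast
      then show ?thesis by auto
    qed
  qed
qed

text \<open>The \<open>falg G\<close>-module generated by \<open>U\<close>, seen only on
  \<open>X\<close>, since the monic relations to be used hold only there. Each generator indexes its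
  own coefficient.\<close>

definition span_over :: "('a \<Rightarrow> complex) set \<Rightarrow> 'a set \<Rightarrow> ('a \<Rightarrow> complex) set \<Rightarrow> ('a \<Rightarrow> complex) set" where
  "span_over G X U = {f. \<exists>m. (\<forall>u\<in>U. m u \<in> falg G) \<and> (\<forall>x\<in>X. f x = (\<Sum>u\<in>U. m u x * u x))}"

lemma span_over_cong: "f \<in> span_over G X U \<Longrightarrow> (\<And>x. x \<in> X \<Longrightarrow> g x = f x) \<Longrightarrow> g \<in> span_over G X U"
  unfolding span_over_def by auto

lemma span_over_base:
  assumes "finite U" "u \<in> U"
  shows "u \<in> span_over G X U"
proof -
  have "u x = (\<Sum>v\<in>U. (if v = u then 1 else 0) * v x)" for x
    using assms by (simp add: if_distrib[of "\<lambda>c. c * _"] cong: if_cong)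
  moreover have "(\<lambda>x. if v = u then 1 else 0) \<in> falg G" for v
    by (rule falg.const)
  ultimately show ?thesis
    unfolding span_over_def by (intro CollectI exI[of _ "\<lambda>v x. if v = u then 1 else 0"]) blast
qed

lemma span_over_add:
  assumes "f \<in> span_over G X U" "g \<in> span_over G X U"
  shows "(\<lambda>x. f x + g x) \<in> span_over G X U"
proof -
  obtain m k where "\<forall>u\<in>U. m u \<in> falg G" "\<forall>x\<in>X. f x = (\<Sum>u\<in>U. m u x * u x)"
    "\<forall>u\<in>U. k u \<in> falg G" "\<forall>x\<in>X. g x = (\<Sum>u\<in>U. k u x * u x)"
    using assms unfolding span_over_def by blast
  then show ?thesis unfolding span_over_def
    by (intro CollectI exI[of _ "\<lambda>u x. m u x + k u x"])
      (auto intro: falg.add simp: distrib_right sum.distrib)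
qed

lemma span_over_scale:
  assumes "f \<in> span_over G X U" "s \<in> falg G"
  shows "(\<lambda>x. s x * f x) \<in> span_over G X U"
proof -
  obtain m where "\<forall>u\<in>U. m u \<in> falg G" "\<forall>x\<in>X. f x = (\<Sum>u\<in>U. m u x * u x)"
    using assms unfolding span_over_def by blast
  then show ?thesis unfolding span_over_def
    by (intro CollectI exI[of _ "\<lambda>u x. s x * m u x"])
      (auto intro: falg.mult assms(2) simp: sum_distrib_left mult.assoc)
qed

lemma span_over_sum:
  "(\<And>i. i \<in> I \<Longrightarrow> f i \<in> span_over G X U) \<Longrightarrow> (\<lambda>x. \<Sum>i\<in>I. f i x) \<in> span_over G X U"
proof (induction I rule: infinite_finite_induct)
  case (insert i I)
  then show ?case by (auto intro: span_over_add)
qed (auto simp: span_over_def intro!: exI[of _ "\<lambda>u x. 0"] falg.const)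

lemma span_over_mult:
  assumes "f \<in> span_over G X U" "\<And>u. u \<in> U \<Longrightarrow> (\<lambda>x. g x * u x) \<in> span_over G X U"
  shows "(\<lambda>x. g x * f x) \<in> span_over G X U"
proof -
  obtain m where m: "\<forall>u\<in>U. m u \<in> falg G" "\<forall>x\<in>X. f x = (\<Sum>u\<in>U. m u x * u x)"
    using assms unfolding span_over_def by blast
  have "(\<lambda>x. \<Sum>u\<in>U. m u x * (g x * u x)) \<in> span_over G X U"
    using m by (intro span_over_sum span_over_scale assms(2)) auto
  then show ?thesis
    by (rule span_over_cong) (auto simp: m sum_distrib_left mult.left_commute)
qed

text \<open>Stability under the generators of an algebra gives stability under the algebra, so a
  finite module has to be tested against coordinates only.\<close>

lemma span_over_falg:
  assumes "f \<in> falg H" "e \<in> span_over G X U"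
    and "\<And>h u. h \<in> H \<Longrightarrow> u \<in> U \<Longrightarrow> (\<lambda>x. h x * u x) \<in> span_over G X U"
  shows "(\<lambda>x. f x * e x) \<in> span_over G X U"
  using assms(1,2)
proof (induction arbitrary: e)
  case (const c)
  then show ?case by (intro span_over_scale falg.const)
next
  case (gen g)
  show ?case by (rule span_over_mult[OF gen(2)]) (rule assms(3)[OF gen(1)])
next
  case (add f g)
  then show ?case using span_over_add[of "\<lambda>x. f x * e x" G X U "\<lambda>x. g x * e x"]
    by (simp add: distrib_right)
next
  case (mult f g)
  then show ?case by (simp add: mult.assoc)
qed

section \<open>Polynomial functions\<close>

definition coord :: "'i \<Rightarrow> ('i \<Rightarrow> complex) \<Rightarrow> complex" where
  "coord i x = x i"

text \<open>Polynomial functions instead of formal polynomials: over an infinite field they carry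
  the same information, and composing with a projection is a substitution of generators.\<close>

definition polys :: "'i set \<Rightarrow> (('i \<Rightarrow> complex) \<Rightarrow> complex) set" where
  "polys J = falg (coord ` J)"

lemma polys_comp:
  assumes "f \<in> polys J" "\<And>i. i \<in> J \<Longrightarrow> (\<lambda>x. h x i) \<in> falg G"
  shows "(\<lambda>x. f (h x)) \<in> falg G"
  using assms unfolding polys_def by (elim falg_comp) (auto simp: coord_def)

lemma polys_cong: "f \<in> polys J \<Longrightarrow> (\<And>i. i \<in> J \<Longrightarrow> x i = y i) \<Longrightarrow> f x = f y"
  unfolding polys_def by (erule falg_cong_on) (auto simp: coord_def)

lemma polys_coord: "i \<in> J \<Longrightarrow> (\<lambda>x. x i) \<in> polys J"
  using falg.gen[of "coord i" "coord ` J"] by (simp add: polys_def coord_def[abs_def])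

section \<open>Homogeneous parts and restriction to lines\<close>

inductive homog :: "'i set \<Rightarrow> nat \<Rightarrow> (('i \<Rightarrow> complex) \<Rightarrow> complex) \<Rightarrow> bool" for J where
  zero: "homog J k (\<lambda>x. 0)"
| const: "homog J 0 (\<lambda>x. c)"
| coord: "i \<in> J \<Longrightarrow> homog J 1 (\<lambda>x. x i)"
| add: "homog J k f \<Longrightarrow> homog J k g \<Longrightarrow> homog J k (\<lambda>x. f x + g x)"
| mult: "homog J k f \<Longrightarrow> homog J l g \<Longrightarrow> homog J (k + l) (\<lambda>x. f x * g x)"

lemma homog_sum: "(\<And>a. a \<in> I \<Longrightarrow> homog J k (f a)) \<Longrightarrow> homog J k (\<lambda>x. \<Sum>a\<in>I. f a x)"
  by (induction I rule: infinite_finite_induct) (auto intro: homog.intros)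

lemma homog_scale: "homog J k f \<Longrightarrow> f (\<lambda>i. c * x i) = c ^ k * f x"
  by (induction rule: homog.induct) (auto simp: power_add algebra_simps)

lemma coeff_mult_top:
  fixes p q :: "complex poly"
  assumes "degree p \<le> k" "degree q \<le> l"
  shows "coeff (p * q) (k + l) = coeff p k * coeff q l"
proof -
  have "coeff (p * q) (k + l) = (\<Sum>i\<le>k + l. coeff p i * coeff q (k + l - i))"
    by (simp add: coeff_mult)
  also have "\<dots> = (\<Sum>i\<in>{k}. coeff p i * coeff q (k + l - i))"
  proof (rule sum.mono_neutral_right)
    show "\<forall>i\<in>{..k + l} - {k}. coeff p i * coeff q (k + l - i) = 0"
    proof
      fix i assume i: "i \<in> {..k + l} - {k}"
      show "coeff p i * coeff q (k + l - i) = 0"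
      proof (cases "i < k")
        case True
        then show ?thesis using assms by (simp add: coeff_eq_0)
      next
        case False
        then show ?thesis using assms i by (simp add: coeff_eq_0)
      qed
    qed
  qed auto
  finally show ?thesis by simp
qed

text \<open>Along \<open>x + t v\<close> a form of degree \<open>k\<close> has
  \<open>t^k\<close>-coefficient \<open>f v\<close>, whatever the base point \<open>x\<close>. This
  independence makes every direction with \<open>f v \<noteq> 0\<close> a monic one.\<close>

lemma homog_slice:
  assumes "homog J k f"
  shows "\<exists>q. (\<forall>x t. poly (q x) t = f (\<lambda>i. x i + t * v i)) \<and> (\<forall>x. degree (q x) \<le> k) \<and>
             (\<forall>x. coeff (q x) k = f v) \<and> (\<forall>n. (\<lambda>x. coeff (q x) n) \<in> polys J)"
  using assms
proof induction
  case (zero k)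
  show ?case by (intro exI[of _ "\<lambda>x. 0"]) (auto simp: polys_def intro: falg.const)
next
  case (const c)
  have "(\<lambda>x. coeff [:c:] n) \<in> polys J" for n unfolding polys_def by (rule falg.const)
  then show ?case by (intro exI[of _ "\<lambda>x. [:c:]"]) auto
next
  case (coord i)
  have "(\<lambda>x. coeff [:x i, v i:] n) \<in> polys J" for n
    using polys_coord[OF coord]
    by (cases n) (auto simp: polys_def coeff_pCons split: nat.split intro: falg.const)
  then show ?case by (intro exI[of _ "\<lambda>x. [:x i, v i:]"]) (auto simp: degree_pCons_eq_if)
next
  case (add k f g)
  obtain p where p: "\<forall>x t. poly (p x) t = f (\<lambda>i. x i + t * v i)" "\<forall>x. degree (p x) \<le> k"
    "\<forall>x. coeff (p x) k = f v" "\<forall>n. (\<lambda>x. coeff (p x) n) \<in> polys J" using add.IH(1) by blast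
  obtain q where q: "\<forall>x t. poly (q x) t = g (\<lambda>i. x i + t * v i)" "\<forall>x. degree (q x) \<le> k"
    "\<forall>x. coeff (q x) k = g v" "\<forall>n. (\<lambda>x. coeff (q x) n) \<in> polys J" using add.IH(2) by blast
  show ?case
    using p q by (intro exI[of _ "\<lambda>x. p x + q x"])
      (auto simp: polys_def intro: falg.add degree_add_le)
next
  case (mult k f l g)
  obtain p where p: "\<forall>x t. poly (p x) t = f (\<lambda>i. x i + t * v i)" "\<forall>x. degree (p x) \<le> k"
    "\<forall>x. coeff (p x) k = f v" "\<forall>n. (\<lambda>x. coeff (p x) n) \<in> polys J" using mult.IH(1) by blast
  obtain q where q: "\<forall>x t. poly (q x) t = g (\<lambda>i. x i + t * v i)" "\<forall>x. degree (q x) \<le> l"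
    "\<forall>x. coeff (q x) l = g v" "\<forall>n. (\<lambda>x. coeff (q x) n) \<in> polys J" using mult.IH(2) by blast
  have "(\<lambda>x. coeff (p x * q x) n) \<in> polys J" for n
    using p q unfolding polys_def coeff_mult by (intro falg_sum falg.mult) auto
  moreover have "degree (p x * q x) \<le> k + l" for x
    using p q by (meson add_mono degree_mult_le order_trans)
  ultimately show ?case
    using p q by (intro exI[of _ "\<lambda>x. p x * q x"]) (auto simp: coeff_mult_top)
qed

text \<open>The parts are stored as coefficients of a univariate polynomial \<open>p x\<close> whose
  variable records the degree; it represents \<open>t \<mapsto> f (t x)\<close>. Multiplying graded
  sums is then polynomial multiplication.\<close>

lemma polys_homog_parts:
  assumes "f \<in> polys J"
  shows "\<exists>p D. (\<forall>x. f x = poly (p x) 1) \<and> (\<forall>x. degree (p x) \<le> D) \<and>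
               (\<forall>k. homog J k (\<lambda>x. coeff (p x) k))"
  using assms unfolding polys_def
proof induction
  case (const c)
  have "homog J k (\<lambda>x. coeff [:c:] k)" for k
    by (cases k) (auto intro: homog.intros)
  then show ?case by (intro exI[of _ "\<lambda>x. [:c:]"] exI[of _ 0]) auto
next
  case (gen g)
  then obtain i where i: "i \<in> J" "g = (\<lambda>x. x i)" by (auto simp: coord_def[abs_def])
  have "homog J k (\<lambda>x. coeff [:0, x i:] k)" for k
  proof (cases "k = 1")
    case True
    then show ?thesis using homog.coord[OF i(1)] by simp
  next
    case False
    then have "coeff [:0, x i:] k = 0" for x :: "_ \<Rightarrow> complex" by (simp add: coeff_pCons split: nat.split)
    then show ?thesis by (simp add: homog.zero)
  qed
  then show ?case by (intro exI[of _ "\<lambda>x. [:0, x i:]"] exI[of _ 1]) (auto simp: i)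
next
  case (add f g)
  obtain p D where p: "\<forall>x. f x = poly (p x) 1" "\<forall>x. degree (p x) \<le> D"
    "\<forall>k. homog J k (\<lambda>x. coeff (p x) k)" using add.IH(1) by blast
  obtain q E where q: "\<forall>x. g x = poly (q x) 1" "\<forall>x. degree (q x) \<le> E"
    "\<forall>k. homog J k (\<lambda>x. coeff (q x) k)" using add.IH(2) by blast
  have "degree (p x + q x) \<le> max D E" for x
    using p q by (meson degree_add_le max.coboundedI1 max.coboundedI2)
  then show ?case using p q
    by (intro exI[of _ "\<lambda>x. p x + q x"] exI[of _ "max D E"]) (auto intro: homog.add)
next
  case (mult f g)
  obtain p D where p: "\<forall>x. f x = poly (p x) 1" "\<forall>x. degree (p x) \<le> D"
    "\<forall>k. homog J k (\<lambda>x. coeff (p x) k)" using mult.IH(1) by blast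
  obtain q E where q: "\<forall>x. g x = poly (q x) 1" "\<forall>x. degree (q x) \<le> E"
    "\<forall>k. homog J k (\<lambda>x. coeff (q x) k)" using mult.IH(2) by blast
  have "degree (p x * q x) \<le> D + E" for x
    using p q by (meson add_mono degree_mult_le order_trans)
  moreover have "homog J k (\<lambda>x. coeff (p x * q x) k)" for k
    unfolding coeff_mult
  proof (rule homog_sum)
    fix i assume "i \<in> {..k}"
    then show "homog J k (\<lambda>x. coeff (p x) i * coeff (q x) (k - i))"
      using homog.mult[of J i "\<lambda>x. coeff (p x) i" "k - i" "\<lambda>x. coeff (q x) (k - i)"] p q by simp
  qed
  ultimately show ?case using p q
    by (intro exI[of _ "\<lambda>x. p x * q x"] exI[of _ "D + E"]) auto
qed

lemma poly_eq_sum_coeff: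
  fixes p :: "complex poly"
  assumes "degree p \<le> n"
  shows "poly p t = (\<Sum>k\<le>n. coeff p k * t ^ k)"
proof -
  have "poly (\<Sum>i\<le>n. monom (coeff p i) i) t = (\<Sum>k\<le>n. coeff p k * t ^ k)"
    by (simp add: poly_sum poly_monom)
  then show ?thesis using poly_as_sum_of_monoms'[OF assms] by simp
qed

lemma poly_slice_sum:
  assumes "\<And>k. k \<le> N \<Longrightarrow> homog J k (f k)"
  shows "\<exists>q. (\<forall>x t. poly (q x) t = (\<Sum>k\<le>N. f k (\<lambda>i. x i + t * v i))) \<and>
             (\<forall>x. degree (q x) \<le> N) \<and> (\<forall>x. coeff (q x) N = f N v) \<and>
             (\<forall>n. (\<lambda>x. coeff (q x) n) \<in> polys J)"
proof -
  have "\<forall>k. \<exists>q. k \<le> N \<longrightarrow> ((\<forall>x t. poly (q x) t = f k (\<lambda>i. x i + t * v i)) \<and> (\<forall>x. degree (q x) \<le> k) \<and>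
             (\<forall>x. coeff (q x) k = f k v) \<and> (\<forall>n. (\<lambda>x. coeff (q x) n) \<in> polys J))"
    using homog_slice assms by blast
  from choice[OF this] obtain q where q0: "\<forall>k. k \<le> N \<longrightarrow> ((\<forall>x t. poly (q k x) t = f k (\<lambda>i. x i + t * v i)) \<and> (\<forall>x. degree (q k x) \<le> k) \<and>
             (\<forall>x. coeff (q k x) k = f k v) \<and> (\<forall>n. (\<lambda>x. coeff (q k x) n) \<in> polys J))" ..
  have q: "\<And>k x t. k \<le> N \<Longrightarrow> poly (q k x) t = f k (\<lambda>i. x i + t * v i)"
    "\<And>k x. k \<le> N \<Longrightarrow> degree (q k x) \<le> k" "\<And>k x. k \<le> N \<Longrightarrow> coeff (q k x) k = f k v"
    "\<And>k n. k \<le> N \<Longrightarrow> (\<lambda>x. coeff (q k x) n) \<in> polys J" using q0 by simp_all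
  define Q where "Q = (\<lambda>x. \<Sum>k\<le>N. q k x)"
  have "degree (Q x) \<le> N" for x
    unfolding Q_def by (rule degree_sum_le) (auto intro: order_trans[OF q(2)])
  moreover have "coeff (Q x) N = f N v" for x
  proof -
    have "coeff (Q x) N = (\<Sum>k\<in>{N}. coeff (q k x) N)"
      unfolding Q_def coeff_sum
    proof (rule sum.mono_neutral_right)
      show "\<forall>k\<in>{..N} - {N}. coeff (q k x) N = 0"
      proof
        fix k assume "k \<in> {..N} - {N}"
        then show "coeff (q k x) N = 0"
          using q(2)[of k x] by (intro coeff_eq_0) auto
      qed
    qed auto
    then show ?thesis using q(3)[of N] by simp
  qed
  moreover have "(\<lambda>x. coeff (Q x) n) \<in> polys J" for n
    unfolding Q_def coeff_sum polys_def
    by (rule falg_sum) (use q(4) in \<open>auto simp: polys_def\<close>)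
  moreover have "poly (Q x) t = (\<Sum>k\<le>N. f k (\<lambda>i. x i + t * v i))" for x t
    unfolding Q_def by (simp add: poly_sum q(1))
  ultimately show ?thesis by blast
qed

lemma poly_slice:
  assumes "f \<in> polys J"
  shows "\<exists>q D. (\<forall>x t. poly (q x) t = f (\<lambda>i. x i + t * v i)) \<and> (\<forall>x. degree (q x) \<le> D) \<and>
             (\<forall>n. (\<lambda>x. coeff (q x) n) \<in> polys J)"
proof -
  obtain p D where p: "\<forall>x. f x = poly (p x) 1" "\<forall>x. degree (p x) \<le> D"
      "\<forall>k. homog J k (\<lambda>x. coeff (p x) k)" using polys_homog_parts[OF assms] by blast
  have "f x = (\<Sum>k\<le>D. coeff (p x) k)" for x
    using p(1,2) poly_eq_sum_coeff[of "p x" D 1] by simp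
  then show ?thesis using poly_slice_sum[of D J "\<lambda>k x. coeff (p x) k" v] p(3) by auto
qed

text \<open>The top homogeneous part of \<open>P\<close> does not vanish at \<open>v\<close>, so \<open>P\<close> is monic along \<open>v\<close>.\<close>

lemma monic_slice:
  assumes P: "P \<in> polys J" "P x0 \<noteq> 0" and j: "j \<in> J"
  obtains q v N c where "\<And>x t. poly (q x) t = P (\<lambda>i. x i + t * v i)"
    "\<And>x. degree (q x) \<le> N" "\<And>x. coeff (q x) N = c" "\<And>n. (\<lambda>x. coeff (q x) n) \<in> polys J"
    "v j = 1" "c \<noteq> 0"
proof -
  obtain p D where p: "\<forall>x. P x = poly (p x) 1" "\<forall>x. degree (p x) \<le> D"
      "\<forall>k. homog J k (\<lambda>x. coeff (p x) k)" using polys_homog_parts[OF P(1)] by blast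
  define A where "A = {k. \<exists>x. coeff (p x) k \<noteq> 0}"
  have "A \<subseteq> {..D}" using p(2) unfolding A_def by (auto intro: le_degree order_trans)
  then have fin: "finite A" by (rule finite_subset) simp
  have "p x0 \<noteq> 0" using P p by auto
  then have "coeff (p x0) (degree (p x0)) \<noteq> 0" by simp
  then have ne: "A \<noteq> {}" unfolding A_def by blast
  define N where "N = Max A"
  have "N \<in> A" unfolding N_def using fin ne by simp
  then obtain w where w: "coeff (p w) N \<noteq> 0" unfolding A_def by blast
  have above: "degree (p x) \<le> N" for x
  proof (cases "p x = 0")
    case False
    then have "coeff (p x) (degree (p x)) \<noteq> 0" by simp
    then have "degree (p x) \<in> A" unfolding A_def by blast
    then show ?thesis using fin by (simp add: N_def)
  qed simp
  have hN: "homog J N (\<lambda>x. coeff (p x) N)" using p(3) by blast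
  \<comment> \<open>The top form must be nonzero at a vector with nonzero
    \<open>j\<close>-coordinate. If \<open>w j = 0\<close>, moving \<open>w\<close> along the
    \<open>j\<close>-th axis keeps the form nonzero except at finitely many parameters.\<close>
  obtain u where u: "coeff (p u) N \<noteq> 0" "u j \<noteq> 0"
  proof (cases "w j = 0")
    case False
    then show ?thesis using w that by blast
  next
    case True
    define e where "e = (\<lambda>i. if i = j then 1 else 0 :: complex)"
    obtain q where q: "\<forall>x t. poly (q x) t = coeff (p (\<lambda>i. x i + t * e i)) N"
      using homog_slice[OF hN, of e] by blast
    have "poly (q w) 0 \<noteq> 0" using q w by simp
    then have "q w \<noteq> 0" by auto
    then have "finite {t. poly (q w) t = 0}" by (rule poly_roots_finite)
    then have "finite (insert 0 {t. poly (q w) t = 0})" by simp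
    then obtain t where "t \<notin> insert 0 {t. poly (q w) t = 0}"
      using ex_new_if_finite[OF infinite_UNIV_char_0] by blast
    then show ?thesis using q that[of "\<lambda>i. w i + t * e i"] True by (auto simp: e_def)
  qed
  \<comment> \<open>Rescaling to \<open>v j = 1\<close> multiplies the top form by a nonzero
    number.\<close>
  define v where "v = (\<lambda>i. (1 / u j) * u i)"
  have v: "v j = 1" "coeff (p v) N \<noteq> 0"
    using u homog_scale[OF hN, of "1 / u j" u] by (auto simp: v_def)
  obtain q where q: "(\<forall>x t. poly (q x) t = (\<Sum>k\<le>N. coeff (p (\<lambda>i. x i + t * v i)) k))"
             "(\<forall>x. degree (q x) \<le> N)" "(\<forall>x. coeff (q x) N = coeff (p v) N)"
             "(\<forall>n. (\<lambda>x. coeff (q x) n) \<in> polys J)"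
    using poly_slice_sum[of N J "\<lambda>k x. coeff (p x) k" v] p(3) by auto
  have "P x = (\<Sum>k\<le>N. coeff (p x) k)" for x
    using p(1) poly_eq_sum_coeff[OF above, of _ 1] by simp
  then show thesis using q v by (intro that[of q v N "coeff (p v) N"]) auto
qed

section \<open>Polynomials in \<open>x\<close> and \<open>cnj y\<close>, and polarization\<close>

definition sespolys :: "'i set \<Rightarrow> (('i \<Rightarrow> complex) \<times> ('i \<Rightarrow> complex) \<Rightarrow> complex) set" where
  "sespolys J = falg ((\<lambda>i (x, y). x i) ` J \<union> (\<lambda>i (x, y). cnj (y i)) ` J)"

lemma sespolys_cong:
  "f \<in> sespolys J \<Longrightarrow> (\<And>i. i \<in> J \<Longrightarrow> x i = x' i \<and> y i = y' i) \<Longrightarrow> f (x, y) = f (x', y')"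
  unfolding sespolys_def by (erule falg_cong_on) auto

lemma sespolys_comp:
  assumes "f \<in> sespolys J" "\<And>i. i \<in> J \<Longrightarrow> (\<lambda>w. g w i) \<in> falg G"
    "\<And>i. i \<in> J \<Longrightarrow> (\<lambda>w. cnj (h w i)) \<in> falg G"
  shows "(\<lambda>w. f (g w, h w)) \<in> falg G"
  using assms(1) unfolding sespolys_def
  by (rule falg_comp[where h = "\<lambda>w. (g w, h w)"]) (auto simp: assms(2,3))

lemma sespolys_fst:
  assumes "f \<in> sespolys J"
  shows "(\<lambda>x. f (x, y)) \<in> polys J"
  unfolding polys_def
  by (rule sespolys_comp[OF assms]) (auto intro: falg.const polys_coord[unfolded polys_def])

lemma sespolys_snd:
  assumes "f \<in> sespolys J"
  shows "(\<lambda>y. cnj (f (x, y))) \<in> polys J"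
  using assms unfolding sespolys_def polys_def
proof induction
  case (gen g)
  then show ?case
    by (auto intro: falg.const polys_coord[unfolded polys_def])
next
  case (add f g)
  then show ?case by (simp add: falg.add)
next
  case (mult f g)
  then show ?case by (simp add: falg.mult)
qed (simp add: falg.const)

text \<open>The conjugation of the second argument cancels the one built into its generators, so the
  dependence on \<open>s\<close> is polynomial and not merely real analytic.\<close>

lemma sespolys_line:
  assumes "f \<in> sespolys J"
  shows "\<exists>q. \<forall>s. poly q s = f (\<lambda>i. a i + s * b i, \<lambda>i. cnj (c i + s * d i))"
  using assms unfolding sespolys_def
proof induction
  case (const c)
  show ?case by (intro exI[of _ "[:c:]"]) auto
next
  case (gen g)
  then consider i where "g = (\<lambda>(x, y). x i)" | i where "g = (\<lambda>(x, y). cnj (y i))" by auto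
  then show ?case
  proof cases
    case 1
    then show ?thesis by (intro exI[of _ "[:a i, b i:]"]) auto
  next
    case 2
    then show ?thesis by (intro exI[of _ "[:c i, d i:]"]) auto
  qed
next
  case (add f g)
  then obtain p q where "\<forall>s. poly p s = f (\<lambda>i. a i + s * b i, \<lambda>i. cnj (c i + s * d i))"
    "\<forall>s. poly q s = g (\<lambda>i. a i + s * b i, \<lambda>i. cnj (c i + s * d i))" by blast
  then show ?case by (intro exI[of _ "p + q"]) simp
next
  case (mult f g)
  then obtain p q where "\<forall>s. poly p s = f (\<lambda>i. a i + s * b i, \<lambda>i. cnj (c i + s * d i))"
    "\<forall>s. poly q s = g (\<lambda>i. a i + s * b i, \<lambda>i. cnj (c i + s * d i))" by blast
  then show ?case by (intro exI[of _ "p * q"]) simp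
qed

text \<open>There is a line on which real parameters give diagonal points and the parameter
  \<open>\<i>\<close> gives \<open>(x, y)\<close>. A polynomial with infinitely many zeros vanishes
  identically.\<close>

lemma sespolys_polarize:
  assumes f: "f \<in> sespolys J" and "\<And>x. f (x, x) = 0"
  shows "f (x, y) = 0"
proof -
  \<comment> \<open>Chosen so that \<open>x = P + \<i> Q\<close> and
    \<open>cnj y = P - \<i> Q\<close>. Writing \<open>P\<close> and \<open>Q\<close> as real part
    plus \<open>s\<close> times imaginary part gives the line; \<open>s = \<i>\<close> recovers
    \<open>P\<close> and \<open>Q\<close>.\<close>
  define P Q where "P = (\<lambda>i. (x i + cnj (y i)) / 2)" and "Q = (\<lambda>i. (x i - cnj (y i)) / (2 * \<i>))"
  define a b c d where "a = (\<lambda>i. of_real (Re (P i)) + \<i> * of_real (Re (Q i)))"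
    and "b = (\<lambda>i. of_real (Im (P i)) + \<i> * of_real (Im (Q i)))"
    and "c = (\<lambda>i. of_real (Re (P i)) - \<i> * of_real (Re (Q i)))"
    and "d = (\<lambda>i. of_real (Im (P i)) - \<i> * of_real (Im (Q i)))"
  obtain q where q: "\<And>s. poly q s = f (\<lambda>i. a i + s * b i, \<lambda>i. cnj (c i + s * d i))"
    using sespolys_line[OF f] by metis
  have "poly q (of_real s) = 0" for s :: real
  proof -
    have "(\<lambda>i. cnj (c i + of_real s * d i)) = (\<lambda>i. a i + of_real s * b i)"
      by (auto simp: a_def b_def c_def d_def complex_eq_iff)
    then show ?thesis using assms(2) q by simp
  qed
  then have "range (of_real :: real \<Rightarrow> complex) \<subseteq> {s. poly q s = 0}" by auto
  moreover have "infinite (range (of_real :: real \<Rightarrow> complex))"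
    using finite_imageD[of "of_real :: real \<Rightarrow> complex" UNIV] by (auto simp: inj_of_real infinite_UNIV_char_0)
  ultimately have "q = 0" using poly_roots_finite finite_subset by blast
  then have "f (\<lambda>i. a i + \<i> * b i, \<lambda>i. cnj (c i + \<i> * d i)) = 0" using q[of \<i>] by simp
  moreover have "a i + \<i> * b i = x i" "cnj (c i + \<i> * d i) = y i" for i
  proof -
    have "a i + \<i> * b i = P i + \<i> * Q i" "c i + \<i> * d i = P i - \<i> * Q i"
      by (auto simp: a_def b_def c_def d_def complex_eq_iff)
    moreover have "P i + \<i> * Q i = x i" "P i - \<i> * Q i = cnj (y i)"
      by (auto simp: P_def Q_def field_simps)
    ultimately show "a i + \<i> * b i = x i" "cnj (c i + \<i> * d i) = y i" by auto
  qed
  ultimately show ?thesis by simp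
qed

section \<open>Polarization on irreducible algebraic sets\<close>

text \<open>Let \<open>f\<close> and \<open>g\<close> be nonzero at \<open>(x1, y1)\<close> and
  \<open>(x2, y2)\<close>. For each \<open>y\<close>, primality in the first variable makes
  \<open>f (x1, y)\<close> or \<open>g (x2, y)\<close> zero; primality in the second variable makes
  one of them zero for all \<open>y\<close>.\<close>

lemma prime_on_sespolys:
  assumes "prime_on (polys J) Y"
  shows "prime_on (sespolys J) (Y \<times> Y)"
  unfolding prime_on_def
proof (intro conjI ballI impI)
  show "Y \<times> Y \<noteq> {}" using assms by (auto simp: prime_on_def)
  fix f g assume f: "f \<in> sespolys J" and g: "g \<in> sespolys J"
    and fg: "\<forall>w\<in>Y \<times> Y. f w * g w = 0"
  show "(\<forall>w\<in>Y \<times> Y. f w = 0) \<or> (\<forall>w\<in>Y \<times> Y. g w = 0)"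
  proof (rule ccontr)
    assume "\<not> ?thesis"
    then obtain x1 y1 x2 y2 where w: "x1 \<in> Y" "y1 \<in> Y" "f (x1, y1) \<noteq> 0"
      "x2 \<in> Y" "y2 \<in> Y" "g (x2, y2) \<noteq> 0" by auto
    have "(\<forall>y\<in>Y. cnj (f (x1, y)) = 0) \<or> (\<forall>y\<in>Y. cnj (g (x2, y)) = 0)"
    proof (rule prime_onD[OF assms sespolys_snd[OF f] sespolys_snd[OF g]])
      fix y assume y: "y \<in> Y"
      have "(\<forall>x\<in>Y. f (x, y) = 0) \<or> (\<forall>x\<in>Y. g (x, y) = 0)"
        by (rule prime_onD[OF assms sespolys_fst[OF f] sespolys_fst[OF g]]) (use fg y in auto)
      then show "cnj (f (x1, y)) * cnj (g (x2, y)) = 0" using w by auto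
    qed
    then show False using w by auto
  qed
qed

text \<open>Multiplication by \<open>t\<close> raises the exponent by one; once it reaches
  \<open>N\<close>, the monic relation brings it back below \<open>N\<close>.\<close>

lemma span_over_monic:
  assumes "finite U" "\<And>k. k < N \<Longrightarrow> (\<lambda>x. t x ^ k * w x) \<in> U"
    and "\<And>k. b k \<in> falg H" "\<And>x. x \<in> X \<Longrightarrow> t x ^ N = (\<Sum>k<N. b k x * t x ^ k)" "a < N"
  shows "(\<lambda>x. t x * (t x ^ a * w x)) \<in> span_over H X U"
proof (cases "Suc a < N")
  case True
  then have "(\<lambda>x. t x ^ Suc a * w x) \<in> span_over H X U"
    by (intro span_over_base assms)
  then show ?thesis by (simp add: mult.assoc)
next
  case False
  then have N: "N = Suc a" using assms(5) by simp
  have "(\<lambda>x. \<Sum>k<N. b k x * (t x ^ k * w x)) \<in> span_over H X U"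
    by (intro span_over_sum span_over_scale span_over_base assms) auto
  then show ?thesis
  proof (rule span_over_cong)
    fix x assume "x \<in> X"
    then have "t x ^ N * w x = (\<Sum>k<N. b k x * t x ^ k) * w x" using assms(4) by simp
    then show "t x * (t x ^ a * w x) = (\<Sum>k<N. b k x * (t x ^ k * w x))"
      by (simp add: N sum_distrib_right mult.assoc del: sum.lessThan_Suc)
  qed
qed

text \<open>
  Points are total functions and closed sets are cylinders over the coordinates outside \<open>J\<close>, so that
  eliminating a coordinate does not change the type.
\<close>

definition poly_closed :: "'i set \<Rightarrow> ('i \<Rightarrow> complex) set \<Rightarrow> bool" where
  "poly_closed J Y \<longleftrightarrow> (\<forall>x. (\<forall>p\<in>polys J. (\<forall>y\<in>Y. p y = 0) \<longrightarrow> p x = 0) \<longrightarrow> x \<in> Y)"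

text \<open>For \<open>v j = 1\<close> this is the projection onto the hyperplane \<open>x j = 0\<close> in the direction \<open>v\<close>.\<close>

definition along :: "'i \<Rightarrow> ('i \<Rightarrow> complex) \<Rightarrow> ('i \<Rightarrow> complex) \<Rightarrow> 'i \<Rightarrow> complex" where
  "along j v x = (\<lambda>i. x i - x j * v i)"

lemma along_upd: "v j = 1 \<Longrightarrow> (along j v x)(j := 0) = along j v x"
  by (auto simp: along_def)

lemma along_shift: "(\<lambda>i. along j v x i + x j * v i) = x"
  by (simp add: along_def)

lemma polys_upd:
  assumes "f \<in> polys (insert j J)"
  shows "(\<lambda>x. f (x(j := 0))) \<in> polys J"
  unfolding polys_def
proof (rule polys_comp[OF assms])
  fix i assume "i \<in> insert j J"
  then show "(\<lambda>x. (x(j := 0)) i) \<in> falg (coord ` J)"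
    by (cases "i = j") (auto intro: falg.const polys_coord[unfolded polys_def])
qed

lemma polys_pullback:
  assumes "f \<in> falg ((\<lambda>g x. g (h x)) ` coord ` J)"
  shows "\<exists>p\<in>polys J. f = (\<lambda>x. p (h x))"
  using falg_pullback[OF assms] by (simp add: polys_def)

lemma polys_pullbackI:
  assumes "f \<in> polys J"
  shows "(\<lambda>x. f (h x)) \<in> falg ((\<lambda>g x. g (h x)) ` coord ` J)"
  using assms unfolding polys_def by (rule falg_comp) (auto intro: falg.gen)

text \<open>One step of Noether normalization. \<open>q x\<close> is \<open>P\<close> on the line
  through \<open>x\<close> in direction \<open>v\<close>, with constant leading coefficient
  \<open>c\<close>; hence on \<open>Y\<close> the coordinate \<open>y j\<close> is integral over the
  projected coordinates.\<close>

locale monic_direction =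
  fixes j :: 'i and J :: "'i set" and Y :: "('i \<Rightarrow> complex) set" and P v N q c
  assumes P: "P \<in> polys (insert j J)" "\<And>y. y \<in> Y \<Longrightarrow> P y = 0"
    and v: "v j = 1" and c: "c \<noteq> 0"
    and q: "\<And>x t. poly (q x) t = P (\<lambda>i. x i + t * v i)" "\<And>x. degree (q x) \<le> N"
      "\<And>x. coeff (q x) N = c" "\<And>n. (\<lambda>x. coeff (q x) n) \<in> polys (insert j J)"
    and ne: "Y \<noteq> {}"
begin

text \<open>Lower coefficients after division by \<open>- c\<close>. Resetting the
  \<open>j\<close>-th coordinate makes them polynomials over \<open>J\<close>, and changes nothing
  on the image of \<open>along j v\<close>.\<close>

definition lowc :: "nat \<Rightarrow> ('i \<Rightarrow> complex) \<Rightarrow> complex" where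
  "lowc k x = - (1 / c) * coeff (q (x(j := 0))) k"

lemma lowc: "lowc k \<in> polys J"
  unfolding lowc_def[abs_def] polys_def
  by (intro falg.mult falg.const) (use polys_upd[OF q(4), unfolded polys_def] in simp)

lemma monic_relation:
  assumes "y \<in> Y"
  shows "y j ^ N = (\<Sum>k<N. lowc k (along j v y) * y j ^ k)"
proof -
  let ?p = "q (along j v y)"
  have "poly ?p (y j) = 0" using P(2)[OF assms] unfolding q(1) along_shift .
  then have "(\<Sum>k<N. coeff ?p k * y j ^ k) + c * y j ^ N = 0"
    using poly_eq_sum_coeff[OF q(2)[of "along j v y"], of "y j"] q(3)
    by (simp add: lessThan_Suc_atMost[symmetric])
  then have "c * y j ^ N = - (\<Sum>k<N. coeff ?p k * y j ^ k)"
    by (simp add: add_eq_0_iff)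
  then have "y j ^ N = - (\<Sum>k<N. coeff ?p k * y j ^ k) / c"
    using c by (simp add: field_simps)
  also have "\<dots> = (\<Sum>k<N. lowc k (along j v y) * y j ^ k)"
    by (simp add: lowc_def along_upd v sum_divide_distrib sum_negf)
  finally show ?thesis .
qed

lemma N_pos: "N > 0"
proof (rule ccontr)
  assume "\<not> N > 0"
  obtain y where "y \<in> Y" using ne by blast
  from monic_relation[OF this] \<open>\<not> N > 0\<close> show False by simp
qed

text \<open>
  The ideal of \<open>Y\<close> restricted to the line through \<open>z\<close> has no common zero, hence contains 1;
  Nakayama's lemma then gives a function that vanishes on the projection of \<open>Y\<close> but not at \<open>z\<close>.
\<close>

lemma lying_over:
  assumes closed: "poly_closed (insert j J) Y"
    and z: "z j = 0" "\<And>p. p \<in> polys J \<Longrightarrow> (\<And>y. y \<in> Y \<Longrightarrow> p (along j v y) = 0) \<Longrightarrow> p z = 0"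
  shows "\<exists>t. (\<lambda>i. z i + t * v i) \<in> Y"
proof (rule ccontr)
  assume none: "\<not> ?thesis"
  define I where "I = {f \<in> polys (insert j J). \<forall>y\<in>Y. f y = 0}"
  define R where "R = {r :: complex poly. \<exists>f\<in>I. \<forall>t. poly r t = f (\<lambda>i. z i + t * v i)}"
  \<comment> \<open>On the line, \<open>x j\<close> equals the parameter, because
    \<open>z j = 0\<close> and \<open>v j = 1\<close>. Multiplying by \<open>poly s (x j)\<close>
    therefore realizes multiplication by \<open>s\<close>, and division with remainder stays inside
    \<open>R\<close>.\<close>
  have R_diff: "r - s * g \<in> R" if r: "r \<in> R" "g \<in> R" for r g s
  proof -
    obtain f h where fh: "f \<in> I" "\<forall>t. poly r t = f (\<lambda>i. z i + t * v i)"
      "h \<in> I" "\<forall>t. poly g t = h (\<lambda>i. z i + t * v i)"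
      using r unfolding R_def by blast
    have "(\<lambda>x. f x - poly s (x j) * h x) \<in> polys (insert j J)"
      using fh polys_coord[of j "insert j J"] unfolding I_def polys_def
      by (auto intro!: falg_diff falg.mult falg_poly)
    then have "(\<lambda>x. f x - poly s (x j) * h x) \<in> I" using fh unfolding I_def by auto
    then show ?thesis using fh z v unfolding R_def
      by (intro CollectI bexI[of _ "\<lambda>x. f x - poly s (x j) * h x"]) auto
  qed
  have "P \<in> I" using P by (simp add: I_def)
  then have qR: "q z \<in> R" using q(1)[of z] unfolding R_def by blast
  have "q z \<noteq> 0" using q(3)[of z] c by auto
  then obtain g where g: "g \<in> R" "g \<noteq> 0" and gmin: "\<And>h. h \<in> R \<Longrightarrow> h \<noteq> 0 \<Longrightarrow> degree g \<le> degree h"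
    using qR ex_has_least_nat[of "\<lambda>h. h \<in> R \<and> h \<noteq> 0" "q z" degree] by auto
  have dvd: "g dvd r" if r: "r \<in> R" for r
  proof (rule ccontr)
    assume "\<not> g dvd r"
    then have nz: "r mod g \<noteq> 0" by (simp add: dvd_eq_mod_eq_0)
    have "r mod g = r - (r div g) * g" by (rule minus_div_mult_eq_mod[symmetric])
    then have "r mod g \<in> R" using R_diff[OF r g(1)] by simp
    then show False using gmin[OF _ nz] degree_mod_less[OF g(2), of r] nz by auto
  qed
  \<comment> \<open>A root of \<open>g\<close> is a common zero of \<open>R\<close>, so by
    closedness it would be a point of \<open>Y\<close> on the line.\<close>
  have "degree g = 0"
  proof (rule ccontr)
    assume "degree g \<noteq> 0"
    then have "\<not> constant (poly g)" by (simp add: constant_degree)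
    then obtain \<zeta> where \<zeta>: "poly g \<zeta> = 0" using fundamental_theorem_of_algebra by blast
    have "(\<lambda>i. z i + \<zeta> * v i) \<notin> Y" using none by blast
    then obtain f where f: "f \<in> polys (insert j J)" "\<forall>y\<in>Y. f y = 0" "f (\<lambda>i. z i + \<zeta> * v i) \<noteq> 0"
      using closed unfolding poly_closed_def by blast
    obtain r where r: "\<forall>x t. poly (r x) t = f (\<lambda>i. x i + t * v i)"
      using poly_slice[OF f(1), of v] by blast
    then have "r z \<in> R" using f unfolding R_def I_def by blast
    then have "poly (r z) \<zeta> = 0" using dvd[of "r z"] \<zeta> by (auto elim!: dvdE)
    then show False using r f by simp
  qed
  then have "g dvd 1" using g(2) by (simp add: is_unit_iff_degree)
  then obtain s where "1 = g * s" by (auto simp: dvd_def)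
  then have "1 = g - (1 - s) * g" by (simp add: algebra_simps)
  then have "1 \<in> R" using R_diff[OF g(1) g(1), of "1 - s"] by simp
  then obtain F where F0: "F \<in> I" "\<forall>t. poly 1 t = F (\<lambda>i. z i + t * v i)"
    unfolding R_def by blast
  have F: "F \<in> I" "\<And>t. F (\<lambda>i. z i + t * v i) = 1" using F0 by simp_all
  \<comment> \<open>\<open>E\<close> is 1 on \<open>Y\<close> and 0 on the line. Its coefficients
    \<open>e k\<close> along \<open>v\<close> vanish at \<open>z\<close>, yet on \<open>Y\<close>
    they combine to 1: on \<open>Y\<close> the unit lies in the ideal generated by functions of the
    projection that vanish at \<open>z\<close>.\<close>
  define E where "E = (\<lambda>x. 1 - F x)"
  have E: "E \<in> polys (insert j J)" "\<And>y. y \<in> Y \<Longrightarrow> E y = 1" "\<And>t. E (\<lambda>i. z i + t * v i) = 0"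
    using F unfolding E_def I_def polys_def by (auto intro: falg_diff falg.const)
  obtain r D where r: "\<And>x t. poly (r x) t = E (\<lambda>i. x i + t * v i)" "\<And>x. degree (r x) \<le> D"
    "\<And>n. (\<lambda>x. coeff (r x) n) \<in> polys (insert j J)" using poly_slice[OF E(1), of v] by blast
  define e where "e = (\<lambda>k x. coeff (r (x(j := 0))) k)"
  have e: "e k \<in> polys J" for k unfolding e_def using polys_upd[OF r(3)] .
  have "r z = 0" using r(1)[of z] E(3) by (simp add: poly_all_0_iff_0[symmetric])
  moreover have "z(j := 0) = z" using z(1) by auto
  ultimately have ez: "e k z = 0" for k by (simp add: e_def)
  have e1: "(\<Sum>k\<le>D. e k (along j v y) * y j ^ k) = 1" if "y \<in> Y" for y
    using poly_eq_sum_coeff[OF r(2)[of "along j v y"], of "y j"] E(2)[OF that]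
    unfolding r(1) along_shift by (simp add: e_def along_upd v)
  let ?H = "(\<lambda>g x. g (along j v x)) ` coord ` J"
  define U where "U = (\<lambda>a (x :: 'i \<Rightarrow> complex). x j ^ a * 1) ` {..<N}"
  have finU: "finite U" by (simp add: U_def)
  have low: "(\<lambda>x. lowc k (along j v x)) \<in> falg ?H" for k
    by (rule polys_pullbackI[OF lowc])
  have stable: "(\<lambda>x. x j * u x) \<in> span_over ?H Y U" if "u \<in> U" for u
  proof -
    obtain a where a: "a < N" "u = (\<lambda>x. x j ^ a * 1)" using \<open>u \<in> U\<close> by (auto simp: U_def)
    show ?thesis unfolding a(2)
      by (rule span_over_monic[where t = "\<lambda>x. x j" and b = "\<lambda>k x. lowc k (along j v x)" and N = N, OF finU])
        (use low monic_relation a in \<open>auto simp: U_def\<close>)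
  qed
  have "\<exists>m. (\<forall>u'\<in>U. m u' \<in> polys J) \<and> (\<forall>y\<in>Y. y j ^ k * u y = (\<Sum>u'\<in>U. m u' (along j v y) * u' y))"
    if u: "u \<in> U" for k u
  proof -
    have "(\<lambda>x. x j ^ k * u x) \<in> span_over ?H Y U"
    proof (rule span_over_falg[where H = "{\<lambda>x. x j}"])
      show "(\<lambda>x. x j ^ k) \<in> falg {\<lambda>x. x j}" by (intro falg_power falg.gen) simp
      show "u \<in> span_over ?H Y U" by (rule span_over_base[OF finU u])
    qed (auto intro: stable)
    then obtain m where m: "\<forall>u'\<in>U. m u' \<in> falg ?H" "\<forall>y\<in>Y. y j ^ k * u y = (\<Sum>u'\<in>U. m u' y * u' y)"
      unfolding span_over_def by blast
    have "\<forall>u'\<in>U. \<exists>p. p \<in> polys J \<and> m u' = (\<lambda>x. p (along j v x))"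
      using m(1) polys_pullback by blast
    from bchoice[OF this] obtain p where p: "\<forall>u'\<in>U. p u' \<in> polys J \<and> m u' = (\<lambda>x. p u' (along j v x))" ..
    have "(\<Sum>u'\<in>U. m u' y * u' y) = (\<Sum>u'\<in>U. p u' (along j v y) * u' y)" for y
      using p by (intro sum.cong) auto
    then show ?thesis using m p by (intro exI[of _ p]) auto
  qed
  then have "\<forall>(k, u)\<in>UNIV \<times> U. \<exists>m. (\<forall>u'\<in>U. m u' \<in> polys J) \<and>
      (\<forall>y\<in>Y. y j ^ k * u y = (\<Sum>u'\<in>U. m u' (along j v y) * u' y))" by blast
  then have "\<forall>ku\<in>UNIV \<times> U. \<exists>m. (\<forall>u'\<in>U. m u' \<in> polys J) \<and>
      (\<forall>y\<in>Y. y j ^ fst ku * snd ku y = (\<Sum>u'\<in>U. m u' (along j v y) * u' y))" by auto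
  from bchoice[OF this] obtain m where m0: "\<forall>ku\<in>UNIV \<times> U. (\<forall>u'\<in>U. m ku u' \<in> polys J) \<and>
      (\<forall>y\<in>Y. y j ^ fst ku * snd ku y = (\<Sum>u'\<in>U. m ku u' (along j v y) * u' y))" ..
  define \<mu> where "\<mu> = (\<lambda>k u. m (k, u))"
  have \<mu>: "\<And>k u u'. u \<in> U \<Longrightarrow> u' \<in> U \<Longrightarrow> \<mu> k u u' \<in> polys J"
    "\<And>k u y. u \<in> U \<Longrightarrow> y \<in> Y \<Longrightarrow> y j ^ k * u y = (\<Sum>u'\<in>U. \<mu> k u u' (along j v y) * u' y)"
    using m0 unfolding \<mu>_def by force+
  define B where "B = (\<lambda>u u' x. (if u = u' then 1 else 0) - (\<Sum>k\<le>D. e k x * \<mu> k u u' x))"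
  have "\<exists>D\<in>falg (coord ` J). D z = 1 \<and> (\<forall>y\<in>Y. \<forall>u\<in>U. D (along j v y) * u y = 0)"
  proof (rule nakayama_elimination[OF finU, where B = B])
    fix u u' assume u: "u \<in> U" "u' \<in> U"
    show "B u u' \<in> falg (coord ` J)"
      using \<mu>(1)[OF u] e unfolding B_def polys_def
      by (intro falg_diff falg_sum falg.mult falg.const) auto
    show "B u u' z = (if u = u' then 1 else 0)" by (simp add: B_def ez)
  next
    fix u y assume u: "u \<in> U" and y: "y \<in> Y"
    have "(\<Sum>u'\<in>U. B u u' (along j v y) * u' y) = (\<Sum>u'\<in>U. (if u = u' then 1 else 0) * u' y) -
        (\<Sum>u'\<in>U. \<Sum>k\<le>D. e k (along j v y) * (\<mu> k u u' (along j v y) * u' y))"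
      by (simp add: B_def left_diff_distrib sum_subtractf sum_distrib_right mult.assoc)
    also have "(\<Sum>u'\<in>U. (if u = u' then 1 else 0) * u' y) = u y"
      using u finU by (simp add: if_distrib[of "\<lambda>c. c * _"] cong: if_cong)
    also have "(\<Sum>u'\<in>U. \<Sum>k\<le>D. e k (along j v y) * (\<mu> k u u' (along j v y) * u' y)) =
        (\<Sum>k\<le>D. e k (along j v y) * (y j ^ k * u y))"
      by (subst sum.swap) (simp add: \<mu>(2)[OF u y] sum_distrib_left)
    also have "\<dots> = (\<Sum>k\<le>D. e k (along j v y) * y j ^ k) * u y"
      by (simp add: sum_distrib_right mult.assoc)
    finally show "(\<Sum>u'\<in>U. B u u' (along j v y) * u' y) = 0" by (simp add: e1[OF y])
  qed
  then obtain G where G: "G \<in> polys J" "G z = 1" "\<And>y u. y \<in> Y \<Longrightarrow> u \<in> U \<Longrightarrow> G (along j v y) * u y = 0"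
    unfolding polys_def by blast
  \<comment> \<open>The constant 1 is among the generators, so the annihilator \<open>G\<close>
    itself vanishes on the projection of \<open>Y\<close>.\<close>
  have "(\<lambda>x. x j ^ 0 * 1) \<in> U" unfolding U_def using N_pos by blast
  then have "G (along j v y) = 0" if "y \<in> Y" for y using G(3)[OF that] by force
  then show False using z(2)[OF G(1)] G(2) by simp
qed

end

lemma ex_monic_direction:
  assumes P: "P \<in> polys (insert j J)" "\<And>y. y \<in> Y \<Longrightarrow> P y = 0" and "Y \<noteq> {}" "P x0 \<noteq> 0"
  shows "\<exists>v N q c. monic_direction j J Y P v N q c"
proof (rule monic_slice[of P "insert j J" x0 j])
  fix q v N c
  assume *: "\<And>x t. poly (q x) t = P (\<lambda>i. x i + t * v i)"
    "\<And>x. degree (q x) \<le> N" "\<And>x. coeff (q x) N = c"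
    "\<And>n. (\<lambda>x. coeff (q x) n) \<in> polys (insert j J)" "v j = 1" "c \<noteq> 0"
  have "monic_direction j J Y P v N q c"
    by (rule monic_direction.intro[OF P *(5,6,1-4) assms(3)])
  then show ?thesis by blast
qed (use assms in auto)

lemma polys_along:
  assumes "f \<in> polys J"
  shows "(\<lambda>x. f (along j v x)) \<in> polys (insert j J)"
  unfolding polys_def along_def
proof (rule polys_comp[OF assms])
  fix i assume "i \<in> J"
  then show "(\<lambda>x. x i - x j * v i) \<in> falg (coord ` insert j J)"
    using polys_coord[of _ "insert j J"] unfolding polys_def
    by (intro falg_diff falg.mult falg.const) auto
qed

lemma sespolys_of_polys:
  assumes "f \<in> polys J"
  shows "(\<lambda>w. f (fst w)) \<in> sespolys J" "(\<lambda>w. cnj (f (snd w))) \<in> sespolys J"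
proof -
  have gen: "(\<lambda>w. fst w i) \<in> sespolys J" "(\<lambda>w. cnj (snd w i)) \<in> sespolys J" if "i \<in> J" for i
    unfolding sespolys_def using that
    by (auto intro!: falg.gen simp: case_prod_unfold)
  show "(\<lambda>w. f (fst w)) \<in> sespolys J"
    unfolding sespolys_def
    by (rule polys_comp[OF assms, where h = fst]) (rule gen(1)[unfolded sespolys_def])
  show "(\<lambda>w. cnj (f (snd w))) \<in> sespolys J"
    using assms unfolding polys_def
  proof induction
    case (gen g)
    then show ?case using \<open>\<And>i. i \<in> J \<Longrightarrow> (\<lambda>w. cnj (snd w i)) \<in> sespolys J\<close>
      by (auto simp: coord_def)
  next
    case (add f g)
    then show ?case by (simp add: falg.add sespolys_def)
  next
    case (mult f g)
    then show ?case by (simp add: falg.mult sespolys_def)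
  qed (simp add: falg.const sespolys_def)
qed

text \<open>
  In a nontrivial relation of least degree for \<open>Q\<close> over the projected variables, the constant
  coefficient vanishes on the diagonal, hence everywhere by induction.
\<close>

theorem sespolys_vanish:
  assumes "finite J" "prime_on (polys J) Y"
    and "poly_closed J Y"
    and "Q \<in> sespolys J" "\<And>x. x \<in> Y \<Longrightarrow> Q (x, x) = 0" "x \<in> Y" "y \<in> Y"
  shows "Q (x, y) = 0"
  using assms
proof (induction J arbitrary: Y Q x y rule: finite_induct)
  case empty
  \<comment> \<open>Without coordinates all polynomials are constant, so a nonempty closed set is
    the whole space.\<close>
  have "p z = 0" if "p \<in> polys {}" "\<forall>y\<in>Y. p y = 0" for p z
    using polys_cong[of p "{}" z y] that empty.prems(6) by auto
  then have "z \<in> Y" for z using empty.prems(2) by (simp add: poly_closed_def)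
  then have "Q (z, z) = 0" for z by (rule empty.prems(4))
  then show ?case by (rule sespolys_polarize[OF empty.prems(3)])
next
  case (insert j J)
  note prime = insert.prems(1) and closed = insert.prems(2) and Q = insert.prems(3)
    and diag = insert.prems(4)
  show ?case
  proof (cases "\<forall>p\<in>polys (insert j J). (\<forall>y\<in>Y. p y = 0) \<longrightarrow> (\<forall>x. p x = 0)")
    case True
    then have "z \<in> Y" for z using closed by (simp add: poly_closed_def)
    then have "Q (z, z) = 0" for z by (rule diag)
    then show ?thesis by (rule sespolys_polarize[OF Q])
  next
    case False
    then obtain P x0 where P: "P \<in> polys (insert j J)" "\<forall>y\<in>Y. P y = 0" "P x0 \<noteq> 0" by blast
    have neY: "Y \<noteq> {}" using insert.prems by blast
    obtain v N q c where "monic_direction j J Y P v N q c"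
      using ex_monic_direction[of P j J Y x0] P neY by blast
    then interpret monic_direction j J Y P v N q c .
    define \<pi> where "\<pi> = along j v"
    \<comment> \<open>The Zariski closure of the projection, to which the induction hypothesis for
      \<open>J\<close> is applied.\<close>
    define Y' where "Y' = {z. \<forall>p\<in>polys J. (\<forall>y\<in>Y. p (\<pi> y) = 0) \<longrightarrow> p z = 0}"
    have \<pi>Y: "\<pi> y \<in> Y'" if "y \<in> Y" for y using that by (auto simp: Y'_def)
    have IH: "a (x, y) = 0" if a: "a \<in> sespolys J" and d: "\<And>y. y \<in> Y \<Longrightarrow> a (\<pi> y, \<pi> y) = 0"
      and xy: "x \<in> Y'" "y \<in> Y'" for a x y
    proof (rule insert.IH[of Y' a, OF _ _ a _ xy])
      show "prime_on (polys J) Y'"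
        unfolding prime_on_def
      proof (intro conjI ballI impI)
        show "Y' \<noteq> {}" using neY \<pi>Y by blast
        fix f g assume f: "f \<in> polys J" and g: "g \<in> polys J" and fg: "\<forall>x\<in>Y'. f x * g x = 0"
        have "(\<forall>y\<in>Y. f (\<pi> y) = 0) \<or> (\<forall>y\<in>Y. g (\<pi> y) = 0)"
          unfolding \<pi>_def
          by (rule prime_onD[OF prime polys_along[OF f] polys_along[OF g]])
            (use fg \<pi>Y in \<open>auto simp: \<pi>_def\<close>)
        then show "(\<forall>x\<in>Y'. f x = 0) \<or> (\<forall>x\<in>Y'. g x = 0)"
          using f g unfolding Y'_def by blast
      qed
      show "poly_closed J Y'"
        unfolding poly_closed_def Y'_def by blast
      \<comment> \<open>By \<open>lying_over\<close> every point of the closure is the projection of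
        a point of \<open>Y\<close>, up to its \<open>j\<close>-th coordinate, which polynomials
        over \<open>J\<close> do not see. So vanishing on projected diagonal points gives vanishing
        on the diagonal of \<open>Y'\<close>.\<close>
      fix z assume z: "z \<in> Y'"
      define z0 where "z0 = z(j := 0)"
      have z0: "z0 i = z i" if "i \<in> J" for i using that insert.hyps by (auto simp: z0_def)
      have "\<exists>t. (\<lambda>i. z0 i + t * v i) \<in> Y"
      proof (rule lying_over[OF closed])
        show "z0 j = 0" by (simp add: z0_def)
        fix p assume p: "p \<in> polys J" "\<And>y. y \<in> Y \<Longrightarrow> p (along j v y) = 0"
        then have "p z = 0" using z unfolding Y'_def \<pi>_def by blast
        then show "p z0 = 0" using polys_cong[OF p(1), of z0 z] z0 by simp
      qed
      then obtain t where t: "(\<lambda>i. z0 i + t * v i) \<in> Y" by blast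
      have "\<pi> (\<lambda>i. z0 i + t * v i) = z0"
        using v by (auto simp: \<pi>_def along_def z0_def)
      then have "a (z0, z0) = 0" using d[OF t] by simp
      then show "a (z, z) = 0" using sespolys_cong[OF a, of z0 z z0 z] z0 by simp
    qed
    define h where "h = (\<lambda>w :: ('a \<Rightarrow> complex) \<times> ('a \<Rightarrow> complex). (\<pi> (fst w), \<pi> (snd w)))"
    \<comment> \<open>Generators of the coefficient ring: the projected coordinates of both
      variables. \<open>H_out\<close> writes coefficients as pullbacks, as the induction hypothesis
      requires; \<open>H_sub\<close> puts them into the ring that is a domain on
      \<open>Y \<times> Y\<close>.\<close>
    define H where "H = (\<lambda>g w. g (h w)) ` ((\<lambda>i (x, y). x i) ` J \<union> (\<lambda>i (x, y). cnj (y i)) ` J)"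
    have H_in: "(\<lambda>w. p (h w)) \<in> falg H" if "p \<in> sespolys J" for p
      using that unfolding sespolys_def H_def by (rule falg_comp) (auto intro: falg.gen)
    have H_out: "\<exists>p\<in>sespolys J. f = (\<lambda>w. p (h w))" if "f \<in> falg H" for f
      using falg_pullback[OF that[unfolded H_def]] by (simp add: sespolys_def)
    have H_sub: "f \<in> sespolys (insert j J)" if f: "f \<in> falg H" for f
    proof -
      obtain p where p: "p \<in> sespolys J" "f = (\<lambda>w. p (h w))" using H_out[OF f] by blast
      have "(\<lambda>w. p (\<pi> (fst w), \<pi> (snd w))) \<in> sespolys (insert j J)"
        unfolding sespolys_def
      proof (rule sespolys_comp[OF p(1)])
        fix i assume i: "i \<in> J"
        have *: "(\<lambda>x. \<pi> x i) \<in> polys (insert j J)"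
          using polys_along[OF polys_coord[OF i]] by (simp add: \<pi>_def)
        show "(\<lambda>w. \<pi> (fst w) i) \<in> falg ((\<lambda>i (x, y). x i) ` insert j J \<union> (\<lambda>i (x, y). cnj (y i)) ` insert j J)"
          "(\<lambda>w. cnj (\<pi> (snd w) i)) \<in> falg ((\<lambda>i (x, y). x i) ` insert j J \<union> (\<lambda>i (x, y). cnj (y i)) ` insert j J)"
          using sespolys_of_polys[OF *] by (simp_all add: sespolys_def)
      qed
      then show ?thesis by (simp add: p h_def)
    qed
    define t t' where "t = (\<lambda>w :: ('a \<Rightarrow> complex) \<times> ('a \<Rightarrow> complex). fst w j)"
      and "t' = (\<lambda>w :: ('a \<Rightarrow> complex) \<times> ('a \<Rightarrow> complex). cnj (snd w j))"
    \<comment> \<open>Both \<open>t\<close> and \<open>t'\<close> satisfy monic relations of degree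
      \<open>N\<close> over the coefficient ring, so these finitely many monomials generate
      everything on \<open>Y \<times> Y\<close>.\<close>
    define U where "U = (\<lambda>(a, b) w. t w ^ a * t' w ^ b) ` ({..<N} \<times> {..<N})"
    have finU: "finite U" by (simp add: U_def)
    have U_mem: "(\<lambda>w. t w ^ a * t' w ^ b) \<in> U" if "a < N" "b < N" for a b
      unfolding U_def using that by (intro image_eqI[of _ _ "(a, b)"]) auto
    have t_stable: "(\<lambda>w. t w * u w) \<in> span_over H (Y \<times> Y) U" if "u \<in> U" for u
    proof -
      obtain a b where ab: "a < N" "b < N" "u = (\<lambda>w. t w ^ a * t' w ^ b)"
        using \<open>u \<in> U\<close> by (auto simp: U_def)
      have "(\<lambda>w. lowc k (fst (h w))) \<in> falg H" for k
        by (rule H_in[OF sespolys_of_polys(1)[OF lowc]])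
      then show ?thesis unfolding ab(3) using ab U_mem monic_relation
        by (intro span_over_monic[where b = "\<lambda>k w. lowc k (fst (h w))" and N = N, OF finU])
          (auto simp: h_def \<pi>_def t_def)
    qed
    have t'_stable: "(\<lambda>w. t' w * u w) \<in> span_over H (Y \<times> Y) U" if "u \<in> U" for u
    proof -
      obtain a b where ab: "a < N" "b < N" "u = (\<lambda>w. t w ^ a * t' w ^ b)"
        using \<open>u \<in> U\<close> by (auto simp: U_def)
      have "(\<lambda>w. t' w * (t' w ^ b * t w ^ a)) \<in> span_over H (Y \<times> Y) U"
      proof (rule span_over_monic[where b = "\<lambda>k w. cnj (lowc k (snd (h w)))" and N = N, OF finU])
        show "(\<lambda>w. t' w ^ k * t w ^ a) \<in> U" if "k < N" for k
          using U_mem[OF ab(1) that] by (simp add: mult.commute)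
        show "(\<lambda>w. cnj (lowc k (snd (h w)))) \<in> falg H" for k
          by (rule H_in[OF sespolys_of_polys(2)[OF lowc]])
        fix w assume "w \<in> Y \<times> Y"
        then have e: "snd w j ^ N = (\<Sum>k<N. lowc k (\<pi> (snd w)) * snd w j ^ k)"
          using monic_relation[of "snd w"] by (auto simp: \<pi>_def)
        have "t' w ^ N = cnj (snd w j ^ N)" by (simp add: t'_def)
        also have "\<dots> = (\<Sum>k<N. cnj (lowc k (snd (h w))) * t' w ^ k)"
          unfolding e by (simp add: t'_def h_def)
        finally show "t' w ^ N = (\<Sum>k<N. cnj (lowc k (snd (h w))) * t' w ^ k)" .
      qed (rule ab)
      then show ?thesis by (rule span_over_cong) (auto simp: ab mult.commute)
    qed
    have gen_stable: "(\<lambda>w. g w * u w) \<in> span_over H (Y \<times> Y) U"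
      if g: "g \<in> (\<lambda>i (x, y). x i) ` insert j J \<union> (\<lambda>i (x, y). cnj (y i)) ` insert j J" and u: "u \<in> U" for g u
    proof -
      have sp: "u \<in> span_over H (Y \<times> Y) U" by (rule span_over_base[OF finU u])
      have c: "(\<lambda>w. c) \<in> falg H" for c by (rule falg.const)
      from g consider "g = t" | "g = t'" | i where "i \<in> J" "g = (\<lambda>w. fst w i)"
        | i where "i \<in> J" "g = (\<lambda>w. cnj (snd w i))"
        by (auto simp: t_def t'_def case_prod_unfold)
      then show ?thesis
      proof cases
        case 1
        then show ?thesis using t_stable u by simp
      next
        case 2
        then show ?thesis using t'_stable u by simp
      next
        case 3
        have "(\<lambda>w. fst (h w) i) \<in> falg H"
          by (rule H_in[OF sespolys_of_polys(1)[OF polys_coord[OF 3(1)]]])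
        then have "(\<lambda>w. fst (h w) i * u w + v i * (t w * u w)) \<in> span_over H (Y \<times> Y) U"
          by (intro span_over_add span_over_scale[OF sp] span_over_scale[OF t_stable[OF u] c])
        then show ?thesis
          by (rule span_over_cong) (auto simp: 3 h_def \<pi>_def along_def t_def algebra_simps)
      next
        case 4
        have "(\<lambda>w. cnj (snd (h w) i)) \<in> falg H"
          by (rule H_in[OF sespolys_of_polys(2)[OF polys_coord[OF 4(1)]]])
        then have "(\<lambda>w. cnj (snd (h w) i) * u w + cnj (v i) * (t' w * u w)) \<in> span_over H (Y \<times> Y) U"
          by (intro span_over_add span_over_scale[OF sp] span_over_scale[OF t'_stable[OF u] c])
        then show ?thesis
          by (rule span_over_cong) (auto simp: 4 h_def \<pi>_def along_def t'_def algebra_simps)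
      qed
    qed
    have one: "(\<lambda>w. 1) \<in> span_over H (Y \<times> Y) U"
      using span_over_base[OF finU U_mem[OF N_pos N_pos]] by simp
    have "\<exists>m. (\<forall>u\<in>U. m u \<in> falg H) \<and> (\<forall>w\<in>Y \<times> Y. Q w ^ k = (\<Sum>u\<in>U. m u w * u w))" for k
    proof -
      have "(\<lambda>w. Q w ^ k * 1) \<in> span_over H (Y \<times> Y) U"
        by (rule span_over_falg[OF falg_power[OF Q[unfolded sespolys_def]] one gen_stable])
      then show ?thesis unfolding span_over_def by simp
    qed
    then have "\<forall>k. \<exists>m. (\<forall>u\<in>U. m u \<in> falg H) \<and> (\<forall>w\<in>Y \<times> Y. Q w ^ k = (\<Sum>u\<in>U. m u w * u w))"
      by blast
    from choice[OF this] obtain m where m: "\<forall>k. (\<forall>u\<in>U. m k u \<in> falg H) \<and>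
        (\<forall>w\<in>Y \<times> Y. Q w ^ k = (\<Sum>u\<in>U. m k u w * u w))" ..
    have primeS: "prime_on (sespolys (insert j J)) (Y \<times> Y)" by (rule prime_on_sespolys[OF prime])
    then have primeH: "prime_on (falg H) (Y \<times> Y)"
      unfolding prime_on_def using H_sub by blast
    \<comment> \<open>The \<open>card U + 1\<close> powers of \<open>Q\<close> have
      \<open>card U\<close> coordinates each, hence a nontrivial relation.\<close>
    obtain a where a: "\<forall>k\<in>{..card U}. a k \<in> falg H" "\<exists>k\<in>{..card U}. \<exists>w\<in>Y \<times> Y. a k w \<noteq> 0"
      "\<forall>u\<in>U. \<forall>w\<in>Y \<times> Y. (\<Sum>k\<in>{..card U}. a k w * m k u w) = 0"
      using dependent_over_domain[OF finU, of "{..card U}" H "Y \<times> Y" m] primeH m by auto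
    have rel: "(\<Sum>k\<le>card U. a k w * Q w ^ k) = 0" if w: "w \<in> Y \<times> Y" for w
    proof -
      have "Q w ^ k = (\<Sum>u\<in>U. m k u w * u w)" for k using m w by blast
      then have "(\<Sum>k\<le>card U. a k w * Q w ^ k) = (\<Sum>k\<le>card U. \<Sum>u\<in>U. a k w * m k u w * u w)"
        by (simp add: sum_distrib_left mult.assoc)
      also have "\<dots> = (\<Sum>u\<in>U. (\<Sum>k\<le>card U. a k w * m k u w) * u w)"
        by (subst sum.swap) (simp add: sum_distrib_right)
      also have "\<dots> = 0"
      proof (rule sum.neutral, rule ballI)
        fix u assume "u \<in> U"
        then have "(\<Sum>k\<le>card U. a k w * m k u w) = 0" using a(3) w by blast
        then show "(\<Sum>k\<le>card U. a k w * m k u w) * u w = 0" by simp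
      qed
      finally show ?thesis .
    qed
    define R where "R n \<longleftrightarrow> (\<exists>a. (\<forall>k\<le>n. a k \<in> falg H) \<and> (\<exists>w\<in>Y \<times> Y. a n w \<noteq> 0) \<and>
      (\<forall>w\<in>Y \<times> Y. (\<Sum>k\<le>n. a k w * Q w ^ k) = 0))" for n
    \<comment> \<open>The top coefficients may vanish identically on \<open>Y \<times> Y\<close>;
      the relation is cut off after the last one that does not.\<close>
    define K where "K = {k. k \<le> card U \<and> (\<exists>w\<in>Y \<times> Y. a k w \<noteq> 0)}"
    have K: "finite K" "K \<noteq> {}" unfolding K_def using a(2) by auto
    have MK: "Max K \<in> K" by (rule Max_in[OF K])
    have above: "a k w = 0" if "k \<le> card U" "\<not> k \<le> Max K" "w \<in> Y \<times> Y" for k w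
      using Max_ge[OF K(1), of k] that unfolding K_def by blast
    have "R (Max K)"
      unfolding R_def
    proof (intro exI[of _ a] conjI ballI)
      show "\<forall>k\<le>Max K. a k \<in> falg H" using a(1) MK by (auto simp: K_def)
      show "\<exists>w\<in>Y \<times> Y. a (Max K) w \<noteq> 0" using MK by (simp add: K_def)
      fix w assume w: "w \<in> Y \<times> Y"
      have "(\<Sum>k\<le>Max K. a k w * Q w ^ k) = (\<Sum>k\<le>card U. a k w * Q w ^ k)"
        using MK above[OF _ _ w] by (intro sum.mono_neutral_left) (auto simp: K_def)
      then show "(\<Sum>k\<le>Max K. a k w * Q w ^ k) = 0" using rel[OF w] by simp
    qed
    then obtain n where n: "R n" "\<And>k. R k \<Longrightarrow> n \<le> k"
      using LeastI[of R] Least_le[of R] by blast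
    then obtain b where b: "\<forall>k\<le>n. b k \<in> falg H" "\<exists>w\<in>Y \<times> Y. b n w \<noteq> 0"
      "\<forall>w\<in>Y \<times> Y. (\<Sum>k\<le>n. b k w * Q w ^ k) = 0" unfolding R_def by blast
    obtain p where p: "p \<in> sespolys J" "b 0 = (\<lambda>w. p (h w))" using H_out b(1) by blast
    \<comment> \<open>On the diagonal \<open>Q\<close> is zero and the relation reduces to its
      constant term. The induction hypothesis spreads the vanishing of that term to all
      pairs.\<close>
    have b0: "b 0 w = 0" if w: "w \<in> Y \<times> Y" for w
    proof -
      have "p (\<pi> y, \<pi> y) = 0" if "y \<in> Y" for y
      proof -
        have "(\<Sum>k\<le>n. b k (y, y) * Q (y, y) ^ k) = b 0 (y, y)"
          using diag[OF that] by (simp add: power_0_left if_distrib[of "\<lambda>c. _ * c"] cong: if_cong)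
        then show ?thesis using b(3) that p by (simp add: h_def)
      qed
      then show ?thesis using IH[OF p(1), of "\<pi> (fst w)" "\<pi> (snd w)"] \<pi>Y w p by (auto simp: h_def)
    qed
    have "n \<noteq> 0" using b0 b(2) by metis
    then obtain n' where n': "n = Suc n'" using not0_implies_Suc by blast
    define g where "g = (\<lambda>w. \<Sum>k\<le>n'. b (Suc k) w * Q w ^ k)"
    \<comment> \<open>Without constant term the relation factors as \<open>Q * g = 0\<close>, and
      \<open>g = 0\<close> would be a relation of smaller degree.\<close>
    have "(\<forall>w\<in>Y \<times> Y. Q w = 0) \<or> (\<forall>w\<in>Y \<times> Y. g w = 0)"
    proof (rule prime_onD[OF primeS Q])
      have "b (Suc k) \<in> sespolys (insert j J)" if "k \<le> n'" for k
        using b(1) n' that H_sub by simp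
      then show "g \<in> sespolys (insert j J)"
        using Q unfolding g_def sespolys_def by (intro falg_sum falg.mult falg_power) auto
      fix w assume w: "w \<in> Y \<times> Y"
      have "(\<Sum>k\<le>n. b k w * Q w ^ k) = b 0 w + (\<Sum>k\<le>n'. b (Suc k) w * Q w ^ Suc k)"
        unfolding n' by (simp add: sum.atMost_Suc_shift del: sum.atMost_Suc power_Suc)
      also have "\<dots> = Q w * g w" using b0[OF w] by (simp add: g_def sum_distrib_left mult_ac)
      finally show "Q w * g w = 0" using b(3) w by simp
    qed
    then show ?thesis
    proof
      assume "\<forall>w\<in>Y \<times> Y. Q w = 0"
      then show ?thesis using insert.prems by blast
    next
      assume "\<forall>w\<in>Y \<times> Y. g w = 0"
      then have "R n'"
        unfolding R_def g_def using b n' by (intro exI[of _ "\<lambda>k. b (Suc k)"]) auto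
      then show ?thesis using n(2) n' by fastforce
    qed
  qed
qed

section \<open>Complex inner products\<close>

abbreviation clin :: "(complex ^ 'd \<Rightarrow> complex ^ 'd) \<Rightarrow> bool" where
  "clin A \<equiv> Vector_Spaces.linear (*s) (*s) A"

lemma clin_iff: "clin A \<longleftrightarrow> (\<forall>x y. A (x + y) = A x + A y) \<and> (\<forall>c x. A (c *s x) = c *s A x)"
  by (auto simp: Vector_Spaces.linear_iff vec.vector_space_axioms)

lemma clin_add: "clin A \<Longrightarrow> A (x + y) = A x + A y"
  and clin_scale: "clin A \<Longrightarrow> A (c *s x) = c *s A x"
  by (simp_all add: clin_iff)

lemma clin_zero: "clin A \<Longrightarrow> A 0 = 0"
  using clin_scale[of A 0 0] by simp

lemma clin_diff: "clin A \<Longrightarrow> A (x - y) = A x - A y"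
  using clin_add[of A "x - y" y] by simp

lemma clin_sum: "clin A \<Longrightarrow> A (\<Sum>i\<in>I. f i) = (\<Sum>i\<in>I. A (f i))"
  by (induction I rule: infinite_finite_induct) (auto simp: clin_add clin_zero)

lemma scaleR_eq_vec: "r *\<^sub>R (x :: complex ^ 'd) = complex_of_real r *s x"
  by (simp add: vec_eq_iff scaleR_conv_of_real[where 'a = complex])

lemma clin_linear: "clin A \<Longrightarrow> linear A"
  by (auto intro!: linearI simp: clin_add clin_scale scaleR_eq_vec)

lemma vec_subspace_closed:
  fixes S :: "(complex ^ 'd) set"
  assumes "vec.subspace S"
  shows "closed S"
proof (rule closed_subspace)
  show "subspace S"
    using assms by (auto simp: subspace_def vec.subspace_def scaleR_eq_vec)
qed

lemma cinner_add_left: "cinner (x + y) z = cinner x z + cinner y z"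
  and cinner_add_right: "cinner z (x + y) = cinner z x + cinner z y"
  and cinner_diff_left: "cinner (x - y) z = cinner x z - cinner y z"
  and cinner_diff_right: "cinner z (x - y) = cinner z x - cinner z y"
  and cinner_scale_left: "cinner (c *s x) y = c * cinner x y"
  and cinner_scale_right: "cinner x (c *s y) = cnj c * cinner x y"
  and cinner_zero_left [simp]: "cinner 0 x = 0"
  and cinner_zero_right [simp]: "cinner x 0 = 0"
  by (simp_all add: cinner_def algebra_simps sum.distrib sum_subtractf sum_distrib_left)

lemma cinner_sum_left: "cinner (\<Sum>i\<in>I. f i) y = (\<Sum>i\<in>I. cinner (f i) y)"
  by (induction I rule: infinite_finite_induct) (auto simp: cinner_add_left)

lemma cinner_sum_right: "cinner y (\<Sum>i\<in>I. f i) = (\<Sum>i\<in>I. cinner y (f i))"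
  by (induction I rule: infinite_finite_induct) (auto simp: cinner_add_right)

lemma cinner_combination:
  "cinner (\<Sum>x\<in>F. r x *s f x) (\<Sum>y\<in>G. s y *s g y) = (\<Sum>x\<in>F. \<Sum>y\<in>G. r x * cnj (s y) * cinner (f x) (g y))"
proof -
  have "cinner (\<Sum>x\<in>F. r x *s f x) (\<Sum>y\<in>G. s y *s g y) = (\<Sum>x\<in>F. r x * cinner (f x) (\<Sum>y\<in>G. s y *s g y))"
    by (simp only: cinner_sum_left cinner_scale_left)
  then show ?thesis by (simp only: cinner_sum_right cinner_scale_right sum_distrib_left mult.assoc)
qed

lemma cinner_commute: "cinner y x = cnj (cinner x y)"
  by (simp add: cinner_def mult.commute)

lemma cinner_self: "cinner x x = of_real ((norm x)\<^sup>2)"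
  unfolding cinner_def norm_vec_sq by (simp only: of_real_sum complex_norm_square)

lemma Re_cinner: "Re (cinner x y) = inner x y"
  by (simp add: cinner_def inner_vec_def inner_complex_def)

lemma norm_cscale: "norm (c *s (x :: complex ^ 'd)) = cmod c * norm x"
proof -
  have "(norm (c *s x))\<^sup>2 = (cmod c * norm x)\<^sup>2"
    by (simp add: norm_vec_sq norm_mult power_mult_distrib sum_distrib_left)
  then show ?thesis by (simp add: power2_eq_iff_nonneg)
qed

lemma cmod_cinner_le: "cmod (cinner x y) \<le> norm x * norm y"
proof (cases "cinner x y = 0")
  case False
  define z where "z = cinner x y"
  have z: "z \<noteq> 0" using False by (simp add: z_def)
  let ?c = "cnj z / of_real (cmod z)"
  have c: "cmod ?c = 1" using z by (simp add: norm_divide)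
  have "cinner (?c *s x) y = (z * cnj z) / of_real (cmod z)"
    by (simp add: cinner_scale_left z_def)
  also have "\<dots> = of_real (cmod z)"
    using z unfolding complex_norm_square[symmetric] by (simp add: power2_eq_square)
  finally have "cmod z = inner (?c *s x) y" by (metis Re_cinner Re_complex_of_real)
  also have "\<dots> \<le> norm (?c *s x) * norm y" by (rule norm_cauchy_schwarz)
  finally show ?thesis using c by (simp add: norm_cscale z_def)
qed simp

lemma norm_add_sq: "(norm (x + y :: complex ^ 'd))\<^sup>2 = (norm x)\<^sup>2 + (norm y)\<^sup>2 + 2 * Re (cinner x y)"
  by (simp add: power2_norm_eq_inner inner_add_left inner_add_right Re_cinner inner_commute)

text \<open>Norms of sums determine the real part of the form; applying this to
  \<open>\<i> *s x\<close>, which stays in the complex subspace, gives the imaginary part.\<close>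

lemma isometric_on_subspace:
  assumes A: "clin A" and S: "vec.subspace S" and iso: "isometric_on A S" and xy: "x \<in> S" "y \<in> S"
  shows "cinner (A x) (A y) = cinner x y"
proof -
  have re: "Re (cinner (A u) (A v)) = Re (cinner u v)" if "u \<in> S" "v \<in> S" for u v
  proof -
    have "norm (A u) = norm u" "norm (A v) = norm v" "norm (A u + A v) = norm (u + v)"
      using iso that vec.subspace_add[OF S that] clin_add[OF A, of u v]
      unfolding isometric_on_def by metis+
    then show ?thesis using norm_add_sq[of "A u" "A v"] norm_add_sq[of u v] by simp
  qed
  have "Re (cinner (A (\<i> *s x)) (A y)) = Re (cinner (\<i> *s x) y)"
    by (rule re) (use xy vec.subspace_scale[OF S] in auto)
  then have "Im (cinner (A x) (A y)) = Im (cinner x y)"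
    by (simp add: clin_scale[OF A] cinner_scale_left)
  then show ?thesis using re[OF xy] by (simp add: complex_eq_iff)
qed

section \<open>Orthonormal families, projections and angles\<close>

definition orthonormal :: "'b set \<Rightarrow> ('b \<Rightarrow> complex ^ 'd) \<Rightarrow> bool" where
  "orthonormal B e \<longleftrightarrow> (\<forall>b\<in>B. \<forall>b'\<in>B. cinner (e b) (e b') = (if b = b' then 1 else 0))"

lemma orthonormal_coeff:
  assumes "orthonormal B e" "finite B" "b \<in> B"
  shows "cinner (\<Sum>b\<in>B. a b *s e b) (e b) = a b"
proof -
  have "cinner (\<Sum>b\<in>B. a b *s e b) (e b) = (\<Sum>b'\<in>B. a b' * (if b' = b then 1 else 0))"
    unfolding cinner_sum_left
    using assms by (intro sum.cong) (auto simp: cinner_scale_left orthonormal_def)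
  also have "\<dots> = a b" using assms by (simp add: if_distrib cong: if_cong)
  finally show ?thesis .
qed

lemma orthonormal_norm:
  assumes "orthonormal B e" "finite B"
  shows "(norm (\<Sum>b\<in>B. a b *s e b))\<^sup>2 = (\<Sum>b\<in>B. (cmod (a b))\<^sup>2)"
proof -
  let ?x = "\<Sum>b\<in>B. a b *s e b"
  have "complex_of_real ((norm ?x)\<^sup>2) = cinner ?x (\<Sum>b\<in>B. a b *s e b)" by (simp add: cinner_self)
  also have "\<dots> = (\<Sum>b\<in>B. cnj (a b) * cinner ?x (e b))"
    by (simp only: cinner_sum_right cinner_scale_right)
  also have "\<dots> = (\<Sum>b\<in>B. complex_of_real ((cmod (a b))\<^sup>2))"
  proof (rule sum.cong[OF refl])
    fix b assume "b \<in> B"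
    then show "cnj (a b) * cinner ?x (e b) = complex_of_real ((cmod (a b))\<^sup>2)"
      using orthonormal_coeff[OF assms, of b a] by (simp only: complex_norm_square mult.commute)
  qed
  also have "\<dots> = complex_of_real (\<Sum>b\<in>B. (cmod (a b))\<^sup>2)" by simp
  finally show ?thesis by (simp only: of_real_eq_iff)
qed

lemma orthonormal_independent:
  assumes "orthonormal B (\<lambda>b. b)" "finite B"
  shows "vec.independent B"
proof (rule vec.independent_if_scalars_zero[OF assms(2)])
  fix f x assume "(\<Sum>x\<in>B. f x *s x) = 0" "x \<in> B"
  then show "f x = 0" using orthonormal_coeff[OF assms, of x f] by simp
qed

lemma orthonormal_basis_exists:
  fixes S :: "(complex ^ 'd) set"
  assumes S: "vec.subspace S"
  shows "\<exists>B. finite B \<and> B \<subseteq> S \<and> orthonormal B (\<lambda>b. b) \<and> (\<forall>x\<in>S. x = (\<Sum>b\<in>B. cinner x b *s b))"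
proof -
  define P where "P = (\<lambda>B. finite B \<and> B \<subseteq> S \<and> orthonormal B (\<lambda>b. b))"
  have "P {}" by (simp add: P_def orthonormal_def)
  moreover have "\<forall>B. P B \<longrightarrow> card B < Suc (vec.dim S)"
    using orthonormal_independent unfolding P_def less_Suc_eq_le
    by (auto intro: vec.independent_card_le_dim)
  ultimately have "\<exists>B. P B \<and> (\<forall>C. P C \<longrightarrow> card C \<le> card B)"
    by (rule ex_has_greatest_nat)
  then obtain B where B: "P B" "\<forall>C. P C \<longrightarrow> card C \<le> card B" by blast
  then have fin: "finite B" and sub: "B \<subseteq> S" and on: "orthonormal B (\<lambda>b. b)" by (auto simp: P_def)
  have "x = (\<Sum>b\<in>B. cinner x b *s b)" if x: "x \<in> S" for x
  proof (rule ccontr)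
    assume neq: "x \<noteq> (\<Sum>b\<in>B. cinner x b *s b)"
    define y where "y = x - (\<Sum>b\<in>B. cinner x b *s b)"
    have yS: "y \<in> S" unfolding y_def using x sub S
      by (intro vec.subspace_diff vec.subspace_sum vec.subspace_scale) auto
    have y0: "norm y \<noteq> 0" using neq by (simp add: y_def)
    have orth: "cinner y b = 0" if "b \<in> B" for b
      using orthonormal_coeff[OF on fin that, of "cinner x"] by (simp add: y_def cinner_diff_left)
    define e where "e = complex_of_real (1 / norm y) *s y"
    have e1: "cinner e e = 1"
      using y0 by (simp add: cinner_self e_def norm_cscale norm_divide)
    have eB: "cinner e b = 0" "cinner b e = 0" if "b \<in> B" for b
      using orth[OF that] cinner_commute[of b e] by (auto simp: e_def cinner_scale_left)
    have "e \<notin> B" using eB e1 by force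
    moreover have "P (insert e B)"
      unfolding P_def using fin sub e1 eB on \<open>e \<notin> B\<close> vec.subspace_scale[OF S yS]
      by (auto simp: orthonormal_def e_def)
    ultimately show False using B(2) fin by fastforce
  qed
  then show ?thesis using fin sub on by blast
qed

lemma orthogonal_projection_exists:
  assumes S: "vec.subspace S"
  shows "\<exists>R. clin R \<and> (\<forall>x. R x \<in> S) \<and> (\<forall>x. \<forall>y\<in>S. cinner (R x) y = cinner x y)"
proof -
  obtain B where B: "finite B" "B \<subseteq> S" "orthonormal B (\<lambda>b. b)" "\<forall>x\<in>S. x = (\<Sum>b\<in>B. cinner x b *s b)"
    using orthonormal_basis_exists[OF S] by blast
  define R where "R = (\<lambda>x. \<Sum>b\<in>B. cinner x b *s b)"
  have "clin R"
    unfolding clin_iff R_def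
    by (auto simp: cinner_add_left cinner_scale_left vec.scale_left_distrib sum.distrib vec.scale_sum_right)
  moreover have "R x \<in> S" for x unfolding R_def using B S
    by (intro vec.subspace_sum vec.subspace_scale) auto
  moreover have "cinner (R x) y = cinner x y" if y: "y \<in> S" for x y
  proof -
    have "cinner (R x) b = cinner x b" if "b \<in> B" for b
      unfolding R_def using orthonormal_coeff[OF B(3,1) that] .
    then have "cinner (R x) (\<Sum>b\<in>B. cinner y b *s b) = cinner x (\<Sum>b\<in>B. cinner y b *s b)"
      by (simp add: cinner_sum_right cinner_scale_right)
    then show ?thesis using B(4) y by simp
  qed
  ultimately show ?thesis by blast
qed

lemma unitary_between:
  fixes K L :: "(complex ^ 'd) set"
  assumes K: "vec.subspace K" and L: "vec.subspace L" and dim: "vec.dim K = vec.dim L"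
  shows "\<exists>U. clin U \<and> U ` L = K \<and> isometric_on U L"
proof -
  obtain B where B: "finite B" "B \<subseteq> L" "orthonormal B (\<lambda>b. b)" "\<forall>x\<in>L. x = (\<Sum>b\<in>B. cinner x b *s b)"
    using orthonormal_basis_exists[OF L] by blast
  obtain C where C: "finite C" "C \<subseteq> K" "orthonormal C (\<lambda>b. b)" "\<forall>x\<in>K. x = (\<Sum>b\<in>C. cinner x b *s b)"
    using orthonormal_basis_exists[OF K] by blast
  have sp: "L \<subseteq> vec.span B"
  proof
    fix x assume "x \<in> L"
    moreover have "(\<Sum>b\<in>B. cinner x b *s b) \<in> vec.span B"
      by (intro vec.span_sum vec.span_scale vec.span_base)
    ultimately show "x \<in> vec.span B" using B(4) by simp
  qed
  have sp': "K \<subseteq> vec.span C"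
  proof
    fix x assume "x \<in> K"
    moreover have "(\<Sum>b\<in>C. cinner x b *s b) \<in> vec.span C"
      by (intro vec.span_sum vec.span_scale vec.span_base)
    ultimately show "x \<in> vec.span C" using C(4) by simp
  qed
  have "card B = vec.dim L"
    by (rule vec.basis_card_eq_dim[OF B(2) sp orthonormal_independent[OF B(3,1)]])
  moreover have "card C = vec.dim K"
    by (rule vec.basis_card_eq_dim[OF C(2) sp' orthonormal_independent[OF C(3,1)]])
  ultimately obtain \<phi> where \<phi>: "bij_betw \<phi> B C"
    using dim B(1) C(1) finite_same_card_bij by metis
  have on: "orthonormal B \<phi>"
    using C(3) \<phi> unfolding orthonormal_def bij_betw_def inj_on_def by auto
  define U where "U = (\<lambda>x. \<Sum>b\<in>B. cinner x b *s \<phi> b)"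
  have U: "clin U"
    unfolding clin_iff U_def
    by (auto simp: cinner_add_left cinner_scale_left vec.scale_left_distrib sum.distrib vec.scale_sum_right)
  have "isometric_on U L"
    unfolding isometric_on_def
  proof
    fix x assume "x \<in> L"
    then have "(norm x)\<^sup>2 = (\<Sum>b\<in>B. (cmod (cinner x b))\<^sup>2)"
      using orthonormal_norm[OF B(3,1), of "cinner x"] B(4) by simp
    also have "\<dots> = (norm (U x))\<^sup>2"
      unfolding U_def using orthonormal_norm[OF on B(1), of "cinner x"] by simp
    finally show "norm (U x) = norm x" by (simp add: power2_eq_iff_nonneg)
  qed
  moreover have "U ` L \<subseteq> K"
  proof
    fix y assume "y \<in> U ` L"
    then obtain x where "y = U x" by blast
    moreover have "\<phi> b \<in> K" if "b \<in> B" for b using \<phi> C(2) that by (auto simp: bij_betw_def)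
    ultimately show "y \<in> K" unfolding U_def using K
      by (auto intro!: vec.subspace_sum vec.subspace_scale)
  qed
  moreover have "K \<subseteq> U ` L"
  proof
    fix z assume z: "z \<in> K"
    define x where "x = (\<Sum>b\<in>B. cinner z (\<phi> b) *s b)"
    have "x \<in> L" unfolding x_def using B(2) L by (intro vec.subspace_sum vec.subspace_scale) auto
    moreover have "U x = z"
    proof -
      have "U x = (\<Sum>b\<in>B. cinner z (\<phi> b) *s \<phi> b)"
        unfolding U_def x_def using orthonormal_coeff[OF B(3,1)] by (intro sum.cong) auto
      also have "\<dots> = (\<Sum>c\<in>C. cinner z c *s c)"
        using sum.reindex_bij_betw[OF \<phi>, of "\<lambda>c. cinner z c *s c"] .
      finally show ?thesis using C(4) z by simp
    qed
    ultimately show "z \<in> U ` L" by blast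
  qed
  ultimately show ?thesis using U by blast
qed

text \<open>\<open>isometries_extend\<close> tests only automorphisms of \<open>K\<close>, while
  \<open>A\<close> may move \<open>K\<close> elsewhere. A unitary map from the image of
  \<open>K\<close> back onto \<open>K\<close> corrects this without changing norms.\<close>

lemma isometries_extendD:
  assumes ext: "isometries_extend K M N" and K: "vec.subspace K" "M \<subseteq> K" "N \<subseteq> K"
    and A: "clin A" "inj_on A K" "isometric_on A M"
  shows "isometric_on A N"
proof -
  have L: "vec.subspace (A ` K)" using vec.linear_subspace_image A(1) K(1) by blast
  have sK: "vec.span K = K" using K(1) by simp
  have "vec.dim (A ` K) = vec.dim K"
    using vec.dim_image_eq[OF A(1), of K] A(2) sK by simp
  then obtain U where U: "clin U" "U ` A ` K = K" "isometric_on U (A ` K)"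
    using unitary_between[OF K(1) L] by auto
  have nU: "norm (U (A x)) = norm (A x)" if "x \<in> K" for x
    using U(3) that by (auto simp: isometric_on_def)
  have "clin (\<lambda>x. U (A x))" using U(1) A(1) by (simp add: clin_iff)
  moreover have "inj_on (\<lambda>x. U (A x)) K"
  proof (rule inj_onI)
    fix x y assume xy: "x \<in> K" "y \<in> K" "U (A x) = U (A y)"
    then have "norm (U (A (x - y))) = 0" using U(1) A(1) by (simp add: clin_diff)
    then have "A (x - y) = 0" using nU vec.subspace_diff[OF K(1) xy(1,2)] by simp
    then have "A x = A y" using A(1) by (simp add: clin_diff)
    then show "x = y" using A(2) xy by (auto dest: inj_onD)
  qed
  ultimately have "lin_aut K (\<lambda>x. U (A x))"
    using U(2) by (auto simp: lin_aut_def bij_betw_def image_image)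
  moreover have "isometric_on (\<lambda>x. U (A x)) M"
    using A(3) nU K(2) unfolding isometric_on_def by (metis subsetD)
  ultimately have "isometric_on (\<lambda>x. U (A x)) N" using ext unfolding isometries_extend_def by blast
  then show ?thesis using nU K(3) unfolding isometric_on_def by (metis subsetD)
qed

text \<open>The supremum over pairs of unit vectors is attained by compactness. The value 1 would
  mean equality in Cauchy-Schwarz and put a unit vector into both subspaces.\<close>

lemma subspace_angle:
  fixes S Q :: "(complex ^ 'd) set"
  assumes S: "vec.subspace S" and Q: "vec.subspace Q" and int: "S \<inter> Q = {0}"
  shows "\<exists>c. 0 \<le> c \<and> c < 1 \<and> (\<forall>p\<in>S. \<forall>q\<in>Q. cmod (cinner p q) \<le> c * norm p * norm q)"
proof -
  define K where "K = (S \<inter> sphere 0 1) \<times> (Q \<inter> sphere 0 1)"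
  have scale: "cmod (cinner p q) \<le> c * norm p * norm q"
    if c: "\<And>p q. (p, q) \<in> K \<Longrightarrow> cmod (cinner p q) \<le> c" "0 \<le> c" and pq: "p \<in> S" "q \<in> Q" for c p q
  proof (cases "p = 0 \<or> q = 0")
    case False
    let ?p = "complex_of_real (1 / norm p) *s p" and ?q = "complex_of_real (1 / norm q) *s q"
    have "(?p, ?q) \<in> K"
      unfolding K_def using pq False vec.subspace_scale[OF S pq(1)] vec.subspace_scale[OF Q pq(2)]
      by (auto simp: norm_cscale norm_divide)
    then have "cmod (cinner ?p ?q) \<le> c" by (rule c)
    then show ?thesis using False
      by (simp add: cinner_scale_left cinner_scale_right norm_mult norm_divide field_simps)
  qed (use c in auto)
  show ?thesis
  proof (cases "K = {}")
    case True
    then show ?thesis using scale[of 0] by (intro exI[of _ 0]) auto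
  next
    case False
    have comp: "compact K" unfolding K_def
      by (intro compact_Times closed_Int_compact vec_subspace_closed S Q compact_sphere)
    have cont: "continuous_on K (\<lambda>w. cmod (cinner (fst w) (snd w)))"
      unfolding cinner_def by (intro continuous_intros)
    from continuous_attains_sup[OF comp False cont] obtain w where
      w: "w \<in> K" "\<forall>v\<in>K. cmod (cinner (fst v) (snd v)) \<le> cmod (cinner (fst w) (snd w))" ..
    obtain p q where pq: "w = (p, q)" by fastforce
    define c where "c = cmod (cinner p q)"
    have n: "norm p = 1" "norm q = 1" "p \<in> S" "q \<in> Q" using w(1) by (auto simp: pq K_def)
    have "c \<le> 1" using cmod_cinner_le[of p q] n by (simp add: c_def)
    moreover have "c \<noteq> 1"
    proof
      assume c1: "c = 1"
      let ?r = "p - cinner p q *s q"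
      have a: "cinner p q * cnj (cinner p q) = 1"
        using c1 unfolding c_def by (simp add: complex_norm_square[symmetric])
      have "cinner ?r ?r = 0"
        using cinner_self[of p] cinner_self[of q] n a cinner_commute[of q p]
        by (simp add: cinner_diff_left cinner_diff_right cinner_scale_left cinner_scale_right)
      then have "p = cinner p q *s q" by (simp add: cinner_self)
      then have "p \<in> Q" using vec.subspace_scale[OF Q n(4)] by metis
      then have "p = 0" using int n(3) by blast
      then show False using n by simp
    qed
    moreover have "0 \<le> c" by (simp add: c_def)
    moreover have "\<forall>p\<in>S. \<forall>q\<in>Q. cmod (cinner p q) \<le> c * norm p * norm q"
      using scale[of c] w(2) \<open>0 \<le> c\<close> by (force simp: c_def pq)
    ultimately show ?thesis by force
  qed
qed

section \<open>Positive semidefinite kernels\<close>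

definition psd :: "'a set \<Rightarrow> ('a \<Rightarrow> 'a \<Rightarrow> complex) \<Rightarrow> bool" where
  "psd X K \<longleftrightarrow> (\<forall>F c. finite F \<longrightarrow> F \<subseteq> X \<longrightarrow> 0 \<le> Re (\<Sum>x\<in>F. \<Sum>y\<in>F. c x * cnj (c y) * K x y))"

lemma psdD: "psd X K \<Longrightarrow> finite F \<Longrightarrow> F \<subseteq> X \<Longrightarrow> 0 \<le> Re (\<Sum>x\<in>F. \<Sum>y\<in>F. c x * cnj (c y) * K x y)"
  unfolding psd_def by blast

lemma psd_cong:
  assumes "psd X K" "\<And>x y. x \<in> X \<Longrightarrow> y \<in> X \<Longrightarrow> L x y = K x y"
  shows "psd X L"
  unfolding psd_def
proof (intro allI impI)
  fix F and c :: "'a \<Rightarrow> complex" assume F: "finite F" "F \<subseteq> X"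
  have "(\<Sum>x\<in>F. \<Sum>y\<in>F. c x * cnj (c y) * L x y) = (\<Sum>x\<in>F. \<Sum>y\<in>F. c x * cnj (c y) * K x y)"
    using F assms(2) by (intro sum.cong) auto
  then show "0 \<le> Re (\<Sum>x\<in>F. \<Sum>y\<in>F. c x * cnj (c y) * L x y)" using psdD[OF assms(1) F] by simp
qed

lemma psd_subset: "psd X K \<Longrightarrow> Y \<subseteq> X \<Longrightarrow> psd Y K"
  unfolding psd_def by blast

lemma psd_zero: "psd X (\<lambda>x y. 0)"
  by (simp add: psd_def)

lemma psd_add: "psd X K \<Longrightarrow> psd X L \<Longrightarrow> psd X (\<lambda>x y. K x y + L x y)"
  unfolding psd_def by (simp add: distrib_left sum.distrib)

lemma psd_sum: "(\<And>i. i \<in> I \<Longrightarrow> psd X (K i)) \<Longrightarrow> psd X (\<lambda>x y. \<Sum>i\<in>I. K i x y)"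
  by (induction I rule: infinite_finite_induct) (auto intro: psd_add psd_zero)

lemma psd_feature:
  assumes "psd X K"
  shows "psd X (\<lambda>x y. f x * cnj (f y) * K x y)"
  unfolding psd_def
proof (intro allI impI)
  fix F and c :: "'a \<Rightarrow> complex" assume F: "finite F" "F \<subseteq> X"
  show "0 \<le> Re (\<Sum>x\<in>F. \<Sum>y\<in>F. c x * cnj (c y) * (f x * cnj (f y) * K x y))"
    using psdD[OF assms F, of "\<lambda>x. c x * f x"] by (simp add: mult_ac)
qed

lemma psd_scale:
  assumes "psd X K" "0 \<le> r"
  shows "psd X (\<lambda>x y. complex_of_real r * K x y)"
proof -
  have "complex_of_real (sqrt r) * cnj (complex_of_real (sqrt r)) = complex_of_real r"
    using assms(2) by (simp flip: of_real_mult)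
  then show ?thesis using psd_feature[OF assms(1), of "\<lambda>x. complex_of_real (sqrt r)"] by simp
qed

lemma psd_one: "psd X (\<lambda>x y. 1)"
  unfolding psd_def
proof (intro allI impI)
  fix F and c :: "'a \<Rightarrow> complex"
  have "(\<Sum>x\<in>F. \<Sum>y\<in>F. c x * cnj (c y) * 1) = (\<Sum>x\<in>F. c x) * cnj (\<Sum>x\<in>F. c x)"
    by (simp add: sum_product)
  also have "\<dots> = of_real ((cmod (\<Sum>x\<in>F. c x))\<^sup>2)" by (simp only: complex_norm_square)
  finally show "0 \<le> Re (\<Sum>x\<in>F. \<Sum>y\<in>F. c x * cnj (c y) * 1)"
    by (simp only: Re_complex_of_real) simp
qed

lemma quadratic_form_diff:
  fixes c :: "'a \<Rightarrow> complex"
  shows "(\<Sum>x\<in>F. \<Sum>y\<in>F. c x * cnj (c y) * (a * K x y - L x y)) =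
    a * (\<Sum>x\<in>F. \<Sum>y\<in>F. c x * cnj (c y) * K x y) - (\<Sum>x\<in>F. \<Sum>y\<in>F. c x * cnj (c y) * L x y)"
  by (simp add: right_diff_distrib sum_subtractf sum_distrib_left mult_ac)

text \<open>Since \<open>g\<close> may identify points, the coefficients are summed over its
  fibres.\<close>

lemma psd_pullback:
  assumes "psd Y K" "\<And>x. x \<in> X \<Longrightarrow> g x \<in> Y"
  shows "psd X (\<lambda>x y. K (g x) (g y))"
  unfolding psd_def
proof (intro allI impI)
  fix F and c :: "'b \<Rightarrow> complex" assume F: "finite F" "F \<subseteq> X"
  define d where "d = (\<lambda>u. \<Sum>x\<in>{x\<in>F. g x = u}. c x)"
  have fib: "(\<Sum>x\<in>F. c x * h (g x)) = (\<Sum>u\<in>g ` F. d u * h u)" for h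
    unfolding sum.image_gen[OF F(1), of _ g] d_def sum_distrib_right
    by (intro sum.cong) auto
  have "(\<Sum>x\<in>F. \<Sum>y\<in>F. c x * cnj (c y) * K (g x) (g y))
      = (\<Sum>x\<in>F. c x * cnj (\<Sum>y\<in>F. c y * cnj (K (g x) (g y))))"
    by (simp add: sum_distrib_left mult.assoc)
  also have "\<dots> = (\<Sum>x\<in>F. c x * cnj (\<Sum>v\<in>g ` F. d v * cnj (K (g x) v)))"
  proof (rule sum.cong[OF refl])
    fix x
    have "(\<Sum>y\<in>F. c y * cnj (K (g x) (g y))) = (\<Sum>v\<in>g ` F. d v * cnj (K (g x) v))"
      by (rule fib)
    then show "c x * cnj (\<Sum>y\<in>F. c y * cnj (K (g x) (g y))) = c x * cnj (\<Sum>v\<in>g ` F. d v * cnj (K (g x) v))"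
      by simp
  qed
  also have "\<dots> = (\<Sum>u\<in>g ` F. d u * cnj (\<Sum>v\<in>g ` F. d v * cnj (K u v)))"
    by (rule fib)
  also have "\<dots> = (\<Sum>u\<in>g ` F. \<Sum>v\<in>g ` F. d u * cnj (d v) * K u v)"
    by (simp add: sum_distrib_left mult.assoc)
  finally show "0 \<le> Re (\<Sum>x\<in>F. \<Sum>y\<in>F. c x * cnj (c y) * K (g x) (g y))"
    using psdD[OF assms(1), of "g ` F" d] F assms(2) by auto
qed

lemma psd_limit:
  assumes "\<And>n::nat. psd X (K n)" "\<And>x y. x \<in> X \<Longrightarrow> y \<in> X \<Longrightarrow> (\<lambda>n. K n x y) \<longlonglongrightarrow> L x y"
  shows "psd X L"
  unfolding psd_def
proof (intro allI impI)
  fix F and c :: "'a \<Rightarrow> complex" assume F: "finite F" "F \<subseteq> X"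
  show "0 \<le> Re (\<Sum>x\<in>F. \<Sum>y\<in>F. c x * cnj (c y) * L x y)"
  proof (rule tendsto_lowerbound)
    show "(\<lambda>n. Re (\<Sum>x\<in>F. \<Sum>y\<in>F. c x * cnj (c y) * K n x y)) \<longlonglongrightarrow>
        Re (\<Sum>x\<in>F. \<Sum>y\<in>F. c x * cnj (c y) * L x y)"
      using F by (intro tendsto_intros assms(2)) auto
    show "\<forall>\<^sub>F n in sequentially. 0 \<le> Re (\<Sum>x\<in>F. \<Sum>y\<in>F. c x * cnj (c y) * K n x y)"
      using psdD[OF assms(1) F] by simp
  qed simp
qed

text \<open>A Gram kernel of finite-dimensional vectors is a sum of rank one kernels, so this case
  of the Schur product theorem requires no decomposition of \<open>K\<close>.\<close>

lemma psd_cinner_mult: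
  assumes "psd X K"
  shows "psd X (\<lambda>x y. cinner (g x) (g y) * K x y)"
  unfolding cinner_def sum_distrib_right
  by (rule psd_sum) (rule psd_feature[OF assms])

lemma psd_cinner_power_mult:
  assumes "psd X K"
  shows "psd X (\<lambda>x y. cinner (g x) (g y) ^ m * K x y)"
proof (induction m)
  case (Suc m)
  then show ?case using psd_cinner_mult[OF Suc, of g] by (simp add: mult.assoc)
qed (simp add: assms)

lemma psd_cinner_power: "psd X (\<lambda>x y. cinner (g x) (g y) ^ m)"
  using psd_cinner_power_mult[OF psd_one, of X g m] by simp

text \<open>\<open>a\<^sup>m\<^sup>+\<^sup>1 - b\<^sup>m\<^sup>+\<^sup>1 = a\<^sup>m (a - b) + b (a\<^sup>m - b\<^sup>m)\<close> reduces tensor powers to the case \<open>m = 1\<close>.\<close>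

lemma psd_contraction_power:
  fixes f g :: "complex ^ 'd \<Rightarrow> complex ^ 'd"
  assumes S: "vec.subspace S" and f: "clin f" and g: "clin g" and c: "0 \<le> c"
    and le: "\<And>x. x \<in> S \<Longrightarrow> norm (g x) \<le> c * norm (f x)"
  shows "psd S (\<lambda>x y. of_real (c ^ (2 * m)) * cinner (f x) (f y) ^ m - cinner (g x) (g y) ^ m)"
proof (induction m)
  case 0
  then show ?case by (simp add: psd_zero)
next
  case (Suc m)
  have base: "psd S (\<lambda>x y. of_real (c\<^sup>2) * cinner (f x) (f y) - cinner (g x) (g y))"
    unfolding psd_def
  proof (intro allI impI)
    fix F and a :: "complex ^ 'd \<Rightarrow> complex" assume F: "finite F" "F \<subseteq> S"
    \<comment> \<open>For linear \<open>h\<close> the quadratic form of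
      \<open>cinner (h x) (h y)\<close> at \<open>a\<close> is the squared norm of
      \<open>h z\<close>, so the inequality concerns the single vector \<open>z\<close>.\<close>
    define z where "z = (\<Sum>x\<in>F. a x *s x)"
    have z: "z \<in> S" unfolding z_def using F S by (intro vec.subspace_sum vec.subspace_scale) auto
    have q: "(\<Sum>x\<in>F. \<Sum>y\<in>F. a x * cnj (a y) * cinner (h x) (h y)) = of_real ((norm (h z))\<^sup>2)"
      if h: "clin h" for h
    proof -
      have "cinner (h z) (h z) = (\<Sum>x\<in>F. \<Sum>y\<in>F. a x * cnj (a y) * cinner (h x) (h y))"
        unfolding z_def clin_sum[OF h] clin_scale[OF h] by (rule cinner_combination)
      then show ?thesis by (simp add: cinner_self)
    qed
    have "(\<Sum>x\<in>F. \<Sum>y\<in>F. a x * cnj (a y) * (of_real (c\<^sup>2) * cinner (f x) (f y) - cinner (g x) (g y)))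
        = of_real (c\<^sup>2) * of_real ((norm (f z))\<^sup>2) - of_real ((norm (g z))\<^sup>2)"
      unfolding quadratic_form_diff q[OF f] q[OF g] ..
    also have "\<dots> = of_real (c\<^sup>2 * (norm (f z))\<^sup>2 - (norm (g z))\<^sup>2)"
      by simp
    finally have "Re (\<Sum>x\<in>F. \<Sum>y\<in>F. a x * cnj (a y) * (of_real (c\<^sup>2) * cinner (f x) (f y) - cinner (g x) (g y)))
       = c\<^sup>2 * (norm (f z))\<^sup>2 - (norm (g z))\<^sup>2" by (simp only: Re_complex_of_real)
    moreover have "(norm (g z))\<^sup>2 \<le> (c * norm (f z))\<^sup>2" by (rule power_mono[OF le[OF z]]) simp
    ultimately show "0 \<le> Re (\<Sum>x\<in>F. \<Sum>y\<in>F. a x * cnj (a y) *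
        (of_real (c\<^sup>2) * cinner (f x) (f y) - cinner (g x) (g y)))"
      by (simp add: power_mult_distrib)
  qed
  have "psd S (\<lambda>x y. of_real (c ^ (2 * m)) * (cinner (f x) (f y) ^ m *
        (of_real (c\<^sup>2) * cinner (f x) (f y) - cinner (g x) (g y))) +
      cinner (g x) (g y) * (of_real (c ^ (2 * m)) * cinner (f x) (f y) ^ m - cinner (g x) (g y) ^ m))"
    by (intro psd_add psd_scale psd_cinner_power_mult base psd_cinner_mult[OF Suc.IH]) (use c in simp)
  then show ?case
    by (rule psd_cong) (simp add: algebra_simps power2_eq_square)
qed

section \<open>Tensor powers\<close>

text \<open>
  \<open>tensor_comb g F c\<close> lists the coordinates of \<open>\<Sum>x\<in>F. c x (g x)\<^bsup>\<otimes>m\<^esup>\<close> for all \<open>m\<close> at once: those with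
  respect to the standard basis of the \<open>m\<close>-th tensor power are indexed by the words of length \<open>m\<close>.
\<close>

definition tensor_comb ::
    "('a \<Rightarrow> complex ^ 'd) \<Rightarrow> 'a set \<Rightarrow> ('a \<Rightarrow> complex) \<Rightarrow> 'd list \<Rightarrow> complex" where
  "tensor_comb g F c w = (\<Sum>x\<in>F. c x * prod_list (map (\<lambda>i. g x $ i) w))"

definition word_ip :: "nat \<Rightarrow> ('d list \<Rightarrow> complex) \<Rightarrow> ('d list \<Rightarrow> complex) \<Rightarrow> complex" where
  "word_ip m u v = (\<Sum>w | length w = m. u w * cnj (v w))"

definition word_norm :: "nat \<Rightarrow> ('d list \<Rightarrow> complex) \<Rightarrow> real" where
  "word_norm m u = L2_set (\<lambda>w. cmod (u w)) {w. length w = m}"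

lemma word_norm_nonneg [simp]: "0 \<le> word_norm m u"
  by (simp add: word_norm_def L2_set_nonneg)

lemma word_ip_self: "word_ip m u u = of_real ((word_norm m u)\<^sup>2)"
proof -
  have "word_ip m u u = (\<Sum>w | length w = m. of_real ((cmod (u w))\<^sup>2))"
    unfolding word_ip_def by (simp only: complex_norm_square)
  then show ?thesis by (simp add: word_norm_def L2_set_def sum_nonneg)
qed

lemma cmod_word_ip_le: "cmod (word_ip m u v) \<le> word_norm m u * word_norm m v"
proof -
  have "cmod (word_ip m u v) \<le> (\<Sum>w | length w = m. cmod (u w) * cmod (v w))"
    unfolding word_ip_def by (rule order_trans[OF norm_sum]) (simp add: norm_mult)
  also have "\<dots> \<le> word_norm m u * word_norm m v"
    using L2_set_mult_ineq[of "\<lambda>w. cmod (u w)" "\<lambda>w. cmod (v w)"] unfolding word_norm_def by simp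
  finally show ?thesis .
qed

lemma word_ip_sum: "word_ip m (\<lambda>w. \<Sum>i\<in>I. u i w) (\<lambda>w. \<Sum>j\<in>J. v j w) = (\<Sum>i\<in>I. \<Sum>j\<in>J. word_ip m (u i) (v j))"
proof -
  have "word_ip m (\<lambda>w. \<Sum>i\<in>I. u i w) (\<lambda>w. \<Sum>j\<in>J. v j w) =
      (\<Sum>w | length w = m. \<Sum>i\<in>I. \<Sum>j\<in>J. u i w * cnj (v j w))"
    by (simp add: word_ip_def sum_product)
  also have "\<dots> = (\<Sum>i\<in>I. \<Sum>w | length w = m. \<Sum>j\<in>J. u i w * cnj (v j w))" by (rule sum.swap)
  also have "\<dots> = (\<Sum>i\<in>I. \<Sum>j\<in>J. word_ip m (u i) (v j))"
    unfolding word_ip_def by (intro sum.cong refl sum.swap)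
  finally show ?thesis .
qed

lemma cinner_power_words:
  "cinner x y ^ m = (\<Sum>w | length w = m. prod_list (map (\<lambda>i. x $ i) w) * cnj (prod_list (map (\<lambda>i. y $ i) w)))"
proof -
  have "prod_list (map (\<lambda>i. x $ i * cnj (y $ i)) w) =
      prod_list (map (\<lambda>i. x $ i) w) * cnj (prod_list (map (\<lambda>i. y $ i) w))" for w
    by (induction w) (auto simp: mult_ac)
  then show ?thesis
    unfolding cinner_def using sum_prod_words[of "\<lambda>i. x $ i * cnj (y $ i)" m] by simp
qed

lemma word_ip_tensor_comb:
  "word_ip m (tensor_comb g F c) (tensor_comb h G d) =
     (\<Sum>x\<in>F. \<Sum>y\<in>G. c x * cnj (d y) * cinner (g x) (h y) ^ m)"
proof -
  have "word_ip m (tensor_comb g F c) (tensor_comb h G d) =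
      (\<Sum>x\<in>F. \<Sum>y\<in>G. word_ip m (\<lambda>w. c x * prod_list (map (\<lambda>i. g x $ i) w)) (\<lambda>w. d y * prod_list (map (\<lambda>i. h y $ i) w)))"
    unfolding tensor_comb_def[abs_def] by (rule word_ip_sum)
  also have "\<dots> = (\<Sum>x\<in>F. \<Sum>y\<in>G. c x * cnj (d y) * cinner (g x) (h y) ^ m)"
    unfolding word_ip_def cinner_power_words by (simp add: sum_distrib_left mult_ac)
  finally show ?thesis .
qed

lemma word_norm_tensor_comb:
  "(word_norm m (tensor_comb g F c))\<^sup>2 = Re (\<Sum>x\<in>F. \<Sum>y\<in>F. c x * cnj (c y) * cinner (g x) (g y) ^ m)"
  unfolding word_ip_tensor_comb[symmetric] word_ip_self by (simp only: Re_complex_of_real)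

lemma word_norm_psd:
  assumes "psd X (\<lambda>x y. of_real a * cinner (f x) (f y) ^ m - cinner (g x) (g y) ^ m)" "finite F" "F \<subseteq> X"
  shows "(word_norm m (tensor_comb g F c))\<^sup>2 \<le> a * (word_norm m (tensor_comb f F c))\<^sup>2"
  using psdD[OF assms, of c] unfolding quadratic_form_diff by (simp add: word_norm_tensor_comb)

text \<open>Together with \<open>word_norm_psd\<close> this identifies kernel inequalities with norm
  inequalities between tensors. The latter form admits splitting a tensor into blocks.\<close>

lemma psd_word_norm:
  assumes "\<And>F c. finite F \<Longrightarrow> F \<subseteq> X \<Longrightarrow>
    (word_norm m (tensor_comb g F c))\<^sup>2 \<le> a * (word_norm m (tensor_comb f F c))\<^sup>2"
  shows "psd X (\<lambda>x y. of_real a * cinner (f x) (f y) ^ m - cinner (g x) (g y) ^ m)"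
  unfolding psd_def
proof (intro allI impI)
  fix F and c :: "'a \<Rightarrow> complex" assume F: "finite F" "F \<subseteq> X"
  show "0 \<le> Re (\<Sum>x\<in>F. \<Sum>y\<in>F. c x * cnj (c y) *
      (of_real a * cinner (f x) (f y) ^ m - cinner (g x) (g y) ^ m))"
    using assms[OF F, of c] unfolding quadratic_form_diff by (simp add: word_norm_tensor_comb)
qed

text \<open>The projection onto \<open>Q\<close> shrinks \<open>P\<close> by the factor \<open>c\<close>, so its tensor power shrinks by \<open>c\<^sup>m\<close>.\<close>

lemma tensor_angle:
  assumes P: "vec.subspace P" and Q: "vec.subspace Q" and c: "0 \<le> c"
    and angle: "\<And>p q. p \<in> P \<Longrightarrow> q \<in> Q \<Longrightarrow> cmod (cinner p q) \<le> c * norm p * norm q"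
    and g: "finite F" "\<And>x. x \<in> F \<Longrightarrow> g x \<in> P" and h: "\<And>y. y \<in> G \<Longrightarrow> h y \<in> Q"
  shows "cmod (word_ip m (tensor_comb g F a) (tensor_comb h G b))
      \<le> c ^ m * word_norm m (tensor_comb g F a) * word_norm m (tensor_comb h G b)"
proof -
  obtain R where R0: "clin R" "\<forall>x. R x \<in> Q" "\<forall>x. \<forall>y\<in>Q. cinner (R x) y = cinner x y"
    using orthogonal_projection_exists[OF Q] by blast
  then have R: "clin R" "\<And>x. R x \<in> Q" "\<And>x y. y \<in> Q \<Longrightarrow> cinner (R x) y = cinner x y" by auto
  have "norm (R x) \<le> c * norm x" if "x \<in> P" for x
  proof -
    have "(norm (R x))\<^sup>2 = cmod (cinner (R x) (R x))"
      by (simp add: cinner_self norm_power)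
    also have "\<dots> = cmod (cinner x (R x))" using R by simp
    also have "\<dots> \<le> (c * norm x) * norm (R x)" using angle[OF that R(2)] by simp
    finally have "norm (R x) * norm (R x) \<le> (c * norm x) * norm (R x)" by (simp add: power2_eq_square)
    then show ?thesis using c by (cases "norm (R x) = 0") (auto dest: mult_right_le_imp_le)
  qed
  then have "psd P (\<lambda>x y. of_real (c ^ (2 * m)) * cinner x y ^ m - cinner (R x) (R y) ^ m)"
    using psd_contraction_power[OF P _ R(1) c, of "\<lambda>x. x" m] by (simp add: clin_iff)
  then have "psd F (\<lambda>x y. of_real (c ^ (2 * m)) * cinner (g x) (g y) ^ m - cinner (R (g x)) (R (g y)) ^ m)"
    by (rule psd_pullback) (rule g)
  from word_norm_psd[OF this g(1) order_refl]
  have "(word_norm m (tensor_comb (\<lambda>x. R (g x)) F a))\<^sup>2 \<le> (c ^ m * word_norm m (tensor_comb g F a))\<^sup>2"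
    by (simp add: power_mult_distrib power_mult[symmetric] mult.commute)
  then have le: "word_norm m (tensor_comb (\<lambda>x. R (g x)) F a) \<le> c ^ m * word_norm m (tensor_comb g F a)"
    by (rule power2_le_imp_le) (use c in simp)
  have "word_ip m (tensor_comb g F a) (tensor_comb h G b) =
      word_ip m (tensor_comb (\<lambda>x. R (g x)) F a) (tensor_comb h G b)"
    unfolding word_ip_tensor_comb using R(3) h by (intro sum.cong) auto
  also have "cmod \<dots> \<le> word_norm m (tensor_comb (\<lambda>x. R (g x)) F a) * word_norm m (tensor_comb h G b)"
    by (rule cmod_word_ip_le)
  also have "\<dots> \<le> c ^ m * word_norm m (tensor_comb g F a) * word_norm m (tensor_comb h G b)"
    by (rule mult_right_mono[OF le]) simp
  finally show ?thesis .
qed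

text \<open>Each mixed term is at most \<open>\<eta>\<close> times the mean of two squared norms;
  summing these means over all pairs of indices gives the factor \<open>k * \<eta>\<close>.\<close>

lemma almost_orthogonal_sum:
  assumes "0 \<le> \<eta>" "\<And>i j. i < k \<Longrightarrow> j < k \<Longrightarrow> i \<noteq> j \<Longrightarrow>
      cmod (word_ip m (u i) (u j)) \<le> \<eta> * word_norm m (u i) * word_norm m (u j)"
  shows "\<bar>(word_norm m (\<lambda>w. \<Sum>i<k. u i w))\<^sup>2 - (\<Sum>i<k. (word_norm m (u i))\<^sup>2)\<bar>
      \<le> real k * \<eta> * (\<Sum>i<k. (word_norm m (u i))\<^sup>2)"
proof -
  let ?n = "\<lambda>i. word_norm m (u i)"
  have split: "(\<Sum>j<k. word_ip m (u i) (u j)) = of_real ((?n i)\<^sup>2) + (\<Sum>j\<in>{..<k} - {i}. word_ip m (u i) (u j))"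
    if "i < k" for i
    using that by (subst sum.remove[of _ i]) (auto simp: word_ip_self)
  have "complex_of_real ((word_norm m (\<lambda>w. \<Sum>i<k. u i w))\<^sup>2) = (\<Sum>i<k. \<Sum>j<k. word_ip m (u i) (u j))"
    unfolding word_ip_self[symmetric] by (rule word_ip_sum)
  also have "\<dots> = complex_of_real (\<Sum>i<k. (?n i)\<^sup>2) + (\<Sum>i<k. \<Sum>j\<in>{..<k} - {i}. word_ip m (u i) (u j))"
    by (simp add: split sum.distrib)
  finally have "complex_of_real ((word_norm m (\<lambda>w. \<Sum>i<k. u i w))\<^sup>2 - (\<Sum>i<k. (?n i)\<^sup>2)) =
      (\<Sum>i<k. \<Sum>j\<in>{..<k} - {i}. word_ip m (u i) (u j))" by simp
  from arg_cong[OF this, of cmod] have "\<bar>(word_norm m (\<lambda>w. \<Sum>i<k. u i w))\<^sup>2 - (\<Sum>i<k. (?n i)\<^sup>2)\<bar> =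
      cmod (\<Sum>i<k. \<Sum>j\<in>{..<k} - {i}. word_ip m (u i) (u j))" by (simp only: norm_of_real)
  also have "\<dots> \<le> (\<Sum>i<k. \<Sum>j\<in>{..<k} - {i}. cmod (word_ip m (u i) (u j)))"
    by (rule order_trans[OF norm_sum]) (rule sum_mono, rule norm_sum)
  also have "\<dots> \<le> (\<Sum>i<k. \<Sum>j<k. \<eta> * (((?n i)\<^sup>2 + (?n j)\<^sup>2) / 2))"
  proof (rule sum_mono)
    fix i assume i: "i \<in> {..<k}"
    have "(\<Sum>j\<in>{..<k} - {i}. cmod (word_ip m (u i) (u j))) \<le> (\<Sum>j\<in>{..<k} - {i}. \<eta> * (((?n i)\<^sup>2 + (?n j)\<^sup>2) / 2))"
    proof (rule sum_mono)
      fix j assume j: "j \<in> {..<k} - {i}"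
      have "cmod (word_ip m (u i) (u j)) \<le> \<eta> * (?n i * ?n j)" using assms(2)[of i j] i j by auto
      also have "\<dots> \<le> \<eta> * (((?n i)\<^sup>2 + (?n j)\<^sup>2) / 2)"
        using sum_squares_bound[of "?n i" "?n j"] assms(1) by (intro mult_left_mono) auto
      finally show "cmod (word_ip m (u i) (u j)) \<le> \<eta> * (((?n i)\<^sup>2 + (?n j)\<^sup>2) / 2)" .
    qed
    also have "\<dots> \<le> (\<Sum>j<k. \<eta> * (((?n i)\<^sup>2 + (?n j)\<^sup>2) / 2))"
      using assms(1) by (intro sum_mono2) auto
    finally show "(\<Sum>j\<in>{..<k} - {i}. cmod (word_ip m (u i) (u j))) \<le> (\<Sum>j<k. \<eta> * (((?n i)\<^sup>2 + (?n j)\<^sup>2) / 2))" .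
  qed
  also have "\<dots> = \<eta> * (\<Sum>i<k. \<Sum>j<k. ((?n i)\<^sup>2 + (?n j)\<^sup>2) / 2)"
    by (simp add: sum_distrib_left)
  also have "(\<Sum>i<k. \<Sum>j<k. ((?n i)\<^sup>2 + (?n j)\<^sup>2) / 2) = real k * (\<Sum>i<k. (?n i)\<^sup>2)"
    by (simp add: sum.distrib add_divide_distrib sum_divide_distrib[symmetric] sum_distrib_left[symmetric])
  finally show ?thesis by (simp add: mult_ac)
qed

text \<open>Blocks from different subspaces have cosine at most \<open>c^m\<close> in the
  \<open>m\<close>-th tensor power, under \<open>f\<close> as under \<open>g\<close>. Both squared
  norms therefore differ from their block sums by a relative error \<open>k * c^m\<close>, which
  degrades the blockwise constant \<open>a\<close> to \<open>b\<close>.\<close>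

lemma psd_union_of_subspaces:
  fixes f g :: "complex ^ 'd \<Rightarrow> complex ^ 'd" and N S :: "nat \<Rightarrow> (complex ^ 'd) set"
  assumes f: "clin f" and g: "clin g" and S: "\<And>i. i < k \<Longrightarrow> vec.subspace (S i)" "\<And>i. i < k \<Longrightarrow> N i \<subseteq> S i"
    and c: "0 \<le> c" "real k * c ^ m < 1"
    and angle_f: "\<And>i j x y. i < k \<Longrightarrow> j < k \<Longrightarrow> i \<noteq> j \<Longrightarrow> x \<in> S i \<Longrightarrow> y \<in> S j \<Longrightarrow>
        cmod (cinner (f x) (f y)) \<le> c * norm (f x) * norm (f y)"
    and angle_g: "\<And>i j x y. i < k \<Longrightarrow> j < k \<Longrightarrow> i \<noteq> j \<Longrightarrow> x \<in> S i \<Longrightarrow> y \<in> S j \<Longrightarrow>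
        cmod (cinner (g x) (g y)) \<le> c * norm (g x) * norm (g y)"
    and a: "0 \<le> a" "\<And>i. i < k \<Longrightarrow> psd (N i) (\<lambda>x y. of_real a * cinner (f x) (f y) ^ m - cinner (g x) (g y) ^ m)"
    and b: "a * (1 + real k * c ^ m) \<le> b * (1 - real k * c ^ m)"
  shows "psd (\<Union>i<k. N i) (\<lambda>x y. of_real b * cinner (f x) (f y) ^ m - cinner (g x) (g y) ^ m)"
proof (rule psd_word_norm)
  fix F and e :: "complex ^ 'd \<Rightarrow> complex"
  assume F: "finite F" "F \<subseteq> (\<Union>i<k. N i)"
  \<comment> \<open>The sets \<open>N i\<close> may overlap, so each point is assigned to one of
    them.\<close>
  define blk where "blk = (\<lambda>x. LEAST i. i < k \<and> x \<in> N i)"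
  define G where "G = (\<lambda>i. {x\<in>F. blk x = i})"
  have blk: "blk x < k \<and> x \<in> N (blk x)" if x: "x \<in> F" for x
  proof -
    obtain i where "i < k \<and> x \<in> N i" using F(2) x by blast
    then show ?thesis unfolding blk_def by (rule LeastI)
  qed
  have G: "finite (G i)" "G i \<subseteq> N i" for i using F(1) blk by (auto simp: G_def)
  have FG: "F = (\<Union>i<k. G i)" using blk by (auto simp: G_def)
  have comb: "tensor_comb h F e = (\<lambda>w. \<Sum>i<k. tensor_comb h (G i) e w)" for h :: "complex ^ 'd \<Rightarrow> complex ^ 'd"
  proof
    fix w
    show "tensor_comb h F e w = (\<Sum>i<k. tensor_comb h (G i) e w)"
      unfolding tensor_comb_def FG
      by (rule sum.UNION_disjoint) (use G in \<open>auto simp: G_def\<close>)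
  qed
  let ?u = "\<lambda>i. (word_norm m (tensor_comb f (G i) e))\<^sup>2" and ?v = "\<lambda>i. (word_norm m (tensor_comb g (G i) e))\<^sup>2"
  let ?\<eta> = "real k * c ^ m"
  have ang: "cmod (word_ip m (tensor_comb h (G i) e) (tensor_comb h (G j) e))
      \<le> c ^ m * word_norm m (tensor_comb h (G i) e) * word_norm m (tensor_comb h (G j) e)"
    if ij: "i < k" "j < k" "i \<noteq> j" and h: "clin h"
      and an: "\<And>x y. x \<in> S i \<Longrightarrow> y \<in> S j \<Longrightarrow> cmod (cinner (h x) (h y)) \<le> c * norm (h x) * norm (h y)" for i j h
  proof (rule tensor_angle[where P = "h ` S i" and Q = "h ` S j"])
    show "vec.subspace (h ` S i)" "vec.subspace (h ` S j)"
      using vec.linear_subspace_image[OF h] S(1) ij by auto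
  qed (use an G S(2) ij c in \<open>auto simp: subset_eq\<close>)
  have uf: "\<bar>(word_norm m (tensor_comb f F e))\<^sup>2 - (\<Sum>i<k. ?u i)\<bar> \<le> ?\<eta> * (\<Sum>i<k. ?u i)"
    unfolding comb by (rule almost_orthogonal_sum) (use c ang[OF _ _ _ f] angle_f in auto)
  have ug: "\<bar>(word_norm m (tensor_comb g F e))\<^sup>2 - (\<Sum>i<k. ?v i)\<bar> \<le> ?\<eta> * (\<Sum>i<k. ?v i)"
    unfolding comb by (rule almost_orthogonal_sum) (use c ang[OF _ _ _ g] angle_g in auto)
  have "(\<Sum>i<k. ?v i) \<le> (\<Sum>i<k. a * ?u i)"
    by (rule sum_mono) (use word_norm_psd[OF a(2) G] in auto)
  then have vu: "(\<Sum>i<k. ?v i) \<le> a * (\<Sum>i<k. ?u i)" by (simp add: sum_distrib_left)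
  have \<eta>: "0 \<le> ?\<eta>" using c by simp
  have b0: "0 \<le> b"
  proof (rule ccontr)
    assume "\<not> 0 \<le> b"
    then have "b * (1 - ?\<eta>) < 0" using c(2) by (simp add: mult_neg_pos)
    moreover have "0 \<le> a * (1 + ?\<eta>)" using a(1) \<eta> by simp
    ultimately show False using b by linarith
  qed
  have "(word_norm m (tensor_comb g F e))\<^sup>2 \<le> (1 + ?\<eta>) * (\<Sum>i<k. ?v i)"
    using ug by (simp add: distrib_right abs_le_iff)
  also have "\<dots> \<le> (1 + ?\<eta>) * (a * (\<Sum>i<k. ?u i))" using vu \<eta> by (intro mult_left_mono) auto
  also have "\<dots> = (a * (1 + ?\<eta>)) * (\<Sum>i<k. ?u i)" by simp
  also have "\<dots> \<le> (b * (1 - ?\<eta>)) * (\<Sum>i<k. ?u i)"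
    by (rule mult_right_mono[OF b]) (simp add: sum_nonneg)
  also have "\<dots> = b * ((1 - ?\<eta>) * (\<Sum>i<k. ?u i))" by simp
  also have "\<dots> \<le> b * (word_norm m (tensor_comb f F e))\<^sup>2"
    using uf b0 by (intro mult_left_mono) (auto simp: left_diff_distrib abs_le_iff)
  finally show "(word_norm m (tensor_comb g F e))\<^sup>2 \<le> b * (word_norm m (tensor_comb f F e))\<^sup>2" .
qed

section \<open>Tractable unions and nearly isometric maps\<close>

definition near_isometry :: "real \<Rightarrow> (complex ^ 'd) set \<Rightarrow> (complex ^ 'd \<Rightarrow> complex ^ 'd) \<Rightarrow> bool" where
  "near_isometry \<delta> K A \<longleftrightarrow> clin A \<and>
     (\<forall>x\<in>K. norm (A x) \<le> (1 + \<delta>) * norm x \<and> norm x \<le> (1 + \<delta>) * norm (A x))"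

text \<open>
  The maps \<open>A\<^bsup>\<otimes>m\<^esup>\<close> and their inverses have squared norm at most \<open>1 + \<epsilon>\<close> on the span of the vectors
  \<open>x\<^bsup>\<otimes>m\<^esup>\<close> with \<open>x \<in> M\<close>, uniformly in \<open>m\<close>.
\<close>

definition gram_close :: "real \<Rightarrow> (complex ^ 'd) set \<Rightarrow> (complex ^ 'd \<Rightarrow> complex ^ 'd) \<Rightarrow> bool" where
  "gram_close \<epsilon> M A \<longleftrightarrow> (\<forall>m.
     psd M (\<lambda>x y. of_real (1 + \<epsilon>) * cinner x y ^ m - cinner (A x) (A y) ^ m) \<and>
     psd M (\<lambda>x y. of_real (1 + \<epsilon>) * cinner (A x) (A y) ^ m - cinner x y ^ m))"

lemma gram_close_subset: "gram_close \<epsilon> M A \<Longrightarrow> M' \<subseteq> M \<Longrightarrow> gram_close \<epsilon> M' A"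
  unfolding gram_close_def using psd_subset by blast

lemma near_isometry_mono:
  assumes "near_isometry \<delta> K A" "\<delta> \<le> \<delta>'" "K' \<subseteq> K"
  shows "near_isometry \<delta>' K' A"
proof -
  have "(1 + \<delta>) * norm z \<le> (1 + \<delta>') * norm z" for z :: "complex ^ 'a"
    using assms(2) by (intro mult_right_mono) auto
  then show ?thesis using assms unfolding near_isometry_def by (meson order_trans subsetD)
qed

lemma near_isometry_inj:
  assumes "near_isometry \<delta> K A" "vec.subspace K"
  shows "inj_on A K"
proof (rule inj_onI)
  fix x y assume xy: "x \<in> K" "y \<in> K" "A x = A y"
  then have "A (x - y) = 0" using assms by (simp add: near_isometry_def clin_diff)
  moreover have "x - y \<in> K" using vec.subspace_diff[OF assms(2) xy(1,2)] .
  ultimately show "x = y" using assms(1) by (force simp: near_isometry_def)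
qed

text \<open>For unit vectors, polarization and the parallelogram law bound the real part; a phase
  factor then gives the modulus. The constant is \<open>(1 + \<delta>)\<^sup>2 - 1\<close>.\<close>

lemma near_isometry_form:
  assumes A: "near_isometry \<delta> K A" and K: "vec.subspace K" and \<delta>: "0 \<le> \<delta>" and xy: "x \<in> K" "y \<in> K"
  shows "cmod (cinner (A x) (A y) - cinner x y) \<le> (2 * \<delta> + \<delta>\<^sup>2) * (norm x * norm y)"
proof -
  let ?\<eta> = "2 * \<delta> + \<delta>\<^sup>2"
  have lin: "clin A" using A by (simp add: near_isometry_def)
  have \<eta>: "(1 + \<delta>)\<^sup>2 = 1 + ?\<eta>" "0 \<le> ?\<eta>" using \<delta> by (auto simp: power2_eq_square algebra_simps)
  have D: "\<bar>(norm (A z))\<^sup>2 - (norm z)\<^sup>2\<bar> \<le> ?\<eta> * (norm z)\<^sup>2" if z: "z \<in> K" for z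
  proof -
    have "(norm (A z))\<^sup>2 \<le> ((1 + \<delta>) * norm z)\<^sup>2" "(norm z)\<^sup>2 \<le> ((1 + \<delta>) * norm (A z))\<^sup>2"
      using A z by (auto simp: near_isometry_def intro!: power_mono)
    then have "(norm (A z))\<^sup>2 \<le> (1 + ?\<eta>) * (norm z)\<^sup>2" "(norm z)\<^sup>2 \<le> (1 + ?\<eta>) * (norm (A z))\<^sup>2"
      by (simp_all only: power_mult_distrib \<eta>)
    moreover have "\<bar>a - b\<bar> \<le> e * b" if "a \<le> (1 + e) * b" "b \<le> (1 + e) * a" "0 \<le> e" for a b e :: real
    proof (cases "a \<le> b")
      case True
      then have "e * a \<le> e * b" using that(3) by (rule mult_left_mono)
      then show ?thesis using that True by (simp add: distrib_right)
    next
      case False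
      then show ?thesis using that by (simp add: distrib_right)
    qed
    ultimately show ?thesis using \<eta>(2) by blast
  qed
  have re: "Re (cinner (A u) (A v) - cinner u v) \<le> ?\<eta>"
    if u: "u \<in> K" "v \<in> K" "norm u = 1" "norm v = 1" for u v
  proof -
    have s: "(norm (u - v))\<^sup>2 = (norm u)\<^sup>2 + (norm v)\<^sup>2 - 2 * Re (cinner u v)" for u v :: "complex ^ 'a"
      by (simp add: power2_norm_eq_inner inner_diff_left inner_diff_right Re_cinner inner_commute)
    have "\<bar>(norm (A u + A v))\<^sup>2 - (norm (u + v))\<^sup>2\<bar> \<le> ?\<eta> * (norm (u + v))\<^sup>2"
      "\<bar>(norm (A u - A v))\<^sup>2 - (norm (u - v))\<^sup>2\<bar> \<le> ?\<eta> * (norm (u - v))\<^sup>2"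
      using D[OF vec.subspace_add[OF K u(1,2)]] D[OF vec.subspace_diff[OF K u(1,2)]]
      by (simp_all add: clin_add[OF lin] clin_diff[OF lin])
    moreover have "?\<eta> * (norm (u + v))\<^sup>2 + ?\<eta> * (norm (u - v))\<^sup>2 = 4 * ?\<eta>"
      unfolding s norm_add_sq distrib_left[symmetric] using u(3,4) by simp
    ultimately show ?thesis unfolding s norm_add_sq by simp
  qed
  define w where "w = cinner (A x) (A y) - cinner x y"
  show ?thesis
  proof (cases "w = 0 \<or> x = 0 \<or> y = 0")
    case True
    then show ?thesis using \<eta>(2) by (auto simp: w_def clin_zero[OF lin])
  next
    case False
    have sc: "cinner (A (a *s x)) (A (b *s y)) - cinner (a *s x) (b *s y) = a * cnj b * w" for a b
      by (simp add: clin_scale[OF lin] cinner_scale_left cinner_scale_right w_def algebra_simps)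
    \<comment> \<open>\<open>?a\<close> carries the conjugate phase of \<open>w\<close>, so that the
      error of the form at the rescaled unit vectors is real and positive.\<close>
    let ?a = "cnj w / of_real (cmod w * norm x)" and ?b = "complex_of_real (1 / norm y)"
    have "Re (cinner (A (?a *s x)) (A (?b *s y)) - cinner (?a *s x) (?b *s y)) \<le> ?\<eta>"
      by (rule re) (use False xy vec.subspace_scale[OF K] in \<open>auto simp: norm_cscale norm_divide norm_mult\<close>)
    also have "cinner (A (?a *s x)) (A (?b *s y)) - cinner (?a *s x) (?b *s y) = ?a * cnj ?b * w"
      by (rule sc)
    also have "\<dots> = (w * cnj w) / of_real (cmod w * norm x * norm y)" by simp
    also have "\<dots> = of_real (cmod w / (norm x * norm y))"
      using False unfolding complex_norm_square[symmetric] by (simp add: power2_eq_square)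
    finally have "cmod w / (norm x * norm y) \<le> ?\<eta>" by simp
    then show ?thesis using False by (simp add: w_def field_simps)
  qed
qed

lemma psd_gram_weaken:
  assumes "psd X (\<lambda>x y. of_real a * cinner (f x) (f y) ^ m - K x y)" "a \<le> b"
  shows "psd X (\<lambda>x y. of_real b * cinner (f x) (f y) ^ m - K x y)"
proof -
  have "psd X (\<lambda>x y. (of_real a * cinner (f x) (f y) ^ m - K x y) + of_real (b - a) * cinner (f x) (f y) ^ m)"
    using assms by (intro psd_add psd_scale psd_cinner_power) auto
  then show ?thesis by (rule psd_cong) (simp add: algebra_simps)
qed

lemma gram_close_of_isometry:
  assumes "clin A" "vec.subspace K" "isometric_on A K" "0 \<le> \<epsilon>"
  shows "gram_close \<epsilon> K A"
proof -
  have eq: "cinner (A x) (A y) = cinner x y" if "x \<in> K" "y \<in> K" for x y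
    using isometric_on_subspace[OF assms(1-3) that] .
  have "psd K (\<lambda>x y. of_real \<epsilon> * cinner x y ^ m)" for m
    using psd_scale[OF psd_cinner_power assms(4)] .
  note p = this
  have "psd K (\<lambda>x y. of_real (1 + \<epsilon>) * cinner x y ^ m - cinner (A x) (A y) ^ m)"
    "psd K (\<lambda>x y. of_real (1 + \<epsilon>) * cinner (A x) (A y) ^ m - cinner x y ^ m)" for m
    by (rule psd_cong[OF p[of m]], simp add: eq algebra_simps)+
  then show ?thesis unfolding gram_close_def by blast
qed

lemma tractable_union_basic:
  assumes "tractable_union K M"
  shows "vec.subspace K \<and> M \<subseteq> K \<and> 0 \<in> M"
proof -
  have zero: "0 \<in> M" if "union_of_subspaces M" for M :: "(complex ^ 'a) set"
    using that unfolding union_of_subspaces_def by (metis Union_iff all_not_in_conv vec.subspace_0)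
  show ?thesis using assms
    by cases (auto simp: vec.subspace_0 zero intro: vec.span_base)
qed

text \<open>Setting one summand to 0 gives the first two claims, and norms of sums give
  orthogonality of the images. As \<open>N\<close> is only a union of subspaces, the factor
  \<open>\<i>\<close> for the imaginary part is put on the vector of \<open>E\<close>.\<close>

lemma isometric_on_orthogonal_sum:
  assumes A: "clin A" and E: "vec.subspace E" and z: "0 \<in> N"
    and orth: "\<forall>e\<in>E. \<forall>x\<in>N. cinner e x = 0" and iso: "isometric_on A (set_sum E N)"
  shows "isometric_on A E" "isometric_on A N" "\<forall>e\<in>E. \<forall>x\<in>N. cinner (A e) (A x) = 0"
proof -
  have s: "norm (A e + A x) = norm (e + x)" if "e \<in> E" "x \<in> N" for e x
    using iso that clin_add[OF A, of e x] unfolding isometric_on_def set_sum_def by fastforce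
  show E': "isometric_on A E"
    unfolding isometric_on_def using s[OF _ z] by (simp add: clin_zero[OF A])
  show N': "isometric_on A N"
    unfolding isometric_on_def using s[OF vec.subspace_0[OF E]] by (simp add: clin_zero[OF A])
  have re: "Re (cinner (A e) (A x)) = 0" if "e \<in> E" "x \<in> N" for e x
    using norm_add_sq[of "A e" "A x"] norm_add_sq[of e x] s[OF that] E' N' orth that
    by (simp add: isometric_on_def)
  show "\<forall>e\<in>E. \<forall>x\<in>N. cinner (A e) (A x) = 0"
  proof (intro ballI)
    fix e x assume ex: "e \<in> E" "x \<in> N"
    have "Re (cinner (A (\<i> *s e)) (A x)) = 0"
      by (rule re) (use ex vec.subspace_scale[OF E] in auto)
    then have "Im (cinner (A e) (A x)) = 0" by (simp add: clin_scale[OF A] cinner_scale_left)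
    then show "cinner (A e) (A x) = 0" using re[OF ex] by (simp add: complex_eq_iff)
  qed
qed

text \<open>In the binomial expansion the powers of \<open>cinner (e x) (e y)\<close> are common to
  both kernels and multiply a positive difference for \<open>N\<close> in degree
  \<open>m - j\<close>. Hence the hypothesis for all degrees with one constant
  \<open>b\<close>.\<close>

lemma psd_orthogonal_sum:
  assumes K: "\<And>m. psd N (\<lambda>x y. of_real b * cinner (f x) (f y) ^ m - cinner (g x) (g y) ^ m)"
    and n: "\<And>x. x \<in> X \<Longrightarrow> n x \<in> N"
    and f: "\<And>x y. x \<in> X \<Longrightarrow> y \<in> X \<Longrightarrow> F x y = cinner (e x) (e y) + cinner (f (n x)) (f (n y))"
    and g: "\<And>x y. x \<in> X \<Longrightarrow> y \<in> X \<Longrightarrow> G x y = cinner (e x) (e y) + cinner (g (n x)) (g (n y))"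
  shows "psd X (\<lambda>x y. of_real b * F x y ^ m - G x y ^ m)"
proof -
  have "psd X (\<lambda>x y. \<Sum>j\<le>m. of_real (real (m choose j)) * (cinner (e x) (e y) ^ j *
      (of_real b * cinner (f (n x)) (f (n y)) ^ (m - j) - cinner (g (n x)) (g (n y)) ^ (m - j))))"
    by (intro psd_sum psd_scale psd_cinner_power_mult psd_pullback[OF K]) (auto intro: n)
  then show ?thesis
  proof (rule psd_cong)
    fix x y assume xy: "x \<in> X" "y \<in> X"
    show "of_real b * F x y ^ m - G x y ^ m = (\<Sum>j\<le>m. of_real (real (m choose j)) * (cinner (e x) (e y) ^ j *
      (of_real b * cinner (f (n x)) (f (n y)) ^ (m - j) - cinner (g (n x)) (g (n y)) ^ (m - j))))"
      unfolding f[OF xy] g[OF xy] binomial_ring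
      by (simp add: sum_distrib_left right_diff_distrib sum_subtractf mult_ac)
  qed
qed

lemma gram_close_orthogonal_sum:
  assumes A: "clin A" and E: "vec.subspace E" and z: "0 \<in> N"
    and orth: "\<forall>e\<in>E. \<forall>x\<in>N. cinner e x = 0" and iso: "isometric_on A (set_sum E N)"
    and N: "gram_close \<epsilon> N A"
  shows "gram_close \<epsilon> (set_sum E N) A"
proof -
  note iso' = isometric_on_orthogonal_sum[OF A E z orth iso]
  have "\<forall>x\<in>set_sum E N. \<exists>p. fst p \<in> E \<and> snd p \<in> N \<and> x = fst p + snd p"
    by (auto simp: set_sum_def)
  from bchoice[OF this] obtain p where
    p: "\<forall>x\<in>set_sum E N. fst (p x) \<in> E \<and> snd (p x) \<in> N \<and> x = fst (p x) + snd (p x)" ..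
  let ?e = "\<lambda>x. fst (p x)" and ?n = "\<lambda>x. snd (p x)"
  have px: "?e x \<in> E" "?n x \<in> N" "x = ?e x + ?n x" if "x \<in> set_sum E N" for x
    using p that by blast+
  have f: "cinner x y = cinner (?e x) (?e y) + cinner (?n x) (?n y)"
    if xy: "x \<in> set_sum E N" "y \<in> set_sum E N" for x y
  proof -
    have "cinner (?e x) (?n y) = 0" "cinner (?n x) (?e y) = 0"
      using orth px(1,2)[OF xy(1)] px(1,2)[OF xy(2)] cinner_commute[of "?n x" "?e y"] by auto
    moreover have "cinner x y = cinner (?e x + ?n x) (?e y + ?n y)"
      by (rule arg_cong2[OF px(3)[OF xy(1)] px(3)[OF xy(2)]])
    ultimately show ?thesis by (simp add: cinner_add_left cinner_add_right)
  qed
  have g: "cinner (A x) (A y) = cinner (?e x) (?e y) + cinner (A (?n x)) (A (?n y))"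
    if xy: "x \<in> set_sum E N" "y \<in> set_sum E N" for x y
  proof -
    have "cinner (A (?e x)) (A (?n y)) = 0" "cinner (A (?n x)) (A (?e y)) = 0"
      using iso'(3) px(1,2)[OF xy(1)] px(1,2)[OF xy(2)] cinner_commute[of "A (?n x)" "A (?e y)"] by auto
    moreover have "A x = A (?e x) + A (?n x)" if "x \<in> set_sum E N" for x
      using arg_cong[OF px(3)[OF that], of A] by (simp only: clin_add[OF A])
    moreover have "cinner (A (?e x)) (A (?e y)) = cinner (?e x) (?e y)"
      using isometric_on_subspace[OF A E iso'(1)] px(1) xy by blast
    ultimately show ?thesis by (simp add: cinner_add_left cinner_add_right xy)
  qed
  have n: "?n x \<in> N" if "x \<in> set_sum E N" for x using p that by blast
  have N1: "psd N (\<lambda>x y. of_real (1 + \<epsilon>) * cinner x y ^ m - cinner (A x) (A y) ^ m)"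
    and N2: "psd N (\<lambda>x y. of_real (1 + \<epsilon>) * cinner (A x) (A y) ^ m - cinner x y ^ m)" for m
    using N unfolding gram_close_def by blast+
  have "psd (set_sum E N) (\<lambda>x y. of_real (1 + \<epsilon>) * cinner x y ^ m - cinner (A x) (A y) ^ m)" for m
    by (rule psd_orthogonal_sum[where f = "\<lambda>x. x" and g = A and n = ?n and e = ?e and N = N
          and F = cinner and G = "\<lambda>x y. cinner (A x) (A y)"])
      (rule N1, rule n, assumption, rule f, assumption, assumption, rule g, assumption, assumption)
  moreover have "psd (set_sum E N) (\<lambda>x y. of_real (1 + \<epsilon>) * cinner (A x) (A y) ^ m - cinner x y ^ m)" for m
    by (rule psd_orthogonal_sum[where g = "\<lambda>x. x" and f = A and n = ?n and e = ?e and N = N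
          and G = cinner and F = "\<lambda>x y. cinner (A x) (A y)"])
      (rule N2, rule n, assumption, rule g, assumption, assumption, rule f, assumption, assumption)
  ultimately show ?thesis unfolding gram_close_def by blast
qed

text \<open>In bounded degree the crude estimate by powers of the norm is good enough, and it holds
  on all of \<open>K\<close>.\<close>

lemma gram_close_low_degree:
  assumes A: "near_isometry \<delta> K A" and K: "vec.subspace K" and \<delta>: "0 \<le> \<delta>"
    and m: "m \<le> m0" "(1 + \<delta>) ^ (2 * m0) \<le> b"
  shows "psd K (\<lambda>x y. of_real b * cinner x y ^ m - cinner (A x) (A y) ^ m)"
    "psd K (\<lambda>x y. of_real b * cinner (A x) (A y) ^ m - cinner x y ^ m)"
proof -
  have lin: "clin A" "clin (\<lambda>x :: complex ^ 'a. x)" using A by (simp_all add: near_isometry_def clin_iff)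
  have "(1 + \<delta>) ^ (2 * m) \<le> (1 + \<delta>) ^ (2 * m0)" using \<delta> m by (intro power_increasing) auto
  then have le: "(1 + \<delta>) ^ (2 * m) \<le> b" using m by simp
  show "psd K (\<lambda>x y. of_real b * cinner x y ^ m - cinner (A x) (A y) ^ m)"
    by (rule psd_gram_weaken[OF psd_contraction_power[OF K lin(2,1)] le])
      (use A \<delta> in \<open>auto simp: near_isometry_def\<close>)
  show "psd K (\<lambda>x y. of_real b * cinner (A x) (A y) ^ m - cinner x y ^ m)"
    by (rule psd_gram_weaken[OF psd_contraction_power[OF K lin(1,2)] le])
      (use A \<delta> in \<open>auto simp: near_isometry_def\<close>)
qed

lemma common_angle:
  fixes S :: "nat \<Rightarrow> (complex ^ 'd) set"
  assumes "\<forall>i<k. vec.subspace (S i)" "\<forall>i<k. \<forall>j<k. i \<noteq> j \<longrightarrow> S i \<inter> S j = {0}"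
  shows "\<exists>c. 0 \<le> c \<and> c < 1 \<and> (\<forall>i<k. \<forall>j<k. i \<noteq> j \<longrightarrow>
    (\<forall>x\<in>S i. \<forall>y\<in>S j. cmod (cinner x y) \<le> c * (norm x * norm y)))"
proof -
  have "\<forall>ij. \<exists>c. 0 \<le> c \<and> c < 1 \<and> (fst ij < k \<and> snd ij < k \<and> fst ij \<noteq> snd ij \<longrightarrow>
      (\<forall>x\<in>S (fst ij). \<forall>y\<in>S (snd ij). cmod (cinner x y) \<le> c * norm x * norm y))"
  proof
    fix ij :: "nat \<times> nat"
    show "\<exists>c. 0 \<le> c \<and> c < 1 \<and> (fst ij < k \<and> snd ij < k \<and> fst ij \<noteq> snd ij \<longrightarrow>
      (\<forall>x\<in>S (fst ij). \<forall>y\<in>S (snd ij). cmod (cinner x y) \<le> c * norm x * norm y))"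
    proof (cases "fst ij < k \<and> snd ij < k \<and> fst ij \<noteq> snd ij")
      case True
      then show ?thesis using subspace_angle[of "S (fst ij)" "S (snd ij)"] assms by auto
    next
      case False
      then show ?thesis by (intro exI[of _ 0]) auto
    qed
  qed
  from choice[OF this] obtain a where a: "\<forall>ij. 0 \<le> a ij \<and> a ij < 1 \<and> (fst ij < k \<and> snd ij < k \<and> fst ij \<noteq> snd ij \<longrightarrow>
      (\<forall>x\<in>S (fst ij). \<forall>y\<in>S (snd ij). cmod (cinner x y) \<le> a ij * norm x * norm y))" ..
  define C where "C = insert 0 (a ` ({..<k} \<times> {..<k}))"
  have C: "finite C" "C \<noteq> {}" by (auto simp: C_def)
  have "Max C \<in> C" using C by (rule Max_in)
  then have "0 \<le> Max C" "Max C < 1" using a by (auto simp: C_def)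
  moreover have "cmod (cinner x y) \<le> Max C * (norm x * norm y)"
    if ij: "i < k" "j < k" "i \<noteq> j" "x \<in> S i" "y \<in> S j" for i j x y
  proof -
    have "cmod (cinner x y) \<le> a (i, j) * norm x * norm y" using a[rule_format, of "(i, j)"] ij by simp
    also have "\<dots> \<le> Max C * (norm x * norm y)"
      using Max_ge[OF C(1), of "a (i, j)"] ij by (auto simp: C_def mult.assoc intro!: mult_right_mono)
    finally show ?thesis .
  qed
  ultimately show ?thesis by blast
qed

text \<open>One \<open>\<delta>\<close> serves all degrees and all maps. In the case
  \<open>ortho\<close> both \<open>\<delta>\<close> and \<open>\<epsilon>\<close> are inherited
  unchanged; in the case \<open>split\<close> the blocks use up \<open>\<epsilon> / 2\<close>, and
  the rest pays for their imperfect orthogonality.\<close>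

theorem tractable_union_gram_close:
  assumes "tractable_union K M"
  shows "\<forall>\<epsilon>>0. \<exists>\<delta>>0. \<forall>A. near_isometry \<delta> K A \<longrightarrow> isometric_on A M \<longrightarrow> gram_close \<epsilon> M A"
  using assms
proof induction
  case (whole K)
  have "gram_close \<epsilon> K A" if "\<epsilon> > 0" "near_isometry 1 K A" "isometric_on A K" for \<epsilon> A
    using that by (intro gram_close_of_isometry whole) (simp_all add: near_isometry_def)
  then show ?case using zero_less_one by blast
next
  case (split K M k N)
  show ?case
  proof (intro allI impI)
    fix \<epsilon> :: real assume \<epsilon>: "\<epsilon> > 0"
    have subK: "vec.span (N i) \<subseteq> K" if "i < k" for i
      by (rule vec.span_minimal[OF split.hyps(6)[rule_format, OF that] split.hyps(1)])
    have "\<forall>i\<in>{..<k}. \<exists>\<delta>>0. \<forall>A. near_isometry \<delta> (vec.span (N i)) A \<longrightarrow> isometric_on A (N i) \<longrightarrow>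
        gram_close (\<epsilon> / 2) (N i) A"
    proof
      fix i assume "i \<in> {..<k}"
      then show "\<exists>\<delta>>0. \<forall>A. near_isometry \<delta> (vec.span (N i)) A \<longrightarrow> isometric_on A (N i) \<longrightarrow>
          gram_close (\<epsilon> / 2) (N i) A"
        using split.IH[rule_format, of i, THEN conjunct2, rule_format, of "\<epsilon> / 2"] \<epsilon> by simp
    qed
    from bchoice[OF this] obtain d where d: "\<forall>i\<in>{..<k}. d i > 0 \<and> (\<forall>A. near_isometry (d i) (vec.span (N i)) A \<longrightarrow>
        isometric_on A (N i) \<longrightarrow> gram_close (\<epsilon> / 2) (N i) A)" ..
    obtain c0 where c0: "0 \<le> c0" "c0 < 1" "\<forall>i<k. \<forall>j<k. i \<noteq> j \<longrightarrow>
      (\<forall>x\<in>vec.span (N i). \<forall>y\<in>vec.span (N j). cmod (cinner x y) \<le> c0 * (norm x * norm y))"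
      using common_angle[of k "\<lambda>i. vec.span (N i)"] split.hyps(7) by auto
    \<comment> \<open>Halfway between \<open>c0\<close> and 1, which leaves room for the distortion
      of angles by \<open>A\<close>.\<close>
    define c where "c = (1 + c0) / 2"
    have c: "c0 < c" "c < 1" "0 \<le> c" using c0 by (auto simp: c_def)
    \<comment> \<open>With \<open>t = real k * c ^ m\<close>, passing from
      \<open>1 + \<epsilon> / 2\<close> to \<open>1 + \<epsilon>\<close> requires
      \<open>(2 + 3 / 2 * \<epsilon>) * t \<le> \<epsilon> / 2\<close>, and
      \<open>t \<le> \<epsilon> / (4 * (1 + \<epsilon>))\<close> ensures this.\<close>
    define \<eta> where "\<eta> = \<epsilon> / (4 * real k * (1 + \<epsilon>))"
    have kpos: "real k > 0" using split.hyps(4) by simp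
    have "\<eta> > 0" using \<epsilon> kpos by (simp add: \<eta>_def)
    then obtain m0 where m0: "c ^ m0 < \<eta>" using real_arch_pow_inv c by blast
    have k\<eta>: "real k * \<eta> = \<epsilon> / (4 * (1 + \<epsilon>))" using kpos by (simp add: \<eta>_def)
    have high: "real k * c ^ m < 1 \<and> (1 + \<epsilon> / 2) * (1 + real k * c ^ m) \<le> (1 + \<epsilon>) * (1 - real k * c ^ m)"
      if m: "m0 \<le> m" for m
    proof -
      have "c ^ m \<le> \<eta>" using power_decreasing[OF m, of c] c m0 by simp
      then have t: "real k * c ^ m \<le> \<epsilon> / (4 * (1 + \<epsilon>))"
        unfolding k\<eta>[symmetric] using kpos by (intro mult_left_mono) auto
      moreover have "\<epsilon> / (4 * (1 + \<epsilon>)) < 1" using \<epsilon> by (simp add: field_simps)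
      moreover have "(1 + \<epsilon> / 2) * (1 + real k * c ^ m) \<le> (1 + \<epsilon>) * (1 - real k * c ^ m)"
      proof -
        have "(2 + 3 / 2 * \<epsilon>) * (real k * c ^ m) \<le> (2 + 3 / 2 * \<epsilon>) * (\<epsilon> / (4 * (1 + \<epsilon>)))"
          using t \<epsilon> by (intro mult_left_mono) auto
        also have "\<dots> \<le> (2 + 2 * \<epsilon>) * (\<epsilon> / (4 * (1 + \<epsilon>)))"
          using \<epsilon> by (intro mult_right_mono) auto
        also have "\<dots> = \<epsilon> / 2" using \<epsilon> by (simp add: field_simps)
        finally show ?thesis by (simp add: algebra_simps)
      qed
      ultimately show ?thesis by simp
    qed
    have lim: "((\<lambda>x::real. x) \<longlongrightarrow> 0) (at_right 0)" by (rule tendsto_ident_at)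
    \<comment> \<open>For \<open>x = \<delta>\<close> the term added to \<open>c0\<close> is the
      distortion of the form by a near isometry; the squared factor converts the norms of two
      vectors into the norms of their images.\<close>
    have "((\<lambda>x::real. (c0 + (2 * x + x\<^sup>2)) * (1 + x)\<^sup>2) \<longlongrightarrow> (c0 + (2 * 0 + 0\<^sup>2)) * (1 + 0)\<^sup>2) (at_right 0)"
      by (intro tendsto_intros)
    then have e1: "\<forall>\<^sub>F x in at_right (0::real). (c0 + (2 * x + x\<^sup>2)) * (1 + x)\<^sup>2 < c"
      using c(1) by (intro order_tendstoD(2)) auto
    \<comment> \<open>This settles the degrees below \<open>m0\<close>, where no orthogonality of
      blocks is available.\<close>
    have "((\<lambda>x::real. (1 + x) ^ (2 * m0)) \<longlongrightarrow> (1 + 0) ^ (2 * m0)) (at_right 0)"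
      by (intro tendsto_intros)
    then have e2: "\<forall>\<^sub>F x in at_right (0::real). (1 + x) ^ (2 * m0) < 1 + \<epsilon>"
      using \<epsilon> by (intro order_tendstoD(2)) auto
    have e3: "\<forall>\<^sub>F x in at_right (0::real). \<forall>i\<in>{..<k}. x < d i"
      by (intro eventually_ball_finite ballI order_tendstoD(2)[OF lim]) (use d in auto)
    have "\<forall>\<^sub>F x in at_right (0::real). 0 < x \<and> (c0 + (2 * x + x\<^sup>2)) * (1 + x)\<^sup>2 < c \<and>
        (1 + x) ^ (2 * m0) < 1 + \<epsilon> \<and> (\<forall>i\<in>{..<k}. x < d i)"
      using eventually_at_right_less[of 0] e1 e2 e3 by eventually_elim simp
    from eventually_happens'[OF trivial_limit_at_right_real this]
    obtain \<delta> where \<delta>: "0 < \<delta>" "(c0 + (2 * \<delta> + \<delta>\<^sup>2)) * (1 + \<delta>)\<^sup>2 < c"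
      "(1 + \<delta>) ^ (2 * m0) < 1 + \<epsilon>" "\<forall>i\<in>{..<k}. \<delta> < d i"
      by blast
    show "\<exists>\<delta>>0. \<forall>A. near_isometry \<delta> K A \<longrightarrow> isometric_on A M \<longrightarrow> gram_close \<epsilon> M A"
    proof (intro exI[of _ \<delta>] conjI allI impI)
      show "\<delta> > 0" by fact
      fix A assume A: "near_isometry \<delta> K A" and iso: "isometric_on A M"
      have lin: "clin A" "clin (\<lambda>x :: complex ^ 'a. x)" using A by (simp_all add: near_isometry_def clin_iff)
      have NK: "(\<Union>i<k. N i) \<subseteq> K" using split.hyps(6) by auto
      have MK: "M \<subseteq> K" using split.hyps(3) vec.span_superset by blast
      have isoN: "isometric_on A (\<Union>i<k. N i)"
        by (rule isometries_extendD[OF split.hyps(9,1) MK NK lin(1) near_isometry_inj[OF A split.hyps(1)] iso])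
      have close: "gram_close (\<epsilon> / 2) (N i) A" if i: "i < k" for i
      proof -
        have "near_isometry (d i) (vec.span (N i)) A"
          by (rule near_isometry_mono[OF A _ subK[OF i]]) (use \<delta>(4) i in \<open>simp add: less_imp_le\<close>)
        moreover have "isometric_on A (N i)" using isoN i by (auto simp: isometric_on_def)
        ultimately show ?thesis using d i by auto
      qed
      have angle: "cmod (cinner x y) \<le> c * norm x * norm y"
        "cmod (cinner (A x) (A y)) \<le> c * norm (A x) * norm (A y)"
        if ij: "i < k" "j < k" "i \<noteq> j" "x \<in> vec.span (N i)" "y \<in> vec.span (N j)" for i j x y
      proof -
        have a: "cmod (cinner x y) \<le> c0 * (norm x * norm y)" using c0(3) ij by blast
        also have "\<dots> \<le> c * (norm x * norm y)" using c(1) by (intro mult_right_mono) auto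
        finally show "cmod (cinner x y) \<le> c * norm x * norm y" by (simp add: mult.assoc)
        have K: "x \<in> K" "y \<in> K" using subK ij by auto
        let ?q = "c0 + (2 * \<delta> + \<delta>\<^sup>2)"
        have q: "0 \<le> ?q" using c0 \<delta>(1) by simp
        have "cinner (A x) (A y) = (cinner (A x) (A y) - cinner x y) + cinner x y" by simp
        then have "cmod (cinner (A x) (A y)) \<le> cmod (cinner (A x) (A y) - cinner x y) + cmod (cinner x y)"
          by (metis norm_triangle_ineq)
        also have "\<dots> \<le> ?q * (norm x * norm y)"
          using a near_isometry_form[OF A split.hyps(1) _ K] \<delta>(1) by (simp add: distrib_right)
        also have "\<dots> \<le> ?q * (((1 + \<delta>) * norm (A x)) * ((1 + \<delta>) * norm (A y)))"
          using A K \<delta>(1) q by (intro mult_left_mono mult_mono) (auto simp: near_isometry_def)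
        also have "\<dots> = (?q * (1 + \<delta>)\<^sup>2) * (norm (A x) * norm (A y))" by (simp add: power2_eq_square)
        also have "\<dots> \<le> c * (norm (A x) * norm (A y))"
          using \<delta>(2) by (intro mult_right_mono) auto
        finally show "cmod (cinner (A x) (A y)) \<le> c * norm (A x) * norm (A y)" by (simp add: mult.assoc)
      qed
      have sp: "vec.subspace (vec.span (N i))" "N i \<subseteq> vec.span (N i)" for i
        by (auto intro: vec.span_base)
      have "psd (\<Union>i<k. N i) (\<lambda>x y. of_real (1 + \<epsilon>) * cinner x y ^ m - cinner (A x) (A y) ^ m) \<and>
        psd (\<Union>i<k. N i) (\<lambda>x y. of_real (1 + \<epsilon>) * cinner (A x) (A y) ^ m - cinner x y ^ m)" for m
      proof (cases "m0 \<le> m")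
        case True
        show ?thesis
        proof
          show "psd (\<Union>i<k. N i) (\<lambda>x y. of_real (1 + \<epsilon>) * cinner x y ^ m - cinner (A x) (A y) ^ m)"
            by (rule psd_union_of_subspaces[OF lin(2,1) sp c(3), where a = "1 + \<epsilon> / 2"])
              (use high[OF True] angle close \<epsilon> in \<open>auto simp: gram_close_def\<close>)
          show "psd (\<Union>i<k. N i) (\<lambda>x y. of_real (1 + \<epsilon>) * cinner (A x) (A y) ^ m - cinner x y ^ m)"
            by (rule psd_union_of_subspaces[OF lin(1,2) sp c(3), where a = "1 + \<epsilon> / 2"])
              (use high[OF True] angle close \<epsilon> in \<open>auto simp: gram_close_def\<close>)
        qed
      next
        case False
        then show ?thesis
          using gram_close_low_degree[OF A split.hyps(1), of m m0 "1 + \<epsilon>"] \<delta>(1,3) psd_subset[OF _ NK] by auto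
      qed
      then have "gram_close \<epsilon> (\<Union>i<k. N i) A" unfolding gram_close_def by blast
      then show "gram_close \<epsilon> M A" by (rule gram_close_subset) (rule split.hyps(5))
    qed
  qed
next
  case (ortho K M E N)
  show ?case
  proof (intro allI impI)
    fix \<epsilon> :: real assume "\<epsilon> > 0"
    then obtain \<delta> where \<delta>: "\<delta> > 0" "\<forall>A. near_isometry \<delta> (vec.span N) A \<longrightarrow> isometric_on A N \<longrightarrow> gram_close \<epsilon> N A"
      using ortho.IH by blast
    show "\<exists>\<delta>>0. \<forall>A. near_isometry \<delta> K A \<longrightarrow> isometric_on A M \<longrightarrow> gram_close \<epsilon> M A"
    proof (intro exI[of _ \<delta>] conjI allI impI)
      show "\<delta> > 0" by fact
      fix A assume A: "near_isometry \<delta> K A" and iso: "isometric_on A M"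
      have lin: "clin A" using A by (simp add: near_isometry_def)
      have MK: "M \<subseteq> K" using ortho.hyps(3) vec.span_superset by blast
      have SK: "set_sum E N \<subseteq> K"
        using ortho.hyps(1,6,7) by (auto simp: set_sum_def intro!: vec.subspace_add)
      have isoS: "isometric_on A (set_sum E N)"
        by (rule isometries_extendD[OF ortho.hyps(11) ortho.hyps(1) MK SK lin near_isometry_inj[OF A ortho.hyps(1)] iso])
      have z: "0 \<in> N" using tractable_union_basic[OF ortho.hyps(8)] by blast
      have orth: "\<forall>e\<in>E. \<forall>x\<in>N. cinner e x = 0" using ortho.hyps(9) by (auto intro: vec.span_base)
      have "vec.span N \<subseteq> K" by (rule vec.span_minimal[OF ortho.hyps(7,1)])
      then have "near_isometry \<delta> (vec.span N) A" using near_isometry_mono[OF A] by blast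
      then have "gram_close \<epsilon> N A"
        using \<delta>(2) isometric_on_orthogonal_sum(2)[OF lin ortho.hyps(4) z orth isoS] by blast
      then have "gram_close \<epsilon> (set_sum E N) A"
        by (rule gram_close_orthogonal_sum[OF lin ortho.hyps(4) z orth isoS])
      then show "gram_close \<epsilon> M A" by (rule gram_close_subset) (rule ortho.hyps(10))
    qed
  qed
qed

section \<open>Reproducing kernel Hilbert spaces\<close>

locale function_hilbert_space =
  fixes X :: "'a set" and H :: "'a hfs"
  assumes hilbert: "hilbert_function_space X H"
begin

lemma outside: "f \<in> funs H \<Longrightarrow> x \<notin> X \<Longrightarrow> f x = 0"
  and zero_mem: "(\<lambda>x. 0) \<in> funs H"
  and add_mem: "f \<in> funs H \<Longrightarrow> g \<in> funs H \<Longrightarrow> (\<lambda>x. f x + g x) \<in> funs H"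
  and scale_mem: "f \<in> funs H \<Longrightarrow> (\<lambda>x. c * f x) \<in> funs H"
  and ip_add_left: "f \<in> funs H \<Longrightarrow> g \<in> funs H \<Longrightarrow> h \<in> funs H \<Longrightarrow>
        ip H (\<lambda>x. f x + g x) h = ip H f h + ip H g h"
  and ip_scale_left: "f \<in> funs H \<Longrightarrow> h \<in> funs H \<Longrightarrow> ip H (\<lambda>x. c * f x) h = c * ip H f h"
  and ip_cnj: "f \<in> funs H \<Longrightarrow> g \<in> funs H \<Longrightarrow> ip H g f = cnj (ip H f g)"
  and ip_pos: "f \<in> funs H \<Longrightarrow> f \<noteq> (\<lambda>x. 0) \<Longrightarrow> Re (ip H f f) > 0"
  using hilbert unfolding hilbert_function_space_def by blast+

lemma complete:
  assumes "\<And>n. s n \<in> funs H" "\<And>e. e > 0 \<Longrightarrow> \<exists>N. \<forall>m\<ge>N. \<forall>n\<ge>N. hnorm H (\<lambda>x. s m x - s n x) < e"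
  shows "\<exists>f\<in>funs H. (\<lambda>n::nat. hnorm H (\<lambda>x. s n x - f x)) \<longlonglongrightarrow> 0"
proof -
  have "\<forall>s::nat \<Rightarrow> 'a \<Rightarrow> complex.
        (\<forall>n. s n \<in> funs H) \<and>
        (\<forall>e>0. \<exists>N. \<forall>m\<ge>N. \<forall>n\<ge>N. hnorm H (\<lambda>x. s m x - s n x) < e) \<longrightarrow>
        (\<exists>f\<in>funs H. (\<lambda>n. hnorm H (\<lambda>x. s n x - f x)) \<longlonglongrightarrow> 0)"
    using hilbert unfolding hilbert_function_space_def by (elim conjE)
  from this[rule_format, of s] show ?thesis using assms by simp
qed

lemma diff_mem: "f \<in> funs H \<Longrightarrow> g \<in> funs H \<Longrightarrow> (\<lambda>x. f x - g x) \<in> funs H"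
  using add_mem[OF _ scale_mem[of g "-1"], of f] by simp

lemma sum_mem: "(\<And>i. i \<in> I \<Longrightarrow> f i \<in> funs H) \<Longrightarrow> (\<lambda>x. \<Sum>i\<in>I. f i x) \<in> funs H"
  by (induction I rule: infinite_finite_induct) (auto intro: zero_mem add_mem)

lemma ip_diff_left:
  "f \<in> funs H \<Longrightarrow> g \<in> funs H \<Longrightarrow> h \<in> funs H \<Longrightarrow> ip H (\<lambda>x. f x - g x) h = ip H f h - ip H g h"
  using ip_add_left[OF _ scale_mem[of g "-1"], of f h] ip_scale_left[of g h "-1"] by simp

lemma ip_add_right:
  "f \<in> funs H \<Longrightarrow> g \<in> funs H \<Longrightarrow> h \<in> funs H \<Longrightarrow> ip H h (\<lambda>x. f x + g x) = ip H h f + ip H h g"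
  by (simp only: ip_cnj[of "\<lambda>x. f x + g x" h] ip_cnj[of f h] ip_cnj[of g h] add_mem ip_add_left complex_cnj_add)

lemma ip_scale_right:
  "f \<in> funs H \<Longrightarrow> h \<in> funs H \<Longrightarrow> ip H h (\<lambda>x. c * f x) = cnj c * ip H h f"
  by (simp only: ip_cnj[of "\<lambda>x. c * f x" h] ip_cnj[of f h] scale_mem ip_scale_left complex_cnj_mult)

lemma ip_diff_right:
  "f \<in> funs H \<Longrightarrow> g \<in> funs H \<Longrightarrow> h \<in> funs H \<Longrightarrow> ip H h (\<lambda>x. f x - g x) = ip H h f - ip H h g"
  using ip_add_right[OF _ scale_mem[of g "-1"], of f h] ip_scale_right[of g h "-1"] by simp

lemma ip_zero_left: "f \<in> funs H \<Longrightarrow> ip H (\<lambda>x. 0) f = 0"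
  using ip_scale_left[OF zero_mem, of f 0] by simp

lemma ip_zero_right: "f \<in> funs H \<Longrightarrow> ip H f (\<lambda>x. 0) = 0"
  using ip_scale_right[OF zero_mem, of f 0] by simp

lemma ip_sum_right:
  "(\<And>i. i \<in> I \<Longrightarrow> f i \<in> funs H) \<Longrightarrow> h \<in> funs H \<Longrightarrow> ip H h (\<lambda>x. \<Sum>i\<in>I. f i x) = (\<Sum>i\<in>I. ip H h (f i))"
  by (induction I rule: infinite_finite_induct) (auto simp: ip_zero_right ip_add_right sum_mem)

lemma ip_self_nonneg: "f \<in> funs H \<Longrightarrow> 0 \<le> Re (ip H f f)"
  using ip_pos[of f] ip_zero_left[OF zero_mem] by (cases "f = (\<lambda>x. 0)") auto

lemma hnorm_nonneg [simp]: "f \<in> funs H \<Longrightarrow> 0 \<le> hnorm H f"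
  by (simp add: hnorm_def ip_self_nonneg)

lemma hnorm_sq: "f \<in> funs H \<Longrightarrow> (hnorm H f)\<^sup>2 = Re (ip H f f)"
  by (simp add: hnorm_def ip_self_nonneg)

lemma ip_self: "f \<in> funs H \<Longrightarrow> ip H f f = of_real ((hnorm H f)\<^sup>2)"
  using arg_cong[OF ip_cnj[of f f], of Im] by (simp add: hnorm_sq complex_eq_iff)

lemma hnorm_eq_0: "f \<in> funs H \<Longrightarrow> hnorm H f = 0 \<Longrightarrow> f = (\<lambda>x. 0)"
  using ip_pos[of f] hnorm_sq[of f] by fastforce

lemma hnorm_zero [simp]: "hnorm H (\<lambda>x. 0) = 0"
  by (simp add: hnorm_def ip_zero_left zero_mem)

lemma hnorm_scale: "f \<in> funs H \<Longrightarrow> hnorm H (\<lambda>x. c * f x) = cmod c * hnorm H f"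
proof -
  assume f: "f \<in> funs H"
  have "complex_of_real ((hnorm H (\<lambda>x. c * f x))\<^sup>2) = (c * cnj c) * complex_of_real ((hnorm H f)\<^sup>2)"
    using f by (simp only: ip_self[symmetric] scale_mem ip_scale_left ip_scale_right mult.assoc)
  also have "\<dots> = complex_of_real ((cmod c * hnorm H f)\<^sup>2)"
    by (simp only: complex_norm_square[symmetric] of_real_mult[symmetric] power_mult_distrib)
  finally have "(hnorm H (\<lambda>x. c * f x))\<^sup>2 = (cmod c * hnorm H f)\<^sup>2" by (simp only: of_real_eq_iff)
  then show ?thesis using f by (simp add: power2_eq_iff_nonneg scale_mem)
qed

lemma hnorm_add_sq:
  assumes "f \<in> funs H" "g \<in> funs H"
  shows "(hnorm H (\<lambda>x. f x + g x))\<^sup>2 = (hnorm H f)\<^sup>2 + (hnorm H g)\<^sup>2 + 2 * Re (ip H f g)"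
  using assms ip_cnj[of f g] by (simp add: hnorm_sq add_mem ip_add_left ip_add_right)

lemma hnorm_diff_sq:
  assumes "f \<in> funs H" "g \<in> funs H"
  shows "(hnorm H (\<lambda>x. f x - g x))\<^sup>2 = (hnorm H f)\<^sup>2 + (hnorm H g)\<^sup>2 - 2 * Re (ip H f g)"
  using assms ip_cnj[of f g] by (simp add: hnorm_sq diff_mem ip_diff_left ip_diff_right)

lemma cauchy_schwarz:
  assumes f: "f \<in> funs H" and g: "g \<in> funs H"
  shows "cmod (ip H f g) \<le> hnorm H f * hnorm H g"
proof (cases "hnorm H g = 0")
  case True
  then show ?thesis using hnorm_eq_0[OF g] ip_zero_right[OF f] by simp
next
  case False
  define n where "n = (hnorm H g)\<^sup>2"
  have n: "n > 0" using False by (simp add: n_def)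
  define a where "a = ip H f g / of_real n"
  have "0 \<le> (hnorm H (\<lambda>x. f x - a * g x))\<^sup>2" by simp
  also have "\<dots> = (hnorm H f)\<^sup>2 + (cmod a)\<^sup>2 * n - 2 * Re (cnj a * ip H f g)"
    using f g by (simp add: hnorm_diff_sq scale_mem hnorm_scale ip_scale_right n_def power_mult_distrib)
  also have "cnj a * ip H f g = of_real ((cmod (ip H f g))\<^sup>2 / n)"
    unfolding a_def using complex_norm_square[of "ip H f g"] by (simp add: mult.commute)
  also have "(cmod a)\<^sup>2 * n = (cmod (ip H f g))\<^sup>2 / n"
    using n by (simp add: a_def norm_divide power_divide power2_eq_square)
  finally have "(cmod (ip H f g))\<^sup>2 / n \<le> (hnorm H f)\<^sup>2" by simp
  then have "(cmod (ip H f g))\<^sup>2 \<le> (hnorm H f * hnorm H g)\<^sup>2"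
    using n by (simp add: field_simps n_def power_mult_distrib)
  then show ?thesis by (rule power2_le_imp_le) (use f g in simp)
qed

lemma hnorm_triangle:
  assumes "f \<in> funs H" "g \<in> funs H"
  shows "hnorm H (\<lambda>x. f x + g x) \<le> hnorm H f + hnorm H g"
proof (rule power2_le_imp_le)
  have "Re (ip H f g) \<le> hnorm H f * hnorm H g"
    using cauchy_schwarz[OF assms] complex_Re_le_cmod order_trans by blast
  then show "(hnorm H (\<lambda>x. f x + g x))\<^sup>2 \<le> (hnorm H f + hnorm H g)\<^sup>2"
    by (simp add: hnorm_add_sq[OF assms] power2_sum)
qed (use assms in simp)

lemma hnorm_diff_commute:
  assumes "f \<in> funs H" "g \<in> funs H"
  shows "hnorm H (\<lambda>x. f x - g x) = hnorm H (\<lambda>x. g x - f x)"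
  using hnorm_scale[OF diff_mem[OF assms], of "-1"] by simp

lemma hnorm_le_diff:
  assumes "f \<in> funs H" "g \<in> funs H"
  shows "hnorm H f \<le> hnorm H g + hnorm H (\<lambda>x. f x - g x)"
  using hnorm_triangle[OF assms(2) diff_mem[OF assms]] by simp

lemma hnorm_tendsto:
  assumes "\<And>n. s n \<in> funs H" "f \<in> funs H" "(\<lambda>n. hnorm H (\<lambda>x. s n x - f x)) \<longlonglongrightarrow> 0"
  shows "(\<lambda>n. hnorm H (s n)) \<longlonglongrightarrow> hnorm H f"
proof (rule tendsto_sandwich)
  show "\<forall>\<^sub>F n in sequentially. hnorm H f - hnorm H (\<lambda>x. s n x - f x) \<le> hnorm H (s n)"
    using hnorm_le_diff[OF assms(2,1)] hnorm_diff_commute[OF assms(2,1)] by (simp add: algebra_simps)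
  show "\<forall>\<^sub>F n in sequentially. hnorm H (s n) \<le> hnorm H f + hnorm H (\<lambda>x. s n x - f x)"
    using hnorm_le_diff[OF assms(1,2)] by simp
  show "(\<lambda>n. hnorm H f - hnorm H (\<lambda>x. s n x - f x)) \<longlonglongrightarrow> hnorm H f"
    using tendsto_diff[OF tendsto_const assms(3), of "hnorm H f"] by simp
  show "(\<lambda>n. hnorm H f + hnorm H (\<lambda>x. s n x - f x)) \<longlonglongrightarrow> hnorm H f"
    using tendsto_add[OF tendsto_const assms(3), of "hnorm H f"] by simp
qed

lemma ip_tendsto:
  assumes "\<And>n. s n \<in> funs H" "f \<in> funs H" "h \<in> funs H" "(\<lambda>n. hnorm H (\<lambda>x. s n x - f x)) \<longlonglongrightarrow> 0"
  shows "(\<lambda>n. ip H (s n) h) \<longlonglongrightarrow> ip H f h"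
proof (rule Lim_null[THEN iffD2], rule Lim_null_comparison)
  show "\<forall>\<^sub>F n in sequentially. norm (ip H (s n) h - ip H f h) \<le> hnorm H (\<lambda>x. s n x - f x) * hnorm H h"
    using cauchy_schwarz[OF diff_mem[OF assms(1,2)] assms(3)] by (simp add: ip_diff_left assms)
  show "(\<lambda>n. hnorm H (\<lambda>x. s n x - f x) * hnorm H h) \<longlonglongrightarrow> 0"
    using tendsto_mult_right[OF assms(4), of "hnorm H h"] by simp
qed

end

section \<open>Kernel functions and a criterion for membership\<close>

locale rkhs =
  fixes X :: "'a set" and k :: "'a \<Rightarrow> 'a \<Rightarrow> complex" and H :: "'a hfs"
  assumes rkhs: "is_rkhs X k H"

sublocale rkhs \<subseteq> function_hilbert_space X H
  using rkhs by unfold_locales (simp add: is_rkhs_def)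

context rkhs
begin

definition kf :: "'a \<Rightarrow> 'a \<Rightarrow> complex" where
  "kf x = restr X (\<lambda>y. k y x)"

lemma kf_mem: "x \<in> X \<Longrightarrow> kf x \<in> funs H"
  and reproducing: "f \<in> funs H \<Longrightarrow> x \<in> X \<Longrightarrow> ip H f (kf x) = f x"
  using rkhs unfolding is_rkhs_def kf_def by blast+

lemma kf_apply: "y \<in> X \<Longrightarrow> kf x y = k y x"
  by (simp add: kf_def restr_def)

definition comb :: "'a set \<Rightarrow> ('a \<Rightarrow> complex) \<Rightarrow> 'a \<Rightarrow> complex" where
  "comb F c = (\<lambda>y. \<Sum>x\<in>F. c x * kf x y)"

lemma comb_mem: "F \<subseteq> X \<Longrightarrow> comb F c \<in> funs H"
  unfolding comb_def by (intro sum_mem scale_mem kf_mem) auto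

lemma comb_mono:
  assumes "finite G" "F \<subseteq> G" "\<And>x. x \<in> G - F \<Longrightarrow> c x = 0"
  shows "comb F c = comb G c"
  unfolding comb_def using assms by (intro ext sum.mono_neutral_left) auto

lemma comb_add: "comb F (\<lambda>x. c x + d x) = (\<lambda>y. comb F c y + comb F d y)"
  by (simp add: comb_def distrib_right sum.distrib)

lemma comb_scale: "comb F (\<lambda>x. a * c x) = (\<lambda>y. a * comb F c y)"
  by (simp add: comb_def sum_distrib_left mult.assoc)

lemma ip_comb: "F \<subseteq> X \<Longrightarrow> f \<in> funs H \<Longrightarrow> ip H f (comb F c) = (\<Sum>x\<in>F. cnj (c x) * f x)"
proof -
  assume F: "F \<subseteq> X" and f: "f \<in> funs H"
  have "ip H f (comb F c) = (\<Sum>x\<in>F. ip H f (\<lambda>y. c x * kf x y))"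
    unfolding comb_def using F f by (intro ip_sum_right scale_mem kf_mem) auto
  also have "\<dots> = (\<Sum>x\<in>F. cnj (c x) * f x)"
    using F f by (intro sum.cong) (auto simp: ip_scale_right kf_mem reproducing)
  finally show ?thesis .
qed

lemma hnorm_comb:
  assumes "F \<subseteq> X"
  shows "(hnorm H (comb F c))\<^sup>2 = Re (\<Sum>x\<in>F. \<Sum>y\<in>F. c x * cnj (c y) * k y x)"
proof -
  have "ip H (comb F c) (comb F c) = (\<Sum>y\<in>F. cnj (c y) * comb F c y)"
    using assms by (intro ip_comb comb_mem)
  also have "\<dots> = (\<Sum>y\<in>F. \<Sum>x\<in>F. cnj (c y) * (c x * k y x))"
    using assms unfolding comb_def sum_distrib_left by (intro sum.cong) (auto simp: kf_apply)
  also have "\<dots> = (\<Sum>x\<in>F. \<Sum>y\<in>F. c x * cnj (c y) * k y x)"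
    by (subst sum.swap) (simp add: mult_ac)
  finally show ?thesis using hnorm_sq[OF comb_mem[OF assms]] by simp
qed

text \<open>
  The function is obtained by minimizing \<open>\<parallel>g\<parallel>\<^sup>2 - 2 Re \<Lambda> g\<close> over the span of the kernel
  functions, as in the proof of the Riesz representation theorem.
\<close>

lemma rkhs_membership:
  assumes f0: "\<And>x. x \<notin> X \<Longrightarrow> f x = 0" and C: "0 \<le> C"
    and bound: "\<And>F c. finite F \<Longrightarrow> F \<subseteq> X \<Longrightarrow> cmod (\<Sum>x\<in>F. c x * cnj (f x)) \<le> C * hnorm H (comb F c)"
  shows "f \<in> funs H \<and> hnorm H f \<le> C"
proof -
  define I where "I = {(F, c). finite F \<and> F \<subseteq> X \<and> (\<forall>x. x \<notin> F \<longrightarrow> c x = (0::complex))}"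
  define L where "L = (\<lambda>F c. \<Sum>x\<in>F. c x * cnj (f x))"
  define q where "q = (\<lambda>(F, c). (hnorm H (comb F c))\<^sup>2 - 2 * Re (L F c))"
  \<comment> \<open>Completing the square:
    \<open>s\<^sup>2 - 2 * C * s \<ge> - C\<^sup>2\<close>.\<close>
  have lower: "- (C\<^sup>2) \<le> q p" if "p \<in> I" for p
  proof -
    obtain F c where p: "p = (F, c)" "finite F" "F \<subseteq> X" using \<open>p \<in> I\<close> by (auto simp: I_def)
    have "Re (L F c) \<le> C * hnorm H (comb F c)"
      using bound[OF p(2,3), of c] complex_Re_le_cmod order_trans unfolding L_def by blast
    moreover have "0 \<le> (hnorm H (comb F c) - C)\<^sup>2" by simp
    ultimately show ?thesis by (simp add: p q_def power2_diff mult.commute)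
  qed
  have I0: "({}, \<lambda>x. 0) \<in> I" by (simp add: I_def)
  define d where "d = Inf (q ` I)"
  have bdd: "bdd_below (q ` I)" using lower by (intro bdd_belowI2)
  have d: "d \<le> q p" if "p \<in> I" for p unfolding d_def using bdd that by (intro cInf_lower) auto
  have "\<exists>p\<in>I. q p < d + 1 / real (Suc n)" for n
  proof -
    have "Inf (q ` I) < d + 1 / real (Suc n)" unfolding d_def by simp
    then show ?thesis using I0 by (subst (asm) cInf_less_iff) (use bdd in auto)
  qed
  then have "\<forall>n. \<exists>p. p \<in> I \<and> q p < d + 1 / real (Suc n)" by blast
  from choice[OF this] obtain p where p: "\<forall>n. p n \<in> I \<and> q (p n) < d + 1 / real (Suc n)" ..
  define F c where "F = (\<lambda>n. fst (p n))" and "c = (\<lambda>n. snd (p n))"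
  have Fc: "finite (F n)" "F n \<subseteq> X" "\<And>x. x \<notin> F n \<Longrightarrow> c n x = 0" "q (F n, c n) < d + 1 / real (Suc n)" for n
    using p[rule_format, of n] by (auto simp: F_def c_def I_def split: prod.splits)
  define g where "g = (\<lambda>n. comb (F n) (c n))"
  have g: "g n \<in> funs H" for n unfolding g_def by (rule comb_mem[OF Fc(2)])
  \<comment> \<open>Coefficients vanish outside their support, so different members of the
    minimizing sequence can be compared on a common finite set.\<close>
  have q_sup: "q (G, c n) = q (F n, c n)" "comb G (c n) = g n"
    if G: "finite G" "F n \<subseteq> G" for G n
  proof -
    have "comb (F n) (c n) = comb G (c n)" by (rule comb_mono[OF G]) (use Fc in auto)
    moreover have "L (F n) (c n) = L G (c n)"
      unfolding L_def by (rule sum.mono_neutral_left) (use G Fc(3) in auto)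
    ultimately show "q (G, c n) = q (F n, c n)" "comb G (c n) = g n" by (simp_all add: q_def g_def)
  qed
  \<comment> \<open>The parallelogram law with the midpoint \<open>e\<close> of the coefficients:
    \<open>q\<close> is at least \<open>d\<close> there, so near-minimizers are close to each
    other.\<close>
  have diff: "(hnorm H (\<lambda>x. g m x - g n x))\<^sup>2 \<le> 2 / real (Suc m) + 2 / real (Suc n)" for m n
  proof -
    define G where "G = F m \<union> F n"
    have G: "finite G" "F m \<subseteq> G" "F n \<subseteq> G" "G \<subseteq> X" using Fc by (auto simp: G_def)
    define e where "e = (\<lambda>x. (1/2) * (c m x + c n x))"
    have eI: "(G, e) \<in> I" using G Fc(3) by (auto simp: I_def e_def G_def)
    have ce: "comb G e = (\<lambda>x. (1/2) * (g m x + g n x))"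
      unfolding e_def comb_scale comb_add q_sup(2)[OF G(1,2)] q_sup(2)[OF G(1,3)] ..
    have "L G e = (1/2) * (L G (c m) + L G (c n))"
      by (simp add: L_def e_def algebra_simps sum.distrib sum_divide_distrib[symmetric])
    from arg_cong[OF this, of Re]
    have Le: "Re (L G e) = (1/2) * (Re (L G (c m)) + Re (L G (c n)))" by simp
    have "(hnorm H (comb G e))\<^sup>2 = (1/4) * (hnorm H (\<lambda>x. g m x + g n x))\<^sup>2"
      unfolding ce hnorm_scale[OF add_mem[OF g g]] by (simp add: power_mult_distrib power2_eq_square)
    moreover have "(hnorm H (\<lambda>x. g m x - g n x))\<^sup>2 = 2 * (hnorm H (g m))\<^sup>2 + 2 * (hnorm H (g n))\<^sup>2
        - (hnorm H (\<lambda>x. g m x + g n x))\<^sup>2"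
      using hnorm_add_sq[OF g g, of m n] hnorm_diff_sq[OF g g, of m n] by simp
    ultimately have "(hnorm H (\<lambda>x. g m x - g n x))\<^sup>2 = 2 * q (G, c m) + 2 * q (G, c n) - 4 * q (G, e)"
      using Le by (simp add: q_def q_sup(2)[OF G(1,2)] q_sup(2)[OF G(1,3)])
    also have "\<dots> \<le> 2 * (d + 1 / real (Suc m)) + 2 * (d + 1 / real (Suc n)) - 4 * d"
    proof (intro diff_mono add_mono mult_left_mono)
      show "q (G, c m) \<le> d + 1 / real (Suc m)" "q (G, c n) \<le> d + 1 / real (Suc n)"
        unfolding q_sup(1)[OF G(1,2)] q_sup(1)[OF G(1,3)] by (intro less_imp_le Fc(4))+
    qed (use d[OF eI] in simp_all)
    finally show ?thesis by simp
  qed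
  have "\<exists>N. \<forall>m\<ge>N. \<forall>n\<ge>N. hnorm H (\<lambda>x. g m x - g n x) < e" if e: "e > 0" for e
  proof -
    obtain N where "4 / e\<^sup>2 < real N" using reals_Archimedean2 by blast
    then have N: "4 / e\<^sup>2 < real (Suc N)" by simp
    have "hnorm H (\<lambda>x. g m x - g n x) < e" if mn: "N \<le> m" "N \<le> n" for m n
    proof (rule power2_less_imp_less)
      have "2 / real (Suc m) \<le> 2 / real (Suc N)" "2 / real (Suc n) \<le> 2 / real (Suc N)"
        using mn by (auto intro!: divide_left_mono)
      then have "(hnorm H (\<lambda>x. g m x - g n x))\<^sup>2 \<le> 4 / real (Suc N)" using diff[of m n] by simp
      also have "\<dots> < e\<^sup>2" using N e by (simp add: field_simps)
      finally show "(hnorm H (\<lambda>x. g m x - g n x))\<^sup>2 < e\<^sup>2" .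
    qed (use e in simp)
    then show ?thesis by blast
  qed
  from complete[OF g this] obtain h where h: "h \<in> funs H" "(\<lambda>n. hnorm H (\<lambda>x. g n x - h x)) \<longlonglongrightarrow> 0" by blast
  have "h x = f x" if x: "x \<in> X" for x
  proof -
    \<comment> \<open>First variation: the minimizing sequence is perturbed by \<open>t\<close>
      times the kernel function at \<open>x\<close>, and the limit is taken with \<open>t\<close>
      fixed.\<close>
    have ineq: "0 \<le> 2 * Re (cnj t * (h x - f x)) + (cmod t)\<^sup>2 * (hnorm H (kf x))\<^sup>2" for t
    proof -
      have step: "- (1 / real (Suc n)) \<le> 2 * Re (cnj t * (g n x - f x)) + (cmod t)\<^sup>2 * (hnorm H (kf x))\<^sup>2" for n
      proof -
        define G where "G = insert x (F n)"
        have G: "finite G" "F n \<subseteq> G" "G \<subseteq> X" "x \<in> G" using Fc x by (auto simp: G_def)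
        define e where "e = (\<lambda>y. c n y + (if y = x then t else 0))"
        have eI: "(G, e) \<in> I" using G Fc(3) by (auto simp: I_def e_def G_def)
        have "comb G (\<lambda>y. if y = x then t else 0) = (\<lambda>y. t * kf x y)"
          unfolding comb_def using G by (simp add: if_distrib[of "\<lambda>a. a * _"] cong: if_cong)
        then have ce: "comb G e = (\<lambda>y. g n y + t * kf x y)"
          unfolding e_def comb_add q_sup(2)[OF G(1,2)] by simp
        have "L G e = L G (c n) + t * cnj (f x)"
          using G by (simp add: L_def e_def distrib_right sum.distrib if_distrib[of "\<lambda>a. a * _"] cong: if_cong)
        then have "q (G, e) = q (G, c n) + 2 * Re (cnj t * g n x) + (cmod t)\<^sup>2 * (hnorm H (kf x))\<^sup>2 - 2 * Re (t * cnj (f x))"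
          using hnorm_add_sq[OF g scale_mem[OF kf_mem[OF x]], of n t] g x
          by (simp add: q_def ce q_sup(2)[OF G(1,2)] hnorm_scale kf_mem ip_scale_right reproducing power_mult_distrib)
        moreover have "Re (t * cnj (f x)) = Re (cnj t * f x)" by simp
        ultimately have "q (G, e) = q (G, c n) + (2 * Re (cnj t * (g n x - f x)) + (cmod t)\<^sup>2 * (hnorm H (kf x))\<^sup>2)"
          by (simp add: right_diff_distrib)
        then show ?thesis using d[OF eI] Fc(4)[of n] q_sup(1)[OF G(1,2)] by linarith
      qed
      have "(\<lambda>n. g n x) \<longlonglongrightarrow> h x"
        using ip_tendsto[OF g h(1) kf_mem[OF x] h(2)] by (simp add: reproducing g h x)
      then have "(\<lambda>n. 2 * Re (cnj t * (g n x - f x)) + (cmod t)\<^sup>2 * (hnorm H (kf x))\<^sup>2 + 1 / real (Suc n))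
          \<longlonglongrightarrow> 2 * Re (cnj t * (h x - f x)) + (cmod t)\<^sup>2 * (hnorm H (kf x))\<^sup>2 + 0"
        by (intro tendsto_intros LIMSEQ_Suc[OF lim_inverse_n'])
      moreover have "0 \<le> 2 * Re (cnj t * (g n x - f x)) + (cmod t)\<^sup>2 * (hnorm H (kf x))\<^sup>2 + 1 / real (Suc n)" for n
        using step[of n] by linarith
      ultimately have "0 \<le> 2 * Re (cnj t * (h x - f x)) + (cmod t)\<^sup>2 * (hnorm H (kf x))\<^sup>2 + 0"
        using LIMSEQ_le_const by blast
      then show ?thesis by simp
    qed
    define D K where "D = h x - f x" and "K = (hnorm H (kf x))\<^sup>2"
    have K: "0 \<le> K" by (simp add: K_def)
    \<comment> \<open>For \<open>t = - s * D\<close> the inequality becomes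
      \<open>0 \<le> s * (s * K - 2)\<close> times the squared modulus of \<open>D\<close>; with
      this \<open>s\<close> one has \<open>s * K < 1\<close>, so \<open>D = 0\<close>.\<close>
    define s where "s = 1 / (1 + K)"
    have "0 \<le> 2 * Re (cnj (of_real (- s) * D) * D) + (cmod (of_real (- s) * D))\<^sup>2 * K"
      using ineq[of "of_real (- s) * D"] by (simp add: D_def K_def)
    also have "cnj (of_real (- s) * D) * D = of_real (- s * (cmod D)\<^sup>2)"
      using complex_norm_square[of D] by (simp add: mult.commute)
    also have "(cmod (of_real (- s) * D))\<^sup>2 * K = s * (s * K) * (cmod D)\<^sup>2"
      by (simp add: norm_mult power_mult_distrib power2_eq_square)
    finally have "0 \<le> s * (cmod D)\<^sup>2 * (s * K - 2)" by (simp add: algebra_simps)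
    moreover have "s * K - 2 < 0" "s > 0" using K by (auto simp: s_def field_simps)
    ultimately have "(cmod D)\<^sup>2 \<le> 0" by (simp add: zero_le_mult_iff mult_le_0_iff not_less)
    then show ?thesis by (simp add: D_def)
  qed
  then have hf: "h = f" using outside[OF h(1)] f0 by (metis ext)
  \<comment> \<open>The assumed bound is tested on the approximants \<open>g n\<close> of
    \<open>h\<close> itself.\<close>
  have "hnorm H h \<le> C"
  proof -
    have le: "cmod (ip H (g n) h) \<le> C * hnorm H (g n)" for n
    proof -
      have "ip H (g n) h = cnj (ip H h (g n))" by (rule ip_cnj[OF h(1) g])
      also have "\<dots> = L (F n) (c n)"
        unfolding g_def using ip_comb[OF Fc(2) h(1)] by (simp add: L_def hf)
      finally show ?thesis unfolding g_def L_def using bound[OF Fc(1,2)] by simp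
    qed
    have "cmod (ip H h h) \<le> C * hnorm H h"
    proof (rule LIMSEQ_le)
      show "(\<lambda>n. cmod (ip H (g n) h)) \<longlonglongrightarrow> cmod (ip H h h)"
        by (rule tendsto_norm[OF ip_tendsto[OF g h(1) h(1) h(2)]])
      show "(\<lambda>n. C * hnorm H (g n)) \<longlonglongrightarrow> C * hnorm H h"
        by (rule tendsto_mult_left[OF hnorm_tendsto[OF g h]])
    qed (use le in blast)
    then have "hnorm H h * hnorm H h \<le> C * hnorm H h"
      using h by (simp add: ip_self norm_power power2_eq_square norm_mult)
    then show ?thesis using C h(1) hnorm_nonneg[OF h(1)] by (cases "hnorm H h = 0") (auto simp: less_le)
  qed
  then show ?thesis using h hf by simp
qed

end

section \<open>The spaces \<open>H\<^sub>V\<close>\<close>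

interpretation DA: rkhs "ball 0 1" da_kernel "drury_arveson :: (complex ^ 'd) hfs"
  by unfold_locales (rule is_rkhs_drury_arveson)

lemma kfun_ball: "kfun (ball 0 1) x = DA.kf x"
  by (simp add: kfun_def DA.kf_def)

lemma kernel_span_eq: "kernel_span V = {DA.comb F c |F c. finite F \<and> F \<subseteq> V}"
  unfolding kernel_span_def DA.comb_def kfun_ball by blast

lemma restr_add: "restr V (\<lambda>x. f x + g x) = (\<lambda>x. restr V f x + restr V g x)"
  and restr_scale: "restr V (\<lambda>x. c * f x) = (\<lambda>x. c * restr V f x)"
  and restr_diff: "restr V (\<lambda>x. f x - g x) = (\<lambda>x. restr V f x - restr V g x)"
  and restr_zero: "restr V (\<lambda>x. 0) = (\<lambda>x. 0)"
  by (auto simp: restr_def)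

context
  fixes V :: "(complex ^ 'd) set"
  assumes V: "V \<subseteq> ball 0 1"
begin

lemma kernel_span_add:
  assumes "f \<in> kernel_span V" "g \<in> kernel_span V"
  shows "(\<lambda>x. f x + g x) \<in> kernel_span V"
proof -
  obtain F c G d where fg: "finite F" "F \<subseteq> V" "f = DA.comb F c" "finite G" "G \<subseteq> V" "g = DA.comb G d"
    using assms unfolding kernel_span_eq by blast
  have "f = DA.comb (F \<union> G) (\<lambda>x. if x \<in> F then c x else 0)"
    unfolding fg(3) DA.comb_def using fg by (intro ext sum.mono_neutral_cong_left) auto
  moreover have "g = DA.comb (F \<union> G) (\<lambda>x. if x \<in> G then d x else 0)"
    unfolding fg(6) DA.comb_def using fg by (intro ext sum.mono_neutral_cong_left) auto
  ultimately have "(\<lambda>x. f x + g x) =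
      DA.comb (F \<union> G) (\<lambda>x. (if x \<in> F then c x else 0) + (if x \<in> G then d x else 0))"
    unfolding DA.comb_add by simp
  moreover have "finite (F \<union> G)" "F \<union> G \<subseteq> V" using fg by auto
  ultimately show ?thesis unfolding kernel_span_eq by blast
qed

lemma kernel_span_scale:
  assumes "f \<in> kernel_span V"
  shows "(\<lambda>x. a * f x) \<in> kernel_span V"
proof -
  obtain F c where "finite F" "F \<subseteq> V" "f = DA.comb F c" using assms unfolding kernel_span_eq by blast
  then have "(\<lambda>x. a * f x) = DA.comb F (\<lambda>x. a * c x)" by (simp add: DA.comb_scale)
  then show ?thesis using \<open>finite F\<close> \<open>F \<subseteq> V\<close> unfolding kernel_span_eq by blast
qed

lemma kernel_span_mem: "f \<in> kernel_span V \<Longrightarrow> f \<in> funs drury_arveson"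
  unfolding kernel_span_eq using V DA.comb_mem by blast

lemma kernel_closed_spanD:
  "f \<in> kernel_closed_span V \<Longrightarrow> f \<in> funs drury_arveson"
  "f \<in> kernel_closed_span V \<Longrightarrow> e > 0 \<Longrightarrow> \<exists>g\<in>kernel_span V. hnorm drury_arveson (\<lambda>y. f y - g y) < e"
  unfolding kernel_closed_span_def by blast+

lemma kernel_span_subset: "f \<in> kernel_span V \<Longrightarrow> f \<in> kernel_closed_span V"
  unfolding kernel_closed_span_def using kernel_span_mem by (auto intro!: bexI[of _ f])

lemma kernel_closed_span_zero: "(\<lambda>x. 0) \<in> kernel_closed_span V"
proof (rule kernel_span_subset)
  have "(\<lambda>x. 0) = DA.comb {} (\<lambda>x. 0)" by (simp add: DA.comb_def)
  then show "(\<lambda>x. 0) \<in> kernel_span V" unfolding kernel_span_eq by blast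
qed

lemma kernel_closed_span_add:
  assumes "f \<in> kernel_closed_span V" "g \<in> kernel_closed_span V"
  shows "(\<lambda>x. f x + g x) \<in> kernel_closed_span V"
  unfolding kernel_closed_span_def
proof (intro CollectI conjI allI impI)
  note m = kernel_closed_spanD(1)[OF assms(1)] kernel_closed_spanD(1)[OF assms(2)]
  show "(\<lambda>x. f x + g x) \<in> funs drury_arveson" using m by (rule DA.add_mem)
  fix e :: real assume "e > 0"
  then have e: "e / 2 > 0" by simp
  obtain f' where f': "f' \<in> kernel_span V" "hnorm drury_arveson (\<lambda>y. f y - f' y) < e / 2"
    using kernel_closed_spanD(2)[OF assms(1) e] by blast
  obtain g' where g': "g' \<in> kernel_span V" "hnorm drury_arveson (\<lambda>y. g y - g' y) < e / 2"
    using kernel_closed_spanD(2)[OF assms(2) e] by blast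
  have "hnorm drury_arveson (\<lambda>y. (f y - f' y) + (g y - g' y)) < e"
    using DA.hnorm_triangle[OF DA.diff_mem[OF m(1) kernel_span_mem[OF f'(1)]] DA.diff_mem[OF m(2) kernel_span_mem[OF g'(1)]]]
      f'(2) g'(2) by linarith
  then show "\<exists>h\<in>kernel_span V. hnorm drury_arveson (\<lambda>y. f y + g y - h y) < e"
    using kernel_span_add[OF f'(1) g'(1)] by (intro bexI[of _ "\<lambda>x. f' x + g' x"]) (simp_all add: algebra_simps)
qed

lemma kernel_closed_span_scale:
  assumes "f \<in> kernel_closed_span V"
  shows "(\<lambda>x. a * f x) \<in> kernel_closed_span V"
  unfolding kernel_closed_span_def
proof (intro CollectI conjI allI impI)
  note m = kernel_closed_spanD(1)[OF assms(1)]
  show "(\<lambda>x. a * f x) \<in> funs drury_arveson" using m by (rule DA.scale_mem)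
  fix e :: real assume e: "e > 0"
  have p: "cmod a + 1 > 0" by (simp add: add_nonneg_pos)
  obtain f' where f': "f' \<in> kernel_span V" "hnorm drury_arveson (\<lambda>y. f y - f' y) < e / (cmod a + 1)"
    using kernel_closed_spanD(2)[OF assms(1), of "e / (cmod a + 1)"] e p by auto
  have mem: "(\<lambda>y. f y - f' y) \<in> funs drury_arveson" using m kernel_span_mem[OF f'(1)] by (rule DA.diff_mem)
  have "hnorm drury_arveson (\<lambda>y. a * (f y - f' y)) = cmod a * hnorm drury_arveson (\<lambda>y. f y - f' y)"
    by (rule DA.hnorm_scale[OF mem])
  also have "\<dots> \<le> (cmod a + 1) * hnorm drury_arveson (\<lambda>y. f y - f' y)"
    using mem by (intro mult_right_mono) auto
  also have "\<dots> < e" using f'(2) p by (simp add: field_simps)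
  finally show "\<exists>h\<in>kernel_span V. hnorm drury_arveson (\<lambda>y. a * f y - h y) < e"
    using kernel_span_scale[OF f'(1), of a] by (intro bexI[of _ "\<lambda>x. a * f' x"]) (simp_all add: algebra_simps)
qed

lemma kernel_closed_span_diff:
  "f \<in> kernel_closed_span V \<Longrightarrow> g \<in> kernel_closed_span V \<Longrightarrow> (\<lambda>x. f x - g x) \<in> kernel_closed_span V"
  using kernel_closed_span_add[OF _ kernel_closed_span_scale[of g "-1"], of f] by simp

lemma kernel_closed_span_limit:
  assumes "\<And>n. s n \<in> kernel_closed_span V" "f \<in> funs drury_arveson"
    "(\<lambda>n. hnorm drury_arveson (\<lambda>x. s n x - f x)) \<longlonglongrightarrow> 0"
  shows "f \<in> kernel_closed_span V"
  unfolding kernel_closed_span_def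
proof (intro CollectI conjI allI impI)
  fix e :: real assume "e > 0"
  then have e: "e / 2 > 0" by simp
  obtain n where n: "hnorm drury_arveson (\<lambda>x. s n x - f x) < e / 2"
    using order_tendstoD(2)[OF assms(3) e] eventually_happens'[OF sequentially_bot] by blast
  obtain g where g: "g \<in> kernel_span V" "hnorm drury_arveson (\<lambda>y. s n y - g y) < e / 2"
    using kernel_closed_spanD(2)[OF assms(1) e] by blast
  note m = kernel_closed_spanD(1)[OF assms(1)[of n]] kernel_span_mem[OF g(1)]
  have "hnorm drury_arveson (\<lambda>y. (f y - s n y) + (s n y - g y)) < e"
    using DA.hnorm_triangle[OF DA.diff_mem[OF assms(2) m(1)] DA.diff_mem[OF m]]
      DA.hnorm_diff_commute[OF assms(2) m(1)] n g(2) by linarith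
  then show "\<exists>h\<in>kernel_span V. hnorm drury_arveson (\<lambda>y. f y - h y) < e"
    using g(1) by (intro bexI[of _ g]) simp_all
qed (rule assms(2))

text \<open>By the reproducing property \<open>f\<close> is orthogonal to
  \<open>kernel_span V\<close>, in whose closure it lies. This makes restriction to \<open>V\<close>
  injective, so that \<open>inv_into\<close> in \<open>HV\<close> recovers the original
  function.\<close>

lemma kernel_closed_span_eq_0:
  assumes f: "f \<in> kernel_closed_span V" and f0: "\<And>x. x \<in> V \<Longrightarrow> f x = 0"
  shows "f = (\<lambda>x. 0)"
proof (rule ccontr)
  assume nz: "f \<noteq> (\<lambda>x. 0)"
  let ?n = "hnorm drury_arveson f"
  have m: "f \<in> funs drury_arveson" by (rule kernel_closed_spanD(1)[OF f])
  have n: "?n > 0" using DA.hnorm_eq_0[OF m] nz DA.hnorm_nonneg[OF m] by linarith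
  obtain g where g: "g \<in> kernel_span V" "hnorm drury_arveson (\<lambda>y. f y - g y) < ?n"
    using kernel_closed_spanD(2)[OF f n] by blast
  obtain F c where F: "finite F" "F \<subseteq> V" "g = DA.comb F c" using g(1) unfolding kernel_span_eq by blast
  have gm: "g \<in> funs drury_arveson" by (rule kernel_span_mem[OF g(1)])
  have "ip drury_arveson f g = (\<Sum>x\<in>F. cnj (c x) * f x)"
    unfolding F(3) using F(2) V m by (intro DA.ip_comb) auto
  also have "\<dots> = 0" using f0 F(2) by (intro sum.neutral) auto
  finally have "(?n)\<^sup>2 = cmod (ip drury_arveson f (\<lambda>y. f y - g y))"
    using m gm by (simp add: DA.ip_diff_right DA.ip_self norm_power)
  also have "\<dots> \<le> ?n * hnorm drury_arveson (\<lambda>y. f y - g y)"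
    by (rule DA.cauchy_schwarz[OF m DA.diff_mem[OF m gm]])
  also have "\<dots> < ?n * ?n" using g(2) n by (intro mult_strict_left_mono)
  finally show False by (simp add: power2_eq_square)
qed

lemma inj_on_restr: "inj_on (restr V) (kernel_closed_span V)"
proof (rule inj_onI)
  fix f g assume fg: "f \<in> kernel_closed_span V" "g \<in> kernel_closed_span V" "restr V f = restr V g"
  have "(\<lambda>x. f x - g x) = (\<lambda>x. 0)"
  proof (rule kernel_closed_span_eq_0[OF kernel_closed_span_diff[OF fg(1,2)]])
    fix x assume "x \<in> V"
    then show "f x - g x = 0" using fun_cong[OF fg(3), of x] by (simp add: restr_def)
  qed
  then show "f = g" by (auto simp: fun_eq_iff)
qed

lemma funs_HV: "funs (HV V) = restr V ` kernel_closed_span V"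
  by (simp add: HV_def)

lemma ip_HV:
  assumes "f \<in> kernel_closed_span V" "g \<in> kernel_closed_span V"
  shows "ip (HV V) (restr V f) (restr V g) = ip drury_arveson f g"
  using assms inv_into_f_f[OF inj_on_restr] by (simp add: HV_def)

lemma hnorm_HV: "f \<in> kernel_closed_span V \<Longrightarrow> hnorm (HV V) (restr V f) = hnorm drury_arveson f"
  by (simp add: hnorm_def ip_HV)

lemma kf_closed_span:
  assumes "x \<in> V"
  shows "DA.kf x \<in> kernel_closed_span V"
proof (rule kernel_span_subset)
  have "DA.kf x = DA.comb {x} (\<lambda>x. 1)" by (simp add: DA.comb_def)
  then show "DA.kf x \<in> kernel_span V" unfolding kernel_span_eq using assms by blast
qed

lemma restr_kf: "restr V (DA.kf x) = restr V (\<lambda>y. da_kernel y x)"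
  using V by (auto simp: restr_def DA.kf_def subset_eq fun_eq_iff)

text \<open>Restriction is isometric on \<open>kernel_closed_span V\<close>, and that span is closed
  in \<open>drury_arveson\<close>; so completeness and the reproducing property are
  inherited.\<close>

lemma is_rkhs_HV: "is_rkhs V da_kernel (HV V)"
proof -
  let ?S = "kernel_closed_span V"
  have "hilbert_function_space V (HV V)"
    unfolding hilbert_function_space_def
  proof (intro conjI)
    show "\<forall>f\<in>funs (HV V). \<forall>x. x \<notin> V \<longrightarrow> f x = 0" by (auto simp: funs_HV restr_def)
    show "(\<lambda>x. 0) \<in> funs (HV V)"
      unfolding funs_HV using kernel_closed_span_zero restr_zero[of V] by (metis image_eqI)
    show "\<forall>f\<in>funs (HV V). \<forall>g\<in>funs (HV V). (\<lambda>x. f x + g x) \<in> funs (HV V)"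
      unfolding funs_HV by (auto simp flip: restr_add intro!: imageI kernel_closed_span_add)
    show "\<forall>c. \<forall>f\<in>funs (HV V). (\<lambda>x. c * f x) \<in> funs (HV V)"
      unfolding funs_HV by (auto simp flip: restr_scale intro!: imageI kernel_closed_span_scale)
    show "\<forall>f\<in>funs (HV V). \<forall>g\<in>funs (HV V). \<forall>h\<in>funs (HV V).
        ip (HV V) (\<lambda>x. f x + g x) h = ip (HV V) f h + ip (HV V) g h"
      unfolding funs_HV
      by (auto simp flip: restr_add simp: ip_HV kernel_closed_span_add kernel_closed_spanD(1) DA.ip_add_left)
    show "\<forall>c. \<forall>f\<in>funs (HV V). \<forall>h\<in>funs (HV V). ip (HV V) (\<lambda>x. c * f x) h = c * ip (HV V) f h"
      unfolding funs_HV
      by (auto simp flip: restr_scale simp: ip_HV kernel_closed_span_scale kernel_closed_spanD(1) DA.ip_scale_left)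
    show "\<forall>f\<in>funs (HV V). \<forall>g\<in>funs (HV V). ip (HV V) g f = cnj (ip (HV V) f g)"
      unfolding funs_HV by (auto simp: ip_HV kernel_closed_spanD(1) intro!: DA.ip_cnj)
    show "\<forall>f\<in>funs (HV V). f \<noteq> (\<lambda>x. 0) \<longrightarrow> Re (ip (HV V) f f) > 0"
      unfolding funs_HV
    proof (intro ballI impI)
      fix f assume "f \<in> restr V ` ?S" "f \<noteq> (\<lambda>x. 0)"
      then obtain f' where f': "f' \<in> ?S" "f = restr V f'" "f' \<noteq> (\<lambda>x. 0)"
        using restr_zero[of V] by blast
      then show "Re (ip (HV V) f f) > 0"
        using DA.ip_pos[OF kernel_closed_spanD(1)[OF f'(1)]] by (simp add: ip_HV)
    qed
    show "\<forall>s::nat \<Rightarrow> complex ^ 'd \<Rightarrow> complex.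
        (\<forall>n. s n \<in> funs (HV V)) \<and>
        (\<forall>e>0. \<exists>N. \<forall>m\<ge>N. \<forall>n\<ge>N. hnorm (HV V) (\<lambda>x. s m x - s n x) < e) \<longrightarrow>
        (\<exists>f\<in>funs (HV V). (\<lambda>n. hnorm (HV V) (\<lambda>x. s n x - f x)) \<longlonglongrightarrow> 0)"
    proof (intro allI impI, elim conjE)
      fix s :: "nat \<Rightarrow> complex ^ 'd \<Rightarrow> complex"
      assume s: "\<forall>n. s n \<in> funs (HV V)"
        and C: "\<forall>e>0. \<exists>N. \<forall>m\<ge>N. \<forall>n\<ge>N. hnorm (HV V) (\<lambda>x. s m x - s n x) < e"
      have "\<forall>n. \<exists>t. t \<in> ?S \<and> s n = restr V t" using s unfolding funs_HV by blast
      from choice[OF this] obtain t where t: "\<forall>n. t n \<in> ?S \<and> s n = restr V (t n)" ..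
      have nt: "hnorm (HV V) (\<lambda>x. s n x - restr V g x) = hnorm drury_arveson (\<lambda>x. t n x - g x)"
        if "g \<in> ?S" for n g
        using t that by (simp add: hnorm_HV kernel_closed_span_diff flip: restr_diff)
      have nt2: "hnorm (HV V) (\<lambda>x. s m x - s n x) = hnorm drury_arveson (\<lambda>x. t m x - t n x)" for m n
        using nt[of "t n" m] t by simp
      have tm: "t n \<in> funs drury_arveson" for n using t kernel_closed_spanD(1) by blast
      have "\<exists>N. \<forall>m\<ge>N. \<forall>n\<ge>N. hnorm drury_arveson (\<lambda>x. t m x - t n x) < e" if "e > 0" for e
        using C that unfolding nt2 by blast
      from DA.complete[OF tm this] obtain f where f: "f \<in> funs drury_arveson"
        "(\<lambda>n. hnorm drury_arveson (\<lambda>x. t n x - f x)) \<longlonglongrightarrow> 0" by blast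
      have fS: "f \<in> ?S" by (rule kernel_closed_span_limit[OF _ f]) (use t in blast)
      then show "\<exists>f\<in>funs (HV V). (\<lambda>n. hnorm (HV V) (\<lambda>x. s n x - f x)) \<longlonglongrightarrow> 0"
        using f(2) unfolding funs_HV by (intro bexI[of _ "restr V f"]) (simp_all add: nt)
    qed
  qed
  moreover have "restr V (\<lambda>y. da_kernel y x) \<in> funs (HV V)" if "x \<in> V" for x
    unfolding funs_HV restr_kf[symmetric] using kf_closed_span[OF that] by blast
  moreover have "ip (HV V) f (restr V (\<lambda>y. da_kernel y x)) = f x" if f: "f \<in> funs (HV V)" and x: "x \<in> V" for f x
  proof -
    obtain f' where f': "f' \<in> ?S" "f = restr V f'" using f unfolding funs_HV by blast
    have "ip (HV V) f (restr V (DA.kf x)) = ip drury_arveson f' (DA.kf x)"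
      unfolding f'(2) using f'(1) kf_closed_span[OF x] by (rule ip_HV)
    also have "\<dots> = f' x" using x V kernel_closed_spanD(1)[OF f'(1)] by (intro DA.reproducing) auto
    also have "\<dots> = f x" using x by (simp add: f'(2) restr_def)
    finally show ?thesis unfolding restr_kf .
  qed
  ultimately show ?thesis unfolding is_rkhs_def by blast
qed

lemma rkhs_HV: "rkhs V da_kernel (HV V)"
  by unfold_locales (rule is_rkhs_HV)

lemma kf_HV: "rkhs.kf V da_kernel x = kfun V x"
  by (simp add: rkhs.kf_def[OF rkhs_HV] kfun_def)

text \<open>The kernel function at 0 is the constant 1. It is the test vector for all lower bounds
  of norms below.\<close>

lemma hnorm_kf_zero:
  assumes "0 \<in> V"
  shows "hnorm (HV V) (rkhs.kf V da_kernel 0) = 1"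
proof -
  interpret V: rkhs V da_kernel "HV V" by (rule rkhs_HV)
  note m = V.kf_mem[OF assms]
  have "(hnorm (HV V) (V.kf 0))\<^sup>2 = 1"
    using V.hnorm_sq[OF m] V.reproducing[OF m assms] assms by (simp add: V.kf_apply da_kernel_def)
  then show ?thesis using V.hnorm_nonneg[OF m] by (simp add: power2_eq_1_iff)
qed

lemma HV_dense:
  assumes f: "f \<in> funs (HV V)" and e: "e > 0"
  shows "\<exists>F c. finite F \<and> F \<subseteq> V \<and> hnorm (HV V) (\<lambda>x. f x - rkhs.comb V da_kernel F c x) < e"
proof -
  obtain f' where f': "f' \<in> kernel_closed_span V" "f = restr V f'" using f unfolding funs_HV by blast
  obtain g where g: "g \<in> kernel_span V" "hnorm drury_arveson (\<lambda>y. f' y - g y) < e"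
    using kernel_closed_spanD(2)[OF f'(1) e] by blast
  obtain F c where F: "finite F" "F \<subseteq> V" "g = DA.comb F c" using g(1) unfolding kernel_span_eq by blast
  have "restr V g = rkhs.comb V da_kernel F c"
  proof
    fix y
    show "restr V g y = rkhs.comb V da_kernel F c y"
      unfolding F(3) DA.comb_def rkhs.comb_def[OF rkhs_HV] kf_HV
      using V by (auto simp: restr_def kfun_def DA.kf_def intro!: sum.cong)
  qed
  then have "(\<lambda>x. f x - rkhs.comb V da_kernel F c x) = restr V (\<lambda>x. f' x - g x)"
    by (simp add: f'(2) restr_diff)
  then have "hnorm (HV V) (\<lambda>x. f x - rkhs.comb V da_kernel F c x) < e"
    using g(2) hnorm_HV[OF kernel_closed_span_diff[OF f'(1) kernel_span_subset[OF g(1)]]] by simp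
  then show ?thesis using F by blast
qed

end

section \<open>Kernel maps and multipliers\<close>

lemma opnorm_le: "(\<And>x. x \<in> S \<Longrightarrow> N x \<le> 1 \<Longrightarrow> N' (T x) \<le> c) \<Longrightarrow> opnorm S N N' T \<le> c"
  unfolding opnorm_def by (rule SUP_least) auto

lemma opnorm_ge: "x \<in> S \<Longrightarrow> N x \<le> 1 \<Longrightarrow> N' (T x) \<le> opnorm S N N' T"
  unfolding opnorm_def by (rule SUP_upper) auto

lemma (in function_hilbert_space) hopnorm_le:
  assumes "0 \<le> c" "\<And>f. f \<in> funs H \<Longrightarrow> hnorm H' (T f) \<le> c * hnorm H f"
  shows "hopnorm H H' T \<le> ennreal c"
  unfolding hopnorm_def
proof (rule opnorm_le)
  fix f assume f: "f \<in> funs H" "ennreal (hnorm H f) \<le> 1"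
  then have "hnorm H f \<le> 1" by simp
  then have "c * hnorm H f \<le> c * 1" by (rule mult_left_mono) (rule assms(1))
  then show "ennreal (hnorm H' (T f)) \<le> ennreal c"
    using assms(2)[OF f(1)] by (intro ennreal_leI) simp
qed

lemma (in function_hilbert_space) hnorm_le_of_hopnorm:
  assumes c: "0 \<le> c" "hopnorm H H' T \<le> ennreal c"
    and hom: "\<And>a f. f \<in> funs H \<Longrightarrow> T (\<lambda>x. a * f x) = (\<lambda>x. a * T f x)"
    and H': "function_hilbert_space Y H'" "\<And>f. f \<in> funs H \<Longrightarrow> T f \<in> funs H'" and f: "f \<in> funs H"
  shows "hnorm H' (T f) \<le> c * hnorm H f"
proof (cases "hnorm H f = 0")
  case True
  then have "f = (\<lambda>x. 0)" using hnorm_eq_0[OF f] by simp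
  then have "T f = (\<lambda>x. 0)" using hom[OF f, of 0] by simp
  then show ?thesis using True function_hilbert_space.hnorm_zero[OF H'(1)] by simp
next
  case False
  define n where "n = hnorm H f"
  have n: "n > 0" using False hnorm_nonneg[OF f] unfolding n_def by linarith
  let ?g = "\<lambda>x. of_real (1 / n) * f x"
  have g: "?g \<in> funs H" by (rule scale_mem[OF f])
  have "hnorm H ?g = 1 / n * n"
    unfolding hnorm_scale[OF f] using n by (simp add: norm_divide n_def)
  then have "hnorm H ?g = 1" using n by simp
  then have "ennreal (hnorm H' (T ?g)) \<le> hopnorm H H' T"
    unfolding hopnorm_def using g by (intro opnorm_ge[of _ _ "\<lambda>f. ennreal (hnorm H f)"]) auto
  also have "\<dots> \<le> ennreal c" by (rule c)
  finally have "hnorm H' (T ?g) \<le> c" using c(1) by simp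
  also have "hnorm H' (T ?g) = 1 / n * hnorm H' (T f)"
    unfolding hom[OF f] function_hilbert_space.hnorm_scale[OF H'(1) H'(2)[OF f]]
    using n by (simp add: norm_divide)
  finally show ?thesis using n by (simp add: n_def field_simps)
qed

context rkhs
begin

lemma kernel_sum_mem: "(\<And>i. i \<in> F \<Longrightarrow> g i \<in> X) \<Longrightarrow> (\<lambda>z. \<Sum>i\<in>F. c i * kf (g i) z) \<in> funs H"
  by (intro sum_mem scale_mem kf_mem)

lemma ip_kernel_sum:
  assumes "\<And>i. i \<in> F \<Longrightarrow> g i \<in> X" "f \<in> funs H"
  shows "ip H f (\<lambda>z. \<Sum>i\<in>F. c i * kf (g i) z) = (\<Sum>i\<in>F. cnj (c i) * f (g i))"
proof -
  have "ip H f (\<lambda>z. \<Sum>i\<in>F. c i * kf (g i) z) = (\<Sum>i\<in>F. ip H f (\<lambda>z. c i * kf (g i) z))"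
    using assms by (intro ip_sum_right scale_mem kf_mem)
  also have "\<dots> = (\<Sum>i\<in>F. cnj (c i) * f (g i))"
    using assms by (intro sum.cong) (auto simp: ip_scale_right kf_mem reproducing)
  finally show ?thesis .
qed

lemma hnorm_kernel_sum:
  assumes "\<And>i. i \<in> F \<Longrightarrow> g i \<in> X"
  shows "(hnorm H (\<lambda>z. \<Sum>i\<in>F. c i * kf (g i) z))\<^sup>2 = Re (\<Sum>i\<in>F. \<Sum>j\<in>F. c i * cnj (c j) * k (g j) (g i))"
proof -
  let ?u = "\<lambda>z. \<Sum>i\<in>F. c i * kf (g i) z"
  have "ip H ?u ?u = (\<Sum>j\<in>F. cnj (c j) * ?u (g j))"
    using assms by (intro ip_kernel_sum kernel_sum_mem)
  also have "\<dots> = (\<Sum>j\<in>F. \<Sum>i\<in>F. cnj (c j) * (c i * k (g j) (g i)))"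
    unfolding sum_distrib_left by (intro sum.cong) (auto simp: kf_apply assms)
  also have "\<dots> = (\<Sum>i\<in>F. \<Sum>j\<in>F. c i * cnj (c j) * k (g j) (g i))"
    by (subst sum.swap) (simp add: mult_ac)
  finally have e: "ip H ?u ?u = (\<Sum>i\<in>F. \<Sum>j\<in>F. c i * cnj (c j) * k (g j) (g i))" .
  have "(hnorm H ?u)\<^sup>2 = Re (ip H ?u ?u)" by (intro hnorm_sq kernel_sum_mem assms)
  then show ?thesis unfolding e .
qed

end

text \<open>Combinations of kernel functions have Gram matrix \<open>k y x\<close>, whereas the
  tensor estimates are in terms of \<open>cinner x y\<close>; this reconciles the two
  orders.\<close>

lemma psd_transpose:
  assumes "psd X K"
  shows "psd X (\<lambda>x y. K y x)"
  unfolding psd_def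
proof (intro allI impI)
  fix F and c :: "'a \<Rightarrow> complex" assume F: "finite F" "F \<subseteq> X"
  have "(\<Sum>x\<in>F. \<Sum>y\<in>F. c x * cnj (c y) * K y x) = (\<Sum>x\<in>F. \<Sum>y\<in>F. cnj (c x) * cnj (cnj (c y)) * K x y)"
    by (subst sum.swap) (simp add: mult_ac)
  then show "0 \<le> Re (\<Sum>x\<in>F. \<Sum>y\<in>F. c x * cnj (c y) * K y x)"
    using psdD[OF assms F, of "\<lambda>x. cnj (c x)"] by simp
qed

lemma cmod_cinner_less_1: "x \<in> ball 0 1 \<Longrightarrow> y \<in> ball 0 1 \<Longrightarrow> cmod (cinner x y) < 1"
proof -
  assume xy: "x \<in> ball 0 1" "y \<in> ball 0 1"
  have "norm x * norm y \<le> norm x * 1" using xy by (intro mult_left_mono) auto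
  then show ?thesis using cmod_cinner_le[of x y] xy by simp
qed

lemma da_kernel_tendsto:
  assumes "x \<in> ball 0 1" "y \<in> ball 0 1"
  shows "(\<lambda>n. \<Sum>m<n. cinner x y ^ m) \<longlonglongrightarrow> da_kernel x y"
  using geometric_sums[OF cmod_cinner_less_1[OF assms]] by (simp add: sums_def da_kernel_def)

lemma psd_da_kernel_diff:
  assumes "\<And>m. psd X (\<lambda>x y. of_real b * cinner x y ^ m - cinner (A x) (A y) ^ m)"
    and X: "X \<subseteq> ball 0 1" "\<And>x. x \<in> X \<Longrightarrow> A x \<in> ball 0 1"
  shows "psd X (\<lambda>x y. of_real b * da_kernel x y - da_kernel (A x) (A y))"
proof (rule psd_limit)
  show "psd X (\<lambda>x y. \<Sum>m<n. of_real b * cinner x y ^ m - cinner (A x) (A y) ^ m)" for n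
    by (intro psd_sum assms(1))
  fix x y assume xy: "x \<in> X" "y \<in> X"
  then have xy': "x \<in> ball 0 1" "y \<in> ball 0 1" using X(1) by blast+
  have "(\<lambda>n. of_real b * (\<Sum>m<n. cinner x y ^ m) - (\<Sum>m<n. cinner (A x) (A y) ^ m)) \<longlonglongrightarrow>
      of_real b * da_kernel x y - da_kernel (A x) (A y)"
    by (intro tendsto_intros da_kernel_tendsto xy' X(2) xy)
  then show "(\<lambda>n. \<Sum>m<n. of_real b * cinner x y ^ m - cinner (A x) (A y) ^ m) \<longlonglongrightarrow>
      of_real b * da_kernel x y - da_kernel (A x) (A y)"
    by (simp add: sum_subtractf sum_distrib_left)
qed

text \<open>Schur multiplication by the kernel, through the partial sums of its geometric
  series.\<close>

lemma psd_da_kernel_mult: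
  assumes "psd X K" and X: "X \<subseteq> ball 0 1"
  shows "psd X (\<lambda>x y. da_kernel x y * K x y)"
proof (rule psd_limit)
  show "psd X (\<lambda>x y. \<Sum>m<n. cinner x y ^ m * K x y)" for n
    by (intro psd_sum psd_cinner_power_mult assms(1))
  fix x y assume "x \<in> X" "y \<in> X"
  then have "x \<in> ball 0 1" "y \<in> ball 0 1" using X by blast+
  then show "(\<lambda>n. \<Sum>m<n. cinner x y ^ m * K x y) \<longlonglongrightarrow> da_kernel x y * K x y"
    unfolding sum_distrib_right[symmetric] by (intro tendsto_intros da_kernel_tendsto)
qed

section \<open>Operators given on kernel functions by a map of points, and their adjoints\<close>

locale kernel_map =
  fixes V W :: "(complex ^ 'd) set" and A :: "complex ^ 'd \<Rightarrow> complex ^ 'd"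
    and T :: "(complex ^ 'd \<Rightarrow> complex) \<Rightarrow> complex ^ 'd \<Rightarrow> complex" and a :: real
  assumes V: "V \<subseteq> ball 0 1" and W: "W \<subseteq> ball 0 1" and AV: "\<And>x. x \<in> V \<Longrightarrow> A x \<in> W"
    and T_add: "\<And>f g. f \<in> funs (HV V) \<Longrightarrow> g \<in> funs (HV V) \<Longrightarrow> T (\<lambda>x. f x + g x) = (\<lambda>x. T f x + T g x)"
    and T_scale: "\<And>c f. f \<in> funs (HV V) \<Longrightarrow> T (\<lambda>x. c * f x) = (\<lambda>x. c * T f x)"
    and T_mem: "\<And>f. f \<in> funs (HV V) \<Longrightarrow> T f \<in> funs (HV W)"
    and T_kfun: "\<And>x. x \<in> V \<Longrightarrow> T (kfun V x) = kfun W (A x)"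
    and a: "0 \<le> a" and T_bound: "\<And>f. f \<in> funs (HV V) \<Longrightarrow> hnorm (HV W) (T f) \<le> a * hnorm (HV V) f"
begin

sublocale V: rkhs V da_kernel "HV V" by (rule rkhs_HV[OF V])
sublocale W: rkhs W da_kernel "HV W" by (rule rkhs_HV[OF W])

lemma T_kf: "x \<in> V \<Longrightarrow> T (V.kf x) = W.kf (A x)"
  using T_kfun by (simp add: kf_HV[OF V] kf_HV[OF W])

lemma T_zero: "T (\<lambda>x. 0) = (\<lambda>x. 0)"
  using T_scale[OF V.zero_mem, of 0] by simp

lemma T_comb:
  assumes "finite F" "F \<subseteq> V"
  shows "T (V.comb F c) = (\<lambda>z. \<Sum>x\<in>F. c x * W.kf (A x) z)"
  using assms
proof (induction F rule: finite_induct)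
  case empty
  then show ?case by (simp add: V.comb_def T_zero)
next
  case (insert x F)
  have "V.comb (insert x F) c = (\<lambda>z. c x * V.kf x z + V.comb F c z)"
    using insert by (simp add: V.comb_def)
  then show ?case using insert
    by (simp add: T_add T_scale V.scale_mem V.kf_mem V.comb_mem T_kf)
qed

lemma T_diff:
  assumes "f \<in> funs (HV V)" "g \<in> funs (HV V)"
  shows "T (\<lambda>x. f x - g x) = (\<lambda>x. T f x - T g x)"
  using T_add[OF assms(1) V.scale_mem[OF assms(2), of "-1"]] T_scale[OF assms(2), of "-1"] by simp

text \<open>The map \<open>g \<mapsto> g \<circ> A\<close> is the adjoint of \<open>T\<close>.\<close>

lemma pullback:
  assumes g: "g \<in> funs (HV W)"
  shows "restr V (\<lambda>x. g (A x)) \<in> funs (HV V) \<and> hnorm (HV V) (restr V (\<lambda>x. g (A x))) \<le> a * hnorm (HV W) g"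
proof (rule V.rkhs_membership)
  fix F c assume F: "finite F" "F \<subseteq> V"
  have "(\<Sum>x\<in>F. c x * cnj (restr V (\<lambda>x. g (A x)) x)) = cnj (\<Sum>x\<in>F. cnj (c x) * g (A x))"
    using F(2) by (auto simp: restr_def intro!: sum.cong)
  also have "(\<Sum>x\<in>F. cnj (c x) * g (A x)) = ip (HV W) g (T (V.comb F c))"
    unfolding T_comb[OF F] using F(2) AV g by (intro W.ip_kernel_sum[symmetric]) auto
  finally have "cmod (\<Sum>x\<in>F. c x * cnj (restr V (\<lambda>x. g (A x)) x)) = cmod (ip (HV W) g (T (V.comb F c)))"
    by simp
  also have "\<dots> \<le> hnorm (HV W) g * hnorm (HV W) (T (V.comb F c))"
    using F(2) by (intro W.cauchy_schwarz g T_mem V.comb_mem)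
  also have "\<dots> \<le> hnorm (HV W) g * (a * hnorm (HV V) (V.comb F c))"
    using F(2) g by (intro mult_left_mono T_bound V.comb_mem) auto
  finally show "cmod (\<Sum>x\<in>F. c x * cnj (restr V (\<lambda>x. g (A x)) x)) \<le> a * hnorm (HV W) g * hnorm (HV V) (V.comb F c)"
    by (simp add: mult_ac)
qed (use a g in \<open>auto simp: restr_def\<close>)

text \<open>The kernel inequality bounds \<open>T\<close> on finite combinations of kernel
  functions. The a priori bound \<open>a\<close> provides continuity, so the constant
  \<open>sqrt b\<close> passes to the closure.\<close>

lemma hnorm_T_le:
  assumes b: "0 \<le> b" and K: "psd V (\<lambda>x y. of_real b * da_kernel x y - da_kernel (A x) (A y))"
    and f: "f \<in> funs (HV V)"
  shows "hnorm (HV W) (T f) \<le> sqrt b * hnorm (HV V) f"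
proof -
  have comb: "hnorm (HV W) (T (V.comb F c)) \<le> sqrt b * hnorm (HV V) (V.comb F c)"
    if F: "finite F" "F \<subseteq> V" for F c
  proof (rule power2_le_imp_le)
    have "0 \<le> Re (of_real b * (\<Sum>x\<in>F. \<Sum>y\<in>F. c x * cnj (c y) * da_kernel y x)
        - (\<Sum>x\<in>F. \<Sum>y\<in>F. c x * cnj (c y) * da_kernel (A y) (A x)))"
      using psdD[OF psd_transpose[OF K] F, of c] unfolding quadratic_form_diff .
    then have "(hnorm (HV W) (T (V.comb F c)))\<^sup>2 \<le> b * (hnorm (HV V) (V.comb F c))\<^sup>2"
      unfolding T_comb[OF F] V.hnorm_comb[OF F(2)]
      using W.hnorm_kernel_sum[of F A c] F(2) AV by (auto simp: subset_eq)
    then show "(hnorm (HV W) (T (V.comb F c)))\<^sup>2 \<le> (sqrt b * hnorm (HV V) (V.comb F c))\<^sup>2"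
      using b by (simp add: power_mult_distrib)
  qed (use b V.comb_mem[OF F(2)] in simp)
  show ?thesis
  proof (rule field_le_epsilon)
    fix e :: real assume e: "e > 0"
    \<comment> \<open>The approximation error enters with factors \<open>sqrt b\<close> and
      \<open>a\<close>; the summand 1 keeps the denominator positive.\<close>
    define e' where "e' = e / (sqrt b + a + 1)"
    have s: "sqrt b + a + 1 > 0" using a b by (simp add: add_nonneg_pos)
    then have e': "e' > 0" using e by (simp add: e'_def)
    obtain F c where F: "finite F" "F \<subseteq> V" "hnorm (HV V) (\<lambda>x. f x - V.comb F c x) < e'"
      using HV_dense[OF V f e'] by blast
    let ?g = "V.comb F c"
    have g: "?g \<in> funs (HV V)" by (rule V.comb_mem[OF F(2)])
    have "hnorm (HV W) (T f) \<le> hnorm (HV W) (T ?g) + hnorm (HV W) (\<lambda>x. T f x - T ?g x)"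
      by (intro W.hnorm_le_diff T_mem f g)
    also have "hnorm (HV W) (\<lambda>x. T f x - T ?g x) \<le> a * hnorm (HV V) (\<lambda>x. f x - ?g x)"
      using T_bound[OF V.diff_mem[OF f g]] by (simp add: T_diff[OF f g])
    also have "\<dots> \<le> a * e'" using F(3) a by (intro mult_left_mono) auto
    also have "hnorm (HV W) (T ?g) \<le> sqrt b * hnorm (HV V) ?g" by (rule comb[OF F(1,2)])
    also have "\<dots> \<le> sqrt b * (hnorm (HV V) f + e')"
      using V.hnorm_le_diff[OF g f] V.hnorm_diff_commute[OF g f] F(3) b
      by (intro mult_left_mono) auto
    finally have "hnorm (HV W) (T f) \<le> sqrt b * hnorm (HV V) f + (sqrt b + a) * e'"
      by (simp add: algebra_simps)
    also have "(sqrt b + a) * e' \<le> (sqrt b + a + 1) * e'" using e' by simp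
    also have "\<dots> = e" using s by (simp add: e'_def)
    finally show "hnorm (HV W) (T f) \<le> sqrt b * hnorm (HV V) f + e" by simp
  qed
qed

end

lemma dsum_norm_nonneg: "0 \<le> dsum_norm I H h"
  by (simp add: dsum_norm_def sum_nonneg)

lemma dsum_norm_le:
  assumes "\<And>i. i \<in> I \<Longrightarrow> hnorm H' (g i) \<le> a * hnorm H (h i)" "0 \<le> a"
    "\<And>i. i \<in> I \<Longrightarrow> 0 \<le> hnorm H' (g i)"
  shows "dsum_norm I H' g \<le> a * dsum_norm I H h"
proof -
  have "(\<Sum>i\<in>I. (hnorm H' (g i))\<^sup>2) \<le> (\<Sum>i\<in>I. (a * hnorm H (h i))\<^sup>2)"
    by (intro sum_mono power_mono assms)
  also have "\<dots> = a\<^sup>2 * (\<Sum>i\<in>I. (hnorm H (h i))\<^sup>2)"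
    by (simp add: power_mult_distrib sum_distrib_left)
  finally have "dsum_norm I H' g \<le> sqrt (a\<^sup>2 * (\<Sum>i\<in>I. (hnorm H (h i))\<^sup>2))"
    unfolding dsum_norm_def by (rule real_sqrt_le_mono)
  then show ?thesis using assms(2) by (simp add: dsum_norm_def real_sqrt_mult)
qed

lemma dsum_norm_cong: "(\<And>i. i \<in> I \<Longrightarrow> g i = h i) \<Longrightarrow> dsum_norm I H g = dsum_norm I H h"
  unfolding dsum_norm_def by (auto intro!: sum.cong arg_cong[where f = sqrt])

lemma multipliersD:
  "f \<in> multipliers V \<Longrightarrow> h \<in> funs (HV V) \<Longrightarrow> (\<lambda>x. f x * h x) \<in> funs (HV V)"
  "f \<in> multipliers V \<Longrightarrow> x \<notin> V \<Longrightarrow> f x = 0"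
  by (auto simp: multipliers_def)

lemma mat_mult_bound:
  assumes V: "V \<subseteq> ball 0 1" and F: "\<And>i j. i < n \<Longrightarrow> j < n \<Longrightarrow> F i j \<in> multipliers V"
    and le: "mat_mult_norm V n F \<le> 1" and h: "h \<in> dsum {..<n} (HV V)"
  shows "dsum_norm {..<n} (HV V) (\<lambda>i x. \<Sum>j<n. F i j x * h j x) \<le> dsum_norm {..<n} (HV V) h"
proof -
  interpret V: rkhs V da_kernel "HV V" by (rule rkhs_HV[OF V])
  let ?N = "dsum_norm {..<n} (HV V)"
  have hm: "h j \<in> funs (HV V)" if "j < n" for j using h that by (auto simp: dsum_def)
  have sm: "(\<lambda>x. \<Sum>j<n. F i j x * h j x) \<in> funs (HV V)" if "i < n" for i
    by (intro V.sum_mem multipliersD(1)) (use F hm that in auto)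
  show ?thesis
  proof (cases "?N h = 0")
    case True
    then have "(\<Sum>j<n. (hnorm (HV V) (h j))\<^sup>2) = 0" by (simp add: dsum_norm_def)
    then have "h j = (\<lambda>x. 0)" if "j < n" for j
      using V.hnorm_eq_0[OF hm[OF that]] that by (simp add: sum_nonneg_eq_0_iff)
    then have "?N (\<lambda>i x. \<Sum>j<n. F i j x * h j x) = ?N (\<lambda>i x. 0)"
      by (intro dsum_norm_cong) auto
    also have "\<dots> = 0" by (simp add: dsum_norm_def)
    finally show ?thesis using True by simp
  next
    case False
    define N where "N = ?N h"
    have N: "N > 0" using False dsum_norm_nonneg[of "{..<n}" "HV V" h] unfolding N_def by linarith
    define g where "g = (\<lambda>j x. of_real (1 / N) * h j x)"
    have gn: "hnorm (HV V) (g j) = 1 / N * hnorm (HV V) (h j)" if "j < n" for j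
      unfolding g_def V.hnorm_scale[OF hm[OF that]] using N by (simp add: norm_divide)
    have "?N g \<le> (1 / N) * ?N h"
      by (rule dsum_norm_le) (use N hm in \<open>auto simp: gn\<close>)
    then have g1: "?N g \<le> 1" using N by (simp add: N_def)
    have "g j \<in> funs (HV V)" if "j < n" for j
      unfolding g_def by (rule V.scale_mem[OF hm[OF that]])
    then have gd: "g \<in> dsum {..<n} (HV V)" by (simp add: dsum_def)
    have "ennreal (?N (\<lambda>i x. \<Sum>j<n. F i j x * g j x)) \<le> mat_mult_norm V n F"
      unfolding mat_mult_norm_def
      by (rule opnorm_ge[where T = "\<lambda>h i x. \<Sum>j<n. F i j x * h j x" and N' = "\<lambda>g. ennreal (?N g)"]) (use gd g1 in auto)
    then have le1: "?N (\<lambda>i x. \<Sum>j<n. F i j x * g j x) \<le> 1"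
      using le order_trans by fastforce
    have "?N (\<lambda>i x. \<Sum>j<n. F i j x * h j x) \<le> N * ?N (\<lambda>i x. \<Sum>j<n. F i j x * g j x)"
    proof (rule dsum_norm_le)
      fix i assume i: "i \<in> {..<n}"
      have "(\<lambda>x. \<Sum>j<n. F i j x * g j x) = (\<lambda>x. of_real (1 / N) * (\<Sum>j<n. F i j x * h j x))"
        by (simp add: g_def sum_distrib_left mult_ac)
      then have "hnorm (HV V) (\<lambda>x. \<Sum>j<n. F i j x * g j x) =
          cmod (of_real (1 / N)) * hnorm (HV V) (\<lambda>x. \<Sum>j<n. F i j x * h j x)"
        using V.hnorm_scale[OF sm[of i]] i by (simp only: lessThan_iff)
      then show "hnorm (HV V) (\<lambda>x. \<Sum>j<n. F i j x * h j x) \<le> N * hnorm (HV V) (\<lambda>x. \<Sum>j<n. F i j x * g j x)"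
        using N by (simp add: norm_divide)
    qed (use N sm in auto)
    also have "\<dots> \<le> N * 1" using le1 N by (intro mult_left_mono) auto
    finally show ?thesis by (simp add: N_def)
  qed
qed

section \<open>Induced isomorphisms of multiplier algebras\<close>

locale kernel_iso =
  AT: kernel_map V W A T a + BT: kernel_map W V B T' b
  for V W :: "(complex ^ 'd) set" and A B T T' a b +
  assumes BA: "\<And>x. x \<in> V \<Longrightarrow> B (A x) = x" and AB: "\<And>y. y \<in> W \<Longrightarrow> A (B y) = y"
begin

text \<open>Multiplication by \<open>f \<circ> B\<close> factors as composition with
  \<open>A\<close>, multiplication by \<open>f\<close>, and composition with \<open>B\<close>; both
  compositions are bounded adjoints.\<close>

lemma comp_map_multipliers:
  assumes f: "f \<in> multipliers V"
  shows "comp_map W B f \<in> multipliers W"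
  unfolding multipliers_def
proof (intro CollectI conjI allI impI ballI)
  show "comp_map W B f x = 0" if "x \<notin> W" for x using that by (simp add: comp_map_def restr_def)
  fix h assume h: "h \<in> funs (HV W)"
  have "(\<lambda>x. f x * restr V (\<lambda>x. h (A x)) x) \<in> funs (HV V)"
    using multipliersD(1)[OF f] AT.pullback[OF h] by blast
  then have "restr W (\<lambda>y. f (B y) * restr V (\<lambda>x. h (A x)) (B y)) \<in> funs (HV W)"
    using BT.pullback by blast
  also have "restr W (\<lambda>y. f (B y) * restr V (\<lambda>x. h (A x)) (B y)) = (\<lambda>x. comp_map W B f x * h x)"
    using BT.AV AB by (auto simp: restr_def comp_map_def)
  finally show "(\<lambda>x. comp_map W B f x * h x) \<in> funs (HV W)" .
qed

text \<open>The same factorization for matrices: composition with \<open>A\<close> costs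
  \<open>a\<close>, the matrix \<open>F\<close> at most 1, composition with \<open>B\<close> costs
  \<open>b\<close>. Compositions act diagonally on the direct sum, so the bound is independent of
  \<open>n\<close>.\<close>

lemma cb_norm_le:
  assumes \<phi>: "\<And>f. f \<in> multipliers V \<Longrightarrow> \<phi> f = comp_map W B f"
  shows "cb_norm V W \<phi> \<le> ennreal (a * b)"
  unfolding cb_norm_def
proof (rule SUP_least, rule opnorm_le)
  fix n F
  assume "F \<in> {F. \<forall>i<n. \<forall>j<n. F i j \<in> multipliers V}" and le: "mat_mult_norm V n F \<le> 1"
  then have F: "F i j \<in> multipliers V" if "i < n" "j < n" for i j using that by blast
  show "mat_mult_norm W n (\<lambda>i j. \<phi> (F i j)) \<le> ennreal (a * b)"
    unfolding mat_mult_norm_def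
  proof (rule opnorm_le)
    fix h assume h: "h \<in> dsum {..<n} (HV W)" and h1: "ennreal (dsum_norm {..<n} (HV W) h) \<le> 1"
    have hm: "h j \<in> funs (HV W)" if "j < n" for j using h that by (auto simp: dsum_def)
    define g where "g = (\<lambda>j. restr V (\<lambda>x. h j (A x)))"
    have gm: "g j \<in> funs (HV V)" "hnorm (HV V) (g j) \<le> a * hnorm (HV W) (h j)" if "j < n" for j
      using AT.pullback[OF hm[OF that]] by (auto simp: g_def)
    have gd: "g \<in> dsum {..<n} (HV V)" using gm by (auto simp: dsum_def)
    define G where "G = (\<lambda>i x. \<Sum>j<n. F i j x * g j x)"
    have Gm: "G i \<in> funs (HV V)" if "i < n" for i
      unfolding G_def by (intro AT.V.sum_mem multipliersD(1)) (use F gm that in auto)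
    have eq: "(\<lambda>x. \<Sum>j<n. \<phi> (F i j) x * h j x) = restr W (\<lambda>y. G i (B y))" if "i < n" for i
    proof
      fix y
      show "(\<Sum>j<n. \<phi> (F i j) y * h j y) = restr W (\<lambda>y. G i (B y)) y"
      proof (cases "y \<in> W")
        case True
        then show ?thesis using BT.AV[OF True] AB[OF True] \<phi>[OF F[OF that]]
          by (simp add: G_def g_def restr_def comp_map_def)
      next
        case False
        then show ?thesis using \<phi>[OF F[OF that]] by (simp add: restr_def comp_map_def)
      qed
    qed
    have "dsum_norm {..<n} (HV W) (\<lambda>i x. \<Sum>j<n. \<phi> (F i j) x * h j x) = dsum_norm {..<n} (HV W) (\<lambda>i. restr W (\<lambda>y. G i (B y)))"
      by (rule dsum_norm_cong) (use eq in auto)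
    also have "\<dots> \<le> b * dsum_norm {..<n} (HV V) G"
      using BT.pullback[OF Gm] BT.a AT.W.hnorm_nonneg by (intro dsum_norm_le) auto
    also have "\<dots> \<le> b * dsum_norm {..<n} (HV V) g"
      unfolding G_def using mat_mult_bound[OF AT.V F le gd] BT.a by (intro mult_left_mono) auto
    also have "\<dots> \<le> b * (a * dsum_norm {..<n} (HV W) h)"
      using gm AT.a BT.a by (intro mult_left_mono dsum_norm_le) auto
    also have "\<dots> \<le> b * (a * 1)"
      using h1 AT.a BT.a by (intro mult_left_mono) auto
    finally show "ennreal (dsum_norm {..<n} (HV W) (\<lambda>i x. \<Sum>j<n. \<phi> (F i j) x * h j x)) \<le> ennreal (a * b)"
      by (intro ennreal_leI) (simp add: mult.commute)
  qed
qed

end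

section \<open>Row multiplier norms of linear maps\<close>

lemma clin_bounded_linear: "clin A \<Longrightarrow> bounded_linear A"
  using clin_linear linear_conv_bounded_linear by blast

text \<open>This expresses by kernels that the row has norm at most \<open>onorm A\<close>. The
  contraction kernel of degree 1 is multiplied by the kernel \<open>k\<close> of the space, and
  \<open>k * cinner x y + 1 = k\<close> absorbs the inner product.\<close>

lemma psd_row:
  assumes A: "clin A" and V: "V \<subseteq> ball 0 1"
  shows "psd V (\<lambda>x y. of_real ((onorm A)\<^sup>2) * da_kernel x y - cinner (A x) (A y) * da_kernel x y)"
proof -
  let ?o = "onorm A"
  have o: "0 \<le> ?o" using onorm_pos_le[OF clin_bounded_linear[OF A]] .
  have id: "clin (\<lambda>x :: complex ^ 'a. x)" by (simp add: clin_iff)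
  have "psd UNIV (\<lambda>x y. of_real (?o ^ (2 * 1)) * cinner x y ^ 1 - cinner (A x) (A y) ^ 1)"
    by (rule psd_contraction_power[OF vec.subspace_UNIV id A o]) (rule onorm[OF clin_bounded_linear[OF A]])
  then have "psd V (\<lambda>x y. of_real (?o ^ (2 * 1)) * cinner x y ^ 1 - cinner (A x) (A y) ^ 1)"
    by (rule psd_subset) simp
  then have "psd V (\<lambda>x y. da_kernel x y * (of_real (?o ^ (2 * 1)) * cinner x y ^ 1 - cinner (A x) (A y) ^ 1)
      + of_real (?o\<^sup>2) * 1)"
    by (intro psd_add psd_scale psd_one psd_da_kernel_mult V) auto
  then show ?thesis
  proof (rule psd_cong)
    fix x y assume "x \<in> V" "y \<in> V"
    then have "x \<in> ball 0 1" "y \<in> ball 0 1" using V by blast+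
    then have "1 - cinner x y \<noteq> 0" using cmod_cinner_less_1[of x y] by force
    then have e: "da_kernel x y * cinner x y + 1 = da_kernel x y"
      by (simp add: da_kernel_def field_simps)
    have "da_kernel x y * (of_real (?o ^ (2 * 1)) * cinner x y ^ 1 - cinner (A x) (A y) ^ 1) + of_real (?o\<^sup>2) * 1
        = of_real (?o\<^sup>2) * (da_kernel x y * cinner x y + 1) - cinner (A x) (A y) * da_kernel x y"
      by (simp add: algebra_simps power2_eq_square)
    then show "of_real (?o\<^sup>2) * da_kernel x y - cinner (A x) (A y) * da_kernel x y =
        da_kernel x y * (of_real (?o ^ (2 * 1)) * cinner x y ^ 1 - cinner (A x) (A y) ^ 1) + of_real (?o\<^sup>2) * 1"
      unfolding e by (simp add: power2_eq_square)
  qed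
qed

text \<open>By duality: the adjoint of the row multiplies the kernel function at \<open>x\<close> by
  \<open>cnj (A x $ i)\<close> in component \<open>i\<close>, and \<open>psd_row\<close> bounds it
  on combinations. \<open>rkhs_membership\<close> then yields membership and norm bound at
  once.\<close>

lemma row_mult_bound:
  fixes A :: "complex ^ 'd \<Rightarrow> complex ^ 'd"
  assumes A: "clin A" and V: "V \<subseteq> ball 0 1" and h: "h \<in> dsum UNIV (HV V)"
  shows "(\<lambda>x. \<Sum>i\<in>UNIV. restr V (\<lambda>x. A x $ i) x * h i x) \<in> funs (HV V) \<and>
    hnorm (HV V) (\<lambda>x. \<Sum>i\<in>UNIV. restr V (\<lambda>x. A x $ i) x * h i x) \<le> onorm A * dsum_norm UNIV (HV V) h"
proof -
  interpret V: rkhs V da_kernel "HV V" by (rule rkhs_HV[OF V])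
  let ?f = "\<lambda>x. \<Sum>i\<in>UNIV. restr V (\<lambda>x. A x $ i) x * h i x"
  have hm: "h i \<in> funs (HV V)" for i using h by (simp add: dsum_def)
  have o: "0 \<le> onorm A" using onorm_pos_le[OF clin_bounded_linear[OF A]] .
  show ?thesis
  proof (rule V.rkhs_membership)
    fix F c assume F: "finite F" "F \<subseteq> V"
    \<comment> \<open>Component \<open>i\<close> of the adjoint row applied to
      \<open>V.comb F c\<close>.\<close>
    define g where "g = (\<lambda>i. V.comb F (\<lambda>x. c x * cnj (A x $ i)))"
    have gm: "g i \<in> funs (HV V)" for i unfolding g_def by (rule V.comb_mem[OF F(2)])
    have "(\<Sum>i\<in>UNIV. ip (HV V) (h i) (g i)) = (\<Sum>i\<in>UNIV. \<Sum>x\<in>F. cnj (c x) * A x $ i * h i x)"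
      unfolding g_def using V.ip_comb[OF F(2) hm] by simp
    also have "\<dots> = (\<Sum>x\<in>F. cnj (c x) * (\<Sum>i\<in>UNIV. A x $ i * h i x))"
      by (subst sum.swap) (simp add: sum_distrib_left mult.assoc)
    also have "\<dots> = cnj (\<Sum>x\<in>F. c x * cnj (?f x))"
      unfolding cnj_sum complex_cnj_mult complex_cnj_cnj using F(2)
      by (intro sum.cong refl arg_cong2[where f = "(*)"]) (auto simp: restr_def)
    finally have e: "(\<Sum>i\<in>UNIV. ip (HV V) (h i) (g i)) = cnj (\<Sum>x\<in>F. c x * cnj (?f x))" .
    have "cmod (\<Sum>x\<in>F. c x * cnj (?f x)) = cmod (\<Sum>i\<in>UNIV. ip (HV V) (h i) (g i))"
      unfolding e complex_mod_cnj ..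
    also have "\<dots> \<le> (\<Sum>i\<in>UNIV. \<bar>hnorm (HV V) (h i)\<bar> * \<bar>hnorm (HV V) (g i)\<bar>)"
      by (rule order_trans[OF norm_sum], rule sum_mono) (use V.cauchy_schwarz[OF hm gm] hm gm in simp)
    also have "\<dots> \<le> L2_set (\<lambda>i. hnorm (HV V) (h i)) UNIV * L2_set (\<lambda>i. hnorm (HV V) (g i)) UNIV"
      by (rule L2_set_mult_ineq)
    also have "L2_set (\<lambda>i. hnorm (HV V) (h i)) UNIV = dsum_norm UNIV (HV V) h"
      by (simp add: L2_set_def dsum_norm_def)
    finally have le: "cmod (\<Sum>x\<in>F. c x * cnj (?f x)) \<le>
      dsum_norm UNIV (HV V) h * L2_set (\<lambda>i. hnorm (HV V) (g i)) UNIV" .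
    have L2: "L2_set (\<lambda>i. hnorm (HV V) (g i)) UNIV \<le> onorm A * hnorm (HV V) (V.comb F c)"
      unfolding L2_set_def
    proof (rule real_le_lsqrt)
      have "(\<Sum>i\<in>UNIV. (hnorm (HV V) (g i))\<^sup>2) =
          (\<Sum>i\<in>UNIV. Re (\<Sum>x\<in>F. \<Sum>y\<in>F. (c x * cnj (A x $ i)) * cnj (c y * cnj (A y $ i)) * da_kernel y x))"
        unfolding g_def V.hnorm_comb[OF F(2)] ..
      also have "\<dots> = Re (\<Sum>i\<in>UNIV. \<Sum>x\<in>F. \<Sum>y\<in>F. (c x * cnj (A x $ i)) * cnj (c y * cnj (A y $ i)) * da_kernel y x)"
        by simp
      also have "(\<Sum>i\<in>UNIV. \<Sum>x\<in>F. \<Sum>y\<in>F. (c x * cnj (A x $ i)) * cnj (c y * cnj (A y $ i)) * da_kernel y x)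
          = (\<Sum>x\<in>F. \<Sum>y\<in>F. \<Sum>i\<in>UNIV. (c x * cnj (A x $ i)) * cnj (c y * cnj (A y $ i)) * da_kernel y x)"
        by (subst sum.swap, intro sum.cong refl, rule sum.swap)
      also have "\<dots> = (\<Sum>x\<in>F. \<Sum>y\<in>F. c x * cnj (c y) * (cinner (A y) (A x) * da_kernel y x))"
        unfolding cinner_def sum_distrib_left sum_distrib_right by (simp add: mult_ac)
      finally have g2: "(\<Sum>i\<in>UNIV. (hnorm (HV V) (g i))\<^sup>2) =
        Re (\<Sum>x\<in>F. \<Sum>y\<in>F. c x * cnj (c y) * (cinner (A y) (A x) * da_kernel y x))" .
      have "0 \<le> Re (of_real ((onorm A)\<^sup>2) * (\<Sum>x\<in>F. \<Sum>y\<in>F. c x * cnj (c y) * da_kernel y x) -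
        (\<Sum>x\<in>F. \<Sum>y\<in>F. c x * cnj (c y) * (cinner (A y) (A x) * da_kernel y x)))"
        using psdD[OF psd_transpose[OF psd_row[OF A V]] F, of c] unfolding quadratic_form_diff .
      then have "(\<Sum>i\<in>UNIV. (hnorm (HV V) (g i))\<^sup>2) \<le> (onorm A)\<^sup>2 * (hnorm (HV V) (V.comb F c))\<^sup>2"
        unfolding g2 V.hnorm_comb[OF F(2)] by simp
      then show "(\<Sum>i\<in>UNIV. (hnorm (HV V) (g i))\<^sup>2) \<le> (onorm A * hnorm (HV V) (V.comb F c))\<^sup>2"
        by (simp add: power_mult_distrib)
    qed (use o V.comb_mem[OF F(2)] in simp)
    show "cmod (\<Sum>x\<in>F. c x * cnj (?f x)) \<le> onorm A * dsum_norm UNIV (HV V) h * hnorm (HV V) (V.comb F c)"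
      using order_trans[OF le mult_left_mono[OF L2 dsum_norm_nonneg]] by (simp only: mult_ac)
  qed (use o dsum_norm_nonneg[of UNIV "HV V" h] in \<open>auto simp: restr_def\<close>)
qed

lemma lin_mult_norm_le:
  fixes A :: "complex ^ 'd \<Rightarrow> complex ^ 'd"
  assumes A: "clin A" and V: "V \<subseteq> ball 0 1"
  shows "lin_mult_norm V A \<le> ennreal (onorm A)"
  unfolding lin_mult_norm_def row_mult_norm_def
proof (rule opnorm_le)
  fix h :: "'d \<Rightarrow> complex ^ 'd \<Rightarrow> complex"
  assume h: "h \<in> dsum UNIV (HV V)" "ennreal (dsum_norm UNIV (HV V) h) \<le> 1"
  have "onorm A * dsum_norm UNIV (HV V) h \<le> onorm A * 1"
    using h(2) onorm_pos_le[OF clin_bounded_linear[OF A]] by (intro mult_left_mono) auto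
  then show "ennreal (hnorm (HV V) (\<lambda>x. \<Sum>i\<in>UNIV. restr V (\<lambda>x. A x $ i) x * h i x)) \<le> ennreal (onorm A)"
    using row_mult_bound[OF A V h(1)] by (intro ennreal_leI) auto
qed

lemma coordinate_multiplier:
  fixes A :: "complex ^ 'd \<Rightarrow> complex ^ 'd"
  assumes A: "clin A" and V: "V \<subseteq> ball 0 1"
  shows "restr V (\<lambda>x. A x $ i) \<in> multipliers V"
  unfolding multipliers_def
proof (intro CollectI conjI allI impI ballI)
  interpret V: rkhs V da_kernel "HV V" by (rule rkhs_HV[OF V])
  fix h assume h: "h \<in> funs (HV V)"
  define h' where "h' = (\<lambda>j. if j = i then h else (\<lambda>x. 0))"
  have "h' \<in> dsum UNIV (HV V)" using h V.zero_mem by (simp add: dsum_def h'_def)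
  then have "(\<lambda>x. \<Sum>j\<in>UNIV. restr V (\<lambda>x. A x $ j) x * h' j x) \<in> funs (HV V)"
    using row_mult_bound[OF A V] by blast
  also have "(\<lambda>x. \<Sum>j\<in>UNIV. restr V (\<lambda>x. A x $ j) x * h' j x) = (\<lambda>x. restr V (\<lambda>x. A x $ i) x * h x)"
  proof
    fix x
    have "(\<Sum>j\<in>UNIV. restr V (\<lambda>x. A x $ j) x * h' j x) = (\<Sum>j\<in>UNIV. if j = i then restr V (\<lambda>x. A x $ i) x * h x else 0)"
      by (intro sum.cong) (auto simp: h'_def)
    then show "(\<Sum>j\<in>UNIV. restr V (\<lambda>x. A x $ j) x * h' j x) = restr V (\<lambda>x. A x $ i) x * h x" by simp
  qed
  finally show "(\<lambda>x. restr V (\<lambda>x. A x $ i) x * h x) \<in> funs (HV V)" .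
qed (simp add: restr_def)

text \<open>
  The difference quotients \<open>(k\<^bsub>tx\<^esub> - k\<^sub>0) / t\<close> tend to the linear functional \<open>\<langle>\<cdot>, x\<rangle>\<close> as \<open>t\<close> tends to 0.
\<close>

lemma linear_functional_bound:
  fixes V :: "(complex ^ 'd) set"
  assumes V: "V \<subseteq> ball 0 1" and star: "\<And>x t. x \<in> V \<Longrightarrow> 0 \<le> t \<Longrightarrow> t \<le> 1 \<Longrightarrow> complex_of_real t *s x \<in> V"
    and zero: "0 \<in> V" and l: "\<And>c x. l (c *s x) = c * l x" "\<And>x y. l (x + y) = l x + l y"
    and lH: "restr V l \<in> funs (HV V)" "hnorm (HV V) (restr V l) \<le> L" and y: "y \<in> vec.span V"
  shows "cmod (l y) \<le> L * norm y"
proof -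
  interpret V: rkhs V da_kernel "HV V" by (rule rkhs_HV[OF V])
  obtain F u where F: "finite F" "F \<subseteq> V" "y = (\<Sum>x\<in>F. u x *s x)"
    using y unfolding vec.span_explicit by blast
  have l_zero: "l 0 = 0" using l(1)[of 0 0] by simp
  have l_sum: "l (\<Sum>x\<in>G. u x *s x) = (\<Sum>x\<in>G. u x * l x)" for G
    by (induction G rule: infinite_finite_induct) (auto simp: l l_zero)
  \<comment> \<open>As \<open>y\<close> is the combination of the points \<open>x\<close> with
    coefficients \<open>u x\<close>, the sums \<open>g t\<close> approximate the function
    \<open>cinner z y\<close> of \<open>z\<close>. Its conjugate linearity in \<open>y\<close>
    explains the conjugates \<open>cnj (u x)\<close>.\<close>
  define q where "q = (\<lambda>t x z. cnj (u x) / of_real t * (V.kf (of_real t *s x) z - V.kf 0 z))"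
  define g where "g = (\<lambda>t z. \<Sum>x\<in>F. q t x z)"
  \<comment> \<open>The squared norm of \<open>g t\<close> in closed form, whose limit for
    \<open>t\<close> tending to 0 is the squared norm of \<open>y\<close>.\<close>
  define N where "N = (\<lambda>t. Re (\<Sum>x\<in>F. \<Sum>x'\<in>F. cnj (u x) * u x' * (cinner x' x / (1 - of_real (t\<^sup>2) * cinner x' x))))"
  have bound: "(cmod (l y))\<^sup>2 \<le> L\<^sup>2 * N t" if t: "0 < t" "t \<le> 1" for t
  proof -
    have tx: "of_real t *s x \<in> V" if "x \<in> F" for x using star[of x t] t F(2) that by auto
    have km: "(\<lambda>z. V.kf (of_real t *s x) z - V.kf 0 z) \<in> funs (HV V)" if "x \<in> F" for x
      by (intro V.diff_mem V.kf_mem tx that zero)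
    have qm: "q t x \<in> funs (HV V)" if "x \<in> F" for x
      unfolding q_def by (rule V.scale_mem[OF km[OF that]])
    have gm: "g t \<in> funs (HV V)" unfolding g_def by (intro V.sum_mem qm)
    have ipq: "ip (HV V) f (q t x) = u x / of_real t * (f (of_real t *s x) - f 0)"
      if "x \<in> F" "f \<in> funs (HV V)" for f x
      unfolding q_def V.ip_scale_right[OF km[OF that(1)] that(2)]
        V.ip_diff_right[OF V.kf_mem[OF tx[OF that(1)]] V.kf_mem[OF zero] that(2)]
      using that tx zero by (simp add: V.reproducing)
    have ipg: "ip (HV V) f (g t) = (\<Sum>x\<in>F. u x / of_real t * (f (of_real t *s x) - f 0))"
      if "f \<in> funs (HV V)" for f
      unfolding g_def using that qm by (simp add: V.ip_sum_right ipq)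
    have "ip (HV V) (restr V l) (g t) = (\<Sum>x\<in>F. u x / of_real t * (l (of_real t *s x) - l 0))"
      unfolding ipg[OF lH(1)] using tx zero by (intro sum.cong) (auto simp: restr_def)
    also have "\<dots> = l y"
      unfolding F(3) l_sum using t by (intro sum.cong) (simp_all add: l(1) l_zero)
    finally have "cmod (l y) \<le> hnorm (HV V) (restr V l) * hnorm (HV V) (g t)"
      using V.cauchy_schwarz[OF lH(1) gm] by simp
    also have "\<dots> \<le> L * hnorm (HV V) (g t)" using lH(2) gm by (intro mult_right_mono) auto
    finally have le: "cmod (l y) \<le> L * hnorm (HV V) (g t)" .
    have "ip (HV V) (g t) (g t) = (\<Sum>x'\<in>F. u x' / of_real t * (g t (of_real t *s x') - g t 0))"
      by (rule ipg[OF gm])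
    also have "\<dots> = (\<Sum>x'\<in>F. \<Sum>x\<in>F. cnj (u x) * u x' * (cinner x' x / (1 - of_real (t\<^sup>2) * cinner x' x)))"
    proof (rule sum.cong[OF refl])
      fix x' assume x': "x' \<in> F"
      have "u x' / of_real t * (q t x (of_real t *s x') - q t x 0) =
          cnj (u x) * u x' * (cinner x' x / (1 - of_real (t\<^sup>2) * cinner x' x))" if x: "x \<in> F" for x
      proof -
        define w where "w = cinner x' x"
        have "of_real t *s x' \<in> ball 0 1" "of_real t *s x \<in> ball 0 1" using tx x x' V by blast+
        from cmod_cinner_less_1[OF this] have nz: "1 - of_real (t\<^sup>2) * w \<noteq> 0"
          by (auto simp: cinner_scale_left cinner_scale_right w_def power2_eq_square mult.assoc)
        have "V.kf (of_real t *s x) (of_real t *s x') = 1 / (1 - of_real (t\<^sup>2) * w)"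
          using tx[OF x'] by (simp add: V.kf_apply da_kernel_def cinner_scale_left cinner_scale_right w_def
              power2_eq_square mult.assoc)
        moreover have "V.kf (of_real t *s x) 0 = 1" "V.kf 0 (of_real t *s x') = 1" "V.kf 0 0 = 1"
          using tx[OF x'] zero by (simp_all add: V.kf_apply da_kernel_def)
        ultimately have "u x' / of_real t * (q t x (of_real t *s x') - q t x 0) =
            u x' / of_real t * (cnj (u x) / of_real t * (1 / (1 - of_real (t\<^sup>2) * w) - 1))"
          by (simp add: q_def)
        \<comment> \<open>The constant terms of the four kernel values cancel, leaving a factor
          \<open>t\<^sup>2\<close> that offsets the two divisions by \<open>t\<close>.\<close>
        also have "1 / (1 - of_real (t\<^sup>2) * w) - 1 = of_real (t\<^sup>2) * w / (1 - of_real (t\<^sup>2) * w)"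
          using nz by (simp add: field_simps)
        also have "u x' / of_real t * (cnj (u x) / of_real t * (of_real (t\<^sup>2) * w / (1 - of_real (t\<^sup>2) * w)))
            = cnj (u x) * u x' * (w / (1 - of_real (t\<^sup>2) * w))"
          using t by (simp add: power2_eq_square)
        finally show ?thesis by (simp add: w_def)
      qed
      then show "u x' / of_real t * (g t (of_real t *s x') - g t 0) =
          (\<Sum>x\<in>F. cnj (u x) * u x' * (cinner x' x / (1 - of_real (t\<^sup>2) * cinner x' x)))"
        by (simp add: g_def sum_subtractf[symmetric] sum_distrib_left)
    qed
    also have "\<dots> = (\<Sum>x\<in>F. \<Sum>x'\<in>F. cnj (u x) * u x' * (cinner x' x / (1 - of_real (t\<^sup>2) * cinner x' x)))"
      by (rule sum.swap)
    finally have "(hnorm (HV V) (g t))\<^sup>2 = N t" unfolding V.hnorm_sq[OF gm] N_def by simp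
    moreover have "(cmod (l y))\<^sup>2 \<le> (L * hnorm (HV V) (g t))\<^sup>2" by (rule power_mono[OF le]) simp
    ultimately show ?thesis by (simp add: power_mult_distrib)
  qed
  have "(\<lambda>n. N (1 / real (Suc n))) \<longlonglongrightarrow>
      Re (\<Sum>x\<in>F. \<Sum>x'\<in>F. cnj (u x) * u x' * (cinner x' x / (1 - of_real (0\<^sup>2) * cinner x' x)))"
    unfolding N_def by (intro tendsto_intros LIMSEQ_Suc[OF lim_inverse_n']) simp
  also have "(\<Sum>x\<in>F. \<Sum>x'\<in>F. cnj (u x) * u x' * (cinner x' x / (1 - of_real (0\<^sup>2) * cinner x' x))) = cinner y y"
    unfolding F(3) by (simp add: cinner_sum_left cinner_sum_right cinner_scale_left cinner_scale_right sum_distrib_left mult_ac)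
  finally have lim: "(\<lambda>n. L\<^sup>2 * N (1 / real (Suc n))) \<longlonglongrightarrow> L\<^sup>2 * (norm y)\<^sup>2"
    by (intro tendsto_mult_left) (simp add: cinner_self)
  have "(cmod (l y))\<^sup>2 \<le> L\<^sup>2 * (norm y)\<^sup>2"
    by (rule LIMSEQ_le_const[OF lim]) (use bound in auto)
  then have sq: "(cmod (l y))\<^sup>2 \<le> (L * norm y)\<^sup>2" by (simp add: power_mult_distrib)
  have "0 \<le> L" using V.hnorm_nonneg[OF lH(1)] lH(2) by linarith
  then show ?thesis using power2_le_imp_le[OF sq] by simp
qed

text \<open>The row is tested on constants \<open>a i\<close>, multiples of the kernel function at
  0, where \<open>a\<close> is the conjugate of the normalized vector \<open>A y\<close>. The output
  is a linear functional \<open>l\<close> with \<open>l y = norm (A y)\<close>, to which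
  \<open>linear_functional_bound\<close> applies.\<close>

lemma lin_mult_norm_ge:
  fixes A :: "complex ^ 'd \<Rightarrow> complex ^ 'd"
  assumes A: "clin A" and V: "V \<subseteq> ball 0 1"
    and star: "\<And>x t. x \<in> V \<Longrightarrow> 0 \<le> t \<Longrightarrow> t \<le> 1 \<Longrightarrow> complex_of_real t *s x \<in> V"
    and zero: "0 \<in> V" and span: "vec.span V = UNIV" and L: "0 \<le> L" "lin_mult_norm V A \<le> ennreal L"
  shows "norm (A y) \<le> L * norm y"
proof (cases "A y = 0")
  case False
  interpret V: rkhs V da_kernel "HV V" by (rule rkhs_HV[OF V])
  define a where "a = (\<lambda>i. cnj (A y $ i) / of_real (norm (A y)))"
  define l where "l = (\<lambda>x. \<Sum>i\<in>UNIV. A x $ i * a i)"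
  define h where "h = (\<lambda>i x. a i * V.kf 0 x)"
  note k0 = hnorm_kf_zero[OF V zero]
  have hd: "h \<in> dsum UNIV (HV V)"
    unfolding dsum_def h_def using V.scale_mem[OF V.kf_mem[OF zero]] by blast
  have "dsum_norm UNIV (HV V) h = sqrt (\<Sum>i\<in>UNIV. (cmod (a i))\<^sup>2)"
    by (simp add: dsum_norm_def h_def V.hnorm_scale[OF V.kf_mem[OF zero]] k0)
  also have "(\<Sum>i\<in>UNIV. (cmod (a i))\<^sup>2) = (\<Sum>i\<in>UNIV. (cmod (A y $ i))\<^sup>2) / (norm (A y))\<^sup>2"
    by (simp add: a_def norm_divide power_divide sum_divide_distrib)
  also have "\<dots> = 1" using False by (simp add: norm_vec_sq[symmetric])
  finally have h1: "dsum_norm UNIV (HV V) h = 1" by simp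
  have f: "(\<lambda>x. \<Sum>i\<in>UNIV. restr V (\<lambda>x. A x $ i) x * h i x) = restr V l"
    by (auto simp: restr_def l_def h_def V.kf_apply da_kernel_def)
  have "ennreal (hnorm (HV V) (\<lambda>x. \<Sum>i\<in>UNIV. restr V (\<lambda>x. A x $ i) x * h i x)) \<le> lin_mult_norm V A"
    unfolding lin_mult_norm_def row_mult_norm_def
    by (rule opnorm_ge[where T = "\<lambda>h x. \<Sum>i\<in>UNIV. restr V (\<lambda>x. A x $ i) x * h i x"
          and N' = "\<lambda>g. ennreal (hnorm (HV V) g)"]) (use hd h1 in auto)
  also note L(2)
  finally have "hnorm (HV V) (restr V l) \<le> L" using L(1) by (simp add: f)
  moreover have "restr V l \<in> funs (HV V)" using row_mult_bound[OF A V hd] unfolding f by blast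
  ultimately have "cmod (l y) \<le> L * norm y"
    by (intro linear_functional_bound[OF V star zero])
      (auto simp: l_def clin_add[OF A] clin_scale[OF A] distrib_right sum.distrib sum_distrib_left mult.assoc span)
  moreover have "l y = of_real (norm (A y))"
  proof -
    have "l y = (\<Sum>i\<in>UNIV. A y $ i * cnj (A y $ i)) / of_real (norm (A y))"
      by (simp add: l_def a_def sum_divide_distrib)
    also have "(\<Sum>i\<in>UNIV. A y $ i * cnj (A y $ i)) = of_real ((norm (A y))\<^sup>2)"
      using cinner_self[of "A y"] by (simp add: cinner_def)
    finally show ?thesis using False by (simp add: power2_eq_square)
  qed
  ultimately show ?thesis by simp
qed (use L in simp)

lemma lin_mult_norm_eq:
  fixes A :: "complex ^ 'd \<Rightarrow> complex ^ 'd"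
  assumes A: "clin A" and V: "V \<subseteq> ball 0 1"
    and star: "\<And>x t. x \<in> V \<Longrightarrow> 0 \<le> t \<Longrightarrow> t \<le> 1 \<Longrightarrow> complex_of_real t *s x \<in> V"
    and zero: "0 \<in> V" and span: "vec.span V = UNIV"
  shows "lin_mult_norm V A = ennreal (onorm A)"
proof (rule antisym)
  show le: "lin_mult_norm V A \<le> ennreal (onorm A)" by (rule lin_mult_norm_le[OF A V])
  then have fin: "lin_mult_norm V A < \<infinity>" by (simp add: le_less_trans)
  define L where "L = enn2real (lin_mult_norm V A)"
  have L: "lin_mult_norm V A = ennreal L" "0 \<le> L" using fin by (simp_all add: L_def)
  have "norm (A y) \<le> L * norm y" for y
    using L(1) by (intro lin_mult_norm_ge[OF A V star zero span L(2)]) auto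
  then have "onorm A \<le> L" using onorm_bound[OF L(2)] by blast
  then show "ennreal (onorm A) \<le> lin_mult_norm V A" unfolding L(1) by (rule ennreal_leI)
qed

text \<open>\<open>cb_norm\<close> is defined by square matrices, so the row is made the first row
  of an otherwise zero matrix.\<close>

lemma row_as_matrix:
  fixes r :: "'d::finite \<Rightarrow> complex ^ 'd \<Rightarrow> complex"
  assumes V: "V \<subseteq> ball 0 1" and r: "\<And>i. r i \<in> multipliers V" and e: "bij_betw e {..<n} (UNIV :: 'd set)" and n: "0 < n"
  shows "mat_mult_norm V n (\<lambda>i j. if i = 0 then r (e j) else (\<lambda>x. 0)) = row_mult_norm V r"
proof -
  interpret V: rkhs V da_kernel "HV V" by (rule rkhs_HV[OF V])
  let ?F = "\<lambda>i j. if i = 0 then r (e j) else (\<lambda>x. 0)"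
  have norm_eq: "dsum_norm {..<n} (HV V) (\<lambda>i x. \<Sum>j<n. ?F i j x * h (e j) x) = hnorm (HV V) (\<lambda>x. \<Sum>i\<in>UNIV. r i x * h i x)"
    if h: "h \<in> dsum UNIV (HV V)" for h
  proof -
    have row: "(\<lambda>x. \<Sum>j<n. r (e j) x * h (e j) x) = (\<lambda>x. \<Sum>i\<in>UNIV. r i x * h i x)"
      using sum.reindex_bij_betw[OF e, of "\<lambda>i. r i _ * h i _"] by auto
    have mem: "(\<lambda>x. \<Sum>i\<in>UNIV. r i x * h i x) \<in> funs (HV V)"
      using h r by (intro V.sum_mem multipliersD(1)) (auto simp: dsum_def)
    have "(\<Sum>i<n. (hnorm (HV V) (\<lambda>x. \<Sum>j<n. ?F i j x * h (e j) x))\<^sup>2) =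
        (\<Sum>i\<in>{0::nat}. (hnorm (HV V) (\<lambda>x. \<Sum>j<n. ?F i j x * h (e j) x))\<^sup>2)"
      by (rule sum.mono_neutral_right) (use n in auto)
    then show ?thesis using mem by (simp add: dsum_norm_def row)
  qed
  have dn: "dsum_norm {..<n} (HV V) (\<lambda>j. h (e j)) = dsum_norm UNIV (HV V) h" for h
    unfolding dsum_norm_def using sum.reindex_bij_betw[OF e, of "\<lambda>i. (hnorm (HV V) (h i))\<^sup>2"] by simp
  show ?thesis
  proof (rule antisym)
    show "mat_mult_norm V n ?F \<le> row_mult_norm V r"
      unfolding mat_mult_norm_def
    proof (rule opnorm_le)
      fix g assume g: "g \<in> dsum {..<n} (HV V)" "ennreal (dsum_norm {..<n} (HV V) g) \<le> 1"
      define h where "h = (\<lambda>i. g (inv_into {..<n} e i))"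
      have he: "h (e j) = g j" if "j < n" for j
        using e that by (simp add: h_def bij_betw_inv_into_left)
      have hd: "h \<in> dsum UNIV (HV V)"
        using g(1) bij_betw_apply[OF bij_betw_inv_into[OF e]] by (auto simp: dsum_def h_def)
      have "dsum_norm {..<n} (HV V) (\<lambda>j. h (e j)) = dsum_norm {..<n} (HV V) g"
        by (rule dsum_norm_cong) (simp add: he)
      then have h1: "ennreal (dsum_norm UNIV (HV V) h) \<le> 1" using g(2) by (simp add: dn)
      have "dsum_norm {..<n} (HV V) (\<lambda>i x. \<Sum>j<n. ?F i j x * g j x) =
          dsum_norm {..<n} (HV V) (\<lambda>i x. \<Sum>j<n. ?F i j x * h (e j) x)"
        by (simp add: he cong: sum.cong_simp)
      also have "\<dots> = hnorm (HV V) (\<lambda>x. \<Sum>i\<in>UNIV. r i x * h i x)" by (rule norm_eq[OF hd])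
      finally show "ennreal (dsum_norm {..<n} (HV V) (\<lambda>i x. \<Sum>j<n. ?F i j x * g j x)) \<le> row_mult_norm V r"
        unfolding row_mult_norm_def using hd h1
        by (simp only:) (rule opnorm_ge[where T = "\<lambda>h x. \<Sum>i\<in>UNIV. r i x * h i x" and N' = "\<lambda>g. ennreal (hnorm (HV V) g)"])
    qed
    show "row_mult_norm V r \<le> mat_mult_norm V n ?F"
      unfolding row_mult_norm_def
    proof (rule opnorm_le)
      fix h :: "'d \<Rightarrow> complex ^ 'd \<Rightarrow> complex"
      assume h: "h \<in> dsum UNIV (HV V)" "ennreal (dsum_norm UNIV (HV V) h) \<le> 1"
      have "ennreal (dsum_norm {..<n} (HV V) (\<lambda>i x. \<Sum>j<n. ?F i j x * h (e j) x)) \<le> mat_mult_norm V n ?F"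
        unfolding mat_mult_norm_def
        by (rule opnorm_ge[where T = "\<lambda>h i x. \<Sum>j<n. ?F i j x * h j x" and x = "\<lambda>j. h (e j)"
              and N' = "\<lambda>g. ennreal (dsum_norm {..<n} (HV V) g)"]) (use h dn[of h] in \<open>auto simp: dsum_def\<close>)
      then show "ennreal (hnorm (HV V) (\<lambda>x. \<Sum>i\<in>UNIV. r i x * h i x)) \<le> mat_mult_norm V n ?F"
        unfolding norm_eq[OF h(1)] .
    qed
  qed
qed

text \<open>Apply \<open>\<phi>\<close> to the row of coordinate functions.\<close>

lemma cb_norm_ge_lin_mult_norm:
  fixes V W :: "(complex ^ 'd) set"
  assumes V: "V \<subseteq> ball 0 1" and W: "W \<subseteq> ball 0 1" and B: "clin B" "\<And>y. y \<in> W \<Longrightarrow> B y \<in> V"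
    and \<phi>: "\<And>f. f \<in> multipliers V \<Longrightarrow> \<phi> f = comp_map W B f"
  shows "lin_mult_norm W B \<le> cb_norm V W \<phi>"
proof -
  interpret V: rkhs V da_kernel "HV V" by (rule rkhs_HV[OF V])
  define n where "n = CARD('d)"
  have n: "0 < n" by (simp add: n_def)
  have id: "clin (\<lambda>x :: complex ^ 'd. x)" by (simp add: clin_iff)
  obtain e where e: "bij_betw e {..<n} (UNIV :: 'd set)"
    using ex_bij_betw_nat_finite[of "UNIV :: 'd set"] by (auto simp: n_def atLeast0LessThan)
  let ?r = "\<lambda>i. restr V (\<lambda>x. x $ i)" and ?s = "\<lambda>i. restr W (\<lambda>y. B y $ i)"
  have r: "?r i \<in> multipliers V" for i using coordinate_multiplier[OF id V] .
  have s: "?s i \<in> multipliers W" for i using coordinate_multiplier[OF B(1) W] .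
  have z: "(\<lambda>x. 0) \<in> multipliers V"
    by (simp add: multipliers_def V.zero_mem)
  let ?F = "\<lambda>i j. if i = 0 then ?r (e j) else (\<lambda>x. 0)"
  \<comment> \<open>The row of coordinate functions has norm at most 1, so it is admissible in the
    supremum that defines \<open>cb_norm\<close>.\<close>
  have "onorm (\<lambda>x :: complex ^ 'd. x) \<le> 1" by (rule onorm_bound) auto
  then have "row_mult_norm V ?r \<le> 1"
    using order_trans[OF lin_mult_norm_le[OF id V] ennreal_leI[of _ 1]] by (simp add: lin_mult_norm_def)
  then have F1: "mat_mult_norm V n ?F \<le> 1" unfolding row_as_matrix[where r = ?r, OF V r e n] .
  have "comp_map W B (?r i) = ?s i" for i using B(2) by (auto simp: comp_map_def restr_def)
  moreover have "comp_map W B (\<lambda>x. 0) = (\<lambda>x. 0)" by (auto simp: comp_map_def restr_def)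
  ultimately have "\<phi> (?F i j) = (if i = 0 then ?s (e j) else (\<lambda>x. 0))" for i j :: nat
    using \<phi>[OF r] \<phi>[OF z] by (cases "i = 0") (simp_all only: if_True if_False simp_thms)
  then have "mat_mult_norm W n (\<lambda>i j. \<phi> (?F i j)) = lin_mult_norm W B"
    using row_as_matrix[where r = ?s, OF W s e n] by (simp add: lin_mult_norm_def)
  moreover have "mat_mult_norm W n (\<lambda>i j. \<phi> (?F i j)) \<le>
      opnorm {F. \<forall>i<n. \<forall>j<n. F i j \<in> multipliers V} (mat_mult_norm V n) (mat_mult_norm W n) (\<lambda>F i j. \<phi> (F i j))"
    by (rule opnorm_ge[where T = "\<lambda>F i j. \<phi> (F i j)"]) (use r z F1 in auto)
  moreover have "\<dots> \<le> cb_norm V W \<phi>"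
    unfolding cb_norm_def by (rule SUP_upper) simp
  ultimately show ?thesis by simp
qed

section \<open>Homogeneous varieties\<close>

lemma homogeneous_poly_scale:
  assumes "homogeneous_poly p"
  shows "\<exists>m. \<forall>c z. p (c *s z) = c ^ m * p z"
proof -
  obtain m a where p: "p = (\<lambda>z. \<Sum>\<alpha> | (\<Sum>i\<in>UNIV. \<alpha> i) = (m::nat). a \<alpha> * (\<Prod>i\<in>UNIV. (z $ i) ^ \<alpha> i))"
    using assms unfolding homogeneous_poly_def by blast
  have "p (c *s z) = c ^ m * p z" for c z
    unfolding p sum_distrib_left
    by (intro sum.cong refl) (auto simp: power_mult_distrib prod.distrib power_sum[symmetric])
  then show ?thesis by blast
qed

lemma homogeneous_poly_polys:
  fixes p :: "complex ^ 'd \<Rightarrow> complex"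
  assumes "homogeneous_poly p"
  shows "(\<lambda>y. p (\<chi> i. y i)) \<in> polys UNIV"
proof -
  obtain m a where p: "p = (\<lambda>z. \<Sum>\<alpha> | (\<Sum>i\<in>UNIV. \<alpha> i) = (m::nat). a \<alpha> * (\<Prod>i\<in>UNIV. (z $ i) ^ \<alpha> i))"
    using assms unfolding homogeneous_poly_def by blast
  have "(\<lambda>y. \<Sum>\<alpha> | (\<Sum>i\<in>UNIV. \<alpha> i) = m. a \<alpha> * (\<Prod>i\<in>UNIV. y i ^ \<alpha> i)) \<in> polys (UNIV :: 'd set)"
    unfolding polys_def
    by (intro falg_sum falg.mult falg.const falg_prod falg_power polys_coord[unfolded polys_def]) auto
  then show ?thesis by (simp add: p)
qed

lemma homogeneous_variety_ball: "homogeneous_variety V \<Longrightarrow> V \<subseteq> ball 0 1"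
  by (auto simp: homogeneous_variety_def)

lemma homogeneous_variety_scale:
  assumes V: "homogeneous_variety V" and x: "x \<in> V" "c *s x \<in> ball 0 1"
  shows "c *s x \<in> V"
proof -
  obtain P where P: "\<forall>p\<in>P. homogeneous_poly p" "V = {z \<in> ball 0 1. \<forall>p\<in>P. p z = 0}"
    using V unfolding homogeneous_variety_def by blast
  have "p (c *s x) = 0" if "p \<in> P" for p
    using homogeneous_poly_scale[of p] P x that by auto
  then show ?thesis using P x by simp
qed

text \<open>Scaling \<open>x\<close> until \<open>A x\<close> reaches the unit sphere would take \<open>x\<close> out of the ball.\<close>

lemma norm_le_of_image_in_ball:
  assumes V: "homogeneous_variety V" and A: "clin A" "\<And>x. x \<in> V \<Longrightarrow> A x \<in> ball 0 1" and x: "x \<in> V"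
  shows "norm (A x) \<le> norm x"
proof (rule ccontr)
  assume "\<not> norm (A x) \<le> norm x"
  then have lt: "norm x < norm (A x)" by simp
  let ?c = "complex_of_real (1 / norm (A x))"
  have pos: "norm (A x) > 0" using lt norm_ge_zero[of x] by linarith
  have "norm (?c *s x) = norm x / norm (A x)" using pos by (simp add: norm_cscale norm_divide)
  then have "?c *s x \<in> ball 0 1" using lt pos by simp
  then have "?c *s x \<in> V" by (rule homogeneous_variety_scale[OF V x])
  then have "norm (A (?c *s x)) < 1" using A(2) by force
  moreover have "norm (A (?c *s x)) = 1" using pos by (simp add: clin_scale[OF A(1)] norm_cscale norm_divide)
  ultimately show False by simp
qed

lemma HV_ball_subset: "f \<in> funs (HV (ball 0 1)) \<Longrightarrow> f \<in> funs drury_arveson"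
proof -
  assume "f \<in> funs (HV (ball 0 1))"
  then obtain g where g: "g \<in> kernel_closed_span (ball 0 1)" "f = restr (ball 0 1) g"
    using funs_HV[of "ball 0 1"] by auto
  have gm: "g \<in> funs drury_arveson" using kernel_closed_spanD(1)[OF _ g(1)] by simp
  have "f = g" using DA.outside[OF gm] by (auto simp: g(2) restr_def)
  then show ?thesis using gm by simp
qed

text \<open>Coordinates are multipliers of the space on the ball, hence so are polynomials; applied
  to the constant 1 they land in the space. Varieties being zero sets of such functions, polynomials
  may cut out subvarieties.\<close>

lemma polys_drury_arveson:
  fixes f :: "('d::finite \<Rightarrow> complex) \<Rightarrow> complex"
  assumes f: "f \<in> polys UNIV"
  shows "restr (ball 0 1) (\<lambda>x :: complex ^ 'd. f (\<lambda>i. x $ i)) \<in> funs drury_arveson"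
proof -
  let ?B = "ball 0 1 :: (complex ^ 'd) set"
  interpret B: rkhs ?B da_kernel "HV ?B" by (rule rkhs_HV) simp
  have id: "clin (\<lambda>x :: complex ^ 'd. x)" by (simp add: clin_iff)
  have mult: "(\<lambda>x. f (\<lambda>i. x $ i) * h x) \<in> funs (HV ?B)" if "h \<in> funs (HV ?B)" for h
    using f that unfolding polys_def
  proof (induction arbitrary: h)
    case (const c)
    then show ?case by (rule B.scale_mem)
  next
    case (gen g)
    then obtain i where i: "g = coord i" by blast
    have "(\<lambda>x. restr ?B (\<lambda>x. x $ i) x * h x) \<in> funs (HV ?B)"
      by (rule multipliersD(1)[OF coordinate_multiplier[OF id] gen(2)]) simp
    also have "(\<lambda>x. restr ?B (\<lambda>x. x $ i) x * h x) = (\<lambda>x. g (\<lambda>i. x $ i) * h x)"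
      using B.outside[OF gen(2)] by (auto simp: restr_def i coord_def)
    finally show ?case .
  next
    case (add f g)
    then show ?case by (simp add: distrib_right B.add_mem)
  next
    case (mult f g)
    then show ?case by (simp add: mult.assoc)
  qed
  have "(0 :: complex ^ 'd) \<in> ?B" by simp
  from mult[OF B.kf_mem[OF this]] have "(\<lambda>x. f (\<lambda>i. x $ i) * B.kf 0 x) \<in> funs (HV ?B)" .
  also have "(\<lambda>x. f (\<lambda>i. x $ i) * B.kf 0 x) = restr ?B (\<lambda>x. f (\<lambda>i. x $ i))"
    by (auto simp: B.kf_def restr_def da_kernel_def)
  finally show ?thesis by (rule HV_ball_subset)
qed

text \<open>The zero sets of \<open>f\<close> and \<open>g\<close> inside \<open>C\<close> are
  varieties that cover \<open>C\<close>, so one of them is all of \<open>C\<close>.\<close>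

lemma irreducible_variety_prime:
  fixes C :: "(complex ^ 'd) set"
  assumes C: "irreducible_variety C" and f: "f \<in> polys UNIV" and g: "g \<in> polys UNIV"
    and fg: "\<And>x. x \<in> C \<Longrightarrow> f (\<lambda>i. x $ i) * g (\<lambda>i. x $ i) = 0"
  shows "(\<forall>x\<in>C. f (\<lambda>i. x $ i) = 0) \<or> (\<forall>x\<in>C. g (\<lambda>i. x $ i) = 0)"
proof -
  obtain S where S: "S \<noteq> {}" "S \<subseteq> funs drury_arveson" "C = {z \<in> ball 0 1. \<forall>s\<in>S. s z = 0}"
    using C unfolding irreducible_variety_def variety_def by blast
  have sub: "variety {x \<in> C. p (\<lambda>i. x $ i) = 0}" if "p \<in> polys UNIV" for p
    unfolding variety_def
  proof (intro exI[of _ "insert (restr (ball 0 1) (\<lambda>x. p (\<lambda>i. x $ i))) S"] conjI)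
    show "insert (restr (ball 0 1) (\<lambda>x. p (\<lambda>i. x $ i))) S \<subseteq> funs drury_arveson"
      using S(2) polys_drury_arveson[OF that] by blast
  qed (use S(1,3) in \<open>auto simp: restr_def\<close>)
  let ?V1 = "{x \<in> C. f (\<lambda>i. x $ i) = 0}" and ?V2 = "{x \<in> C. g (\<lambda>i. x $ i) = 0}"
  have "C = ?V1 \<union> ?V2" using fg by auto
  then have "?V1 = C \<or> ?V2 = C"
    using C sub[OF f] sub[OF g] unfolding irreducible_variety_def by blast
  then show ?thesis by blast
qed

lemma clin_coords:
  fixes A :: "complex ^ 'd \<Rightarrow> complex ^ 'd"
  assumes "clin A"
  shows "A x $ k = (\<Sum>i\<in>UNIV. x $ i * A (axis i 1) $ k)"
proof -
  have "x = (\<Sum>i\<in>UNIV. x $ i *s axis i 1)"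
    by (simp add: vec_eq_iff axis_def if_distrib[of "\<lambda>a. _ * a"] cong: if_cong)
  then have "A x = (\<Sum>i\<in>UNIV. x $ i *s A (axis i 1))"
    by (metis (no_types, lifting) clin_scale[OF assms] clin_sum[OF assms] sum.cong)
  then show ?thesis by simp
qed

text \<open>
  The sesquilinear form \<open>\<langle>Ax, Ay\<rangle> - \<langle>x, y\<rangle>\<close> vanishes on the diagonal of the Zariski closure of \<open>C\<close>,
  hence on all pairs of its points.
\<close>

lemma isometric_on_span_irreducible:
  fixes C V :: "(complex ^ 'd) set"
  assumes V: "homogeneous_variety V" and A: "clin A" and iso: "isometric_on A V"
    and C: "irreducible_variety C" "C \<subseteq> V"
  shows "isometric_on A (vec.span C)"
proof -
  obtain P where P: "\<forall>p\<in>P. homogeneous_poly p" "V = {z \<in> ball 0 1. \<forall>p\<in>P. p z = 0}"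
    using V unfolding homogeneous_variety_def by blast
  define \<iota> where "\<iota> = (\<lambda>(x :: complex ^ 'd) i. x $ i)"
  \<comment> \<open>\<open>C\<close> is confined to the ball, while the algebraic argument takes
    place on its Zariski closure in the whole space.\<close>
  define Y where "Y = {y. \<forall>p\<in>polys UNIV. (\<forall>x\<in>C. p (\<iota> x) = 0) \<longrightarrow> p y = 0}"
  have CY: "\<iota> x \<in> Y" if "x \<in> C" for x using that by (auto simp: Y_def)
  have closed: "poly_closed UNIV Y" unfolding poly_closed_def Y_def by blast
  define R where "R = (\<lambda>k (y :: 'd \<Rightarrow> complex). \<Sum>i\<in>UNIV. y i * A (axis i 1) $ k)"
  have R: "R k \<in> polys UNIV" for k
    unfolding R_def polys_def
    by (intro falg_sum falg.mult falg.const polys_coord[unfolded polys_def]) auto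
  define Q where "Q = (\<lambda>w. (\<Sum>k\<in>UNIV. R k (fst w) * cnj (R k (snd w))) - (\<Sum>i\<in>UNIV. fst w i * cnj (snd w i)))"
  have Q: "Q \<in> sespolys UNIV"
    unfolding Q_def sespolys_def
    by (intro falg_diff falg_sum falg.mult sespolys_of_polys[unfolded sespolys_def] R polys_coord) auto
  have Q_eq: "Q (\<iota> x, \<iota> y) = cinner (A x) (A y) - cinner x y" for x y
    by (simp add: Q_def R_def \<iota>_def cinner_def clin_coords[OF A, of x] clin_coords[OF A, of y])
  \<comment> \<open>The homogeneous equations of \<open>V\<close> hold on \<open>C\<close>, hence on
    \<open>Y\<close>, so a point of \<open>Y\<close> scaled into the ball lies in \<open>V\<close>,
    where \<open>A\<close> is isometric. The scaling invariance comes from \<open>V\<close> and not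
    from the component.\<close>
  have diag: "Q (y, y) = 0" if y: "y \<in> Y" for y
  proof -
    define z where "z = (\<chi> i. y i)"
    have yz: "\<iota> z = y" by (simp add: \<iota>_def z_def fun_eq_iff)
    define t where "t = 1 / (1 + norm z)"
    have t: "0 < t" "t * norm z < 1"
      by (auto simp: t_def add_pos_nonneg field_simps)
    have "p (complex_of_real t *s z) = 0" if p: "p \<in> P" for p
    proof -
      have pp: "(\<lambda>y. p (\<chi> i. y i)) \<in> polys UNIV" using homogeneous_poly_polys P(1) p by blast
      have "p (\<chi> i. \<iota> x i) = 0" if "x \<in> C" for x
        using C(2) P(2) p that by (auto simp: \<iota>_def vec_nth_inverse)
      then have "p (\<chi> i. y i) = 0" by (intro y[unfolded Y_def mem_Collect_eq, THEN bspec, OF pp, THEN mp] ballI)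
      then show ?thesis using homogeneous_poly_scale[of p] P(1) p by (auto simp: z_def)
    qed
    moreover have "complex_of_real t *s z \<in> ball 0 1" using t by (simp add: norm_cscale)
    ultimately have "complex_of_real t *s z \<in> V" using P(2) by simp
    then have "norm (A (complex_of_real t *s z)) = norm (complex_of_real t *s z)"
      using iso by (simp add: isometric_on_def)
    then have "norm (A z) = norm z" using t(1) by (simp add: clin_scale[OF A] norm_cscale)
    then show ?thesis using Q_eq[of z z] by (simp add: yz cinner_self)
  qed
  have form: "cinner (A x) (A y) = cinner x y" if xy: "x \<in> C" "y \<in> C" for x y
  proof -
    have "prime_on (polys UNIV) Y"
      unfolding prime_on_def
    proof (intro conjI ballI impI)
      show "Y \<noteq> {}" using CY xy by blast
      fix f g assume f: "f \<in> polys UNIV" and g: "g \<in> polys UNIV" and fg: "\<forall>y\<in>Y. f y * g y = 0"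
      have "(\<forall>x\<in>C. f (\<iota> x) = 0) \<or> (\<forall>x\<in>C. g (\<iota> x) = 0)"
        unfolding \<iota>_def
        by (rule irreducible_variety_prime[OF C(1) f g]) (use fg CY in \<open>auto simp: \<iota>_def\<close>)
      then show "(\<forall>y\<in>Y. f y = 0) \<or> (\<forall>y\<in>Y. g y = 0)" using f g unfolding Y_def by blast
    qed
    then have "Q (\<iota> x, \<iota> y) = 0"
      by (rule sespolys_vanish[OF finite_class.finite_UNIV _ closed Q diag CY[OF xy(1)] CY[OF xy(2)]])
    then show ?thesis by (simp add: Q_eq)
  qed
  show ?thesis
    unfolding isometric_on_def
  proof
    fix u assume "u \<in> vec.span C"
    then obtain F r where F: "finite F" "F \<subseteq> C" "u = (\<Sum>x\<in>F. r x *s x)"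
      unfolding vec.span_explicit by blast
    have "cinner (A u) (A u) = (\<Sum>x\<in>F. \<Sum>y\<in>F. r x * cnj (r y) * cinner (A x) (A y))"
      unfolding F(3) clin_sum[OF A] clin_scale[OF A] by (rule cinner_combination)
    also have "\<dots> = (\<Sum>x\<in>F. \<Sum>y\<in>F. r x * cnj (r y) * cinner x y)"
      using F(2) form by (intro sum.cong refl arg_cong2[where f = "(*)"]) auto
    also have "\<dots> = cinner u u"
      unfolding F(3) by (rule cinner_combination[symmetric])
    finally have "(norm (A u))\<^sup>2 = (norm u)\<^sup>2" unfolding cinner_self by (simp only: of_real_eq_iff)
    then show "norm (A u) = norm u" by (simp add: power2_eq_iff_nonneg)
  qed
qed

section \<open>The equivalences\<close>

lemma clin_inv:
  assumes A: "clin A" "bij A"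
  shows "clin (inv A)"
proof -
  have AB: "A (inv A y) = y" for y using A(2) by (simp add: bij_is_surj surj_f_inv_f)
  have inj: "inj A" using A(2) by (rule bij_is_inj)
  show ?thesis
    unfolding clin_iff
  proof (intro conjI allI)
    fix x y c
    show "inv A (x + y) = inv A x + inv A y"
      by (rule injD[OF inj]) (simp add: AB clin_add[OF A(1)])
    show "inv A (c *s x) = c *s inv A x"
      by (rule injD[OF inj]) (simp add: AB clin_scale[OF A(1)])
  qed
qed

lemma (in kernel_map) hopnorm_ge_1:
  assumes "0 \<in> V" "A 0 = 0" "0 \<in> W"
  shows "1 \<le> hopnorm (HV V) (HV W) T"
proof -
  have "ennreal (hnorm (HV W) (T (V.kf 0))) \<le> hopnorm (HV V) (HV W) T"
    unfolding hopnorm_def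
    by (rule opnorm_ge[where N' = "\<lambda>f. ennreal (hnorm (HV W) f)"]) (simp_all add: V.kf_mem assms hnorm_kf_zero[OF V])
  then show ?thesis by (simp add: T_kf assms hnorm_kf_zero[OF W])
qed

text \<open>The constants \<open>a\<close> and \<open>b\<close> are the operator norms themselves,
  read as real numbers, so estimates in terms of \<open>a\<close> and \<open>b\<close> are estimates
  by the norms.\<close>

lemma kernel_iso_exists:
  fixes V W :: "(complex ^ 'd) set"
  assumes V: "V \<subseteq> ball 0 1" and W: "W \<subseteq> ball 0 1" and A: "bij A" "W = A ` V"
    and T: "rkhs_iso V W T" "\<And>x. x \<in> V \<Longrightarrow> T (kfun V x) = kfun W (A x)"
  shows "\<exists>a b. hopnorm (HV V) (HV W) T = ennreal a \<and>
    hopnorm (HV W) (HV V) (inv_into (funs (HV V)) T) = ennreal b \<and>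
    kernel_iso V W A (inv A) T (inv_into (funs (HV V)) T) a b"
proof -
  let ?T' = "inv_into (funs (HV V)) T"
  interpret V: rkhs V da_kernel "HV V" by (rule rkhs_HV[OF V])
  interpret W: rkhs W da_kernel "HV W" by (rule rkhs_HV[OF W])
  have add: "T (\<lambda>x. f x + g x) = (\<lambda>x. T f x + T g x)" if "f \<in> funs (HV V)" "g \<in> funs (HV V)" for f g
    using T(1) that unfolding rkhs_iso_def by blast
  have scale: "T (\<lambda>x. c * f x) = (\<lambda>x. c * T f x)" if "f \<in> funs (HV V)" for c f
    using T(1) that unfolding rkhs_iso_def by blast
  have bij: "bij_betw T (funs (HV V)) (funs (HV W))" and fin: "hopnorm (HV V) (HV W) T < \<infinity>"
    "hopnorm (HV W) (HV V) ?T' < \<infinity>" using T(1) unfolding rkhs_iso_def by blast+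
  have mem: "T f \<in> funs (HV W)" if "f \<in> funs (HV V)" for f using bij that by (rule bij_betw_apply)
  have mem': "?T' g \<in> funs (HV V)" if "g \<in> funs (HV W)" for g
    using bij_betw_apply[OF bij_betw_inv_into[OF bij] that] .
  have TT': "T (?T' g) = g" if "g \<in> funs (HV W)" for g using bij_betw_inv_into_right[OF bij that] .
  have T'I: "?T' g = f" if "f \<in> funs (HV V)" "T f = g" for f g
    using bij that by (auto simp: bij_betw_def intro: inv_into_f_eq)
  have add': "?T' (\<lambda>x. f x + g x) = (\<lambda>x. ?T' f x + ?T' g x)" if "f \<in> funs (HV W)" "g \<in> funs (HV W)" for f g
  proof (rule T'I)
    show "(\<lambda>x. ?T' f x + ?T' g x) \<in> funs (HV V)" by (intro V.add_mem mem' that)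
    show "T (\<lambda>x. ?T' f x + ?T' g x) = (\<lambda>x. f x + g x)"
      unfolding add[OF mem'[OF that(1)] mem'[OF that(2)]] TT'[OF that(1)] TT'[OF that(2)] ..
  qed
  have scale': "?T' (\<lambda>x. c * f x) = (\<lambda>x. c * ?T' f x)" if "f \<in> funs (HV W)" for c f
  proof (rule T'I)
    show "(\<lambda>x. c * ?T' f x) \<in> funs (HV V)" by (intro V.scale_mem mem' that)
    show "T (\<lambda>x. c * ?T' f x) = (\<lambda>x. c * f x)"
      unfolding scale[OF mem'[OF that]] TT'[OF that] ..
  qed
  have AB: "A (inv A y) = y" "inv A (A x) = x" for x y
    using A(1) by (simp_all add: bij_is_surj surj_f_inv_f bij_is_inj)
  have kfun': "?T' (kfun W y) = kfun V (inv A y)" if y: "y \<in> W" for y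
  proof (rule T'I)
    have x: "inv A y \<in> V" using y A(2) AB by auto
    then show "kfun V (inv A y) \<in> funs (HV V)" using V.kf_mem by (simp add: kf_HV[OF V])
    show "T (kfun V (inv A y)) = kfun W y" using T(2)[OF x] by (simp add: AB)
  qed
  define a b where "a = enn2real (hopnorm (HV V) (HV W) T)" and "b = enn2real (hopnorm (HV W) (HV V) ?T')"
  have ab: "hopnorm (HV V) (HV W) T = ennreal a" "0 \<le> a" "hopnorm (HV W) (HV V) ?T' = ennreal b" "0 \<le> b"
    using fin by (simp_all add: a_def b_def)
  have "kernel_map V W A T a"
  proof
    show "hnorm (HV W) (T f) \<le> a * hnorm (HV V) f" if "f \<in> funs (HV V)" for f
      by (rule V.hnorm_le_of_hopnorm[OF ab(2) _ scale W.function_hilbert_space_axioms mem that]) (simp add: ab)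
  qed (use V W A(2) add scale mem T(2) ab in auto)
  moreover have "kernel_map W V (inv A) ?T' b"
  proof
    show "hnorm (HV V) (?T' f) \<le> b * hnorm (HV W) f" if "f \<in> funs (HV W)" for f
      by (rule W.hnorm_le_of_hopnorm[OF ab(4) _ scale' V.function_hilbert_space_axioms mem' that]) (simp add: ab)
  qed (use V W A(2) AB add' scale' mem' kfun' ab in auto)
  ultimately have "kernel_iso V W A (inv A) T ?T' a b"
    by (intro kernel_iso.intro kernel_iso_axioms.intro AB)
  then show ?thesis using ab by blast
qed

lemma (in kernel_iso) swap: "kernel_iso W V B A T' T b a"
  by (intro kernel_iso.intro kernel_iso_axioms.intro AB BA AT.kernel_map_axioms BT.kernel_map_axioms)

lemma (in kernel_iso) inv_into_comp_map:
  assumes \<phi>: "\<And>f. f \<in> multipliers V \<Longrightarrow> \<phi> f = comp_map W B f" and g: "g \<in> multipliers W"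
  shows "inv_into (multipliers V) \<phi> g = comp_map V A g"
proof (rule inv_into_f_eq)
  show m: "comp_map V A g \<in> multipliers V" by (rule kernel_iso.comp_map_multipliers[OF swap g])
  show "inj_on \<phi> (multipliers V)"
  proof (rule inj_onI)
    fix f1 f2 assume f: "f1 \<in> multipliers V" "f2 \<in> multipliers V" "\<phi> f1 = \<phi> f2"
    have "f1 x = f2 x" for x
    proof (cases "x \<in> V")
      case True
      then show ?thesis
        using fun_cong[OF f(3), of "A x"] AT.AV[OF True] BA[OF True]
        by (simp add: \<phi>[OF f(1)] \<phi>[OF f(2)] comp_map_def restr_def)
    next
      case False
      then show ?thesis using multipliersD(2) f by metis
    qed
    then show "f1 = f2" by blast
  qed
  show "\<phi> (comp_map V A g) = g"
  proof
    fix y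
    show "\<phi> (comp_map V A g) y = g y"
      unfolding \<phi>[OF m] using BT.AV[of y] AB[of y] multipliersD(2)[OF g, of y]
      by (auto simp: comp_map_def restr_def)
  qed
qed

lemma tendsto_ennreal_1_iff:
  assumes "\<And>n. 0 \<le> f n"
  shows "(\<lambda>n. ennreal (f n)) \<longlonglongrightarrow> 1 \<longleftrightarrow> f \<longlonglongrightarrow> 1"
  using tendsto_ennreal_iff[of f sequentially 1] assms by simp

theorem theorem1p41:
  fixes V :: "(complex ^ 'd) set"
    and W :: "nat \<Rightarrow> (complex ^ 'd) set"
    and A :: "nat \<Rightarrow> complex ^ 'd \<Rightarrow> complex ^ 'd"
    and T \<phi> :: "nat \<Rightarrow> (complex ^ 'd \<Rightarrow> complex) \<Rightarrow> (complex ^ 'd \<Rightarrow> complex)"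
  assumes "tractable_variety V"
    and "vec.span V = UNIV"
    and "\<And>n. homogeneous_variety (W n)"
    and "\<And>n. Vector_Spaces.linear (*s) (*s) (A n)"
    and "\<And>n. bij (A n)"
    and "\<And>n. W n = A n ` V"
    and "\<And>n. rkhs_iso V (W n) (T n)"
    and "\<And>n x. x \<in> V \<Longrightarrow> T n (kfun V x) = kfun (W n) (A n x)"
    and "\<And>n f. f \<in> multipliers V \<Longrightarrow> \<phi> n f = comp_map (W n) (inv (A n)) f"
  defines "cond1 \<equiv>
      (\<lambda>n. onorm (A n)) \<longlonglongrightarrow> 1 \<and> (\<lambda>n. onorm (inv (A n))) \<longlonglongrightarrow> 1"
    and "cond2 \<equiv>
      (\<lambda>n. hopnorm (HV V) (HV (W n)) (T n) *
           hopnorm (HV (W n)) (HV V) (inv_into (funs (HV V)) (T n))) \<longlonglongrightarrow> 1"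
    and "cond3 \<equiv>
      (\<lambda>n. cb_norm V (W n) (\<phi> n) *
           cb_norm (W n) V (inv_into (multipliers V) (\<phi> n))) \<longlonglongrightarrow> 1"
    and "cond4 \<equiv>
      (\<lambda>n. lin_mult_norm V (A n)) \<longlonglongrightarrow> 1 \<and>
      (\<lambda>n. lin_mult_norm (W n) (inv (A n))) \<longlonglongrightarrow> 1"
  shows "(cond1 \<longleftrightarrow> cond2) \<and> (cond2 \<longleftrightarrow> cond3) \<and> (cond3 \<longleftrightarrow> cond4)"
proof -
  note lin = assms(4)
  let ?B = "\<lambda>n. inv (A n)" and ?T' = "\<lambda>n. inv_into (funs (HV V)) (T n)"
  have hV: "homogeneous_variety V" using assms(1) by (simp add: tractable_variety_def)
  have V: "V \<subseteq> ball 0 1" and W: "W n \<subseteq> ball 0 1" for n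
    using homogeneous_variety_ball hV assms(3) by blast+
  have linB: "clin (?B n)" for n by (rule clin_inv[OF lin assms(5)])
  have AB: "A n (?B n y) = y" "?B n (A n x) = x" for n x y
    using assms(5)[of n] by (simp_all add: bij_is_surj surj_f_inv_f bij_is_inj)
  have AV: "A n x \<in> W n" if "x \<in> V" for n x using assms(6) that by blast
  have BW: "?B n y \<in> V" if "y \<in> W n" for n y using assms(6)[of n] that AB by auto
  have star: "complex_of_real t *s x \<in> U" if "homogeneous_variety U" "x \<in> U" "0 \<le> t" "t \<le> 1" for U t and x :: "complex ^ 'd"
  proof (rule homogeneous_variety_scale[OF that(1,2)])
    have "norm x < 1" using homogeneous_variety_ball[OF that(1)] that(2) by auto
    moreover have "t * norm x \<le> 1 * norm x" using that by (intro mult_right_mono) auto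
    ultimately show "complex_of_real t *s x \<in> ball 0 1" using that by (simp add: norm_cscale)
  qed
  \<comment> \<open>Index types are nonempty, so the space is not zero. A nonzero point of
    \<open>V\<close>, whose norm is preserved, will show that the operator norms are at least
    1.\<close>
  obtain x1 where x1: "x1 \<in> V" "x1 \<noteq> 0"
  proof -
    have "\<not> V \<subseteq> {0}"
    proof
      assume "V \<subseteq> {0}"
      then have "vec.span V \<subseteq> {0}" by (metis vec.span_mono vec.span_insert_0 vec.span_empty)
      then have "(UNIV :: (complex ^ 'd) set) \<subseteq> {0}" using assms(2) by simp
      then have "(\<chi> i. 1 :: complex ^ 'd) = 0" by blast
      then show False by (simp add: vec_eq_iff)
    qed
    then show ?thesis using that by blast
  qed
  have V0: "0 \<in> V" using star[OF hV x1(1), of 0] by simp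
  have A0: "A n 0 = 0" "?B n 0 = 0" for n using clin_zero[OF lin] clin_zero[OF linB] by simp_all
  have W0: "0 \<in> W n" for n using AV[OF V0] by (simp add: A0)
  \<comment> \<open>Both \<open>A n\<close> and its inverse map a homogeneous variety into the ball,
    so neither increases norms.\<close>
  have isoA: "norm (A n x) = norm x" if x: "x \<in> V" for n x
  proof (rule antisym)
    show "norm (A n x) \<le> norm x"
      by (rule norm_le_of_image_in_ball[OF hV lin _ x]) (use AV W in blast)
    have "norm (?B n (A n x)) \<le> norm (A n x)"
      by (rule norm_le_of_image_in_ball[OF assms(3) linB _ AV[OF x]]) (use BW V in blast)
    then show "norm x \<le> norm (A n x)" by (simp add: AB)
  qed
  have spanW: "vec.span (W n) = UNIV" for n
  proof -
    have "vec.span (A n ` V) = A n ` vec.span V" using vec.linear_span_image[OF lin] .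
    then show ?thesis using assms(2,5,6) by (simp add: bij_is_surj)
  qed
  have onA: "1 \<le> onorm (A n)" and onB: "1 \<le> onorm (?B n)" for n
  proof -
    have "norm (A n x1) \<le> onorm (A n) * norm x1" by (rule onorm[OF clin_bounded_linear[OF lin]])
    then show "1 \<le> onorm (A n)" using x1 by (simp add: isoA)
    have "norm (?B n (A n x1)) \<le> onorm (?B n) * norm (A n x1)" by (rule onorm[OF clin_bounded_linear[OF linB]])
    then show "1 \<le> onorm (?B n)" using x1 by (simp add: isoA AB)
  qed
  have lmA: "lin_mult_norm V (A n) = ennreal (onorm (A n))" for n
    by (rule lin_mult_norm_eq[OF lin V star[OF hV] V0 assms(2)])
  have lmB: "lin_mult_norm (W n) (?B n) = ennreal (onorm (?B n))" for n
    by (rule lin_mult_norm_eq[OF linB W star[OF assms(3)] W0 spanW])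
  have eq14: "cond1 \<longleftrightarrow> cond4"
    unfolding cond1_def cond4_def lmA lmB
    using tendsto_ennreal_1_iff[of "\<lambda>n. onorm (A n)"] tendsto_ennreal_1_iff[of "\<lambda>n. onorm (?B n)"]
      order_trans[OF zero_le_one onA] order_trans[OF zero_le_one onB] by simp

  have "\<forall>n. \<exists>ab. hopnorm (HV V) (HV (W n)) (T n) = ennreal (fst ab) \<and>
    hopnorm (HV (W n)) (HV V) (?T' n) = ennreal (snd ab) \<and>
    kernel_iso V (W n) (A n) (?B n) (T n) (?T' n) (fst ab) (snd ab)"
    using kernel_iso_exists[OF V W assms(5,6,7,8)] by simp
  from choice[OF this] obtain ab where ab: "\<forall>n. hopnorm (HV V) (HV (W n)) (T n) = ennreal (fst (ab n)) \<and>
    hopnorm (HV (W n)) (HV V) (?T' n) = ennreal (snd (ab n)) \<and>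
    kernel_iso V (W n) (A n) (?B n) (T n) (?T' n) (fst (ab n)) (snd (ab n))" ..
  define a b where "a = (\<lambda>n. fst (ab n))" and "b = (\<lambda>n. snd (ab n))"
  have iso: "kernel_iso V (W n) (A n) (?B n) (T n) (?T' n) (a n) (b n)" for n
    using ab by (simp add: a_def b_def)
  have Tn: "hopnorm (HV V) (HV (W n)) (T n) = ennreal (a n)"
    "hopnorm (HV (W n)) (HV V) (?T' n) = ennreal (b n)" for n
    using ab by (simp_all add: a_def b_def)
  have mapA: "kernel_map V (W n) (A n) (T n) (a n)" and mapB: "kernel_map (W n) V (?B n) (?T' n) (b n)" for n
    using iso[of n] by (simp_all add: kernel_iso_def)
  have a1: "1 \<le> a n" and b1: "1 \<le> b n" for n
    using kernel_map.hopnorm_ge_1[OF mapA V0 A0(1) W0, of n] kernel_map.hopnorm_ge_1[OF mapB W0 A0(2) V0, of n]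
    unfolding Tn by simp_all
  have cond2_iff: "cond2 \<longleftrightarrow> (\<lambda>n. a n * b n) \<longlonglongrightarrow> 1"
  proof -
    have "0 \<le> a n" "0 \<le> b n" for n using a1[of n] b1[of n] by linarith+
    then show ?thesis
      unfolding cond2_def Tn using tendsto_ennreal_1_iff[of "\<lambda>n. a n * b n"] by (simp add: ennreal_mult)
  qed

  have "cond1 \<Longrightarrow> cond2"
  proof -
    assume c1: cond1
    obtain \<C> where \<C>: "irreducible_decomposition V \<C>" "tractable_union UNIV (\<Union>C\<in>\<C>. vec.span C)"
      using assms(1) unfolding tractable_variety_def by blast
    let ?M = "\<Union>C\<in>\<C>. vec.span C"
    have VM: "V \<subseteq> ?M" using \<C>(1) vec.span_superset unfolding irreducible_decomposition_def by blast
    have isoM: "isometric_on (A n) ?M" for n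
    proof -
      have "isometric_on (A n) V" using isoA by (simp add: isometric_on_def)
      then have "isometric_on (A n) (vec.span C)" if "C \<in> \<C>" for C
        using isometric_on_span_irreducible[OF hV lin] \<C>(1) that
        unfolding irreducible_decomposition_def by blast
      then show ?thesis by (simp add: isometric_on_def)
    qed
    have small: "\<forall>\<^sub>F n in sequentially. a n * b n \<le> 1 + e" if e: "e > 0" for e
    proof -
      obtain \<delta> where \<delta>: "\<delta> > 0" "\<forall>A. near_isometry \<delta> UNIV A \<longrightarrow> isometric_on A ?M \<longrightarrow> gram_close e ?M A"
        using tractable_union_gram_close[OF \<C>(2)] e by blast
      have "\<forall>\<^sub>F n in sequentially. onorm (A n) < 1 + \<delta>" "\<forall>\<^sub>F n in sequentially. onorm (?B n) < 1 + \<delta>"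
        using c1 \<delta>(1) unfolding cond1_def by (auto intro: order_tendstoD(2))
      then show ?thesis
      proof eventually_elim
        case (elim n)
        have "near_isometry \<delta> UNIV (A n)"
          unfolding near_isometry_def
        proof (intro conjI ballI lin)
          fix x
          have "norm (A n x) \<le> onorm (A n) * norm x" by (rule onorm[OF clin_bounded_linear[OF lin]])
          also have "\<dots> \<le> (1 + \<delta>) * norm x" using elim by (intro mult_right_mono) auto
          finally show "norm (A n x) \<le> (1 + \<delta>) * norm x" .
          have "norm (?B n (A n x)) \<le> onorm (?B n) * norm (A n x)" by (rule onorm[OF clin_bounded_linear[OF linB]])
          also have "\<dots> \<le> (1 + \<delta>) * norm (A n x)" using elim by (intro mult_right_mono) auto
          finally show "norm x \<le> (1 + \<delta>) * norm (A n x)" by (simp add: AB)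
        qed
        then have "gram_close e V (A n)" using \<delta>(2) isoM gram_close_subset[OF _ VM] by blast
        then have g1: "psd V (\<lambda>x y. of_real (1 + e) * cinner x y ^ m - cinner (A n x) (A n y) ^ m)"
          and g2: "psd V (\<lambda>x y. of_real (1 + e) * cinner (A n x) (A n y) ^ m - cinner x y ^ m)" for m
          unfolding gram_close_def by blast+
        \<comment> \<open>The inequality for the inverse map lives on \<open>W n\<close>, so its
          points are substituted through \<open>?B n\<close>.\<close>
        have g3: "psd (W n) (\<lambda>x y. of_real (1 + e) * cinner x y ^ m - cinner (?B n x) (?B n y) ^ m)" for m
          using psd_pullback[OF g2[of m], of "W n" "?B n"] BW by (simp add: AB)
        have k1: "psd V (\<lambda>x y. of_real (1 + e) * da_kernel x y - da_kernel (A n x) (A n y))"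
          by (rule psd_da_kernel_diff[OF g1 V]) (use AV W in blast)
        have k2: "psd (W n) (\<lambda>x y. of_real (1 + e) * da_kernel x y - da_kernel (?B n x) (?B n y))"
          by (rule psd_da_kernel_diff[OF g3 W]) (use BW V in blast)
        have e0: "0 \<le> 1 + e" using e by simp
        \<comment> \<open>The kernel constants bound squared norms; the two square roots multiply to
          \<open>1 + e\<close>.\<close>
        have "ennreal (a n) \<le> ennreal (sqrt (1 + e))"
          unfolding Tn(1)[symmetric]
          by (rule function_hilbert_space.hopnorm_le[of V])
            (use kernel_map.hnorm_T_le[OF mapA e0 k1] rkhs_HV[OF V] e in
              \<open>auto simp: rkhs_def is_rkhs_def function_hilbert_space_def\<close>)
        moreover have "ennreal (b n) \<le> ennreal (sqrt (1 + e))"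
          unfolding Tn(2)[symmetric]
          by (rule function_hilbert_space.hopnorm_le[of "W n"])
            (use kernel_map.hnorm_T_le[OF mapB e0 k2] rkhs_HV[OF W] e in
              \<open>auto simp: rkhs_def is_rkhs_def function_hilbert_space_def\<close>)
        ultimately have "a n \<le> sqrt (1 + e)" "b n \<le> sqrt (1 + e)" using e by simp_all
        then have "a n * b n \<le> sqrt (1 + e) * sqrt (1 + e)"
          using a1[of n] b1[of n] e by (intro mult_mono) auto
        then show ?case using e by simp
      qed
    qed
    have "(\<lambda>n. a n * b n) \<longlonglongrightarrow> 1"
    proof (rule order_tendstoI)
      fix y :: real assume "y < 1"
      moreover have "1 \<le> a n * b n" for n using mult_mono[OF a1 b1] a1[of n] by force
      ultimately show "\<forall>\<^sub>F n in sequentially. y < a n * b n"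
        by (intro always_eventually allI) (meson less_le_trans)
    next
      fix y :: real assume "1 < y"
      then have "\<forall>\<^sub>F n in sequentially. a n * b n \<le> 1 + (y - 1) / 2" by (intro small) simp
      then show "\<forall>\<^sub>F n in sequentially. a n * b n < y"
        by eventually_elim (use \<open>1 < y\<close> in \<open>simp add: field_simps\<close>)
    qed
    then show cond2 by (simp add: cond2_iff)
  qed

  moreover have cbB: "ennreal (onorm (?B n)) \<le> cb_norm V (W n) (\<phi> n)" for n
    unfolding lmB[symmetric] by (rule cb_norm_ge_lin_mult_norm[OF V W linB BW assms(9)])
  have \<phi>': "inv_into (multipliers V) (\<phi> n) g = comp_map V (A n) g" if "g \<in> multipliers (W n)" for n g
    by (rule kernel_iso.inv_into_comp_map[OF iso assms(9) that])
  have cbA: "ennreal (onorm (A n)) \<le> cb_norm (W n) V (inv_into (multipliers V) (\<phi> n))" for n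
    unfolding lmA[symmetric] by (rule cb_norm_ge_lin_mult_norm[OF W V lin AV \<phi>'])
  \<comment> \<open>Since both factors in (3) are at least 1, each is bounded by their product, and
    convergence of the product to 1 controls each factor separately.\<close>
  have one_le: "1 \<le> cb_norm V (W n) (\<phi> n)" "1 \<le> cb_norm (W n) V (inv_into (multipliers V) (\<phi> n))" for n
    using order_trans[OF _ cbB[of n], of 1] order_trans[OF _ cbA[of n], of 1] onA[of n] onB[of n]
    by simp_all

  have "cond2 \<Longrightarrow> cond3"
  proof -
    assume cond2
    then have ab1: "(\<lambda>n. a n * b n) \<longlonglongrightarrow> 1" by (simp add: cond2_iff)
    \<comment> \<open>Either completely bounded norm is at most \<open>a n * b n\<close>, whence the
      square.\<close>
    have "(\<lambda>n. (a n * b n) * (a n * b n)) \<longlonglongrightarrow> 1 * 1" by (intro tendsto_intros ab1)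
    then have lim: "(\<lambda>n. ennreal ((a n * b n) * (a n * b n))) \<longlonglongrightarrow> 1"
      by (subst tendsto_ennreal_1_iff) auto
    show cond3
      unfolding cond3_def
    proof (rule tendsto_sandwich[OF _ _ tendsto_const lim])
      show "\<forall>\<^sub>F n in sequentially. 1 \<le> cb_norm V (W n) (\<phi> n) * cb_norm (W n) V (inv_into (multipliers V) (\<phi> n))"
        using mult_mono[OF one_le] by (intro always_eventually allI) simp
      show "\<forall>\<^sub>F n in sequentially. cb_norm V (W n) (\<phi> n) * cb_norm (W n) V (inv_into (multipliers V) (\<phi> n))
          \<le> ennreal ((a n * b n) * (a n * b n))"
      proof (intro always_eventually allI)
        fix n
        have "cb_norm V (W n) (\<phi> n) \<le> ennreal (a n * b n)"
          by (rule kernel_iso.cb_norm_le[OF iso assms(9)])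
        moreover have "cb_norm (W n) V (inv_into (multipliers V) (\<phi> n)) \<le> ennreal (b n * a n)"
          by (rule kernel_iso.cb_norm_le[OF kernel_iso.swap[OF iso] \<phi>'])
        ultimately have "cb_norm V (W n) (\<phi> n) * cb_norm (W n) V (inv_into (multipliers V) (\<phi> n))
            \<le> ennreal (a n * b n) * ennreal (b n * a n)" by (intro mult_mono) auto
        also have "\<dots> = ennreal ((a n * b n) * (a n * b n))"
          using a1[of n] b1[of n] by (simp add: ennreal_mult[symmetric] mult.commute)
        finally show "cb_norm V (W n) (\<phi> n) * cb_norm (W n) V (inv_into (multipliers V) (\<phi> n))
          \<le> ennreal ((a n * b n) * (a n * b n))" .
      qed
    qed
  qed

  moreover have "cond3 \<Longrightarrow> cond1"
  proof -
    assume c3: cond3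
    have le: "cb_norm V (W n) (\<phi> n) \<le> cb_norm V (W n) (\<phi> n) * cb_norm (W n) V (inv_into (multipliers V) (\<phi> n))"
      "cb_norm (W n) V (inv_into (multipliers V) (\<phi> n)) \<le> cb_norm V (W n) (\<phi> n) * cb_norm (W n) V (inv_into (multipliers V) (\<phi> n))" for n
      using mult_mono[OF order_refl one_le(2), of "cb_norm V (W n) (\<phi> n)" n]
        mult_mono[OF one_le(1) order_refl, of n "cb_norm (W n) V (inv_into (multipliers V) (\<phi> n))"] by simp_all
    have "(\<lambda>n. ennreal (onorm (A n))) \<longlonglongrightarrow> 1"
    proof (rule tendsto_sandwich[OF _ _ tendsto_const c3[unfolded cond3_def]])
      show "\<forall>\<^sub>F n in sequentially. 1 \<le> ennreal (onorm (A n))" using onA by simp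
    qed (intro always_eventually allI order_trans[OF cbA le(2)])
    moreover have "(\<lambda>n. ennreal (onorm (?B n))) \<longlonglongrightarrow> 1"
    proof (rule tendsto_sandwich[OF _ _ tendsto_const c3[unfolded cond3_def]])
      show "\<forall>\<^sub>F n in sequentially. 1 \<le> ennreal (onorm (?B n))" using onB by simp
    qed (intro always_eventually allI order_trans[OF cbB le(1)])
    ultimately have cond4 unfolding cond4_def lmA lmB by blast
    then show cond1 using eq14 by blast
  qed
  ultimately show ?thesis using eq14 by blast
qed

end
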